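(* Let $0<s<1$ and let $N\ge 1$ be an integer with $N>2s$. Let either $f(u)=|u|^{p}u$ with $\frac{4s}{N}<p<\frac{4s}{N-2s}$, or $f(u)=(|x|^{-\gamma}\ast|u|^2)u$ with $2s<\gamma<\min\{N,4s\}$. Let $c>0$. Then for any $u_c\in\mathcal M_c$ there exists $\omega_c>0$ such that $u_c$ is a weak solution of $$(-\Delta)^s u+\omega u-f(u)=0 \quad\text{in } \mathbb{R}^N$$ with $\omega=\omega_c$. Furthermore, $u_c$ is a ground state solution of this equation with $\omega=\omega_c$, that is, $$J_{\omega_c}(u_c)=\inf\{J_{\omega_c}(u):\ u\in H^s(\mathbb{R}^N),\ J_{\omega_c}'(u)=0,\ u\ne0\}.$$
   Context: Functions are complex-valued on $\mathbb{R}^N$. $(-\Delta)^s u=\mathcal F^{-1}[|\xi|^{2s}\mathcal F u]$; $H^s=H^s(\mathbb{R}^N)$ is the usual fractional Sobolev space (regarded as a real Hilbert space when differentiating functionals), and $\|u\|_{\dot H^s}=\|(-\Delta)^{s/2}u\|_{L^2}$. Write $D(u)=\int_{\mathbb{R}^N}(|x|^{-\gamma}\ast|u|^2)(x)|u(x)|^2\,dx$. Define the energy $E$ and the functional $Q$ by $$E(u)=\tfrac12\|u\|_{\dot H^s}^2-\tfrac1{p+2}\|u\|_{L^{p+2}}^{p+2},\quad Q(u)=s\|u\|_{\dot H^s}^2-\tfrac{Np}{2(p+2)}\|u\|_{L^{p+2}}^{p+2}\quad\text{if } f(u)=|u|^pu,$$ $$E(u)=\tfrac12\|u\|_{\dot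 H^s}^2-\tfrac14 D(u),\quad Q(u)=s\|u\|_{\dot H^s}^2-\tfrac{\gamma}{4}D(u)\quad\text{if } f(u)=(|x|^{-\gamma}\ast|u|^2)u.$$ The action functional is $J_\omega(u)=E(u)+\frac{\omega}{2}\|u\|_{L^2}^2$. For $c>0$, $$S(c)=\{u\in H^s:\|u\|_{L^2}^2=c\},\quad V(c)=\{u\in S(c): Q(u)=0\},$$ $$\mathcal M_c=\{u\in V(c): E(u)=\inf_{v\in V(c)}E(v)\}.$$ A weak solution $u\in H^s$ of $(-\Delta)^su+\omega u-f(u)=0$ is a $u\in H^s$ satisfying the equation in the sense of distributions (equivalently in $H^{-s}$, i.e. $J_\omega'(u)=0$). *)

theory Defs
  imports "HOL-Analysis.Analysis"
begin

(* R^N is an arbitrary Euclidean space 'a with N = DIM('a).  Elements of L^q and H^s are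
   represented by Borel functions; equality in these spaces is equality almost everywhere. *)

definition Lspace :: "real \<Rightarrow> ('a::euclidean_space \<Rightarrow> complex) set" where
  "Lspace q = {u \<in> borel_measurable borel. integrable lborel (\<lambda>x. cmod (u x) powr q)}"

definition Lnorm :: "real \<Rightarrow> ('a::euclidean_space \<Rightarrow> complex) \<Rightarrow> real" where
  "Lnorm q u = (LINT x|lborel. cmod (u x) powr q) powr (1 / q)"


definition fourier_integral :: "('a::euclidean_space \<Rightarrow> complex) \<Rightarrow> 'a \<Rightarrow> complex" where
  "fourier_integral u \<xi> =
     complex_of_real ((2 * pi) powr (- real DIM('a) / 2)) * (LINT x|lborel. cis (- (x \<bullet> \<xi>)) * u x)"

definition inv_fourier_integral :: "('a::euclidean_space \<Rightarrow> complex) \<Rightarrow> 'a \<Rightarrow> complex" where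
  "inv_fourier_integral v x =
     complex_of_real ((2 * pi) powr (- real DIM('a) / 2)) * (LINT \<xi>|lborel. cis (x \<bullet> \<xi>) * v \<xi>)"

definition truncate :: "real \<Rightarrow> ('a::euclidean_space \<Rightarrow> complex) \<Rightarrow> 'a \<Rightarrow> complex" where
  "truncate R u x = (if norm x \<le> R then u x else 0)"

definition L2_limit ::
  "(real \<Rightarrow> 'a::euclidean_space \<Rightarrow> complex) \<Rightarrow> ('a \<Rightarrow> complex) \<Rightarrow> bool" where
  "L2_limit F v \<longleftrightarrow>
     v \<in> Lspace 2 \<and>
     ((\<lambda>R. \<integral>\<^sup>+\<xi>. ennreal ((cmod (F R \<xi> - v \<xi>))\<^sup>2) \<partial>lborel) \<longlongrightarrow> 0) at_top"

(* The unitary Fourier transform on L^2: the L^2-limit of the Fourier integrals of the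
   truncations.  The limit exists by Plancherel's theorem; it is unique only up to null sets,
   and SOME picks a representative. *)

definition fourier :: "('a::euclidean_space \<Rightarrow> complex) \<Rightarrow> 'a \<Rightarrow> complex" where
  "fourier u = (SOME v. L2_limit (\<lambda>R. fourier_integral (truncate R u)) v)"

definition inv_fourier :: "('a::euclidean_space \<Rightarrow> complex) \<Rightarrow> 'a \<Rightarrow> complex" where
  "inv_fourier v = (SOME u. L2_limit (\<lambda>R. inv_fourier_integral (truncate R v)) u)"


definition bessel_weight :: "real \<Rightarrow> ('a::euclidean_space \<Rightarrow> complex) \<Rightarrow> 'a \<Rightarrow> complex" where
  "bessel_weight s u \<xi> = complex_of_real ((1 + (norm \<xi>)\<^sup>2) powr (s / 2)) * fourier u \<xi>"

definition Hs :: "real \<Rightarrow> ('a::euclidean_space \<Rightarrow> complex) set" where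
  "Hs s = {u \<in> Lspace 2. bessel_weight s u \<in> Lspace 2}"

definition Hs_norm :: "real \<Rightarrow> ('a::euclidean_space \<Rightarrow> complex) \<Rightarrow> real" where
  "Hs_norm s u = Lnorm 2 (bessel_weight s u)"

(* Meaningful as a function whenever u is in H^(2 \<sigma>). *)
definition frac_laplace :: "real \<Rightarrow> ('a::euclidean_space \<Rightarrow> complex) \<Rightarrow> 'a \<Rightarrow> complex" where
  "frac_laplace \<sigma> u = inv_fourier (\<lambda>\<xi>. complex_of_real (norm \<xi> powr (2 * \<sigma>)) * fourier u \<xi>)"

definition Hdot_norm :: "real \<Rightarrow> ('a::euclidean_space \<Rightarrow> complex) \<Rightarrow> real" where
  "Hdot_norm s u = Lnorm 2 (frac_laplace (s / 2) u)"


(* Power p is f(u) = |u|^p u; Hartree \<gamma> is f(u) = (|x|^(-\<gamma>) * |u|^2) u. *)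
datatype nonlinearity = Power real | Hartree real

definition riesz_conv :: "real \<Rightarrow> ('a::euclidean_space \<Rightarrow> complex) \<Rightarrow> 'a \<Rightarrow> real" where
  "riesz_conv \<gamma> u x = (LINT y|lborel. norm (x - y) powr (- \<gamma>) * (cmod (u y))\<^sup>2)"

definition hartree_D :: "real \<Rightarrow> ('a::euclidean_space \<Rightarrow> complex) \<Rightarrow> real" where
  "hartree_D \<gamma> u = (LINT x|lborel. riesz_conv \<gamma> u x * (cmod (u x))\<^sup>2)"

fun nonlin :: "nonlinearity \<Rightarrow> ('a::euclidean_space \<Rightarrow> complex) \<Rightarrow> 'a \<Rightarrow> complex" where
  "nonlin (Power p) u x = complex_of_real (cmod (u x) powr p) * u x"
| "nonlin (Hartree \<gamma>) u x = complex_of_real (riesz_conv \<gamma> u x) * u x"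

fun admissible :: "'a::euclidean_space itself \<Rightarrow> real \<Rightarrow> nonlinearity \<Rightarrow> bool" where
  "admissible _ s (Power p) \<longleftrightarrow>
     4 * s / real DIM('a) < p \<and> p < 4 * s / (real DIM('a) - 2 * s)"
| "admissible _ s (Hartree \<gamma>) \<longleftrightarrow> 2 * s < \<gamma> \<and> \<gamma> < min (real DIM('a)) (4 * s)"

fun energy :: "real \<Rightarrow> nonlinearity \<Rightarrow> ('a::euclidean_space \<Rightarrow> complex) \<Rightarrow> real" where
  "energy s (Power p) u =
     1 / 2 * (Hdot_norm s u)\<^sup>2 - 1 / (p + 2) * Lnorm (p + 2) u powr (p + 2)"
| "energy s (Hartree \<gamma>) u = 1 / 2 * (Hdot_norm s u)\<^sup>2 - 1 / 4 * hartree_D \<gamma> u"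

fun Qfun :: "real \<Rightarrow> nonlinearity \<Rightarrow> ('a::euclidean_space \<Rightarrow> complex) \<Rightarrow> real" where
  "Qfun s (Power p) u =
     s * (Hdot_norm s u)\<^sup>2 - real DIM('a) * p / (2 * (p + 2)) * Lnorm (p + 2) u powr (p + 2)"
| "Qfun s (Hartree \<gamma>) u = s * (Hdot_norm s u)\<^sup>2 - \<gamma> / 4 * hartree_D \<gamma> u"

definition action ::
  "real \<Rightarrow> nonlinearity \<Rightarrow> real \<Rightarrow> ('a::euclidean_space \<Rightarrow> complex) \<Rightarrow> real" where
  "action s f \<omega> u = energy s f u + \<omega> / 2 * (Lnorm 2 u)\<^sup>2"

definition Sset :: "real \<Rightarrow> real \<Rightarrow> ('a::euclidean_space \<Rightarrow> complex) set" where
  "Sset s c = {u \<in> Hs s. (Lnorm 2 u)\<^sup>2 = c}"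

definition Vset :: "real \<Rightarrow> nonlinearity \<Rightarrow> real \<Rightarrow> ('a::euclidean_space \<Rightarrow> complex) set" where
  "Vset s f c = {u \<in> Sset s c. Qfun s f u = 0}"

(* Infima are taken in ereal, so no convention about unbounded sets of reals is involved. *)
definition Mset :: "real \<Rightarrow> nonlinearity \<Rightarrow> real \<Rightarrow> ('a::euclidean_space \<Rightarrow> complex) set" where
  "Mset s f c =
     {u \<in> Vset s f c.
       ereal (energy s f u) = (INF v\<in>(Vset s f c :: ('a \<Rightarrow> complex) set). ereal (energy s f v))}"


(* Frechet derivative at u of a functional on H^s, regarded as a real Hilbert space. *)
definition has_Hs_derivative ::
  "real \<Rightarrow> (('a::euclidean_space \<Rightarrow> complex) \<Rightarrow> real) \<Rightarrow> (('a \<Rightarrow> complex) \<Rightarrow> real)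
     \<Rightarrow> ('a \<Rightarrow> complex) \<Rightarrow> bool" where
  "has_Hs_derivative s F L u \<longleftrightarrow>
     (\<forall>g\<in>Hs s. \<forall>h\<in>Hs s. L (\<lambda>x. g x + h x) = L g + L h) \<and>
     (\<forall>a. \<forall>h\<in>Hs s. L (\<lambda>x. complex_of_real a * h x) = a * L h) \<and>
     (\<exists>C. \<forall>h\<in>Hs s. \<bar>L h\<bar> \<le> C * Hs_norm s h) \<and>
     (\<forall>\<epsilon>>0. \<exists>\<delta>>0. \<forall>h\<in>Hs s. Hs_norm s h < \<delta> \<longrightarrow>
        \<bar>F (\<lambda>x. u x + h x) - F u - L h\<bar> \<le> \<epsilon> * Hs_norm s h)"

definition action_critical ::
  "real \<Rightarrow> nonlinearity \<Rightarrow> real \<Rightarrow> ('a::euclidean_space \<Rightarrow> complex) \<Rightarrow> bool" where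
  "action_critical s f \<omega> u \<longleftrightarrow> has_Hs_derivative s (action s f \<omega>) (\<lambda>h. 0) u"


fun Ck :: "nat \<Rightarrow> ('a::euclidean_space \<Rightarrow> complex) \<Rightarrow> bool" where
  "Ck 0 \<phi> \<longleftrightarrow> continuous_on UNIV \<phi>"
| "Ck (Suc k) \<phi> \<longleftrightarrow>
     (\<forall>x. \<phi> differentiable (at x)) \<and> (\<forall>v. Ck k (\<lambda>x. frechet_derivative \<phi> (at x) v))"

definition test_functions :: "('a::euclidean_space \<Rightarrow> complex) set" where
  "test_functions = {\<phi>. (\<forall>k. Ck k \<phi>) \<and> compact (closure {x. \<phi> x \<noteq> 0})}"

(* The tempered distribution F^(-1)[|\<xi>|^(2s) F u], for u in L^2, applied to a test function:
   the bilinear pairing <F^(-1) T, \<phi>> = <T, F^(-1) \<phi>> with T = |\<xi>|^(2s) F u. *)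
definition frac_laplace_distr ::
  "real \<Rightarrow> ('a::euclidean_space \<Rightarrow> complex) \<Rightarrow> ('a \<Rightarrow> complex) \<Rightarrow> complex" where
  "frac_laplace_distr s u \<phi> =
     (LINT \<xi>|lborel. complex_of_real (norm \<xi> powr (2 * s)) * fourier u \<xi> * inv_fourier_integral \<phi> \<xi>)"

definition weak_solution ::
  "real \<Rightarrow> nonlinearity \<Rightarrow> real \<Rightarrow> ('a::euclidean_space \<Rightarrow> complex) \<Rightarrow> bool" where
  "weak_solution s f \<omega> u \<longleftrightarrow>
     u \<in> Hs s \<and>
     (\<forall>\<phi>\<in>test_functions.
        frac_laplace_distr s u \<phi> + complex_of_real \<omega> * (LINT x|lborel. u x * \<phi> x)
          - (LINT x|lborel. nonlin f u x * \<phi> x) = 0)"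

end

theory Submission
  imports Defs "HOL-Probability.Characteristic_Functions"
begin

text \<open>
  Write \<open>A\<close>, \<open>M\<close>, \<open>B\<close> for the kinetic energy, the mass and the potential term, \<open>q\<close> for the
  homogeneity of \<open>B\<close> and \<open>k\<close> for its exponent under mass-preserving dilations. Changing amplitude
  and scale moves any nonzero competitor into \<open>V(c)\<close>, where the energy is a positive multiple of \<open>A\<close>.
  Hence \<open>u\<^sub>c\<close> minimizes the Gagliardo-Nirenberg quotient \<open>A powr \<alpha> * M powr \<beta> / B\<close> with
  \<open>\<alpha> = k / (2 s)\<close> and \<open>\<beta> = (q - k / s) / 2\<close> over all of \<open>H\<^sup>s\<close>. No constraint is left, so the first
  variation of the quotient is the equation itself, with an explicit \<open>\<omega> > 0\<close>.

  A critical point of the action satisfies \<open>A + \<omega> M = B\<close> (test the equation with \<open>u\<close>), and its action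
  is \<open>(1 / 2 - 1 / q) B\<close>. The quotient inequality and the weighted inequality of arithmetic and
  geometric means give \<open>B u \<ge> B u\<^sub>c\<close>; the Pohozaev identity is not needed.

  Differentiability of the action on \<open>H\<^sup>s\<close> rests on Plancherel's theorem (Gaussian regularization),
  on the Sobolev inequality (from the Gagliardo seminorm, which Plancherel controls through
  translations) and, for the Hartree term, on a Young inequality for the kernel cut at \<open>\<bar>x\<bar> = 1\<close>.
\<close>

section \<open>Integrals over Euclidean space and square norms\<close>

text \<open>A Lagrange multiplier rule on \<open>V(c)\<close> would produce two multipliers, and the
  one attached to \<open>Q\<close> would have to be shown to vanish. The quotient avoids this: it is
  invariant under amplitude changes because \<open>\<alpha> + \<beta> = q / 2\<close>, and under
  dilations because \<open>2 * s * \<alpha> = k\<close>. The exponent ranges supply the signs: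
  \<open>2 * s < k\<close> (mass supercritical) makes the energy on \<open>V(c)\<close> a positive
  multiple of the kinetic energy and gives \<open>\<alpha> > 1\<close>; \<open>k / s < q\<close>
  (energy subcritical) gives \<open>\<beta> > 0\<close> and thereby \<open>\<omega> > 0\<close>. The
  definitions shape the analytic part. \<open>fourier\<close> is a chosen representative, so
  identities for it hold almost everywhere, and they are obtained by L^2 approximation with
  functions whose transform is an honest integral. \<open>action_critical\<close> is a Frechet
  derivative over the reals, so both potentials are expanded with an explicit quadratic remainder,
  uniform over the unit ball of \<open>Hs\<close>.\<close>

lemma ennreal_tendsto_0_le:
  fixes f g :: "'b \<Rightarrow> ennreal"
  assumes "(g \<longlongrightarrow> 0) F" "\<And>x. f x \<le> g x"
  shows "(f \<longlongrightarrow> 0) F"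
  by (rule tendsto_sandwich[OF _ _ tendsto_const assms(1)]) (use assms(2) in auto)

lemma ennreal_le_mult_2: "(x::ennreal) \<le> x * 2"
  using mult_left_mono[of 1 2 x] by simp

section \<open>Affine changes of variables\<close>

lemma nn_integral_lborel_affine:
  fixes g :: "'a::euclidean_space \<Rightarrow> ennreal"
  assumes [measurable]: "g \<in> borel_measurable borel" and "c \<noteq> 0"
  shows "(\<integral>\<^sup>+x. g x \<partial>lborel) = ennreal (\<bar>c\<bar> ^ DIM('a)) * (\<integral>\<^sup>+x. g (t + c *\<^sub>R x) \<partial>lborel)"
  by (subst lborel_affine[OF assms(2), of t])
     (simp add: nn_integral_density nn_integral_distr nn_integral_cmult)

lemma nn_integral_lborel_shift:
  fixes g :: "'a::euclidean_space \<Rightarrow> ennreal"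
  assumes "g \<in> borel_measurable borel"
  shows "(\<integral>\<^sup>+x. g (x + t) \<partial>lborel) = (\<integral>\<^sup>+x. g x \<partial>lborel)"
  using nn_integral_lborel_affine[OF assms, of 1 t] by (simp add: add.commute)

lemma nn_integral_lborel_uminus:
  fixes g :: "'a::euclidean_space \<Rightarrow> ennreal"
  assumes "g \<in> borel_measurable borel"
  shows "(\<integral>\<^sup>+x. g (- x) \<partial>lborel) = (\<integral>\<^sup>+x. g x \<partial>lborel)"
  using nn_integral_lborel_affine[OF assms, of "-1" 0] by simp

lemma nn_integral_lborel_reflect:
  fixes g :: "'a::euclidean_space \<Rightarrow> ennreal"
  assumes "g \<in> borel_measurable borel"
  shows "(\<integral>\<^sup>+x. g (t - x) \<partial>lborel) = (\<integral>\<^sup>+x. g x \<partial>lborel)"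
  using nn_integral_lborel_affine[OF assms, of "-1" t] by simp

lemma nn_integral_lborel_scale:
  fixes g :: "'a::euclidean_space \<Rightarrow> ennreal"
  assumes "g \<in> borel_measurable borel" "0 < c"
  shows "(\<integral>\<^sup>+x. g (c *\<^sub>R x) \<partial>lborel) = ennreal (c powr (- real DIM('a))) * (\<integral>\<^sup>+x. g x \<partial>lborel)"
proof -
  have "ennreal (c powr (- real DIM('a))) * ennreal (c ^ DIM('a)) = 1"
    using assms(2) by (simp add: ennreal_mult'[symmetric] powr_minus powr_realpow)
  then show ?thesis
    using nn_integral_lborel_affine[OF assms(1), of c 0] assms(2)
    by (simp add: mult.assoc[symmetric])
qed

lemma integral_lborel_affine:
  fixes g :: "'a::euclidean_space \<Rightarrow> 'b::{banach, second_countable_topology}"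
  assumes [measurable]: "g \<in> borel_measurable borel" and "c \<noteq> 0"
  shows "(LINT x|lborel. g x) = \<bar>c\<bar> ^ DIM('a) *\<^sub>R (LINT x|lborel. g (t + c *\<^sub>R x))"
  by (subst lborel_affine[OF assms(2), of t])
     (simp add: integral_density integral_distr)

lemma integral_lborel_shift:
  fixes g :: "'a::euclidean_space \<Rightarrow> 'b::{banach, second_countable_topology}"
  assumes "g \<in> borel_measurable borel"
  shows "(LINT x|lborel. g (x + t)) = (LINT x|lborel. g x)"
  using integral_lborel_affine[OF assms, of 1 t] by (simp add: add.commute)

lemma integrable_lborel_affine:
  fixes g :: "'a::euclidean_space \<Rightarrow> 'b::{banach, second_countable_topology}"
  assumes [simp]: "integrable lborel g" and "c \<noteq> 0"
  shows "integrable lborel (\<lambda>x. g (t + c *\<^sub>R x))"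
proof -
  have [measurable]: "g \<in> borel_measurable borel" using borel_measurable_integrable[OF assms(1)]
    by simp
  have "integrable (density (distr lborel borel (\<lambda>x. t + c *\<^sub>R x)) (\<lambda>_. \<bar>c\<bar>^DIM('a))) g"
    using assms(1) by (subst (asm) lborel_affine[OF assms(2), of t]) simp
  then have "integrable lborel (\<lambda>x. \<bar>c\<bar>^DIM('a) *\<^sub>R g (t + c *\<^sub>R x))"
    by (subst (asm) integrable_density) (auto simp: integrable_distr_eq)
  then have "integrable lborel (\<lambda>x. inverse (\<bar>c\<bar>^DIM('a)) *\<^sub>R (\<bar>c\<bar>^DIM('a) *\<^sub>R g (t + c *\<^sub>R x)))"
    by (rule integrable_scaleR_right)
  then show ?thesis using assms(2) by simp
qed

text \<open>Induction over integrable functions. For an indicator, a compact \<open>K\<close> inside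
  \<open>A\<close> and an open \<open>U\<close> around \<open>A\<close> confine the change caused by
  a small shift to \<open>U - K\<close> and its translate; sums use the triangle inequality, limits
  a three-term splitting whose outer terms agree by translation invariance.\<close>

lemma translation_continuous_L1:
  fixes f :: "'a::euclidean_space \<Rightarrow> 'b::{banach, second_countable_topology}"
  assumes "integrable lborel f"
  shows "((\<lambda>z. \<integral>\<^sup>+x. ennreal (norm (f (x + z) - f x)) \<partial>lborel) \<longlongrightarrow> 0) (at 0)"
  using assms
proof induction
  case (base A c)
  have A[measurable]: "A \<in> sets borel" and fin: "emeasure lborel A < \<infinity>" using base by auto
  show ?case
  proof (rule order_tendstoI)
    fix e :: ennreal assume "0 < e"
    \<comment> \<open>\<open>U - K\<close> will have measure at most \<open>e0 + e0\<close>, and it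
      occurs twice, once shifted; this explains the factors.\<close>
    obtain e0 :: real where e0: "0 < e0" "ennreal (norm c) * (2 * (ennreal e0 + ennreal e0)) < e"
    proof (cases "e = \<infinity>")
      case True
      have "ennreal (norm c) * (2 * (ennreal 1 + ennreal 1)) < e"
        unfolding True by (auto simp: ennreal_mult_less_top simp flip: ennreal_plus)
      then show ?thesis using that[of 1] by simp
    next
      case False
      then obtain r where r: "e = ennreal r" "0 < r" using \<open>0 < e\<close>
        by (cases e) (auto simp: )
      have "norm c * (2 * (r / (4 * (norm c + 1)) + r / (4 * (norm c + 1)))) < r"
        using r by (simp add: field_simps) (subst pos_divide_less_eq, auto intro: add_pos_nonneg
            simp: algebra_simps)
      moreover define q where "q = r / (4 * (norm c + 1))"
      ultimately have q: "norm c * (2 * (q + q)) < r" by simp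
      have "q > 0" using r by (auto simp: q_def add_nonneg_pos)
      have "ennreal (norm c) * (2 * (ennreal q + ennreal q)) = ennreal (norm c * (2 * (q + q)))"
      proof -
        have "ennreal (norm c * (2 * (q + q))) = ennreal (norm c) * ennreal (2 * (q + q))"
          using \<open>q > 0\<close> by (intro ennreal_mult) auto
        also have "ennreal (2 * (q + q)) = ennreal 2 * ennreal (q + q)"
          using \<open>q > 0\<close> by (intro ennreal_mult) auto
        also have "ennreal (q + q) = ennreal q + ennreal q"
          using \<open>q > 0\<close> by (intro ennreal_plus) auto
        finally show ?thesis by simp
      qed
      also have "\<dots> < e" using q r \<open>q > 0\<close> by (auto intro!: ennreal_lessI)
      finally show ?thesis using that[of q] \<open>q > 0\<close> by simp
    qed
    \<comment> \<open>Restricting \<open>lborel\<close> to \<open>A\<close> gives a finite measure,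
      to which inner regularity by compact sets applies.\<close>
    have dens: "emeasure (density lborel (indicator A)) X = emeasure lborel (A \<inter> X)"
        if [measurable]: "X \<in> sets borel" for X
      by (subst emeasure_density) (auto simp: indicator_inter_arith[symmetric])
    have sup: "emeasure lborel A
        = (SUP K \<in> {K. K \<subseteq> A \<and> compact K}. emeasure (density lborel (indicator A)) K)"
      using inner_regular[of "density lborel (indicator A)" A] fin A by (simp add: dens)
    have "\<exists>K. K \<subseteq> A \<and> compact K \<and> emeasure lborel A < emeasure lborel K + ennreal e0"
    proof (cases "emeasure lborel A = 0")
      case True then show ?thesis using e0(1) by (intro exI[of _ "{}"]) auto
    next
      case False
      have "emeasure lborel A - ennreal e0 < emeasure lborel A"
        using False fin e0(1) by (intro ennreal_between) (auto simp: zero_less_iff_neq_zero)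
      then obtain K where K: "K \<subseteq> A" "compact K" "emeasure lborel A - ennreal e0
          < emeasure (density lborel (indicator A)) K"
        by (subst (asm) (2) sup) (auto simp: less_SUP_iff)
      have [measurable]: "K \<in> sets borel" using K(2) by (simp add: borel_compact)
      have "emeasure (density lborel (indicator A)) K = emeasure lborel K"
        using K(1) by (simp add: dens Int_absorb1)
      then have lt: "emeasure lborel A - ennreal e0 < emeasure lborel K" using K(3) by simp
      have "emeasure lborel K < \<infinity>" using emeasure_mono[OF K(1), of lborel] fin
        by (simp add: le_less_trans)
      then have "emeasure lborel A < emeasure lborel K + ennreal e0"
        using lt fin e0(1) by (cases "emeasure lborel A"; cases "emeasure lborel K")
          (auto simp: ennreal_minus ennreal_less_iff ennreal_plus[symmetric] simp del: ennreal_plus,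
           smt (verit) ennreal_leI not_le)
      then show ?thesis using K by blast
    qed
    then obtain K where K: "K \<subseteq> A" "compact K" and Ke: "emeasure lborel A
        < emeasure lborel K + ennreal e0" by blast
    obtain U where U: "open U" "A \<subseteq> U" "emeasure lborel (U - A) < e0"
      using outer_regular_lborel[OF A e0(1)] by blast
    have [measurable]: "K \<in> sets borel" "U \<in> sets borel" using K(2) U(1)
      by (auto simp: borel_compact)
    have finK: "emeasure lborel K < \<infinity>" using emeasure_mono[OF K(1), of lborel] fin
      by (simp add: le_less_trans)
    have "emeasure lborel A = emeasure lborel K + emeasure lborel (A - K)"
      using K(1) by (subst plus_emeasure) (auto simp: Un_absorb1)
    then have AK: "emeasure lborel (A - K) < e0"
      using Ke finK by (simp add: ennreal_add_left_cancel_less)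
    have "emeasure lborel (U - K) = emeasure lborel (U - A) + emeasure lborel (A - K)"
      using K(1) U(2) by (subst plus_emeasure) (auto intro!: arg_cong2[where f=emeasure])
    also have "\<dots> \<le> ennreal e0 + ennreal e0" using AK U(3) by (intro add_mono) auto
    finally have UK: "emeasure lborel (U - K) \<le> ennreal e0 + ennreal e0" .
    obtain d where d: "d > 0" "\<And>x y. x \<in> K \<Longrightarrow> y \<notin> U \<Longrightarrow> d \<le> dist x y"
    proof -
      have "closed (- U)" "K \<inter> - U = {}" using K U by auto
      with separate_compact_closed[OF K(2)] show thesis using that by (metis ComplI)
    qed
    have "(\<integral>\<^sup>+x. ennreal (norm (indicator A (x + z) *\<^sub>R c - indicator A x *\<^sub>R c)) \<partial>lborel) < e"
        if z: "norm z < d" for z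
    proof -
      \<comment> \<open>Suppose exactly one of the two points lies in \<open>A\<close>. If it is
        outside \<open>K\<close>, it lies in \<open>U - K\<close>. If it is in \<open>K\<close>, the
        other point is within distance \<open>d\<close>, hence in \<open>U\<close>, and it lies
        outside \<open>A\<close> and so outside \<open>K\<close>.\<close>
      have "ennreal (norm (indicator A (x + z) *\<^sub>R c - indicator A x *\<^sub>R c))
          \<le> ennreal (norm c) * (indicator (U - K) x + indicator (U - K) (x + z))" for x
        using d(2)[of x "x+z"] d(2)[of "x+z" x] z K(1) U(2)
        by (auto simp: indicator_def dist_norm intro: ennreal_le_mult_2)
      then have "(\<integral>\<^sup>+x. ennreal (norm (indicator A (x + z) *\<^sub>R c - indicator A x *\<^sub>R c)) \<partial>lborel)
        \<le> (\<integral>\<^sup>+x. ennreal (norm c) * (indicator (U - K) x + indicator (U - K) (x + z)) \<partial>lborel)"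
        by (intro nn_integral_mono) auto
      also have "\<dots> = ennreal (norm c) * (emeasure lborel (U - K) + emeasure lborel (U - K))"
        using nn_integral_lborel_shift[of "indicator (U - K)" z]
        by (simp add: nn_integral_cmult nn_integral_add)
      also have "\<dots> \<le> ennreal (norm c) * (2 * (ennreal e0 + ennreal e0))"
        using UK by (intro mult_left_mono) (auto simp: mult_2 intro: add_mono)
      finally show ?thesis using e0(2) by simp
    qed
    then show "\<forall>\<^sub>F z in at 0. (\<integral>\<^sup>+x. ennreal (norm (indicator A (x + z) *\<^sub>R c
        - indicator A x *\<^sub>R c)) \<partial>lborel) < e"
      using d(1) by (auto simp: eventually_at dist_norm intro!: exI[of _ d])
  qed auto
next
  case (add f g)
  have [measurable]: "f \<in> borel_measurable borel" "g \<in> borel_measurable borel" using add by auto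
  have "((\<lambda>z. (\<integral>\<^sup>+x. ennreal (norm (f (x + z) - f x)) \<partial>lborel) + (\<integral>\<^sup>+x. ennreal (norm (g (x + z)
      - g x)) \<partial>lborel)) \<longlongrightarrow> 0 + 0) (at 0)"
    by (intro tendsto_add add)
  then have lim: "((\<lambda>z. (\<integral>\<^sup>+x. ennreal (norm (f (x + z) - f x)) \<partial>lborel)
      + (\<integral>\<^sup>+x. ennreal (norm (g (x + z) - g x)) \<partial>lborel)) \<longlongrightarrow> 0) (at 0)"
    by simp
  show ?case
  proof (rule ennreal_tendsto_0_le[OF lim])
    fix z
    show "(\<integral>\<^sup>+x. ennreal (norm (f (x + z) + g (x + z) - (f x + g x))) \<partial>lborel)
      \<le> (\<integral>\<^sup>+x. ennreal (norm (f (x + z) - f x)) \<partial>lborel) + (\<integral>\<^sup>+x. ennreal (norm (g (x + z) - g x))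
          \<partial>lborel)"
      by (subst nn_integral_add[symmetric])
         (auto intro!: nn_integral_mono simp: ennreal_plus[symmetric] add_diff_add
             norm_triangle_ineq simp del: ennreal_plus)
  qed
next
  case (lim f s)
  have [measurable]: "f \<in> borel_measurable borel" "\<And>i. s i \<in> borel_measurable borel" using lim
    by auto
  have intf: "integrable lborel f" by fact
  have conv: "(\<lambda>i. \<integral>\<^sup>+x. ennreal (norm (f x - s i x)) \<partial>lborel) \<longlonglongrightarrow> 0"
  proof (rule nn_integral_dominated_convergence_norm[where w="\<lambda>x. 2 * norm (f x)"])
    have "(\<integral>\<^sup>+x. ennreal (2 * norm (f x)) \<partial>lborel) = 2 * (\<integral>\<^sup>+x. ennreal (norm (f x)) \<partial>lborel)"
      by (subst nn_integral_cmult[symmetric]) (auto simp: ennreal_mult)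
    then show "(\<integral>\<^sup>+x. ennreal (2 * norm (f x)) \<partial>lborel) < \<infinity>"
      using intf by (simp add: integrable_iff_bounded ennreal_mult_less_top)
  qed (use lim in auto)
  show ?case
  proof (rule order_tendstoI)
    fix e :: ennreal assume "0 < e"
    then obtain e1 where e1: "0 < e1" "e1 + e1 + e1 < e"
    proof (cases e)
      case (real r)
      then show ?thesis using \<open>0 < e\<close> that[of "ennreal (r/4)"]
        by (auto simp: ennreal_plus[symmetric] ennreal_less_iff simp del: ennreal_plus)
    qed (use that[of 1] in auto)
    obtain i where i: "(\<integral>\<^sup>+x. ennreal (norm (f x - s i x)) \<partial>lborel) < e1"
      using eventually_happens'[OF sequentially_bot order_tendstoD(2)[OF conv e1(1)]] by blast
    have bd: "(\<integral>\<^sup>+x. ennreal (norm (f (x + z) - f x)) \<partial>lborel)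
        \<le> e1 + (\<integral>\<^sup>+x. ennreal (norm (s i (x + z) - s i x)) \<partial>lborel) + e1" for z
    proof -
      have "(\<integral>\<^sup>+x. ennreal (norm (f (x + z) - f x)) \<partial>lborel) \<le>
         (\<integral>\<^sup>+x. ennreal (norm (f (x+z) - s i (x+z))) + ennreal (norm (s i (x + z) - s i x)) +
             ennreal (norm (f x - s i x)) \<partial>lborel)"
      proof (intro nn_integral_mono)
        fix x
        have "norm (f (x + z) - f x) \<le> norm ((f (x+z) - s i (x+z)) + (s i (x + z) - s i x))
            + norm (s i x - f x)"
          using norm_triangle_ineq[of "(f (x+z) - s i (x+z)) + (s i (x + z) - s i x)" "s i x - f x"]
          by simp
        also have "\<dots> \<le> norm (f (x+z) - s i (x+z)) + norm (s i (x + z) - s i x) + norm (f x - s i x)"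
          by (intro add_mono norm_triangle_ineq) (simp add: norm_minus_commute)
        finally show "ennreal (norm (f (x + z) - f x)) \<le> ennreal (norm (f (x+z) - s i (x+z)))
            + ennreal (norm (s i (x + z) - s i x)) + ennreal (norm (f x - s i x))"
          by (simp add: ennreal_plus[symmetric] del: ennreal_plus)
      qed
      also have "\<dots> = (\<integral>\<^sup>+x. ennreal (norm (f x - s i x)) \<partial>lborel)
          + (\<integral>\<^sup>+x. ennreal (norm (s i (x + z) - s i x)) \<partial>lborel)
          + (\<integral>\<^sup>+x. ennreal (norm (f x - s i x)) \<partial>lborel)"
        using nn_integral_lborel_shift[of "\<lambda>x. ennreal (norm (f x - s i x))" z]
        by (simp add: nn_integral_add)
      also have "\<dots> \<le> e1 + (\<integral>\<^sup>+x. ennreal (norm (s i (x + z) - s i x)) \<partial>lborel) + e1"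
        using i by (intro add_mono) auto
      finally show ?thesis .
    qed
    have "\<forall>\<^sub>F z in at 0. (\<integral>\<^sup>+x. ennreal (norm (s i (x + z) - s i x)) \<partial>lborel) < e1"
      by (rule order_tendstoD(2)[OF _ e1(1)]) (use lim in blast)
    then show "\<forall>\<^sub>F z in at 0. (\<integral>\<^sup>+x. ennreal (norm (f (x + z) - f x)) \<partial>lborel) < e"
    proof eventually_elim
      case (elim z)
      have "e1 + (\<integral>\<^sup>+x. ennreal (norm (s i (x + z) - s i x)) \<partial>lborel) + e1 \<le> e1 + e1 + e1"
        using elim by (intro add_mono) auto
      with bd[of z] e1(2) show ?case by (meson le_less_trans order_trans)
    qed
  qed auto
qed

text \<open>Values in \<open>ennreal\<close> let limits and comparisons be stated before finiteness
  is known.\<close>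

definition l2sq :: "('a::euclidean_space \<Rightarrow> complex) \<Rightarrow> ennreal" where
  "l2sq f = (\<integral>\<^sup>+x. ennreal ((cmod (f x))\<^sup>2) \<partial>lborel)"

lemma Lspace2_iff: "u \<in> Lspace 2 \<longleftrightarrow> u \<in> borel_measurable borel \<and> l2sq u < \<infinity>"
  by (auto simp: Lspace_def l2sq_def integrable_iff_bounded)

lemma Lnorm2_sq: "(Lnorm 2 u)\<^sup>2 = (LINT x|lborel. (cmod (u x))\<^sup>2)"
  by (simp add: Lnorm_def powr_half_sqrt integral_nonneg_AE)

lemma Lnorm2_sq_ennreal: "u \<in> Lspace 2 \<Longrightarrow> ennreal ((Lnorm 2 u)\<^sup>2) = l2sq u"
  unfolding Lnorm2_sq l2sq_def
  by (subst nn_integral_eq_integral) (auto simp: Lspace_def)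

lemma l2sq_cong: "(AE x in lborel. cmod (f x) = cmod (g x)) \<Longrightarrow> l2sq f = l2sq g"
  unfolding l2sq_def by (intro nn_integral_cong_AE) auto

lemma l2sq_mono: "(AE x in lborel. cmod (f x) \<le> cmod (g x)) \<Longrightarrow> l2sq f \<le> l2sq g"
  unfolding l2sq_def by (intro nn_integral_mono_AE) (auto intro!: ennreal_leI)

lemma l2sq_eq_0_iff:
  "f \<in> borel_measurable borel \<Longrightarrow> l2sq f = 0 \<longleftrightarrow> (AE x in lborel. f x = 0)"
  unfolding l2sq_def by (subst nn_integral_0_iff_AE) (auto simp: ennreal_eq_0_iff)

lemma l2sq_cmult: "f \<in> borel_measurable borel \<Longrightarrow> l2sq (\<lambda>x. c * f x) = ennreal ((cmod c)\<^sup>2) * l2sq f"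
  unfolding l2sq_def
  by (subst nn_integral_cmult[symmetric]) (auto simp: norm_mult power_mult_distrib ennreal_mult)

lemma l2sq_shift: "f \<in> borel_measurable borel \<Longrightarrow> l2sq (\<lambda>x. f (x + z)) = l2sq f"
  unfolding l2sq_def by (subst nn_integral_lborel_shift[of "\<lambda>x. ennreal ((cmod (f x))\<^sup>2)" z,
      symmetric]) auto

lemma l2sq_uminus: "f \<in> borel_measurable borel \<Longrightarrow> l2sq (\<lambda>x. f (- x)) = l2sq f"
  unfolding l2sq_def by (subst nn_integral_lborel_uminus[of "\<lambda>x. ennreal ((cmod (f x))\<^sup>2)",
      symmetric]) auto

lemma l2sq_scale:
  fixes f :: "'a::euclidean_space \<Rightarrow> complex"
  shows "f \<in> borel_measurable borel \<Longrightarrow> 0 < c \<Longrightarrow>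
    l2sq (\<lambda>x. f (c *\<^sub>R x)) = ennreal (c powr (- real DIM('a))) * l2sq f"
  unfolding l2sq_def by (subst nn_integral_lborel_scale[of "\<lambda>x. ennreal ((cmod (f x))\<^sup>2)",
      symmetric]) auto

text \<open>The triangle inequality squared, with the cross term split by Young's inequality. A
  factor \<open>1 + e\<close> close to 1 on the main term is what preserves exact constants in
  limits; \<open>e = 1\<close> gives the crude factors 2.\<close>

lemma cmod_sq_eps:
  assumes "e > 0"
  shows "(cmod a)\<^sup>2 \<le> (1 + e) * (cmod b)\<^sup>2 + (1 + 1 / e) * (cmod (a - b))\<^sup>2"
proof -
  have "cmod a \<le> cmod b + cmod (a - b)" using norm_triangle_sub by blast
  then have 1: "(cmod a)\<^sup>2 \<le> (cmod b + cmod (a - b))\<^sup>2" by (intro power_mono) auto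
  have "0 \<le> (sqrt e * cmod b - cmod (a - b) / sqrt e)\<^sup>2" by simp
  also have "\<dots> = e * (cmod b)\<^sup>2 + (cmod (a - b))\<^sup>2 / e - 2 * cmod b * cmod (a - b)"
    using assms by (simp add: power2_diff power_mult_distrib power_divide)
  finally show ?thesis using 1 by (simp add: power2_sum algebra_simps)
qed

lemma l2sq_eps:
  assumes [measurable]: "f \<in> borel_measurable borel" "g \<in> borel_measurable borel" and "e > 0"
  shows "l2sq f \<le> ennreal (1 + e) * l2sq g + ennreal (1 + 1 / e) * l2sq (\<lambda>x. f x - g x)"
proof -
  have "l2sq f \<le> (\<integral>\<^sup>+x. ennreal (1 + e) * ennreal ((cmod (g x))\<^sup>2) + ennreal (1 + 1 / e)
      * ennreal ((cmod (f x - g x))\<^sup>2) \<partial>lborel)"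
    unfolding l2sq_def
    by (intro nn_integral_mono)
       (use cmod_sq_eps[OF assms(3)] assms(3) in \<open>auto simp: ennreal_mult'[symmetric]
           ennreal_plus[symmetric] simp del: ennreal_plus intro!: ennreal_leI\<close>)
  then show ?thesis unfolding l2sq_def
    by (simp add: nn_integral_add nn_integral_cmult)
qed

lemma l2sq_triangle:
  assumes [measurable]: "f \<in> borel_measurable borel" "g \<in> borel_measurable borel"
      "h \<in> borel_measurable borel"
  shows "l2sq (\<lambda>x. f x - g x) \<le> 2 * l2sq (\<lambda>x. f x - h x) + 2 * l2sq (\<lambda>x. h x - g x)"
  using l2sq_eps[of "\<lambda>x. f x - g x" "\<lambda>x. f x - h x" 1] by (simp add: algebra_simps)

lemma l2sq_add_le:
  assumes [measurable]: "f \<in> borel_measurable borel" "g \<in> borel_measurable borel"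
  shows "l2sq (\<lambda>x. f x + g x) \<le> 2 * l2sq f + 2 * l2sq g"
  using l2sq_eps[of "\<lambda>x. f x + g x" f 1] by (simp add: algebra_simps)

lemma l2sq_minus_commute: "l2sq (\<lambda>x. f x - g x) = l2sq (\<lambda>x. g x - f x)"
  by (intro l2sq_cong) (simp add: norm_minus_commute)

lemma L2_limit_iff: "L2_limit F v \<longleftrightarrow> v \<in> Lspace 2 \<and> ((\<lambda>R. l2sq (\<lambda>x. F R x - v x)) \<longlongrightarrow> 0) at_top"
  by (simp add: L2_limit_def l2sq_def)

text \<open>
  The map \<open>z \<mapsto> \<bar>z\<bar> z\<close> sends \<open>L\<^sup>2\<close> to \<open>L\<^sup>1\<close>, so this inequality transfers continuity of translations from
  \<open>L\<^sup>1\<close> to \<open>L\<^sup>2\<close>.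
\<close>

lemma cmod_sq_le_signed_square:
  "(cmod (a - b))\<^sup>2 \<le> 2 * cmod (of_real (cmod a) * a - of_real (cmod b) * b)"
proof (cases "a = b")
  case False
  let ?p = "cmod a" and ?q = "cmod b" and ?d = "a - b"
  let ?w = "of_real ?p * a - of_real ?q * b"
  \<comment> \<open>By polarization the inner product exceeds (p + q) |a - b|^2 / 2 by the
    nonnegative term (p + q) (p - q)^2 / 2. Cauchy-Schwarz bounds it from above, and |a - b| <= p +
    q turns the factor p + q into |a - b|.\<close>
  have "?w \<bullet> ?d = ?p * (a \<bullet> a) + ?q * (b \<bullet> b) - (?p + ?q) * (a \<bullet> b)"
    by (simp add: inner_diff_left inner_diff_right inner_complex_def algebra_simps)
  also have "\<dots> = ?p ^ 3 + ?q ^ 3 - (?p + ?q) * ((?p\<^sup>2 + ?q\<^sup>2 - (cmod ?d)\<^sup>2) / 2)"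
    by (simp add: dot_norm_neg power2_norm_eq_inner[symmetric] power3_eq_cube power2_eq_square)
  also have "\<dots> = (?p + ?q) * (?p - ?q)\<^sup>2 / 2 + (?p + ?q) * (cmod ?d)\<^sup>2 / 2"
    by (simp add: power2_eq_square power3_eq_cube field_simps)
  finally have "(?p + ?q) * (cmod ?d)\<^sup>2 / 2 \<le> ?w \<bullet> ?d" by simp
  moreover have "cmod ?d * (cmod ?d)\<^sup>2 \<le> (?p + ?q) * (cmod ?d)\<^sup>2"
    by (intro mult_right_mono norm_triangle_ineq4) auto
  ultimately have "cmod ?d * (cmod ?d)\<^sup>2 \<le> 2 * (?w \<bullet> ?d)" by simp
  also have "\<dots> \<le> 2 * (cmod ?w * cmod ?d)" by (intro mult_left_mono norm_cauchy_schwarz) simp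
  finally have "cmod ?d * (cmod ?d)\<^sup>2 \<le> cmod ?d * (2 * cmod ?w)" by (simp only: mult_ac)
  then show ?thesis using False by simp
qed simp

lemma translation_continuous_L2:
  fixes f :: "'a::euclidean_space \<Rightarrow> complex"
  assumes [measurable]: "f \<in> borel_measurable borel" and "l2sq f < \<infinity>"
  shows "((\<lambda>z. l2sq (\<lambda>x. f (x + z) - f x)) \<longlongrightarrow> 0) (at 0)"
proof -
  define g where "g = (\<lambda>x. of_real (cmod (f x)) * f x)"
  have [measurable]: "g \<in> borel_measurable borel" unfolding g_def by measurable
  have "integrable lborel g"
    using assms(2) by (simp add: integrable_iff_bounded g_def l2sq_def norm_mult power2_eq_square)
  then have "((\<lambda>z. 2 * (\<integral>\<^sup>+x. ennreal (norm (g (x + z) - g x)) \<partial>lborel)) \<longlongrightarrow> 2 * 0) (at 0)"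
    by (intro ennreal_tendsto_cmult translation_continuous_L1) auto
  then have lim: "((\<lambda>z. 2 * (\<integral>\<^sup>+x. ennreal (norm (g (x + z) - g x)) \<partial>lborel)) \<longlongrightarrow> 0) (at 0)"
    by simp
  show ?thesis
  proof (rule ennreal_tendsto_0_le[OF lim])
      fix z
      have "2 * (\<integral>\<^sup>+x. ennreal (norm (g (x + z) - g x)) \<partial>lborel)
          = (\<integral>\<^sup>+x. ennreal (2 * norm (g (x + z) - g x)) \<partial>lborel)"
        by (subst nn_integral_cmult[symmetric]) (auto simp: ennreal_mult)
      then show "l2sq (\<lambda>x. f (x + z) - f x) \<le> 2 * (\<integral>\<^sup>+x. ennreal (norm (g (x + z) - g x)) \<partial>lborel)"
        unfolding l2sq_def g_def using cmod_sq_le_signed_square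
        by (auto intro!: nn_integral_mono ennreal_leI)
  qed
qed

section \<open>Completeness of \<open>L\<^sup>2\<close> and the Gaussian\<close>

text \<open>The Riesz-Fischer argument: a rapidly converging subsequence converges almost
  everywhere, and Fatou's lemma turns its pointwise limit into an L^2 limit of the whole
  sequence.\<close>

lemma L2_complete:
  fixes f :: "nat \<Rightarrow> 'a::euclidean_space \<Rightarrow> complex"
  assumes [measurable]: "\<And>n. f n \<in> borel_measurable borel"
    and fin: "\<And>n. l2sq (f n) < \<infinity>"
    and Cauchy: "\<And>e::real. e > 0 \<Longrightarrow> \<exists>N. \<forall>m\<ge>N. \<forall>n\<ge>N. l2sq (\<lambda>x. f m x - f n x) < ennreal e"
  shows "\<exists>v\<in>Lspace 2. (\<lambda>n. l2sq (\<lambda>x. f n x - v x)) \<longlonglongrightarrow> 0"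
proof -
  have "\<exists>N. \<forall>m\<ge>N. \<forall>n\<ge>N. l2sq (\<lambda>x. f m x - f n x) < ennreal ((1/4)^k)" for k :: nat
    by (rule Cauchy) simp
  then obtain N where N: "\<And>k m n. m \<ge> N k \<Longrightarrow> n \<ge> N k \<Longrightarrow> l2sq (\<lambda>x. f m x - f n x) < ennreal ((1/4)^k)"
    by metis
  \<comment> \<open>Partial sums make the indices of the subsequence increasing while keeping
    \<open>N k \<le> r k\<close>.\<close>
  define r where "r = (\<lambda>k. \<Sum>i\<le>k. N i + 1)"
  have rN: "N k \<le> r k" for k
    unfolding r_def by (rule order_trans[OF _ member_le_sum[of k]]) auto
  have r_Suc: "r k \<le> r (Suc k)" for k by (simp add: r_def)
  define a where "a = (\<lambda>k x. cmod (f (r (Suc k)) x - f (r k) x))"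
  have [measurable]: "a k \<in> borel_measurable borel" for k unfolding a_def by measurable
  have ak: "(\<integral>\<^sup>+x. ennreal ((a k x)\<^sup>2) \<partial>lborel) \<le> ennreal ((1/4)^k)" for k
    using N[of k "r (Suc k)" "r k"] rN[of k] r_Suc[of k] by (simp add: a_def l2sq_def less_imp_le)
  \<comment> \<open>Against the bound \<open>(1/4)^k\<close> the weight \<open>2^k\<close> still
    leaves a convergent series, and boundedness of the weighted terms forces geometric decay of
    \<open>a k x\<close>.\<close>
  have "(\<integral>\<^sup>+x. (\<Sum>k. ennreal (2^k * (a k x)\<^sup>2)) \<partial>lborel)
      = (\<Sum>k. \<integral>\<^sup>+x. ennreal (2^k * (a k x)\<^sup>2) \<partial>lborel)"
    by (intro nn_integral_suminf) auto
  also have "\<dots> \<le> (\<Sum>k. ennreal ((1/2)^k))"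
  proof (intro suminf_le summableI)
    fix k
    have "(\<integral>\<^sup>+x. ennreal (2^k * (a k x)\<^sup>2) \<partial>lborel)
        = ennreal (2^k) * (\<integral>\<^sup>+x. ennreal ((a k x)\<^sup>2) \<partial>lborel)"
      by (subst nn_integral_cmult[symmetric]) (auto simp: ennreal_mult)
    also have "\<dots> \<le> ennreal (2^k) * ennreal ((1/4)^k)" by (intro mult_left_mono ak) auto
    also have "\<dots> = ennreal ((1/2)^k)"
      by (subst ennreal_mult[symmetric]) (auto simp: power_mult_distrib[symmetric])
    finally show "(\<integral>\<^sup>+x. ennreal (2^k * (a k x)\<^sup>2) \<partial>lborel) \<le> ennreal ((1/2)^k)" .
  qed
  also have "\<dots> = ennreal (\<Sum>k. (1/2)^k)" by (intro suminf_ennreal2 summable_geometric) auto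
  finally have "(\<integral>\<^sup>+x. (\<Sum>k. ennreal (2^k * (a k x)\<^sup>2)) \<partial>lborel) < \<infinity>"
    by (rule le_less_trans) simp
  then have "(\<integral>\<^sup>+x. (\<Sum>k. ennreal (2^k * (a k x)\<^sup>2)) \<partial>lborel) \<noteq> \<infinity>" by simp
  then have "AE x in lborel. (\<Sum>k. ennreal (2^k * (a k x)\<^sup>2)) \<noteq> \<infinity>"
    by (intro nn_integral_noteq_infinite) auto
  then have conv: "AE x in lborel. convergent (\<lambda>k. f (r k) x)"
  proof eventually_elim
    case (elim x)
    then have s: "summable (\<lambda>k. 2^k * (a k x)\<^sup>2)"
      by (intro summable_suminf_not_top) (auto simp: a_def)
    then have "(\<lambda>k. 2^k * (a k x)\<^sup>2) \<longlonglongrightarrow> 0" by (rule summable_LIMSEQ_zero)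
    then have "Bseq (\<lambda>k. 2^k * (a k x)\<^sup>2)" by (intro convergent_imp_Bseq convergentI)
    then obtain C where C': "\<And>k. norm (2^k * (a k x)\<^sup>2) \<le> C" by (auto simp: Bseq_def)
    have C: "2^k * (a k x)\<^sup>2 \<le> C" for k using C'[of k] by simp
    have "C \<ge> 0" using C[of 0] by (rule order_trans[rotated]) simp
    have ab: "a k x \<le> sqrt C * (1 / sqrt 2)^k" for k
    proof (rule power2_le_imp_le)
      have "(a k x)\<^sup>2 \<le> C / 2^k" using C[of k] by (simp add: field_simps)
      also have "\<dots> = (sqrt C * (1 / sqrt 2)^k)\<^sup>2" using \<open>C \<ge> 0\<close>
        by (simp add: power_mult_distrib power_divide power_mult[symmetric] mult.commute[of k]
            power_mult)
      finally show "(a k x)\<^sup>2 \<le> (sqrt C * (1 / sqrt 2)^k)\<^sup>2" .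
    qed (use \<open>C \<ge> 0\<close> in auto)
    have "summable (\<lambda>k. sqrt C * (1 / sqrt 2)^k)" by (intro summable_mult summable_geometric) auto
    then have "summable (\<lambda>k. f (r (Suc k)) x - f (r k) x)"
      by (rule summable_comparison_test'[where N=0]) (use ab in \<open>auto simp: a_def\<close>)
    then have "convergent (\<lambda>n. \<Sum>k<n. f (r (Suc k)) x - f (r k) x)"
      by (simp add: summable_iff_convergent)
    then have "convergent (\<lambda>n. f (r n) x - f (r 0) x)" by (subst (asm) sum_lessThan_telescope)
    then have "convergent (\<lambda>n. (f (r n) x - f (r 0) x) + f (r 0) x)"
      by (intro convergent_add convergent_const)
    then show ?case by simp
  qed
  define v where "v = (\<lambda>x. lim (\<lambda>k. f (r k) x))"
  have v[measurable]: "v \<in> borel_measurable borel" unfolding v_def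
    by (rule borel_measurable_lim_metric) simp
  \<comment> \<open>Fatou's lemma along the subsequence, with the index \<open>n\<close> held
    fixed.\<close>
  have close: "l2sq (\<lambda>x. f n x - v x) \<le> ennreal ((1/4)^k)" if "n \<ge> N k" for n k
  proof -
    have "l2sq (\<lambda>x. f n x - v x)
        = (\<integral>\<^sup>+x. liminf (\<lambda>j. ennreal ((cmod (f n x - f (r j) x))\<^sup>2)) \<partial>lborel)"
      unfolding l2sq_def
    proof (intro nn_integral_cong_AE, use conv in eventually_elim)
      case (elim x)
      then have "(\<lambda>j. f (r j) x) \<longlonglongrightarrow> v x" by (simp add: v_def convergent_LIMSEQ_iff)
      then have "(\<lambda>j. ennreal ((cmod (f n x - f (r j) x))\<^sup>2)) \<longlonglongrightarrow> ennreal ((cmod (f n x - v x))\<^sup>2)"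
        by (intro tendsto_intros tendsto_ennrealI)
      from lim_imp_Liminf[OF sequentially_bot this] show ?case by simp
    qed
    also have "\<dots> \<le> liminf (\<lambda>j. l2sq (\<lambda>x. f n x - f (r j) x))"
      unfolding l2sq_def by (intro nn_integral_liminf) auto
    also have "\<dots> \<le> ennreal ((1/4)^k)"
    proof (rule Liminf_le)
      show "\<forall>\<^sub>F j in sequentially. l2sq (\<lambda>x. f n x - f (r j) x) \<le> ennreal ((1/4)^k)"
        using eventually_ge_at_top[of k]
      proof eventually_elim
        case (elim j)
        have "r k \<le> r j" using elim by (rule lift_Suc_mono_le[of r, OF r_Suc])
        then show ?case using N[of k n "r j"] that rN[of k] by (simp add: less_imp_le)
      qed
    qed simp
    finally show ?thesis .
  qed
  have "l2sq v \<le> 2 * l2sq (\<lambda>x. v x - f (N 0) x) + 2 * l2sq (f (N 0))"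
    using l2sq_add_le[of "\<lambda>x. v x - f (N 0) x" "f (N 0)"] by simp
  also have "\<dots> < \<infinity>"
  proof -
    have "l2sq (\<lambda>x. v x - f (N 0) x) < \<infinity>"
      by (subst l2sq_minus_commute, rule le_less_trans[OF close[of 0 "N 0"]]) auto
    then show ?thesis using fin[of "N 0"] by (simp add: ennreal_mult_less_top)
  qed
  finally have "v \<in> Lspace 2" by (simp add: Lspace2_iff)
  moreover have "(\<lambda>n. l2sq (\<lambda>x. f n x - v x)) \<longlonglongrightarrow> 0"
  proof (rule order_tendstoI)
    fix e :: ennreal assume e: "0 < e"
    have "(\<lambda>k. ennreal ((1/4)^k)) \<longlonglongrightarrow> ennreal 0"
      by (intro tendsto_ennrealI LIMSEQ_realpow_zero) auto
    then have "\<forall>\<^sub>F k in sequentially. ennreal ((1/4)^k) < e" using e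
      by (intro order_tendstoD(2)) auto
    then obtain k where "ennreal ((1/4)^k) < e"
      using eventually_happens'[OF sequentially_bot] by blast
    then show "\<forall>\<^sub>F n in sequentially. l2sq (\<lambda>x. f n x - v x) < e"
      unfolding eventually_sequentially using close[of k] by (meson le_less_trans)
  qed auto
  ultimately show ?thesis by blast
qed

text \<open>Scaled to the value 1 at the origin instead of unit mass, so that
  \<open>gauss (e *\<^sub>R \<xi>)\<close> increases to 1 as \<open>e\<close> decreases to 0; with
  this width it is its own unitary Fourier transform.\<close>

definition gauss :: "'a::euclidean_space \<Rightarrow> real" where
  "gauss x = exp (- (norm x)\<^sup>2 / 2)"

lemma gauss_measurable[measurable]: "gauss \<in> borel_measurable borel"
  unfolding gauss_def[abs_def] by measurable

lemma gauss_bounds: "0 < gauss x" "gauss x \<le> 1" by (auto simp: gauss_def)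

lemma cis_measurable[measurable]: "cis \<in> borel_measurable borel"
  by (intro borel_measurable_continuous_onI continuous_intros)

lemma norm_sq_Basis: "(norm (x::'a::euclidean_space))\<^sup>2 = (\<Sum>b\<in>Basis. (x \<bullet> b)\<^sup>2)"
  unfolding power2_norm_eq_inner by (subst euclidean_inner) (simp add: power2_eq_square)

lemma sum_Basis_gauss: "(\<Sum>b\<in>Basis. - (x \<bullet> b)\<^sup>2 / 2) = - (norm (x::'a::euclidean_space))\<^sup>2 / 2"
  unfolding norm_sq_Basis by (simp add: sum_negf sum_divide_distrib)

lemma gauss_prod: "gauss (x::'a::euclidean_space) = (2 * pi) powr (real DIM('a) / 2)
    * (\<Prod>b\<in>Basis. std_normal_density (x \<bullet> b))"
proof -
  have "(\<Prod>b\<in>Basis. std_normal_density (x \<bullet> b)) = (1 / sqrt (2 * pi)) ^ DIM('a) * exp (\<Sum>b\<in>Basis.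
      - (x \<bullet> b)\<^sup>2 / 2)"
    by (simp add: normal_density_def prod.distrib exp_sum power_divide prod_dividef)
  also have "(\<Sum>b\<in>Basis. - (x \<bullet> b)\<^sup>2 / 2) = - (norm x)\<^sup>2 / 2"
    by (rule sum_Basis_gauss)
  also have "(1 / sqrt (2 * pi)) ^ DIM('a) = (2 * pi) powr (- (real DIM('a) / 2))"
  proof -
    have "1 / sqrt (2 * pi) = (2 * pi) powr (- (1 / 2))"
      by (subst powr_minus, subst powr_half_sqrt) (auto simp: divide_inverse)
    then show ?thesis by (subst powr_realpow[symmetric]) (auto simp: powr_powr)
  qed
  finally show ?thesis unfolding gauss_def by (subst (asm) powr_minus) simp
qed

lemma prod_cis: "(\<Prod>i\<in>I. cis (f i)) = cis (\<Sum>i\<in>I. f i)"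
  by (induction I rule: infinite_finite_induct) (auto simp: cis_mult)

text \<open>Fubini over the coordinates; each factor is the characteristic function of the standard
  normal distribution.\<close>

lemma gauss_fourier_aux:
  fixes z :: "'a::euclidean_space"
  shows "integrable lborel (\<lambda>x. cis (z \<bullet> x) * complex_of_real (gauss x))"
    and "(LINT x|lborel. cis (z \<bullet> x) * complex_of_real (gauss x)) = (2 * pi) powr (real DIM('a) / 2)
        * gauss z"
proof -
  interpret product_sigma_finite "\<lambda>_::'a. lborel :: real measure" ..
  define h where "h = (\<lambda>b (t::real). cis ((z \<bullet> b) * t) * complex_of_real (std_normal_density t))"
  have [measurable]: "h b \<in> borel_measurable borel" for b unfolding h_def by measurable
  have inth: "integrable lborel (h b)" for b
  proof (rule Bochner_Integration.integrable_bound[OF integrable_normal_density[of 1 0]])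
    show "AE t in lborel. norm (h b t) \<le> norm (normal_density 0 1 t)" by (simp add: h_def norm_mult)
  qed auto
  have h1: "integral\<^sup>L lborel (h b) = complex_of_real (exp (- (z \<bullet> b)\<^sup>2 / 2))" for b
  proof -
    have "char std_normal_distribution (z \<bullet> b)
        = (LINT t|lborel. std_normal_density t *\<^sub>R iexp ((z \<bullet> b) * t))"
      unfolding char_def by (subst integral_density) auto
    also have "(\<lambda>t. std_normal_density t *\<^sub>R iexp ((z \<bullet> b) * t)) = h b"
      unfolding h_def cis_conv_exp scaleR_conv_of_real by (intro ext) (rule mult.commute)
    finally show ?thesis by (simp only: char_std_normal_distribution)
  qed
  have eq: "cis (z \<bullet> x) * complex_of_real (gauss x) = (2 * pi) powr (real DIM('a) / 2)
      * (\<Prod>b\<in>Basis. h b (x \<bullet> b))" for x :: 'a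
    unfolding gauss_prod h_def prod.distrib prod_cis euclidean_inner[of z x] by simp
  \<comment> \<open>This is the definition of \<open>lborel\<close>, with the one-dimensional
    factors rewritten as \<open>lborel\<close> on the reals.\<close>
  have lb: "(lborel :: 'a measure) = distr (\<Pi>\<^sub>M b\<in>Basis. lborel) borel (\<lambda>f. \<Sum>b\<in>Basis. f b *\<^sub>R b)"
    unfolding lborel_eq_real by (rule lborel_def)
  have "integrable (\<Pi>\<^sub>M b\<in>(Basis::'a set). lborel) (\<lambda>f. \<Prod>b\<in>Basis. h b (f b))"
    by (intro product_integrable_prod inth) auto
  then have "integrable lborel (\<lambda>x::'a. \<Prod>b\<in>Basis. h b (x \<bullet> b))"
    by (subst lb, subst integrable_distr_eq) (auto cong: prod.cong)
  then show "integrable lborel (\<lambda>x. cis (z \<bullet> x) * complex_of_real (gauss x))"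
    unfolding eq by (rule integrable_mult_right)
  have "(LINT x|lborel. (\<Prod>b\<in>Basis. h b ((x::'a) \<bullet> b)))
      = (LINT f|(\<Pi>\<^sub>M b\<in>(Basis::'a set). lborel). (\<Prod>b\<in>Basis. h b (f b)))"
    by (subst lb, subst integral_distr) (auto cong: prod.cong)
  also have "\<dots> = (\<Prod>b\<in>Basis. integral\<^sup>L lborel (h b))"
    by (intro product_integral_prod inth) auto
  also have "\<dots> = complex_of_real (exp (\<Sum>b\<in>Basis. - (z \<bullet> b)\<^sup>2 / 2))"
    unfolding h1 exp_sum[OF finite_Basis] of_real_prod by (rule refl)
  also have "(\<Sum>b\<in>Basis. - (z \<bullet> b)\<^sup>2 / 2) = - (norm z)\<^sup>2 / 2"
    by (rule sum_Basis_gauss)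
  finally show "(LINT x|lborel. cis (z \<bullet> x) * complex_of_real (gauss x))
      = (2 * pi) powr (real DIM('a) / 2) * gauss z"
    unfolding eq integral_mult_right_zero of_real_mult unfolding gauss_def by (rule arg_cong)
qed

lemma gauss_integrable: "integrable lborel (gauss :: 'a::euclidean_space \<Rightarrow> real)"
  using integrable_norm[OF gauss_fourier_aux(1)[of 0]]
  by (simp add: norm_mult abs_of_pos[OF gauss_bounds(1)])

lemma gauss_0 [simp]: "gauss 0 = 1" by (simp add: gauss_def)

lemma gauss_total: "(LINT x|lborel. gauss (x::'a::euclidean_space))
    = (2 * pi) powr (real DIM('a) / 2)"
proof -
  have "complex_of_real (LINT x|lborel. gauss (x::'a)) = (LINT x|lborel. cis ((0::'a) \<bullet> x)
      * complex_of_real (gauss x))"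
    by simp
  also have "\<dots> = complex_of_real ((2 * pi) powr (real DIM('a) / 2) * gauss (0::'a))"
    by (rule gauss_fourier_aux(2))
  finally show ?thesis unfolding of_real_eq_iff by simp
qed

section \<open>Fourier integrals\<close>

lemma borel_measurable_fourier_integral[measurable]:
  assumes [measurable]: "u \<in> borel_measurable borel"
  shows "fourier_integral (u :: 'a::euclidean_space \<Rightarrow> complex) \<in> borel_measurable borel"
  unfolding fourier_integral_def[abs_def] by measurable

lemma cis_mult_integrable:
  fixes u :: "'a::euclidean_space \<Rightarrow> complex"
  assumes "integrable lborel u" "g \<in> borel_measurable borel"
  shows "integrable lborel (\<lambda>x. cis (g x) * u x)"
proof (rule Bochner_Integration.integrable_bound[OF assms(1)])
  show "(\<lambda>x. cis (g x) * u x) \<in> borel_measurable lborel"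
    using assms(2) borel_measurable_integrable[OF assms(1)] by simp
qed (simp add: norm_mult)

lemma cnj_measurable[measurable]: "cnj \<in> borel_measurable borel"
  by (intro borel_measurable_continuous_onI continuous_intros)

lemma fourier_integral_add:
  fixes u v :: "'a::euclidean_space \<Rightarrow> complex"
  assumes "integrable lborel u" "integrable lborel v"
  shows "fourier_integral (\<lambda>x. u x + v x) \<xi> = fourier_integral u \<xi> + fourier_integral v \<xi>"
  using assms by (simp add: fourier_integral_def distrib_left cis_mult_integrable)

lemma fourier_integral_cmult:
  "fourier_integral (\<lambda>x. c * u x) \<xi> = c * fourier_integral u \<xi>"
proof -
  have "(\<lambda>x. cis (- (x \<bullet> \<xi>)) * (c * u x)) = (\<lambda>x. c * (cis (- (x \<bullet> \<xi>)) * u x))"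
    by (simp add: mult_ac)
  then show ?thesis unfolding fourier_integral_def by simp
qed

lemma fourier_integral_diff:
  fixes u v :: "'a::euclidean_space \<Rightarrow> complex"
  assumes "integrable lborel u" "integrable lborel v"
  shows "fourier_integral (\<lambda>x. u x - v x) \<xi> = fourier_integral u \<xi> - fourier_integral v \<xi>"
  using assms by (simp add: fourier_integral_def right_diff_distrib cis_mult_integrable)

lemma fourier_integral_bound:
  fixes u :: "'a::euclidean_space \<Rightarrow> complex"
  shows "cmod (fourier_integral u \<xi>) \<le> (2 * pi) powr (- real DIM('a) / 2)
      * (LINT x|lborel. cmod (u x))"
proof -
  have "cmod (LINT x|lborel. cis (- (x \<bullet> \<xi>)) * u x) \<le> (LINT x|lborel. cmod (cis (- (x \<bullet> \<xi>)) * u x))"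
    by (rule integral_norm_bound)
  then show ?thesis by (simp add: fourier_integral_def norm_mult mult_left_mono)
qed

lemma fourier_integral_shift:
  fixes u :: "'a::euclidean_space \<Rightarrow> complex"
  assumes [measurable]: "u \<in> borel_measurable borel"
  shows "fourier_integral (\<lambda>x. u (x + y)) \<xi> = cis (y \<bullet> \<xi>) * fourier_integral u \<xi>"
proof -
  have "(LINT x|lborel. cis (- (x \<bullet> \<xi>)) * u (x + y))
      = (LINT x|lborel. (\<lambda>x. cis (y \<bullet> \<xi>) * (cis (- (x \<bullet> \<xi>)) * u x)) (x + y))"
    by (simp add: mult.assoc[symmetric] cis_mult inner_add_left)
  also have "\<dots> = (LINT x|lborel. cis (y \<bullet> \<xi>) * (cis (- (x \<bullet> \<xi>)) * u x))"
    by (rule integral_lborel_shift) measurable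
  finally show ?thesis by (simp add: fourier_integral_def)
qed

lemma fourier_integral_scale:
  fixes u :: "'a::euclidean_space \<Rightarrow> complex"
  assumes [measurable]: "u \<in> borel_measurable borel" and "0 < c"
  shows "fourier_integral (\<lambda>x. u (c *\<^sub>R x)) \<xi> = of_real (c powr (- real DIM('a)))
      * fourier_integral u (\<xi> /\<^sub>R c)"
proof -
  have "(LINT x|lborel. cis (- (x \<bullet> (\<xi> /\<^sub>R c))) * u x)
      = \<bar>c\<bar> ^ DIM('a) *\<^sub>R (LINT x|lborel. cis (- ((0 + c *\<^sub>R x) \<bullet> (\<xi> /\<^sub>R c))) * u (0 + c *\<^sub>R x))"
    by (rule integral_lborel_affine) (use assms in auto)
  also have "\<dots> = of_real (c ^ DIM('a)) * (LINT x|lborel. cis (- (x \<bullet> \<xi>)) * u (c *\<^sub>R x))"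
  proof -
    have "inverse c * (c * a) = a" for a :: real using assms(2) by (simp add: field_simps)
    then show ?thesis using assms(2)
      by (simp only: inner_scaleR_left inner_scaleR_right add_0 scaleR_conv_of_real abs_of_pos)
  qed
  finally have *: "(LINT x|lborel. cis (- (x \<bullet> (\<xi> /\<^sub>R c))) * u x)
      = of_real (c ^ DIM('a)) * (LINT x|lborel. cis (- (x \<bullet> \<xi>)) * u (c *\<^sub>R x))" .
  have "c powr (- real DIM('a)) * c ^ DIM('a) = 1" using assms(2)
    by (simp add: powr_minus powr_realpow)
  then have "of_real (c powr (- real DIM('a))) * of_real (c ^ DIM('a)) = (1::complex)"
    by (metis of_real_mult of_real_1)
  then show ?thesis unfolding fourier_integral_def * by (simp add: mult_ac)
qed

lemma fourier_integral_reflect_cnj: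
  fixes u :: "'a::euclidean_space \<Rightarrow> complex"
  assumes [measurable]: "u \<in> borel_measurable borel"
  shows "cnj (fourier_integral u \<xi>) = fourier_integral (\<lambda>x. cnj (u (- x))) \<xi>"
proof -
  have "cnj (LINT x|lborel. cis (- (x \<bullet> \<xi>)) * u x) = (LINT x|lborel. cis (x \<bullet> \<xi>) * cnj (u x))"
    using Bochner_Integration.integral_cnj[of lborel "\<lambda>x. cis (- (x \<bullet> \<xi>)) * u x"]
    by (simp add: cis_cnj)
  also have "\<dots> = (LINT x|lborel. cis (- (x \<bullet> \<xi>)) * cnj (u (- x)))"
    using integral_lborel_affine[of "\<lambda>x. cis (x \<bullet> \<xi>) * cnj (u x)" "-1" 0] by simp
  finally show ?thesis by (simp add: fourier_integral_def)
qed

lemma integrable_tensor: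
  fixes u v :: "'a::euclidean_space \<Rightarrow> complex"
  assumes u: "integrable lborel u" and v: "integrable lborel v"
  shows "integrable (lborel \<Otimes>\<^sub>M lborel) (\<lambda>(x, y). u x * v y)"
proof -
  have [measurable]: "u \<in> borel_measurable borel" "v \<in> borel_measurable borel"
    using u v borel_measurable_integrable by fastforce+
  show ?thesis
    by (rule lborel_pair.Fubini_integrable)
       (use u v in \<open>auto simp: norm_mult intro!: integrable_mult_left integrable_norm\<close>)
qed

text \<open>Fubini, since the phase is symmetric in \<open>x\<close> and
  \<open>\<xi>\<close>.\<close>

lemma fourier_integral_mult_formula:
  fixes u v :: "'a::euclidean_space \<Rightarrow> complex"
  assumes u: "integrable lborel u" and v: "integrable lborel v"
  shows "(LINT \<xi>|lborel. fourier_integral u \<xi> * v \<xi>) = (LINT x|lborel. u x * fourier_integral v x)"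
proof -
  let ?c = "complex_of_real ((2 * pi) powr (- real DIM('a) / 2))"
  have [measurable]: "u \<in> borel_measurable borel" "v \<in> borel_measurable borel"
    using u v borel_measurable_integrable by fastforce+
  have int: "integrable (lborel \<Otimes>\<^sub>M lborel) (\<lambda>(x, \<xi>). cis (- (x \<bullet> \<xi>)) * (u x * v \<xi>))"
    by (rule Bochner_Integration.integrable_bound[OF integrable_tensor[OF u v]]) (auto simp:
        norm_mult)
  have "(LINT \<xi>|lborel. fourier_integral u \<xi> * v \<xi>)
      = ?c * (LINT \<xi>|lborel. LINT x|lborel. cis (- (x \<bullet> \<xi>)) * (u x * v \<xi>))"
    by (simp add: fourier_integral_def mult.assoc[symmetric] del: integral_mult_right_zero flip:
        integral_mult_right_zero integral_mult_left_zero)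
  also have "(LINT \<xi>|lborel. LINT x|lborel. cis (- (x \<bullet> \<xi>)) * (u x * v \<xi>))
      = (LINT x|lborel. LINT \<xi>|lborel. cis (- (x \<bullet> \<xi>)) * (u x * v \<xi>))"
    using lborel_pair.Fubini_integral[OF int] by simp
  also have "?c * \<dots> = (LINT x|lborel. ?c * (LINT \<xi>|lborel. cis (- (x \<bullet> \<xi>)) * (u x * v \<xi>)))" by simp
  also have "\<dots> = (LINT x|lborel. u x * fourier_integral v x)"
  proof (intro Bochner_Integration.integral_cong refl)
    fix x
    have "(\<lambda>\<xi>. cis (- (x \<bullet> \<xi>)) * (u x * v \<xi>)) = (\<lambda>\<xi>. u x * (cis (- (\<xi> \<bullet> x)) * v \<xi>))"
      by (simp add: inner_commute mult_ac)
    then show "?c * (LINT \<xi>|lborel. cis (- (x \<bullet> \<xi>)) * (u x * v \<xi>)) = u x * fourier_integral v x"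
      by (simp add: fourier_integral_def)
  qed
  finally show ?thesis .
qed

text \<open>The two phases share a sign, so they combine to the frequency \<open>x + y\<close>; the
  substitution \<open>e *\<^sub>R \<xi>\<close> then leads to the transform of the standard
  Gaussian. Up to normalization the result is an approximate identity of width \<open>e\<close>,
  concentrated near \<open>y = - x\<close>.\<close>

lemma fourier_integral_gauss:
  fixes x y :: "'a::euclidean_space"
  assumes "0 < e"
  shows "fourier_integral (\<lambda>\<xi>. cis (- (x \<bullet> \<xi>)) * of_real (gauss (e *\<^sub>R \<xi>))) y
    = of_real (inverse (e ^ DIM('a)) * gauss ((x + y) /\<^sub>R e))"
    and "integrable lborel (\<lambda>\<xi>. cis (- (x \<bullet> \<xi>)) * complex_of_real (gauss (e *\<^sub>R \<xi>)))"
proof -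
  let ?c = "complex_of_real ((2 * pi) powr (- real DIM('a) / 2))"
  let ?z = "- ((x + y) /\<^sub>R e)"
  have "(LINT \<eta>|lborel. cis (?z \<bullet> \<eta>) * complex_of_real (gauss \<eta>)) =
      \<bar>e\<bar> ^ DIM('a) *\<^sub>R (LINT \<xi>|lborel. cis (?z \<bullet> (0 + e *\<^sub>R \<xi>)) * complex_of_real (gauss (0 + e *\<^sub>R
          \<xi>)))"
    by (rule integral_lborel_affine) (use assms in auto)
  also have "(\<lambda>\<xi>. cis (?z \<bullet> (0 + e *\<^sub>R \<xi>)) * complex_of_real (gauss (0 + e *\<^sub>R \<xi>)))
      = (\<lambda>\<xi>. cis (- (\<xi> \<bullet> y)) * (cis (- (x \<bullet> \<xi>)) * complex_of_real (gauss (e *\<^sub>R \<xi>))))"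
  proof
    fix \<xi> :: 'a
    have "e * (inverse e * a) = a" for a :: real using assms by (simp add: field_simps)
    then have "?z \<bullet> (0 + e *\<^sub>R \<xi>) = - ((x + y) \<bullet> \<xi>)"
      by (simp only: inner_minus_left inner_scaleR_left inner_scaleR_right add_0 mult_minus_right)
    also have "\<dots> = - (\<xi> \<bullet> y) + - (x \<bullet> \<xi>)"
      by (simp add: inner_add_left inner_add_right inner_commute)
    finally have "?z \<bullet> (0 + e *\<^sub>R \<xi>) = - (\<xi> \<bullet> y) + - (x \<bullet> \<xi>)" .
    then show "cis (?z \<bullet> (0 + e *\<^sub>R \<xi>)) * complex_of_real (gauss (0 + e *\<^sub>R \<xi>))
      = cis (- (\<xi> \<bullet> y)) * (cis (- (x \<bullet> \<xi>)) * complex_of_real (gauss (e *\<^sub>R \<xi>)))"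
      by (simp only: cis_mult[symmetric] mult.assoc add_0)
  qed
  also have "(LINT \<eta>|lborel. cis (?z \<bullet> \<eta>) * complex_of_real (gauss \<eta>))
      = (2 * pi) powr (real DIM('a) / 2) * gauss ?z"
    by (rule gauss_fourier_aux(2))
  finally have I: "(LINT \<xi>|lborel. cis (- (\<xi> \<bullet> y)) * (cis (- (x \<bullet> \<xi>))
      * complex_of_real (gauss (e *\<^sub>R \<xi>))))
     = inverse (e ^ DIM('a)) * ((2 * pi) powr (real DIM('a) / 2) * gauss ?z)"
    using assms by (simp add: scaleR_conv_of_real field_simps)
  have c: "?c * ((2 * pi) powr (real DIM('a) / 2)) = 1"
    by (simp add: powr_minus flip: of_real_mult)
  have g: "gauss ?z = gauss ((x + y) /\<^sub>R e)" by (simp add: gauss_def)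
  show "fourier_integral (\<lambda>\<xi>. cis (- (x \<bullet> \<xi>)) * of_real (gauss (e *\<^sub>R \<xi>))) y
    = of_real (inverse (e ^ DIM('a)) * gauss ((x + y) /\<^sub>R e))"
    unfolding fourier_integral_def I using c unfolding g
    by (simp add: mult_ac)
  have "integrable lborel (\<lambda>x. complex_of_real (gauss (0 + e *\<^sub>R (x::'a))))"
    using assms by (intro integrable_lborel_affine[of "\<lambda>x. complex_of_real (gauss x)"]
        integrable_of_real gauss_integrable) auto
  then show "integrable lborel (\<lambda>\<xi>. cis (- (x \<bullet> \<xi>)) * complex_of_real (gauss (e *\<^sub>R \<xi>)))"
    by (intro cis_mult_integrable) auto
qed

text \<open>If \<open>f\<close> is not integrable, its Bochner integral is 0 by convention.\<close>

lemma norm_integral_le_nn_integral: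
  fixes f :: "'b \<Rightarrow> 'c::{banach, second_countable_topology}"
  shows "ennreal (norm (integral\<^sup>L M f)) \<le> (\<integral>\<^sup>+x. ennreal (norm (f x)) \<partial>M)"
  by (cases "integrable M f") (auto simp: integral_norm_bound_ennreal not_integrable_integral_eq)

text \<open>
  Applying the multiplication formula twice removes both Fourier integrals; what remains is the
  autocorrelation of \<open>u\<close> averaged against a Gaussian of width \<open>e\<close>.
\<close>

lemma fourier_integral_weighted_sq:
  fixes u :: "'a::euclidean_space \<Rightarrow> complex"
  assumes u: "integrable lborel u" and e: "0 < e"
  shows "integrable lborel (\<lambda>\<xi>. gauss (e *\<^sub>R \<xi>) * (cmod (fourier_integral u \<xi>))\<^sup>2)"
    and "complex_of_real (LINT \<xi>|lborel. gauss (e *\<^sub>R \<xi>) * (cmod (fourier_integral u \<xi>))\<^sup>2)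
     = (LINT x|lborel. u x * (of_real ((2 * pi) powr (- real DIM('a) / 2)) * (LINT w|lborel. cnj (u
         (x - e *\<^sub>R w)) * of_real (gauss w))))"
    and "integrable lborel (\<lambda>x. u x * (of_real ((2 * pi) powr (- real DIM('a) / 2))
        * (LINT w|lborel. cnj (u (x - e *\<^sub>R w)) * of_real (gauss w))))"
proof -
  let ?c = "complex_of_real ((2 * pi) powr (- real DIM('a) / 2))"
  have um[measurable]: "u \<in> borel_measurable borel" using borel_measurable_integrable[OF u] by simp
  define K where "K = (2 * pi) powr (- real DIM('a) / 2) * (LINT x|lborel. cmod (u x))"
  have K: "cmod (fourier_integral u \<xi>) \<le> K" for \<xi> unfolding K_def by (rule fourier_integral_bound)
  have "0 \<le> K" using K[of 0] norm_ge_zero order_trans by blast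
  have g: "integrable lborel (\<lambda>\<xi>::'a. gauss (e *\<^sub>R \<xi>))"
    using integrable_lborel_affine[OF gauss_integrable, of e 0] e by simp
  \<comment> \<open>The Gaussian factor makes the conjugate transform integrable, so the
    multiplication formula applies to the pair \<open>u\<close>, \<open>h\<close>.\<close>
  define h where "h = (\<lambda>\<xi>. complex_of_real (gauss (e *\<^sub>R \<xi>)) * cnj (fourier_integral u \<xi>))"
  have hint: "integrable lborel h"
  proof (rule Bochner_Integration.integrable_bound[OF integrable_mult_right[OF g, of K]])
    show "h \<in> borel_measurable lborel" unfolding h_def by simp
    show "AE x in lborel. cmod (h x) \<le> norm (K * gauss (e *\<^sub>R x))"
      using K \<open>0 \<le> K\<close> gauss_bounds(1)
      by (auto simp: h_def norm_mult abs_mult mult.commute[of K] abs_of_pos intro!: mult_left_mono)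
  qed
  have "integrable lborel (\<lambda>\<xi>. fourier_integral u \<xi> * h \<xi>)"
  proof (rule Bochner_Integration.integrable_bound[OF integrable_mult_right[OF integrable_norm[OF
      hint], of K]])
    show "(\<lambda>\<xi>. fourier_integral u \<xi> * h \<xi>) \<in> borel_measurable lborel"
      using borel_measurable_integrable[OF hint] by simp
    show "AE x in lborel. cmod (fourier_integral u x * h x) \<le> norm (K * cmod (h x))"
      using K \<open>0 \<le> K\<close> by (auto simp: norm_mult abs_mult intro!: mult_right_mono)
  qed
  moreover have eq: "fourier_integral u \<xi> * h \<xi>
      = complex_of_real (gauss (e *\<^sub>R \<xi>) * (cmod (fourier_integral u \<xi>))\<^sup>2)" for \<xi>
    by (simp add: h_def complex_norm_square[symmetric] mult_ac flip: of_real_power)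
  ultimately show "integrable lborel (\<lambda>\<xi>. gauss (e *\<^sub>R \<xi>) * (cmod (fourier_integral u \<xi>))\<^sup>2)"
    by (simp only: complex_of_real_integrable_eq)
  let ?ut = "\<lambda>x. cnj (u (- x))"
  have ut: "integrable lborel ?ut"
    using integrable_lborel_affine[OF u, of "-1" 0] by simp
  \<comment> \<open>The other use of the multiplication formula: the conjugate of the transform of
    \<open>u\<close> is the transform of the reflected conjugate \<open>?ut\<close>, and it is
    paired with the modulated Gaussian \<open>?k\<close>.\<close>
  have Fh: "fourier_integral h x = ?c * (LINT w|lborel. cnj (u (x - e *\<^sub>R w)) * of_real (gauss w))"
      for x
  proof -
    let ?k = "\<lambda>\<xi>. cis (- (x \<bullet> \<xi>)) * complex_of_real (gauss (e *\<^sub>R \<xi>))"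
    have "fourier_integral h x = ?c * (LINT \<xi>|lborel. cis (- (\<xi> \<bullet> x)) * h \<xi>)"
      by (rule fourier_integral_def)
    also have "(\<lambda>\<xi>. cis (- (\<xi> \<bullet> x)) * h \<xi>) = (\<lambda>\<xi>. fourier_integral ?ut \<xi> * ?k \<xi>)"
      by (simp add: h_def fourier_integral_reflect_cnj mult_ac inner_commute)
    finally have "fourier_integral h x = ?c * (LINT \<xi>|lborel. fourier_integral ?ut \<xi> * ?k \<xi>)" .
    also have "(LINT \<xi>|lborel. fourier_integral ?ut \<xi> * ?k \<xi>)
        = (LINT y|lborel. ?ut y * fourier_integral ?k y)"
      by (rule fourier_integral_mult_formula[OF ut fourier_integral_gauss(2)[OF e]])
    also have "\<dots> = (LINT y|lborel. ?ut y * of_real (inverse (e ^ DIM('a)) * gauss ((x + y) /\<^sub>R e)))"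
      by (simp only: fourier_integral_gauss(1)[OF e])
    \<comment> \<open>Substituting \<open>y = - x + e *\<^sub>R w\<close> centres the Gaussian,
      undoes the reflection in \<open>?ut\<close>, and produces a Jacobian that cancels
      \<open>inverse (e ^ DIM('a))\<close>.\<close>
    also have "\<dots> = \<bar>e\<bar> ^ DIM('a) *\<^sub>R (LINT w|lborel. ?ut (- x + e *\<^sub>R w)
        * of_real (inverse (e ^ DIM('a)) * gauss ((x + (- x + e *\<^sub>R w)) /\<^sub>R e)))"
      by (rule integral_lborel_affine) (use e in auto)
    also have "\<dots> = of_real (e ^ DIM('a)) * (LINT w|lborel. of_real (inverse (e ^ DIM('a)))
        * (cnj (u (x - e *\<^sub>R w)) * of_real (gauss w)))"
      using e by (simp add: scaleR_conv_of_real mult_ac)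
    also have "\<dots> = (LINT w|lborel. cnj (u (x - e *\<^sub>R w)) * of_real (gauss w))"
      using e by (subst integral_mult_right_zero) (simp add: mult.assoc[symmetric] flip:
          of_real_mult)
    finally show ?thesis .
  qed
  have "complex_of_real (LINT \<xi>|lborel. gauss (e *\<^sub>R \<xi>) * (cmod (fourier_integral u \<xi>))\<^sup>2)
      = (LINT \<xi>|lborel. fourier_integral u \<xi> * h \<xi>)"
    unfolding eq by (rule integral_complex_of_real[symmetric])
  also have "\<dots> = (LINT x|lborel. u x * fourier_integral h x)"
    by (rule fourier_integral_mult_formula[OF u hint])
  finally show "complex_of_real (LINT \<xi>|lborel. gauss (e *\<^sub>R \<xi>) * (cmod (fourier_integral u \<xi>))\<^sup>2)
     = (LINT x|lborel. u x * (?c * (LINT w|lborel. cnj (u (x - e *\<^sub>R w)) * of_real (gauss w))))"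
    unfolding Fh .
  define L where "L = (2 * pi) powr (- real DIM('a) / 2) * (LINT x|lborel. cmod (h x))"
  have L: "cmod (fourier_integral h \<xi>) \<le> L" for \<xi> unfolding L_def by (rule fourier_integral_bound)
  have "0 \<le> L" using L[of 0] norm_ge_zero order_trans by blast
  have "integrable lborel (\<lambda>x. u x * fourier_integral h x)"
  proof (rule Bochner_Integration.integrable_bound[OF integrable_mult_right[OF integrable_norm[OF
      u], of L]])
    have [measurable]: "h \<in> borel_measurable borel" using borel_measurable_integrable[OF hint]
      by simp
    show "(\<lambda>\<xi>. u \<xi> * fourier_integral h \<xi>) \<in> borel_measurable lborel" by simp
    show "AE x in lborel. cmod (u x * fourier_integral h x) \<le> norm (L * cmod (u x))"
      using L \<open>0 \<le> L\<close> by (auto simp: norm_mult abs_mult mult.commute[of L] intro!: mult_left_mono)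
  qed
  then show "integrable lborel (\<lambda>x. u x * (?c * (LINT w|lborel. cnj (u (x - e *\<^sub>R w))
      * of_real (gauss w))))"
    unfolding Fh .
qed

section \<open>Plancherel's identity for integrable functions\<close>

text \<open>The weight is a probability density, so this is the mean of the squared L^2 displacement
  of \<open>u\<close> under Gaussian shifts of scale \<open>e\<close>.\<close>

definition translation_defect :: "('a::euclidean_space \<Rightarrow> complex) \<Rightarrow> real \<Rightarrow> ennreal" where
  "translation_defect u e = (\<integral>\<^sup>+w. ennreal ((2 * pi) powr (- real DIM('a) / 2) * gauss w)
      * l2sq (\<lambda>x. u (x - e *\<^sub>R w) - u x) \<partial>lborel)"

lemma gauss_normalized:
  "(\<integral>\<^sup>+w. ennreal ((2 * pi) powr (- real DIM('a) / 2) * gauss (w::'a::euclidean_space)) \<partial>lborel)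
      = 1"
proof -
  have "(\<integral>\<^sup>+w. ennreal ((2 * pi) powr (- real DIM('a) / 2) * gauss (w::'a)) \<partial>lborel)
     = ennreal (LINT w|lborel. (2 * pi) powr (- real DIM('a) / 2) * gauss (w::'a))"
    by (rule nn_integral_eq_integral) (auto intro: integrable_mult_right gauss_integrable simp:
        less_imp_le gauss_bounds(1))
  also have "(LINT w|lborel. (2 * pi) powr (- real DIM('a) / 2) * gauss (w::'a)) = 1"
    by (simp add: gauss_total powr_minus)
  finally show ?thesis by simp
qed

lemma l2sq_shift_diff_measurable [measurable]:
  fixes u :: "'a::euclidean_space \<Rightarrow> complex"
  assumes [measurable]: "u \<in> borel_measurable borel"
  shows "(\<lambda>w. l2sq (\<lambda>x. u (x - e *\<^sub>R w) - u x)) \<in> borel_measurable borel"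
  unfolding l2sq_def by measurable

text \<open>Dominated convergence: the displacement is at most \<open>4 * l2sq u\<close> for every
  shift, and it tends to 0 pointwise in \<open>w\<close> by continuity of translations.\<close>

lemma translation_defect_tendsto_0:
  fixes u :: "'a::euclidean_space \<Rightarrow> complex"
  assumes [measurable]: "u \<in> borel_measurable borel" and fin: "l2sq u < \<infinity>"
  shows "(\<lambda>n. translation_defect u (1 / real (Suc n))) \<longlonglongrightarrow> 0"
proof -
  define d where "d = (\<lambda>z. l2sq (\<lambda>x. u (x + z) - u x))"
  have d0: "d 0 = 0" by (simp add: d_def l2sq_def)
  have "isCont d 0"
    using translation_continuous_L2[OF assms] unfolding isCont_def d0 by (simp add: d_def)
  have "l2sq (\<lambda>x. u (x + z) - u x) \<le> 4 * l2sq u" for z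
  proof -
    have "l2sq (\<lambda>x. u (x + z) - u x) \<le> 2 * l2sq (\<lambda>x. u (x + z)) + 2 * l2sq (\<lambda>x. - u x)"
      using l2sq_add_le[of "\<lambda>x. u (x + z)" "\<lambda>x. - u x"] by simp
    also have "l2sq (\<lambda>x. - u x) = l2sq u" by (intro l2sq_cong) simp
    also have "l2sq (\<lambda>x. u (x + z)) = l2sq u" by (rule l2sq_shift) simp
    also have "2 * l2sq u + 2 * l2sq u = 4 * l2sq u" by (simp add: distrib_right[symmetric])
    finally show ?thesis .
  qed
  from this[of "- _"] have bd: "l2sq (\<lambda>x. u (x - z) - u x) \<le> 4 * l2sq u" for z by simp
  let ?g = "\<lambda>w::'a. ennreal ((2 * pi) powr (- real DIM('a) / 2) * gauss w)"
  have "(\<lambda>n. \<integral>\<^sup>+w. ?g w * l2sq (\<lambda>x. u (x - (1 / real (Suc n)) *\<^sub>R w) - u x) \<partial>lborel) \<longlonglongrightarrow> (\<integral>\<^sup>+w. 0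
      \<partial>(lborel::'a measure))"
  proof (rule nn_integral_dominated_convergence[where w="\<lambda>w. ?g w * (4 * l2sq u)"])
    show "(\<integral>\<^sup>+w. ?g w * (4 * l2sq u) \<partial>lborel) < \<infinity>"
      using fin gauss_normalized[where 'a='a] by (simp add: nn_integral_multc ennreal_mult_less_top)
    show "AE w in lborel. ?g w * l2sq (\<lambda>x. u (x - (1 / real (Suc n)) *\<^sub>R w) - u x)
        \<le> ?g w * (4 * l2sq u)" for n
      by (intro AE_I2 mult_left_mono bd) auto
    show "AE w in lborel. (\<lambda>n. ?g w * l2sq (\<lambda>x. u (x - (1 / real (Suc n)) *\<^sub>R w) - u x)) \<longlonglongrightarrow> 0"
    proof (intro AE_I2)
      fix w :: 'a
      have "(\<lambda>n. - ((1 / real (Suc n)) *\<^sub>R w)) \<longlonglongrightarrow> - (0 *\<^sub>R w)"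
        by (intro tendsto_intros LIMSEQ_Suc[OF lim_1_over_n])
      then have "(\<lambda>n. d (- ((1 / real (Suc n)) *\<^sub>R w))) \<longlonglongrightarrow> d 0"
        using \<open>isCont d 0\<close> by (intro isCont_tendsto_compose[of 0 d]) auto
      then have "(\<lambda>n. l2sq (\<lambda>x. u (x - (1 / real (Suc n)) *\<^sub>R w) - u x)) \<longlonglongrightarrow> 0"
        unfolding d0 by (simp add: d_def)
      from ennreal_tendsto_cmult[OF _ this, of "?g w"]
      show "(\<lambda>n. ?g w * l2sq (\<lambda>x. u (x - (1 / real (Suc n)) *\<^sub>R w) - u x)) \<longlonglongrightarrow> 0" by simp
    qed
  qed auto
  then show ?thesis by (simp add: translation_defect_def)
qed

text \<open>Since the Gaussian weight has total mass 1, \<open>u x * cnj (u x)\<close> can be put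
  under the average in \<open>w\<close>. What remains is linear in
  \<open>u (x - e *\<^sub>R w) - u x\<close>, and Young's inequality with the free parameter
  \<open>\<eta>\<close> separates it from \<open>u x\<close>.\<close>

lemma fourier_integral_weighted_sq_close:
  fixes u :: "'a::euclidean_space \<Rightarrow> complex"
  assumes u: "integrable lborel u" and fin: "l2sq u < \<infinity>" and e: "0 < e" and \<eta>: "0 < \<eta>"
  shows "ennreal \<bar>(LINT \<xi>|lborel. gauss (e *\<^sub>R \<xi>) * (cmod (fourier_integral u \<xi>))\<^sup>2)
      - (LINT x|lborel. (cmod (u x))\<^sup>2)\<bar>
    \<le> ennreal (\<eta> / 2) * l2sq u + ennreal (1 / (2 * \<eta>)) * translation_defect u e"
proof -
  define c where "c = (2 * pi) powr (- real DIM('a) / 2)"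
  have c: "0 < c" "c * (LINT w|lborel. gauss (w::'a)) = 1"
    by (auto simp: c_def gauss_total powr_minus)
  have um[measurable]: "u \<in> borel_measurable borel" using borel_measurable_integrable[OF u] by simp
  let ?I = "LINT \<xi>|lborel. gauss (e *\<^sub>R \<xi>) * (cmod (fourier_integral u \<xi>))\<^sup>2"
  let ?U = "LINT x|lborel. (cmod (u x))\<^sup>2"
  let ?A = "\<lambda>x. u x * (of_real c * (LINT w|lborel. cnj (u (x - e *\<^sub>R w)) * of_real (gauss w)))"
  let ?D = "\<lambda>x. u x * (of_real c * (LINT w|lborel. (cnj (u (x - e *\<^sub>R w)) - cnj (u x))
      * of_real (gauss w)))"
  have usq: "integrable lborel (\<lambda>x. (cmod (u x))\<^sup>2)"
    using fin by (simp add: integrable_iff_bounded l2sq_def)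
  have A: "integrable lborel ?A" "complex_of_real ?I = (LINT x|lborel. ?A x)"
    using fourier_integral_weighted_sq[OF u e] by (simp_all add: c_def)
  have U: "complex_of_real ?U = (LINT x|lborel. u x * cnj (u x))"
    by (simp add: complex_norm_square[symmetric] flip: of_real_power)
  have Ui: "integrable lborel (\<lambda>x. u x * cnj (u x))"
    using usq by (simp add: complex_norm_square[symmetric] flip: of_real_power)
  have pt: "?A x - u x * cnj (u x) = ?D x" for x
  proof -
    have 1: "integrable lborel (\<lambda>w. cnj (u (x - e *\<^sub>R w)) * of_real (gauss w))"
    proof (rule Bochner_Integration.integrable_bound)
      show "integrable lborel (\<lambda>w. cnj (u (x + (- e) *\<^sub>R w)))"
        by (intro integrable_cnj integrable_lborel_affine u) (use e in auto)
      show "AE w in lborel. norm (cnj (u (x - e *\<^sub>R w)) * of_real (gauss w))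
          \<le> norm (cnj (u (x + (- e) *\<^sub>R w)))"
        by (intro AE_I2) (simp add: norm_mult abs_of_pos[OF gauss_bounds(1)] gauss_bounds(2)
            mult_left_le)
    qed auto
    have 2: "integrable lborel (\<lambda>w. cnj (u x) * complex_of_real (gauss (w::'a)))"
      by (intro integrable_mult_right integrable_of_real gauss_integrable)
    have "(LINT w|lborel. (cnj (u (x - e *\<^sub>R w)) - cnj (u x)) * of_real (gauss w))
      = (LINT w|lborel. cnj (u (x - e *\<^sub>R w)) * of_real (gauss w)) - cnj (u x) * of_real (LINT
          w|lborel. gauss (w::'a))"
      unfolding left_diff_distrib by (subst Bochner_Integration.integral_diff[OF 1 2]) simp
    moreover have "complex_of_real c * of_real (LINT w|lborel. gauss (w::'a)) = 1"
      using c(2) by (metis of_real_mult of_real_1)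
    ultimately show ?thesis by (simp add: right_diff_distrib mult.left_commute[of
        "complex_of_real c" "cnj (u x)"])
  qed
  have "complex_of_real (?I - ?U) = (LINT x|lborel. ?A x - u x * cnj (u x))"
    unfolding of_real_diff A(2) U by (rule Bochner_Integration.integral_diff[symmetric, OF A(1) Ui])
  then have "complex_of_real (?I - ?U) = (LINT x|lborel. ?D x)" unfolding pt .
  from arg_cong[OF this, of cmod] have "\<bar>?I - ?U\<bar> = cmod (LINT x|lborel. ?D x)"
    unfolding norm_of_real .
  then have "ennreal \<bar>?I - ?U\<bar> = ennreal (cmod (LINT x|lborel. ?D x))" by (rule arg_cong)
  also have "\<dots> \<le> (\<integral>\<^sup>+x. ennreal (cmod (?D x)) \<partial>lborel)" by (rule norm_integral_le_nn_integral)
  also have "\<dots> \<le> (\<integral>\<^sup>+x. (\<integral>\<^sup>+w. ennreal (c * gauss w) * (ennreal (\<eta> / 2) * ennreal ((cmod (u x))\<^sup>2)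
      + ennreal (1 / (2 * \<eta>)) * ennreal ((cmod (u (x - e *\<^sub>R w) - u x))\<^sup>2)) \<partial>lborel) \<partial>lborel)"
  proof (intro nn_integral_mono)
    fix x
    have "ennreal (cmod (?D x)) = ennreal (cmod (u x) * c)
        * ennreal (cmod (LINT w|lborel. (cnj (u (x - e *\<^sub>R w)) - cnj (u x)) * of_real (gauss w)))"
      using c(1) by (subst ennreal_mult[symmetric]) (auto simp: norm_mult)
    also have "\<dots> \<le> ennreal (cmod (u x) * c) * (\<integral>\<^sup>+w. ennreal (cmod ((cnj (u (x - e *\<^sub>R w))
        - cnj (u x)) * of_real (gauss w))) \<partial>lborel)"
      by (intro mult_left_mono norm_integral_le_nn_integral) auto
    also have "\<dots> = (\<integral>\<^sup>+w. ennreal (cmod (u x) * c) * ennreal (cmod ((cnj (u (x - e *\<^sub>R w))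
        - cnj (u x)) * of_real (gauss w))) \<partial>lborel)"
      by (rule nn_integral_cmult[symmetric]) measurable
    also have "\<dots> \<le> (\<integral>\<^sup>+w. ennreal (c * gauss w) * (ennreal (\<eta> / 2) * ennreal ((cmod (u x))\<^sup>2)
        + ennreal (1 / (2 * \<eta>)) * ennreal ((cmod (u (x - e *\<^sub>R w) - u x))\<^sup>2)) \<partial>lborel)"
    proof (intro nn_integral_mono)
      fix w :: 'a
      let ?a = "cmod (u x)" and ?b = "cmod (u (x - e *\<^sub>R w) - u x)"
      have "0 \<le> (sqrt \<eta> * ?a - ?b / sqrt \<eta>)\<^sup>2" by simp
      also have "\<dots> = \<eta> * ?a\<^sup>2 + ?b\<^sup>2 / \<eta> - 2 * ?a * ?b"
        using \<eta> by (simp add: power2_diff power_mult_distrib power_divide)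
      finally have ab: "?a * ?b \<le> \<eta> / 2 * ?a\<^sup>2 + 1 / (2 * \<eta>) * ?b\<^sup>2" by simp
      have "cmod (cnj (u (x - e *\<^sub>R w)) - cnj (u x)) = ?b"
        unfolding complex_cnj_diff[symmetric] complex_mod_cnj by (rule refl)
      then have "ennreal (?a * c) * ennreal (cmod ((cnj (u (x - e *\<^sub>R w)) - cnj (u x))
          * of_real (gauss w)))
         = ennreal (c * gauss w * (?a * ?b))"
        using c(1) gauss_bounds(1)[of w]
        by (subst ennreal_mult[symmetric]) (auto simp: norm_mult mult_ac)
      also have "\<dots> \<le> ennreal (c * gauss w * (\<eta> / 2 * ?a\<^sup>2 + 1 / (2 * \<eta>) * ?b\<^sup>2))"
        using ab c(1) gauss_bounds(1)[of w] by (intro ennreal_leI mult_left_mono) auto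
      also have "\<dots> = ennreal (c * gauss w) * ennreal (\<eta> / 2 * ?a\<^sup>2 + 1 / (2 * \<eta>) * ?b\<^sup>2)"
        using \<eta> c(1) gauss_bounds(1)[of w] by (intro ennreal_mult) auto
      also have "ennreal (\<eta> / 2 * ?a\<^sup>2 + 1 / (2 * \<eta>) * ?b\<^sup>2)
          = ennreal (\<eta> / 2 * ?a\<^sup>2) + ennreal (1 / (2 * \<eta>) * ?b\<^sup>2)"
        using \<eta> by (intro ennreal_plus) auto
      also have "ennreal (\<eta> / 2 * ?a\<^sup>2) = ennreal (\<eta> / 2) * ennreal (?a\<^sup>2)" using \<eta>
        by (intro ennreal_mult) auto
      also have "ennreal (1 / (2 * \<eta>) * ?b\<^sup>2) = ennreal (1 / (2 * \<eta>)) * ennreal (?b\<^sup>2)" using \<eta>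
        by (intro ennreal_mult) auto
      finally show "ennreal (?a * c) * ennreal (cmod ((cnj (u (x - e *\<^sub>R w)) - cnj (u x))
          * of_real (gauss w)))
        \<le> ennreal (c * gauss w) * (ennreal (\<eta> / 2) * ennreal (?a\<^sup>2) + ennreal (1 / (2 * \<eta>)) *
            ennreal (?b\<^sup>2))" .
    qed
    finally show "ennreal (cmod (?D x)) \<le> (\<integral>\<^sup>+w. ennreal (c * gauss w) * (ennreal (\<eta> / 2)
        * ennreal ((cmod (u x))\<^sup>2) + ennreal (1 / (2 * \<eta>)) * ennreal ((cmod (u (x - e *\<^sub>R w) - u
        x))\<^sup>2)) \<partial>lborel)" .
  qed
  also have "\<dots> = (\<integral>\<^sup>+w. (\<integral>\<^sup>+x. ennreal (c * gauss w) * (ennreal (\<eta> / 2) * ennreal ((cmod (u x))\<^sup>2)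
      + ennreal (1 / (2 * \<eta>)) * ennreal ((cmod (u (x - e *\<^sub>R w) - u x))\<^sup>2)) \<partial>lborel) \<partial>lborel)"
    by (rule lborel_pair.Fubini') measurable
  also have "\<dots> = (\<integral>\<^sup>+w. ennreal (c * gauss w) * (ennreal (\<eta> / 2) * l2sq u + ennreal (1 / (2 * \<eta>))
      * l2sq (\<lambda>x. u (x - e *\<^sub>R w) - u x)) \<partial>lborel)"
    by (simp add: nn_integral_cmult nn_integral_add l2sq_def)
  also have "\<dots> = (\<integral>\<^sup>+w. (ennreal (c * gauss w) * (ennreal (\<eta> / 2) * l2sq u) + ennreal (1 / (2 * \<eta>))
      * (ennreal (c * gauss w) * l2sq (\<lambda>x. u (x - e *\<^sub>R w) - u x))) \<partial>lborel)"
    by (simp add: distrib_left mult_ac)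
  also have "\<dots> = ennreal (\<eta> / 2) * l2sq u + ennreal (1 / (2 * \<eta>)) * translation_defect u e"
    using gauss_normalized[where 'a='a]
    by (simp add: nn_integral_cmult nn_integral_multc nn_integral_add translation_defect_def c_def)
  finally show ?thesis .
qed

text \<open>The Gaussian weighted integrals have two limits: \<open>l2sq u\<close> by the estimate
  above, and \<open>l2sq (fourier_integral u)\<close> by monotone convergence.\<close>

theorem plancherel_L1_L2:
  fixes u :: "'a::euclidean_space \<Rightarrow> complex"
  assumes u: "integrable lborel u" and fin: "l2sq u < \<infinity>"
  shows "l2sq (fourier_integral u) = l2sq u"
proof -
  have um[measurable]: "u \<in> borel_measurable borel" using borel_measurable_integrable[OF u] by simp
  define I where "I = (\<lambda>n. LINT \<xi>|lborel. gauss ((1 / real (Suc n)) *\<^sub>R \<xi>)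
      * (cmod (fourier_integral u \<xi>))\<^sup>2)"
  define U where "U = (LINT x|lborel. (cmod (u x))\<^sup>2)"
  have U: "l2sq u = ennreal U" "0 \<le> U"
    using fin unfolding l2sq_def U_def
    by (auto intro!: nn_integral_eq_integral simp: integrable_iff_bounded)
  have "I \<longlonglongrightarrow> U"
  proof (rule LIMSEQ_I)
    fix r :: real assume r: "0 < r"
    \<comment> \<open>Fixed before \<open>n\<close>, so that the first error term is below
      \<open>r / 2\<close>; adding 1 covers \<open>U = 0\<close>.\<close>
    define \<eta> where "\<eta> = r / (U + 1)"
    have \<eta>: "0 < \<eta>" using r U(2) by (simp add: \<eta>_def)
    have 1: "\<eta> / 2 * U < r / 2" using r U(2) by (simp add: \<eta>_def field_simps)
    have "(\<lambda>n. ennreal (1 / (2 * \<eta>)) * translation_defect u (1 / real (Suc n))) \<longlonglongrightarrow> ennreal (1 / (2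
        * \<eta>)) * 0"
      by (intro ennreal_tendsto_cmult translation_defect_tendsto_0 um fin) auto
    then have "(\<lambda>n. ennreal (1 / (2 * \<eta>)) * translation_defect u (1 / real (Suc n))) \<longlonglongrightarrow> 0" by simp
    then have "\<forall>\<^sub>F n in sequentially. ennreal (1 / (2 * \<eta>))
        * translation_defect u (1 / real (Suc n)) < ennreal (r / 2)"
      by (rule order_tendstoD(2)) (use r in simp)
    then show "\<exists>no. \<forall>n\<ge>no. norm (I n - U) < r"
    unfolding eventually_sequentially[symmetric]
    proof eventually_elim
      case (elim n)
      have "ennreal \<bar>I n - U\<bar> \<le> ennreal (\<eta> / 2) * l2sq u + ennreal (1 / (2 * \<eta>))
          * translation_defect u (1 / real (Suc n))"
        unfolding I_def U_def by (rule fourier_integral_weighted_sq_close[OF u fin _ \<eta>]) simp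
      also have "\<dots> \<le> ennreal (r / 2) + ennreal (1 / (2 * \<eta>))
          * translation_defect u (1 / real (Suc n))"
        unfolding U using 1 \<eta> U(2)
        by (intro add_right_mono) (simp add: ennreal_mult[symmetric] ennreal_leI)
      also have "\<dots> < ennreal (r / 2) + ennreal (r / 2)" using elim
        by (simp add: ennreal_add_left_cancel_less)
      also have "\<dots> = ennreal r" using r by (simp flip: ennreal_plus)
      finally show ?case using r by (simp add: ennreal_less_iff)
    qed
  qed
  then have lim1: "(\<lambda>n. ennreal (I n)) \<longlonglongrightarrow> l2sq u" unfolding U by (rule tendsto_ennrealI)
  have In: "ennreal (I n) = (\<integral>\<^sup>+\<xi>. ennreal (gauss ((1 / real (Suc n)) *\<^sub>R \<xi>)
      * (cmod (fourier_integral u \<xi>))\<^sup>2) \<partial>lborel)" for n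
    unfolding I_def
    by (rule nn_integral_eq_integral[symmetric, OF fourier_integral_weighted_sq(1)[OF u]]) (auto
        simp: less_imp_le gauss_bounds(1))
  \<comment> \<open>Monotone convergence in \<open>ennreal\<close>, so square integrability of the
    transform comes out as a consequence.\<close>
  have "(\<lambda>n. ennreal (I n)) \<longlonglongrightarrow> l2sq (fourier_integral u)"
    unfolding In l2sq_def
  proof (rule nn_integral_LIMSEQ)
    have "gauss ((1 / real (Suc m)) *\<^sub>R \<xi>) \<le> gauss ((1 / real (Suc n)) *\<^sub>R \<xi>)" if "m \<le> n" for m n
        and \<xi> :: 'a
    proof -
      have "1 / real (Suc n) * norm \<xi> \<le> 1 / real (Suc m) * norm \<xi>"
        using that by (intro mult_right_mono frac_le) auto
      then have "(1 / real (Suc n) * norm \<xi>)\<^sup>2 \<le> (1 / real (Suc m) * norm \<xi>)\<^sup>2"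
        by (rule power_mono) auto
      then show ?thesis by (simp add: gauss_def)
    qed
    then show "incseq (\<lambda>n \<xi>. ennreal (gauss ((1 / real (Suc n)) *\<^sub>R \<xi>)
        * (cmod (fourier_integral u \<xi>))\<^sup>2))"
      by (auto simp: incseq_def le_fun_def intro!: ennreal_leI mult_right_mono)
    fix \<xi> :: 'a
    have "(\<lambda>n. exp (- (norm ((1 / real (Suc n)) *\<^sub>R \<xi>))\<^sup>2 / 2)) \<longlonglongrightarrow> exp (- (norm (0 *\<^sub>R \<xi>))\<^sup>2 / 2)"
      by (intro tendsto_intros LIMSEQ_Suc[OF lim_1_over_n]) auto
    then have "(\<lambda>n. gauss ((1 / real (Suc n)) *\<^sub>R \<xi>)) \<longlonglongrightarrow> 1" by (simp add: gauss_def)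
    then have "(\<lambda>n. gauss ((1 / real (Suc n)) *\<^sub>R \<xi>) * (cmod (fourier_integral u \<xi>))\<^sup>2) \<longlonglongrightarrow> 1
        * (cmod (fourier_integral u \<xi>))\<^sup>2"
      by (intro tendsto_intros)
    from tendsto_ennrealI[OF this]
    show "(\<lambda>n. ennreal (gauss ((1 / real (Suc n)) *\<^sub>R \<xi>) * (cmod (fourier_integral u \<xi>))\<^sup>2)) \<longlonglongrightarrow>
        ennreal ((cmod (fourier_integral u \<xi>))\<^sup>2)" by simp
  qed auto
  then show ?thesis using lim1 by (rule LIMSEQ_unique)
qed

section \<open>The Fourier transform on \<open>L\<^sup>2\<close>\<close>

lemma truncate_measurable[measurable]:
  assumes [measurable]: "u \<in> borel_measurable borel"
  shows "truncate R u \<in> borel_measurable borel"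
  unfolding truncate_def[abs_def] by measurable

lemma l2sq_truncate_le: "l2sq (truncate R u) \<le> l2sq u"
  by (intro l2sq_mono AE_I2) (auto simp: truncate_def)

lemma truncate_integrable:
  fixes u :: "'a::euclidean_space \<Rightarrow> complex"
  assumes "u \<in> Lspace 2"
  shows "integrable lborel (truncate R u)"
proof -
  have [measurable]: "u \<in> borel_measurable borel" and fin: "l2sq u < \<infinity>" using assms
    by (auto simp: Lspace2_iff)
  have "integrable lborel (\<lambda>x. (cmod (u x))\<^sup>2)"
    using fin by (simp add: integrable_iff_bounded l2sq_def)
  moreover have "integrable lborel (indicator (cball (0::'a) R) :: 'a \<Rightarrow> real)"
    by (intro integrable_real_indicator) (auto intro: emeasure_bounded_finite[unfolded
        infinity_ennreal_def])
  ultimately have "integrable lborel (\<lambda>x. indicator (cball 0 R) x + (cmod (u x))\<^sup>2)"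
    by (rule Bochner_Integration.integrable_add[rotated])
  then show ?thesis
  proof (rule Bochner_Integration.integrable_bound)
    show "AE x in lborel. norm (truncate R u x) \<le> norm (indicator (cball 0 R) x + (cmod (u x))\<^sup>2)"
    proof (intro AE_I2)
      fix x :: 'a
      have "2 * cmod (u x) \<le> 1 + (cmod (u x))\<^sup>2" using sum_squares_bound[of 1 "cmod (u x)"] by simp
      then have "cmod (u x) \<le> 1 + (cmod (u x))\<^sup>2" using norm_ge_zero[of "u x"] by linarith
      then show "norm (truncate R u x) \<le> norm (indicator (cball 0 R) x + (cmod (u x))\<^sup>2)"
        by (auto simp: truncate_def indicator_def)
    qed
  qed simp
qed

lemma truncate_L2_tendsto:
  fixes u :: "'a::euclidean_space \<Rightarrow> complex"
  assumes "u \<in> Lspace 2"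
  shows "((\<lambda>R. l2sq (\<lambda>x. truncate R u x - u x)) \<longlongrightarrow> 0) at_top"
proof (rule tendsto_at_topI_sequentially)
  fix X :: "nat \<Rightarrow> real" assume X: "filterlim X at_top sequentially"
  have [measurable]: "u \<in> borel_measurable borel" and fin: "l2sq u < \<infinity>" using assms
    by (auto simp: Lspace2_iff)
  have "(\<lambda>n. \<integral>\<^sup>+x. ennreal ((cmod (truncate (X n) u x - u x))\<^sup>2) \<partial>lborel) \<longlonglongrightarrow> (\<integral>\<^sup>+x. 0 \<partial>(lborel::'a
      measure))"
  proof (rule nn_integral_dominated_convergence[where w="\<lambda>x. ennreal ((cmod (u x))\<^sup>2)"])
    show "(\<integral>\<^sup>+x. ennreal ((cmod (u x))\<^sup>2) \<partial>lborel) < \<infinity>" using fin by (simp add: l2sq_def)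
    show "AE x in lborel. (\<lambda>n. ennreal ((cmod (truncate (X n) u x - u x))\<^sup>2)) \<longlonglongrightarrow> 0"
    proof (intro AE_I2)
      fix x :: 'a
      have "\<forall>\<^sub>F n in sequentially. norm x \<le> X n" using X by (simp add: filterlim_at_top)
      then have "\<forall>\<^sub>F n in sequentially. ennreal ((cmod (truncate (X n) u x - u x))\<^sup>2) = 0"
        by eventually_elim (simp add: truncate_def)
      then show "(\<lambda>n. ennreal ((cmod (truncate (X n) u x - u x))\<^sup>2)) \<longlonglongrightarrow> 0"
        by (rule tendsto_eventually)
    qed
  qed (auto simp: truncate_def)
  then show "(\<lambda>n. l2sq (\<lambda>x. truncate (X n) u x - u x)) \<longlonglongrightarrow> 0" by (simp add: l2sq_def)
qed

lemma l2sq_fourier_integral_diff: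
  fixes f g :: "'a::euclidean_space \<Rightarrow> complex"
  assumes "integrable lborel f" "l2sq f < \<infinity>" "integrable lborel g" "l2sq g < \<infinity>"
  shows "l2sq (\<lambda>\<xi>. fourier_integral f \<xi> - fourier_integral g \<xi>) = l2sq (\<lambda>x. f x - g x)"
proof -
  have [measurable]: "f \<in> borel_measurable borel" "g \<in> borel_measurable borel"
    using assms borel_measurable_integrable by fastforce+
  have "l2sq (\<lambda>x. f x - g x) \<le> 2 * l2sq f + 2 * l2sq g"
    using l2sq_add_le[of f "\<lambda>x. - g x"] l2sq_cong[of "\<lambda>x. - g x" g] by simp
  also have "\<dots> < \<infinity>" using assms by (simp add: ennreal_mult_less_top)
  finally have "l2sq (fourier_integral (\<lambda>x. f x - g x)) = l2sq (\<lambda>x. f x - g x)"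
    using assms by (intro plancherel_L1_L2) auto
  moreover have "fourier_integral (\<lambda>x. f x - g x)
      = (\<lambda>\<xi>. fourier_integral f \<xi> - fourier_integral g \<xi>)"
    by (rule ext) (rule fourier_integral_diff[OF assms(1,3)])
  ultimately show ?thesis by simp
qed

lemma l2sq_truncate_finite:
  "u \<in> Lspace 2 \<Longrightarrow> l2sq (truncate R u) < \<infinity>"
  using le_less_trans[OF l2sq_truncate_le[of R u]] by (auto simp: Lspace2_iff)

text \<open>By Plancherel for integrable functions the transforms of the truncations are Cauchy
  along the integers. The estimate \<open>bound\<close> then controls arbitrary real radii by
  letting the integer radius tend to infinity.\<close>

lemma fourier_exists:
  fixes u :: "'a::euclidean_space \<Rightarrow> complex"
  assumes u: "u \<in> Lspace 2"
  shows "\<exists>v. L2_limit (\<lambda>R. fourier_integral (truncate R u)) v"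
proof -
  have um[measurable]: "u \<in> borel_measurable borel" and fin: "l2sq u < \<infinity>" using u
    by (auto simp: Lspace2_iff)
  define \<delta> where "\<delta> = (\<lambda>R. l2sq (\<lambda>x. truncate R u x - u x))"
  have \<delta>: "(\<delta> \<longlongrightarrow> 0) at_top" unfolding \<delta>_def by (rule truncate_L2_tendsto[OF u])
  have diff: "l2sq (\<lambda>\<xi>. fourier_integral (truncate R u) \<xi> - fourier_integral (truncate R' u) \<xi>)
      \<le> 2 * \<delta> R + 2 * \<delta> R'" for R R'
  proof -
    have "l2sq (\<lambda>\<xi>. fourier_integral (truncate R u) \<xi> - fourier_integral (truncate R' u) \<xi>)
        = l2sq (\<lambda>x. truncate R u x - truncate R' u x)"
      by (intro l2sq_fourier_integral_diff truncate_integrable l2sq_truncate_finite u)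
    also have "\<dots> \<le> 2 * l2sq (\<lambda>x. truncate R u x - u x) + 2 * l2sq (\<lambda>x. u x - truncate R' u x)"
      by (intro l2sq_triangle) measurable
    finally show ?thesis unfolding \<delta>_def using l2sq_minus_commute[of u "truncate R' u"] by simp
  qed
  have "\<exists>v\<in>Lspace 2. (\<lambda>n. l2sq (\<lambda>x. fourier_integral (truncate (real n) u) x - v x)) \<longlonglongrightarrow> 0"
  proof (rule L2_complete)
    show "l2sq (fourier_integral (truncate (real n) u)) < \<infinity>" for n
      using l2sq_truncate_finite[OF u]
      by (subst plancherel_L1_L2[OF truncate_integrable[OF u]]) auto
    fix e :: real assume e: "0 < e"
    have "\<forall>\<^sub>F R in at_top. \<delta> R < ennreal (e / 4)"
      by (rule order_tendstoD(2)[OF \<delta>]) (use e in simp)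
    then obtain R0 where R0: "\<And>R. R \<ge> R0 \<Longrightarrow> \<delta> R < ennreal (e / 4)"
      unfolding eventually_at_top_linorder by blast
    show "\<exists>N. \<forall>m\<ge>N. \<forall>n\<ge>N. l2sq (\<lambda>x. fourier_integral (truncate (real m) u) x
        - fourier_integral (truncate (real n) u) x) < ennreal e"
    proof (intro exI allI impI)
      fix m n assume "nat \<lceil>R0\<rceil> \<le> m" "nat \<lceil>R0\<rceil> \<le> n"
      then have "R0 \<le> real m" "R0 \<le> real n" by linarith+
      then have "2 * \<delta> (real m) + 2 * \<delta> (real n) < 2 * ennreal (e / 4) + 2 * ennreal (e / 4)"
        by (intro add_strict_mono ennreal_mult_strict_left_mono R0) auto
      also have "\<dots> = ennreal 2 * ennreal (e / 4) + ennreal 2 * ennreal (e / 4)" by simp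
      also have "\<dots> = ennreal e" using e
        by (simp add: ennreal_mult[symmetric] ennreal_plus[symmetric] del: ennreal_plus
          ennreal_numeral)
      finally show "l2sq (\<lambda>x. fourier_integral (truncate (real m) u) x
          - fourier_integral (truncate (real n) u) x) < ennreal e"
        using diff[of "real m" "real n"] by (rule le_less_trans[rotated])
    qed
  qed simp
  then obtain v where v: "v \<in> Lspace 2" "(\<lambda>n. l2sq (\<lambda>x. fourier_integral (truncate (real n) u) x
      - v x)) \<longlonglongrightarrow> 0" by blast
  have vm[measurable]: "v \<in> borel_measurable borel" using v by (simp add: Lspace2_iff)
  have bound: "l2sq (\<lambda>x. fourier_integral (truncate R u) x - v x) \<le> 4 * \<delta> R" for R
  proof (rule tendsto_lowerbound)
    have "(\<lambda>n. \<delta> (real n)) \<longlonglongrightarrow> 0"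
      by (rule filterlim_compose[OF \<delta> filterlim_real_sequentially])
    then have "(\<lambda>n. 2 * (2 * \<delta> R + 2 * \<delta> (real n)) + 2
        * l2sq (\<lambda>x. fourier_integral (truncate (real n) u) x - v x)) \<longlonglongrightarrow> 2 * (2 * \<delta> R + 2 * 0) + 2 *
        0"
      by (intro tendsto_add ennreal_tendsto_cmult tendsto_const v) auto
    then show "(\<lambda>n. 2 * (2 * \<delta> R + 2 * \<delta> (real n)) + 2
        * l2sq (\<lambda>x. fourier_integral (truncate (real n) u) x - v x)) \<longlonglongrightarrow> 4 * \<delta> R"
      by (simp add: mult.assoc[symmetric])
    show "\<forall>\<^sub>F n in sequentially. l2sq (\<lambda>x. fourier_integral (truncate R u) x - v x) \<le>
       2 * (2 * \<delta> R + 2 * \<delta> (real n)) + 2 * l2sq (\<lambda>x. fourier_integral (truncate (real n) u) x - v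
           x)"
    proof (intro always_eventually allI)
      fix n
      have "l2sq (\<lambda>x. fourier_integral (truncate R u) x - v x)
          \<le> 2 * l2sq (\<lambda>x. fourier_integral (truncate R u) x - fourier_integral (truncate (real n) u)
          x)
         + 2 * l2sq (\<lambda>x. fourier_integral (truncate (real n) u) x - v x)"
        by (intro l2sq_triangle) measurable
      also have "\<dots> \<le> 2 * (2 * \<delta> R + 2 * \<delta> (real n)) + 2
          * l2sq (\<lambda>x. fourier_integral (truncate (real n) u) x - v x)"
        by (intro add_right_mono mult_left_mono diff) auto
      finally show "l2sq (\<lambda>x. fourier_integral (truncate R u) x - v x) \<le>
       2 * (2 * \<delta> R + 2 * \<delta> (real n)) + 2 * l2sq (\<lambda>x. fourier_integral (truncate (real n) u) x - v
           x)" .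
    qed
  qed simp
  have "((\<lambda>R. 4 * \<delta> R) \<longlongrightarrow> 4 * 0) at_top" by (intro ennreal_tendsto_cmult \<delta>) auto
  then have "((\<lambda>R. 4 * \<delta> R) \<longlongrightarrow> 0) at_top" by simp
  then have "((\<lambda>R. l2sq (\<lambda>x. fourier_integral (truncate R u) x - v x)) \<longlongrightarrow> 0) at_top"
    by (rule ennreal_tendsto_0_le) (rule bound)
  then show ?thesis using v by (auto simp: L2_limit_iff)
qed

lemma fourier_L2_limit:
  "u \<in> Lspace 2 \<Longrightarrow> L2_limit (\<lambda>R. fourier_integral (truncate R u)) (fourier u)"
  unfolding fourier_def by (rule someI_ex[OF fourier_exists])

lemma fourier_in_L2 [simp]: "u \<in> Lspace 2 \<Longrightarrow> fourier u \<in> Lspace 2"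
  using fourier_L2_limit by (auto simp: L2_limit_iff)

lemma fourier_measurable: "u \<in> Lspace 2 \<Longrightarrow> fourier u \<in> borel_measurable borel"
  using fourier_in_L2 by (auto simp: Lspace2_iff)

text \<open>Compare both sides through the transforms of truncations of \<open>u\<close>; two
  triangle inequalities with factor 2 each account for the constant 4.\<close>

lemma l2sq_fourier_approx:
  fixes u g :: "'a::euclidean_space \<Rightarrow> complex"
  assumes u: "u \<in> Lspace 2" and g: "integrable lborel g" "l2sq g < \<infinity>"
  shows "l2sq (\<lambda>\<xi>. fourier_integral g \<xi> - fourier u \<xi>) \<le> 4 * l2sq (\<lambda>x. g x - u x)"
proof (rule tendsto_lowerbound)
  have [measurable]: "u \<in> borel_measurable borel" "fourier u \<in> borel_measurable borel"
    using u fourier_measurable by (auto simp: Lspace2_iff)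
  have [measurable]: "g \<in> borel_measurable borel" using borel_measurable_integrable[OF g(1)] by simp
  define \<delta> where "\<delta> = (\<lambda>R. l2sq (\<lambda>x. truncate R u x - u x))"
  define \<rho> where "\<rho> = (\<lambda>R. l2sq (\<lambda>x. fourier_integral (truncate R u) x - fourier u x))"
  have "(\<delta> \<longlongrightarrow> 0) at_top" unfolding \<delta>_def by (rule truncate_L2_tendsto[OF u])
  moreover have "(\<rho> \<longlongrightarrow> 0) at_top" using fourier_L2_limit[OF u] by (simp add: L2_limit_iff \<rho>_def)
  ultimately have "((\<lambda>R. 2 * (2 * l2sq (\<lambda>x. g x - u x) + 2 * \<delta> R) + 2 * \<rho> R) \<longlongrightarrow> 2
      * (2 * l2sq (\<lambda>x. g x - u x) + 2 * 0) + 2 * 0) at_top"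
    by (intro tendsto_add ennreal_tendsto_cmult tendsto_const) auto
  then show "((\<lambda>R. 2 * (2 * l2sq (\<lambda>x. g x - u x) + 2 * \<delta> R) + 2 * \<rho> R) \<longlongrightarrow> 4 * l2sq (\<lambda>x. g x
      - u x)) at_top"
    by (simp add: mult.assoc[symmetric])
  show "\<forall>\<^sub>F R in at_top. l2sq (\<lambda>\<xi>. fourier_integral g \<xi> - fourier u \<xi>)
      \<le> 2 * (2 * l2sq (\<lambda>x. g x - u x) + 2 * \<delta> R) + 2 * \<rho> R"
  proof (intro always_eventually allI)
    fix R
    have "l2sq (\<lambda>\<xi>. fourier_integral g \<xi> - fourier u \<xi>) \<le> 2 * l2sq (\<lambda>\<xi>. fourier_integral g \<xi>
        - fourier_integral (truncate R u) \<xi>) + 2 * \<rho> R"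
      unfolding \<rho>_def by (intro l2sq_triangle) measurable
    also have "l2sq (\<lambda>\<xi>. fourier_integral g \<xi> - fourier_integral (truncate R u) \<xi>)
        = l2sq (\<lambda>x. g x - truncate R u x)"
      by (intro l2sq_fourier_integral_diff truncate_integrable l2sq_truncate_finite u g)
    also have "2 * l2sq (\<lambda>x. g x - truncate R u x) + 2 * \<rho> R \<le> 2 * (2 * l2sq (\<lambda>x. g x - u x) + 2
        * l2sq (\<lambda>x. u x - truncate R u x)) + 2 * \<rho> R"
      by (intro add_right_mono mult_left_mono l2sq_triangle) auto
    also have "l2sq (\<lambda>x. u x - truncate R u x) = \<delta> R" unfolding \<delta>_def by (rule l2sq_minus_commute)
    finally show "l2sq (\<lambda>\<xi>. fourier_integral g \<xi> - fourier u \<xi>) \<le> 2 * (2 * l2sq (\<lambda>x. g x - u x) + 2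
        * \<delta> R) + 2 * \<rho> R" .
  qed
qed simp

lemma fourier_eqI:
  fixes u v :: "'a::euclidean_space \<Rightarrow> complex"
  assumes u: "u \<in> Lspace 2" and v[measurable]: "v \<in> borel_measurable borel"
    and un: "\<And>R::real. integrable lborel (g R)" "\<And>R. l2sq (g R) < \<infinity>"
    and lim: "((\<lambda>R. l2sq (\<lambda>x. g R x - u x)) \<longlongrightarrow> 0) at_top"
    and limv: "((\<lambda>R. l2sq (\<lambda>x. fourier_integral (g R) x - v x)) \<longlongrightarrow> 0) at_top"
  shows "AE \<xi> in lborel. fourier u \<xi> = v \<xi>"
proof -
  have [measurable]: "u \<in> borel_measurable borel" "fourier u \<in> borel_measurable borel"
    using u fourier_measurable by (auto simp: Lspace2_iff)
  have [measurable]: "g R \<in> borel_measurable borel" for R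
    using borel_measurable_integrable[OF un(1)] by simp
  have "l2sq (\<lambda>\<xi>. fourier u \<xi> - v \<xi>) \<le> 0"
  proof (rule tendsto_lowerbound)
    have "((\<lambda>R. 2 * (4 * l2sq (\<lambda>x. g R x - u x)) + 2 * l2sq (\<lambda>x. fourier_integral (g R) x
        - v x)) \<longlongrightarrow> 2 * (4 * 0) + 2 * 0) at_top"
      by (intro tendsto_add ennreal_tendsto_cmult lim limv) auto
    then show "((\<lambda>R. 2 * (4 * l2sq (\<lambda>x. g R x - u x)) + 2 * l2sq (\<lambda>x. fourier_integral (g R) x
        - v x)) \<longlongrightarrow> 0) at_top" by simp
    show "\<forall>\<^sub>F R in at_top. l2sq (\<lambda>\<xi>. fourier u \<xi> - v \<xi>) \<le> 2 * (4 * l2sq (\<lambda>x. g R x - u x)) + 2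
        * l2sq (\<lambda>x. fourier_integral (g R) x - v x)"
    proof (intro always_eventually allI)
      fix R
      have "l2sq (\<lambda>\<xi>. fourier u \<xi> - v \<xi>) \<le> 2 * l2sq (\<lambda>\<xi>. fourier u \<xi> - fourier_integral (g R) \<xi>) + 2
          * l2sq (\<lambda>x. fourier_integral (g R) x - v x)"
        by (intro l2sq_triangle) measurable
      also have "\<dots> \<le> 2 * (4 * l2sq (\<lambda>x. g R x - u x)) + 2 * l2sq (\<lambda>x. fourier_integral (g R) x
          - v x)"
        by (subst l2sq_minus_commute, intro add_right_mono mult_left_mono l2sq_fourier_approx u un)
            auto
      finally show "l2sq (\<lambda>\<xi>. fourier u \<xi> - v \<xi>) \<le> 2 * (4 * l2sq (\<lambda>x. g R x - u x)) + 2
          * l2sq (\<lambda>x. fourier_integral (g R) x - v x)" .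
    qed
  qed simp
  then have "AE \<xi> in lborel. fourier u \<xi> - v \<xi> = 0"
    by (subst l2sq_eq_0_iff[symmetric]) auto
  then show ?thesis by simp
qed

lemma ennreal_le_mult_epsilon:
  fixes x C :: ennreal
  assumes "\<And>d::real. 0 < d \<Longrightarrow> x \<le> ennreal (1 + d) * C"
  shows "x \<le> C"
proof (rule ennreal_le_epsilon)
  fix e :: real assume "C < top" and e: "0 < e"
  then obtain c where c: "C = ennreal c" "0 \<le> c" by (cases C) auto
  define d where "d = e / (c + 1)"
  have d: "0 < d" "d * c \<le> e" using e c(2) by (auto simp: d_def field_simps)
  have "x \<le> ennreal (1 + d) * C" by (rule assms[OF d(1)])
  also have "\<dots> = ennreal ((1 + d) * c)" using d c by (simp add: ennreal_mult)
  also have "\<dots> \<le> ennreal (c + e)" using d by (intro ennreal_leI) (simp add: distrib_right)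
  also have "\<dots> = C + ennreal e" using c e by simp
  finally show "x \<le> C + ennreal e" .
qed

text \<open>The factor \<open>1 + d\<close> with arbitrary \<open>d\<close> keeps the constant
  \<open>C\<close> exact; the vanishing error \<open>r\<close> admits bounds that hold only
  asymptotically.\<close>

lemma l2sq_limit_le:
  fixes v :: "'a::euclidean_space \<Rightarrow> complex"
  assumes [measurable]: "v \<in> borel_measurable borel" "\<And>R::real. F R \<in> borel_measurable borel"
    and bd: "\<And>R. l2sq (F R) \<le> C + r R" and lim: "((\<lambda>R. l2sq (\<lambda>x. F R x - v x)) \<longlongrightarrow> 0) at_top"
    and r: "(r \<longlongrightarrow> 0) at_top"
  shows "l2sq v \<le> C"
proof (rule ennreal_le_mult_epsilon, rule tendsto_lowerbound)
  fix d :: real assume d: "0 < d"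
  have "((\<lambda>R. ennreal (1 + d) * (C + r R) + ennreal (1 + 1 / d) * l2sq (\<lambda>x. F R x - v x)) \<longlongrightarrow> ennreal
      (1 + d) * (C + 0) + ennreal (1 + 1 / d) * 0) at_top"
    by (intro tendsto_add ennreal_tendsto_cmult lim tendsto_const r) auto
  then show "((\<lambda>R. ennreal (1 + d) * (C + r R) + ennreal (1 + 1 / d) * l2sq (\<lambda>x. F R x
      - v x)) \<longlongrightarrow> ennreal (1 + d) * C) at_top" by simp
  show "\<forall>\<^sub>F R in at_top. l2sq v \<le> ennreal (1 + d) * (C + r R) + ennreal (1 + 1 / d)
      * l2sq (\<lambda>x. F R x - v x)"
  proof (intro always_eventually allI)
    fix R
    have "l2sq v \<le> ennreal (1 + d) * l2sq (F R) + ennreal (1 + 1 / d) * l2sq (\<lambda>x. v x - F R x)"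
      by (intro l2sq_eps d) auto
    also have "\<dots> \<le> ennreal (1 + d) * (C + r R) + ennreal (1 + 1 / d) * l2sq (\<lambda>x. F R x - v x)"
      by (subst l2sq_minus_commute) (intro add_right_mono mult_left_mono bd, simp)
    finally show "l2sq v \<le> ennreal (1 + d) * (C + r R) + ennreal (1 + 1 / d) * l2sq (\<lambda>x. F R x
        - v x)" .
  qed
qed simp

theorem plancherel:
  fixes u :: "'a::euclidean_space \<Rightarrow> complex"
  assumes u: "u \<in> Lspace 2"
  shows "l2sq (fourier u) = l2sq u"
proof (rule antisym)
  have [measurable]: "u \<in> borel_measurable borel" "fourier u \<in> borel_measurable borel"
    using u fourier_measurable by (auto simp: Lspace2_iff)
  have eq: "l2sq (fourier_integral (truncate R u)) = l2sq (truncate R u)" for R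
    by (intro plancherel_L1_L2 truncate_integrable l2sq_truncate_finite u)
  have lim: "((\<lambda>R. l2sq (\<lambda>x. fourier_integral (truncate R u) x - fourier u x)) \<longlongrightarrow> 0) at_top"
    using fourier_L2_limit[OF u] by (simp add: L2_limit_iff)
  show "l2sq (fourier u) \<le> l2sq u"
    by (rule l2sq_limit_le[OF _ _ _ lim tendsto_const]) (simp_all add: eq l2sq_truncate_le)
  show "l2sq u \<le> l2sq (fourier u)"
  proof (rule ennreal_le_mult_epsilon)
    fix d :: real assume d: "0 < d"
    \<comment> \<open>Now the truncations of \<open>u\<close> are the approximating family. Their
      norms are compared with that of \<open>fourier u\<close> through the isometry
      \<open>eq\<close>, and the discrepancy is the vanishing error.\<close>
    show "l2sq u \<le> ennreal (1 + d) * l2sq (fourier u)"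
    proof (rule l2sq_limit_le[OF _ _ _ truncate_L2_tendsto[OF u]])
      show "((\<lambda>R. ennreal (1 + 1 / d) * l2sq (\<lambda>x. fourier_integral (truncate R u) x - fourier u x))
          \<longlongrightarrow> 0) at_top"
        using ennreal_tendsto_cmult[OF _ lim, of "ennreal (1 + 1 / d)"] by simp
      show "l2sq (truncate R u) \<le> ennreal (1 + d) * l2sq (fourier u) + ennreal (1 + 1 / d)
          * l2sq (\<lambda>x. fourier_integral (truncate R u) x - fourier u x)" for R
        unfolding eq[symmetric] by (intro l2sq_eps d) auto
    qed auto
  qed
qed

section \<open>Linearity, translations and dilations under the transform\<close>

lemma Lspace2_add: "u \<in> Lspace 2 \<Longrightarrow> v \<in> Lspace 2 \<Longrightarrow> (\<lambda>x. u x + v x) \<in> Lspace 2"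
  using l2sq_add_le[of u v]
  by (auto simp: Lspace2_iff ennreal_mult_less_top ennreal_add_less_top elim!: le_less_trans)

lemma Lspace2_cmult: "u \<in> Lspace 2 \<Longrightarrow> (\<lambda>x. c * u x) \<in> Lspace 2"
  using l2sq_cmult[of u c] by (auto simp: Lspace2_iff ennreal_mult_less_top)

lemma Lspace2_shift: "u \<in> Lspace 2 \<Longrightarrow> (\<lambda>x. u (x + y)) \<in> Lspace 2"
  using l2sq_shift[of u y] by (auto simp: Lspace2_iff)

lemma Lspace2_scale: "u \<in> Lspace 2 \<Longrightarrow> 0 < c \<Longrightarrow> (\<lambda>x. u (c *\<^sub>R x)) \<in> Lspace 2"
  using l2sq_scale[of u c] by (auto simp: Lspace2_iff ennreal_mult_less_top)

lemma fourier_add: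
  fixes u v :: "'a::euclidean_space \<Rightarrow> complex"
  assumes u: "u \<in> Lspace 2" and v: "v \<in> Lspace 2"
  shows "AE \<xi> in lborel. fourier (\<lambda>x. u x + v x) \<xi> = fourier u \<xi> + fourier v \<xi>"
proof (rule fourier_eqI[where g="\<lambda>R x. truncate R u x + truncate R v x"])
  have [measurable]: "u \<in> borel_measurable borel" "v \<in> borel_measurable borel"
    "fourier u \<in> borel_measurable borel" "fourier v \<in> borel_measurable borel"
    using u v fourier_measurable by (auto simp: Lspace2_iff)
  show "(\<lambda>x. u x + v x) \<in> Lspace 2" by (rule Lspace2_add[OF u v])
  show "(\<lambda>\<xi>. fourier u \<xi> + fourier v \<xi>) \<in> borel_measurable borel" by simp
  show "integrable lborel (\<lambda>x. truncate R u x + truncate R v x)" for R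
    by (intro Bochner_Integration.integrable_add truncate_integrable u v)
  show "l2sq (\<lambda>x. truncate R u x + truncate R v x) < \<infinity>" for R
    using Lspace2_add[of "truncate R u" "truncate R v"] l2sq_truncate_finite[OF u, of R]
        l2sq_truncate_finite[OF v, of R]
    by (simp add: Lspace2_iff)
  have "((\<lambda>R. 2 * l2sq (\<lambda>x. truncate R u x - u x) + 2 * l2sq (\<lambda>x. truncate R v x - v x)) \<longlongrightarrow> 2 * 0 + 2
      * 0) at_top"
    by (intro tendsto_add ennreal_tendsto_cmult truncate_L2_tendsto u v) auto
  then have "((\<lambda>R. 2 * l2sq (\<lambda>x. truncate R u x - u x) + 2 * l2sq (\<lambda>x. truncate R v x - v x)) \<longlongrightarrow> 0)
      at_top" by simp
  then show "((\<lambda>R. l2sq (\<lambda>x. truncate R u x + truncate R v x - (u x + v x))) \<longlongrightarrow> 0) at_top"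
  proof (rule ennreal_tendsto_0_le)
    fix R show "l2sq (\<lambda>x. truncate R u x + truncate R v x - (u x + v x))
        \<le> 2 * l2sq (\<lambda>x. truncate R u x - u x) + 2 * l2sq (\<lambda>x. truncate R v x - v x)"
      using l2sq_add_le[of "\<lambda>x. truncate R u x - u x" "\<lambda>x. truncate R v x - v x"]
      by (simp add: algebra_simps)
  qed
  have "((\<lambda>R. 2 * l2sq (\<lambda>x. fourier_integral (truncate R u) x - fourier u x) + 2
      * l2sq (\<lambda>x. fourier_integral (truncate R v) x - fourier v x)) \<longlongrightarrow> 2 * 0 + 2 * 0) at_top"
    using fourier_L2_limit[OF u] fourier_L2_limit[OF v]
    by (intro tendsto_add ennreal_tendsto_cmult) (auto simp: L2_limit_iff)
  then have "((\<lambda>R. 2 * l2sq (\<lambda>x. fourier_integral (truncate R u) x - fourier u x) + 2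
      * l2sq (\<lambda>x. fourier_integral (truncate R v) x - fourier v x)) \<longlongrightarrow> 0) at_top" by simp
  then show "((\<lambda>R. l2sq (\<lambda>x. fourier_integral (\<lambda>x. truncate R u x + truncate R v x) x - (fourier u x
      + fourier v x))) \<longlongrightarrow> 0) at_top"
  proof (rule ennreal_tendsto_0_le)
    fix R show "l2sq (\<lambda>x. fourier_integral (\<lambda>x. truncate R u x + truncate R v x) x - (fourier u x
        + fourier v x))
      \<le> 2 * l2sq (\<lambda>x. fourier_integral (truncate R u) x - fourier u x) + 2 * l2sq (\<lambda>x.
          fourier_integral (truncate R v) x - fourier v x)"
      using l2sq_add_le[of "\<lambda>x. fourier_integral (truncate R u) x
          - fourier u x" "\<lambda>x. fourier_integral (truncate R v) x - fourier v x"]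
      by (simp add: fourier_integral_add truncate_integrable u v algebra_simps)
  qed
qed

lemma fourier_cmult:
  fixes u :: "'a::euclidean_space \<Rightarrow> complex"
  assumes u: "u \<in> Lspace 2"
  shows "AE \<xi> in lborel. fourier (\<lambda>x. c * u x) \<xi> = c * fourier u \<xi>"
proof (rule fourier_eqI[where g="\<lambda>R x. c * truncate R u x"])
  have [measurable]: "u \<in> borel_measurable borel" "fourier u \<in> borel_measurable borel"
    using u fourier_measurable by (auto simp: Lspace2_iff)
  show "(\<lambda>x. c * u x) \<in> Lspace 2" by (rule Lspace2_cmult[OF u])
  show "(\<lambda>\<xi>. c * fourier u \<xi>) \<in> borel_measurable borel" by simp
  show "integrable lborel (\<lambda>x. c * truncate R u x)" for R
    by (intro integrable_mult_right truncate_integrable u)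
  show "l2sq (\<lambda>x. c * truncate R u x) < \<infinity>" for R
    using l2sq_truncate_finite[OF u, of R] by (subst l2sq_cmult) (auto simp: ennreal_mult_less_top)
  have "((\<lambda>R. ennreal ((cmod c)\<^sup>2) * l2sq (\<lambda>x. truncate R u x - u x)) \<longlongrightarrow> ennreal ((cmod c)\<^sup>2)
      * 0) at_top"
    by (intro ennreal_tendsto_cmult truncate_L2_tendsto u) auto
  then show "((\<lambda>R. l2sq (\<lambda>x. c * truncate R u x - c * u x)) \<longlongrightarrow> 0) at_top"
    unfolding right_diff_distrib[symmetric] by (subst l2sq_cmult) auto
  have "((\<lambda>R. ennreal ((cmod c)\<^sup>2) * l2sq (\<lambda>x. fourier_integral (truncate R u) x - fourier u x)) \<longlongrightarrow>
      ennreal ((cmod c)\<^sup>2) * 0) at_top"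
    using fourier_L2_limit[OF u] by (intro ennreal_tendsto_cmult) (auto simp: L2_limit_iff)
  then show "((\<lambda>R. l2sq (\<lambda>x. fourier_integral (\<lambda>x. c * truncate R u x) x - c * fourier u x)) \<longlongrightarrow> 0)
      at_top"
    unfolding fourier_integral_cmult right_diff_distrib[symmetric] by (subst l2sq_cmult) auto
qed

lemma fourier_shift:
  fixes u :: "'a::euclidean_space \<Rightarrow> complex"
  assumes u: "u \<in> Lspace 2"
  shows "AE \<xi> in lborel. fourier (\<lambda>x. u (x + y)) \<xi> = cis (y \<bullet> \<xi>) * fourier u \<xi>"
proof (rule fourier_eqI[where g="\<lambda>R x. truncate R u (x + y)"])
  have [measurable]: "u \<in> borel_measurable borel" "fourier u \<in> borel_measurable borel"
    using u fourier_measurable by (auto simp: Lspace2_iff)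
  show "(\<lambda>x. u (x + y)) \<in> Lspace 2" by (rule Lspace2_shift[OF u])
  show "(\<lambda>\<xi>. cis (y \<bullet> \<xi>) * fourier u \<xi>) \<in> borel_measurable borel" by simp
  show "integrable lborel (\<lambda>x. truncate R u (x + y))" for R
    using integrable_lborel_affine[OF truncate_integrable[OF u, of R], of 1 y]
    by (simp add: add.commute)
  show "l2sq (\<lambda>x. truncate R u (x + y)) < \<infinity>" for R
    using l2sq_truncate_finite[OF u, of R] by (subst l2sq_shift) auto
  have "l2sq (\<lambda>x. truncate R u (x + y) - u (x + y)) = l2sq (\<lambda>x. truncate R u x - u x)" for R
    using l2sq_shift[of "\<lambda>x. truncate R u x - u x" y] by simp
  then show "((\<lambda>R. l2sq (\<lambda>x. truncate R u (x + y) - u (x + y))) \<longlongrightarrow> 0) at_top"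
    using truncate_L2_tendsto[OF u] by simp
  have "l2sq (\<lambda>x. fourier_integral (\<lambda>x. truncate R u (x + y)) x - cis (y \<bullet> x) * fourier u x)
      = l2sq (\<lambda>x. fourier_integral (truncate R u) x - fourier u x)" for R
    by (intro l2sq_cong AE_I2) (simp add: fourier_integral_shift norm_mult flip: right_diff_distrib)
  then show "((\<lambda>R. l2sq (\<lambda>x. fourier_integral (\<lambda>x. truncate R u (x + y)) x - cis (y \<bullet> x)
      * fourier u x)) \<longlongrightarrow> 0) at_top"
    using fourier_L2_limit[OF u] by (simp add: L2_limit_iff)
qed

lemma fourier_scale:
  fixes u :: "'a::euclidean_space \<Rightarrow> complex"
  assumes u: "u \<in> Lspace 2" and c: "0 < c"
  shows "AE \<xi> in lborel. fourier (\<lambda>x. u (c *\<^sub>R x)) \<xi> = of_real (c powr (- real DIM('a)))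
      * fourier u (\<xi> /\<^sub>R c)"
proof (rule fourier_eqI[where g="\<lambda>R x. truncate R u (c *\<^sub>R x)"])
  let ?k = "complex_of_real (c powr (- real DIM('a)))"
  have [measurable]: "u \<in> borel_measurable borel" "fourier u \<in> borel_measurable borel"
    using u fourier_measurable by (auto simp: Lspace2_iff)
  show "(\<lambda>x. u (c *\<^sub>R x)) \<in> Lspace 2" by (rule Lspace2_scale[OF u c])
  show "(\<lambda>\<xi>. ?k * fourier u (\<xi> /\<^sub>R c)) \<in> borel_measurable borel" by simp
  show "integrable lborel (\<lambda>x. truncate R u (c *\<^sub>R x))" for R
    using integrable_lborel_affine[OF truncate_integrable[OF u, of R], of c 0] c by simp
  show "l2sq (\<lambda>x. truncate R u (c *\<^sub>R x)) < \<infinity>" for R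
    using l2sq_truncate_finite[OF u, of R] c
    by (subst l2sq_scale) (auto simp: ennreal_mult_less_top)
  have e: "l2sq (\<lambda>x. truncate R u (c *\<^sub>R x) - u (c *\<^sub>R x)) = ennreal (c powr (- real DIM('a)))
      * l2sq (\<lambda>x. truncate R u x - u x)" for R
    using l2sq_scale[of "\<lambda>x. truncate R u x - u x" c] c by simp
  have "((\<lambda>R. ennreal (c powr (- real DIM('a))) * l2sq (\<lambda>x. truncate R u x - u x)) \<longlongrightarrow> ennreal (c powr
      (- real DIM('a))) * 0) at_top"
    by (intro ennreal_tendsto_cmult truncate_L2_tendsto u) auto
  then show "((\<lambda>R. l2sq (\<lambda>x. truncate R u (c *\<^sub>R x) - u (c *\<^sub>R x))) \<longlongrightarrow> 0) at_top" unfolding e by simp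
  define D where "D = (\<lambda>R. l2sq (\<lambda>x. fourier_integral (truncate R u) x - fourier u x))"
  have D: "(D \<longlongrightarrow> 0) at_top" using fourier_L2_limit[OF u] by (simp add: L2_limit_iff D_def)
  define K where "K = ennreal ((cmod ?k)\<^sup>2) * ennreal (inverse c powr (- real DIM('a)))"
  have e2: "l2sq (\<lambda>\<xi>. fourier_integral (\<lambda>x. truncate R u (c *\<^sub>R x)) \<xi> - ?k * fourier u (\<xi> /\<^sub>R c))
      = K * D R" for R
  proof -
    have "(\<lambda>\<xi>. fourier_integral (\<lambda>x. truncate R u (c *\<^sub>R x)) \<xi> - ?k * fourier u (\<xi> /\<^sub>R c))
       = (\<lambda>\<xi>. ?k * (fourier_integral (truncate R u) (inverse c *\<^sub>R \<xi>) - fourier u (inverse c *\<^sub>R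
           \<xi>)))"
      by (simp add: fourier_integral_scale c right_diff_distrib)
    then show ?thesis unfolding K_def D_def
      using l2sq_scale[of "\<lambda>\<xi>. fourier_integral (truncate R u) \<xi> - fourier u \<xi>" "inverse c"] c
      by (simp add: l2sq_cmult mult.assoc)
  qed
  have "((\<lambda>R. K * D R) \<longlongrightarrow> K * 0) at_top"
    by (intro ennreal_tendsto_cmult D) (auto simp: K_def ennreal_mult_less_top)
  then show "((\<lambda>R. l2sq (\<lambda>\<xi>. fourier_integral (\<lambda>x. truncate R u (c *\<^sub>R x)) \<xi> - ?k
      * fourier u (\<xi> /\<^sub>R c))) \<longlongrightarrow> 0) at_top"
    unfolding e2 by simp
qed

lemma fourier_L1_L2:
  fixes u :: "'a::euclidean_space \<Rightarrow> complex"
  assumes u: "u \<in> Lspace 2" "integrable lborel u"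
  shows "AE \<xi> in lborel. fourier u \<xi> = fourier_integral u \<xi>"
proof -
  have [measurable]: "u \<in> borel_measurable borel" using u by (auto simp: Lspace2_iff)
  show ?thesis
    by (rule fourier_eqI[where g="\<lambda>R. u"]) (use u in \<open>auto simp: Lspace2_iff l2sq_def\<close>)
qed

text \<open>The inverse integral is the forward integral read at \<open>- x\<close>, so
  \<open>inv_fourier v\<close> agrees almost everywhere with the reflection of
  \<open>fourier v\<close>, and reflections preserve the norm.\<close>

lemma l2sq_inv_fourier:
  fixes v :: "'a::euclidean_space \<Rightarrow> complex"
  assumes v: "v \<in> Lspace 2"
  shows "l2sq (inv_fourier v) = l2sq v" "inv_fourier v \<in> Lspace 2"
proof -
  have [measurable]: "v \<in> borel_measurable borel" "fourier v \<in> borel_measurable borel"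
    using v fourier_measurable by (auto simp: Lspace2_iff)
  have refl: "inv_fourier_integral g x = fourier_integral g (- x)" for g :: "'a \<Rightarrow> complex" and x
    by (simp add: inv_fourier_integral_def fourier_integral_def inner_commute)
  have eq: "l2sq (\<lambda>x. inv_fourier_integral (truncate R v) x - w x)
      = l2sq (\<lambda>x. fourier_integral (truncate R v) x - w (- x))"
    if [measurable]: "w \<in> borel_measurable borel" for w R
    unfolding refl using l2sq_uminus[of "\<lambda>x. fourier_integral (truncate R v) x - w (- x)"] by simp
  have ex: "L2_limit (\<lambda>R. inv_fourier_integral (truncate R v)) (\<lambda>x. fourier v (- x))"
    using fourier_L2_limit[OF v] l2sq_uminus[of "fourier v"]
    by (auto simp: L2_limit_iff Lspace2_iff eq)
  have "L2_limit (\<lambda>R. inv_fourier_integral (truncate R v)) (inv_fourier v)"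
    unfolding inv_fourier_def
    using someI[of "L2_limit (\<lambda>R. inv_fourier_integral (truncate R v))", OF ex] by simp
  then have I: "inv_fourier v \<in> Lspace 2"
    and L: "((\<lambda>R. l2sq (\<lambda>x. inv_fourier_integral (truncate R v) x - inv_fourier v x)) \<longlongrightarrow> 0) at_top"
    by (auto simp: L2_limit_iff)
  have [measurable]: "inv_fourier v \<in> borel_measurable borel" using I by (simp add: Lspace2_iff)
  have "AE \<xi> in lborel. fourier v \<xi> = inv_fourier v (- \<xi>)"
    by (rule fourier_eqI[where g="\<lambda>R. truncate R v"])
       (use L in \<open>auto simp: v truncate_integrable l2sq_truncate_finite[OF v, simplified]
           truncate_L2_tendsto eq\<close>)
  then have "l2sq (fourier v) = l2sq (\<lambda>\<xi>. inv_fourier v (- \<xi>))"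
    by (intro l2sq_cong) auto
  then show "l2sq (inv_fourier v) = l2sq v" by (simp add: plancherel v l2sq_uminus)
  show "inv_fourier v \<in> Lspace 2" by (rule I)
qed

section \<open>The fractional Sobolev space\<close>

text \<open>Only the real part of the complex pairing is kept, as functionals are differentiated
  over the reals.\<close>

definition weighted_ip :: "('a::euclidean_space \<Rightarrow> real) \<Rightarrow> ('a \<Rightarrow> complex) \<Rightarrow> ('a \<Rightarrow> complex) \<Rightarrow> real"
    where
  "weighted_ip w f g = (LINT x|lborel. w x * Re (f x * cnj (g x)))"

definition weighted_L2 :: "('a::euclidean_space \<Rightarrow> real) \<Rightarrow> ('a \<Rightarrow> complex) set" where
  "weighted_L2 w = {f \<in> borel_measurable borel. integrable lborel (\<lambda>x. w x * (cmod (f x))\<^sup>2)}"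

lemma weighted_ip_self: "weighted_ip w f f = (LINT x|lborel. w x * (cmod (f x))\<^sup>2)"
  unfolding weighted_ip_def complex_norm_square[symmetric] by (simp flip: of_real_power)

lemma weighted_ip_self_nonneg: "(\<And>x. 0 \<le> w x) \<Longrightarrow> 0 \<le> weighted_ip w f f"
  by (simp add: weighted_ip_self integral_nonneg_AE)

lemma weighted_ip_integrable:
  assumes w: "w \<in> borel_measurable borel" "\<And>x. 0 \<le> w x" and f: "f \<in> weighted_L2 w"
      and g: "g \<in> weighted_L2 w"
  shows "integrable lborel (\<lambda>x. complex_of_real (w x) * (f x * cnj (g x)))"
    "integrable lborel (\<lambda>x. w x * Re (f x * cnj (g x)))"
proof -
  have [measurable]: "f \<in> borel_measurable borel" "g \<in> borel_measurable borel" "w \<in> borel_measurable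
      borel"
    using f g w by (auto simp: weighted_L2_def)
  show *: "integrable lborel (\<lambda>x. complex_of_real (w x) * (f x * cnj (g x)))"
  proof (rule Bochner_Integration.integrable_bound)
    show "integrable lborel (\<lambda>x. w x * (cmod (f x))\<^sup>2 + w x * (cmod (g x))\<^sup>2)"
      using f g by (auto simp: weighted_L2_def)
    have "cmod (f x) * cmod (g x) \<le> (cmod (f x))\<^sup>2 + (cmod (g x))\<^sup>2" for x
      using sum_squares_bound[of "cmod (f x)" "cmod (g x)"] mult_nonneg_nonneg[OF norm_ge_zero[of
          "f x"] norm_ge_zero[of "g x"]] by linarith
    from mult_left_mono[OF this w(2)]
    show "AE x in lborel. norm (complex_of_real (w x) * (f x * cnj (g x)))
        \<le> norm (w x * (cmod (f x))\<^sup>2 + w x * (cmod (g x))\<^sup>2)"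
      by (auto simp: norm_mult w(2) distrib_left[symmetric] abs_mult)
  qed simp
  have "integrable lborel (\<lambda>x. Re (complex_of_real (w x) * (f x * cnj (g x))))"
    by (rule integrable_Re[OF *])
  then show "integrable lborel (\<lambda>x. w x * Re (f x * cnj (g x)))" by simp
qed

lemma weighted_L2_add:
  assumes w: "w \<in> borel_measurable borel" "\<And>x. 0 \<le> w x" and f: "f \<in> weighted_L2 w"
      and g: "g \<in> weighted_L2 w"
  shows "(\<lambda>x. f x + g x) \<in> weighted_L2 w"
    and "weighted_ip w (\<lambda>x. f x + g x) (\<lambda>x. f x + g x) = weighted_ip w f f + 2 * weighted_ip w f g
        + weighted_ip w g g"
proof -
  have [measurable]: "f \<in> borel_measurable borel" "g \<in> borel_measurable borel" "w \<in> borel_measurable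
      borel"
    using f g w by (auto simp: weighted_L2_def)
  have eq: "w x * (cmod (f x + g x))\<^sup>2 = w x * (cmod (f x))\<^sup>2 + 2 * (w x * Re (f x * cnj (g x)))
      + w x * (cmod (g x))\<^sup>2" for x
    unfolding cmod_power2 by (simp add: power2_eq_square algebra_simps)
  have i: "integrable lborel (\<lambda>x. w x * (cmod (f x))\<^sup>2)" "integrable lborel (\<lambda>x. w x
      * (cmod (g x))\<^sup>2)"
     "integrable lborel (\<lambda>x. 2 * (w x * Re (f x * cnj (g x))))"
    using f g weighted_ip_integrable(2)[OF w f g] by (auto simp: weighted_L2_def)
  show "(\<lambda>x. f x + g x) \<in> weighted_L2 w" unfolding weighted_L2_def mem_Collect_eq eq using i by auto
  show "weighted_ip w (\<lambda>x. f x + g x) (\<lambda>x. f x + g x) = weighted_ip w f f + 2 * weighted_ip w f g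
      + weighted_ip w g g"
    unfolding weighted_ip_self eq
    by (subst Bochner_Integration.integral_add i Bochner_Integration.integrable_add)+
      (use i in \<open>auto simp: weighted_ip_def\<close>)
qed

lemma weighted_L2_cmult:
  "f \<in> weighted_L2 w \<Longrightarrow> (\<lambda>x. c * f x) \<in> weighted_L2 w"
  "weighted_ip w (\<lambda>x. c * f x) (\<lambda>x. c * f x) = (cmod c)\<^sup>2 * weighted_ip w f f"
proof -
  have eq: "w x * (cmod (c * f x))\<^sup>2 = (cmod c)\<^sup>2 * (w x * (cmod (f x))\<^sup>2)" for x
    by (simp add: norm_mult power_mult_distrib)
  show "f \<in> weighted_L2 w \<Longrightarrow> (\<lambda>x. c * f x) \<in> weighted_L2 w"
    unfolding weighted_L2_def mem_Collect_eq eq by auto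
  show "weighted_ip w (\<lambda>x. c * f x) (\<lambda>x. c * f x) = (cmod c)\<^sup>2 * weighted_ip w f f"
    unfolding weighted_ip_self eq by simp
qed

lemma weighted_ip_scale_right: "weighted_ip w f (\<lambda>x. complex_of_real a * g x)
    = a * weighted_ip w f g"
proof -
  have "w x * Re (f x * cnj (complex_of_real a * g x)) = a * (w x * Re (f x * cnj (g x)))" for x
    by (simp add: algebra_simps)
  then show ?thesis unfolding weighted_ip_def by (simp only: integral_mult_right_zero)
qed

lemma weighted_ip_cong:
  assumes "AE x in lborel. f x = f' x" "AE x in lborel. g x = g' x"
    "f \<in> borel_measurable borel" "g \<in> borel_measurable borel" "f' \<in> borel_measurable borel"
        "g' \<in> borel_measurable borel"
    "w \<in> borel_measurable borel"
  shows "weighted_ip w f g = weighted_ip w f' g'"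
  unfolding weighted_ip_def using assms by (intro integral_cong_AE) auto

lemma weighted_L2_cong:
  assumes "AE x in lborel. f x = g x" "f \<in> weighted_L2 w" "g \<in> borel_measurable borel"
      "w \<in> borel_measurable borel"
  shows "g \<in> weighted_L2 w"
proof -
  have [measurable]: "f \<in> borel_measurable borel" "g \<in> borel_measurable borel" "w \<in> borel_measurable
      borel"
    using assms by (auto simp: weighted_L2_def)
  have "integrable lborel (\<lambda>x. w x * (cmod (g x))\<^sup>2) \<longleftrightarrow> integrable lborel (\<lambda>x. w x * (cmod (f x))\<^sup>2)"
    by (intro integrable_cong_AE) (use assms(1) in auto)
  then show ?thesis using assms by (simp add: weighted_L2_def)
qed

lemma weighted_L2_mono:
  assumes "f \<in> weighted_L2 w" "v \<in> borel_measurable borel" "\<And>x. 0 \<le> v x" "\<And>x. v x \<le> w x"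
  shows "f \<in> weighted_L2 v" "weighted_ip v f f \<le> weighted_ip w f f"
proof -
  have [measurable]: "f \<in> borel_measurable borel" "v \<in> borel_measurable borel" using assms
    by (auto simp: weighted_L2_def)
  have i: "integrable lborel (\<lambda>x. w x * (cmod (f x))\<^sup>2)" using assms by (auto simp: weighted_L2_def)
  have le: "v x * (cmod (f x))\<^sup>2 \<le> w x * (cmod (f x))\<^sup>2" for x using assms(4)
    by (intro mult_right_mono) auto
  have j: "integrable lborel (\<lambda>x. v x * (cmod (f x))\<^sup>2)"
    by (rule Bochner_Integration.integrable_bound[OF i]) (use le assms(3) order_trans[OF assms(3,4)]
        in \<open>auto simp: abs_mult\<close>)
  then show "f \<in> weighted_L2 v" by (simp add: weighted_L2_def)
  show "weighted_ip v f f \<le> weighted_ip w f f" unfolding weighted_ip_self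
    by (intro integral_mono i j le)
qed

lemma weighted_L2_1_iff: "f \<in> weighted_L2 (\<lambda>_. 1) \<longleftrightarrow> f \<in> Lspace 2"
  by (simp add: weighted_L2_def Lspace_def)

section \<open>The homogeneous and the inhomogeneous weight\<close>

definition hdot_weight :: "real \<Rightarrow> 'a::euclidean_space \<Rightarrow> real" where "hdot_weight s \<xi>
    = norm \<xi> powr (2 * s)"
definition hs_weight :: "real \<Rightarrow> 'a::euclidean_space \<Rightarrow> real" where "hs_weight s \<xi>
    = (1 + (norm \<xi>)\<^sup>2) powr s"

lemma hdot_weight_measurable[measurable]: "hdot_weight s \<in> borel_measurable borel"
  unfolding hdot_weight_def[abs_def] by measurable
lemma hs_weight_measurable[measurable]: "hs_weight s \<in> borel_measurable borel"
  unfolding hs_weight_def[abs_def] by measurable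

lemma hdot_weight_nonneg: "0 \<le> hdot_weight s \<xi>" by (simp add: hdot_weight_def)
lemma hs_weight_nonneg: "0 \<le> hs_weight s \<xi>" by (simp add: hs_weight_def)

lemma hdot_weight_le_hs_weight: "0 \<le> s \<Longrightarrow> hdot_weight s \<xi> \<le> hs_weight s \<xi>"
proof -
  assume s: "0 \<le> s"
  have "norm \<xi> powr (2 * s) = (norm \<xi> powr 2) powr s" by (simp only: powr_powr)
  also have "\<dots> = ((norm \<xi>)\<^sup>2) powr s" by simp
  also have "\<dots> \<le> (1 + (norm \<xi>)\<^sup>2) powr s" using s by (intro powr_mono2) auto
  finally show ?thesis by (simp add: hdot_weight_def hs_weight_def)
qed

lemma one_le_hs_weight: "0 \<le> s \<Longrightarrow> 1 \<le> hs_weight s \<xi>"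
  unfolding hs_weight_def by (rule ge_one_powr_ge_zero) auto

lemma bessel_weight_sq: "(cmod (bessel_weight s u \<xi>))\<^sup>2 = hs_weight s \<xi> * (cmod (fourier u \<xi>))\<^sup>2"
proof -
  have "0 < 1 + (norm \<xi>)\<^sup>2" by (simp add: add_pos_nonneg)
  then have "((1 + (norm \<xi>)\<^sup>2) powr (s / 2))\<^sup>2 = hs_weight s \<xi>"
    unfolding hs_weight_def power2_eq_square powr_add[symmetric] by simp
  then show ?thesis by (simp add: bessel_weight_def norm_mult power_mult_distrib)
qed

lemma Hs_iff: "u \<in> Hs s \<longleftrightarrow> u \<in> Lspace 2 \<and> fourier u \<in> weighted_L2 (hs_weight s)"
proof (cases "u \<in> Lspace 2")
  case True
  then have [measurable]: "fourier u \<in> borel_measurable borel" by (rule fourier_measurable)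
  have [measurable]: "bessel_weight s u \<in> borel_measurable borel"
    unfolding bessel_weight_def[abs_def] by measurable
  show ?thesis using True by (simp add: Hs_def weighted_L2_def Lspace_def bessel_weight_sq)
qed (simp add: Hs_def)

lemma Hs_in_L2: "u \<in> Hs s \<Longrightarrow> u \<in> Lspace 2"
  by (simp add: Hs_iff)

lemma Hs_measurable: "u \<in> Hs s \<Longrightarrow> u \<in> borel_measurable borel"
  by (simp add: Hs_iff Lspace2_iff)

lemma Hs_norm_sq: "(Hs_norm s u)\<^sup>2 = weighted_ip (hs_weight s) (fourier u) (fourier u)"
  unfolding Hs_norm_def Lnorm2_sq bessel_weight_sq weighted_ip_self by (rule refl)

lemma Lnorm_nonneg: "0 \<le> Lnorm q u" by (simp add: Lnorm_def)

lemma Hs_norm_nonneg: "0 \<le> Hs_norm s u" by (simp add: Hs_norm_def Lnorm_nonneg)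

lemma Lnorm2_sq_weighted_ip: "(Lnorm 2 u)\<^sup>2 = weighted_ip (\<lambda>_. 1) u u"
  by (simp add: Lnorm2_sq weighted_ip_self)

lemma plancherel_weighted_ip:
  assumes u: "u \<in> Lspace 2"
  shows "weighted_ip (\<lambda>_. 1) (fourier u) (fourier u) = weighted_ip (\<lambda>_. 1) u u"
proof -
  have "ennreal ((Lnorm 2 (fourier u))\<^sup>2) = ennreal ((Lnorm 2 u)\<^sup>2)"
    using u by (simp add: Lnorm2_sq_ennreal plancherel)
  then show ?thesis unfolding Lnorm2_sq_weighted_ip by (simp add: weighted_ip_self_nonneg)
qed

lemma weighted_ip_fourier_cmult:
  assumes u: "u \<in> Lspace 2" and [measurable]: "w \<in> borel_measurable borel"
  shows "weighted_ip w (fourier (\<lambda>x. c * u x)) (fourier (\<lambda>x. c * u x))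
      = (cmod c)\<^sup>2 * weighted_ip w (fourier u) (fourier u)"
proof -
  have [measurable]: "fourier u \<in> borel_measurable borel" "fourier (\<lambda>x. c
      * u x) \<in> borel_measurable borel"
    using u Lspace2_cmult[OF u] by (auto intro: fourier_measurable)
  have "weighted_ip w (fourier (\<lambda>x. c * u x)) (fourier (\<lambda>x. c * u x))
      = weighted_ip w (\<lambda>\<xi>. c * fourier u \<xi>) (\<lambda>\<xi>. c * fourier u \<xi>)"
    by (intro weighted_ip_cong fourier_cmult u) measurable
  then show ?thesis by (simp only: weighted_L2_cmult(2))
qed

lemma Lnorm2_cmult: "(Lnorm 2 (\<lambda>x. c * u x))\<^sup>2 = (cmod c)\<^sup>2 * (Lnorm 2 u)\<^sup>2"
  unfolding Lnorm2_sq_weighted_ip by (rule weighted_L2_cmult(2))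

lemma weighted_ip_fourier_scale_right:
  assumes u: "u \<in> Lspace 2" and v: "v \<in> Lspace 2" and [measurable]: "w \<in> borel_measurable borel"
  shows "weighted_ip w (fourier u) (fourier (\<lambda>x. complex_of_real a * v x))
      = a * weighted_ip w (fourier u) (fourier v)"
proof -
  have [measurable]: "fourier u \<in> borel_measurable borel" "fourier v \<in> borel_measurable borel"
      "fourier (\<lambda>x. complex_of_real a * v x) \<in> borel_measurable borel"
    using u v Lspace2_cmult[OF v] by (auto intro: fourier_measurable)
  have "weighted_ip w (fourier u) (fourier (\<lambda>x. complex_of_real a * v x))
      = weighted_ip w (fourier u) (\<lambda>\<xi>. complex_of_real a * fourier v \<xi>)"
    by (intro weighted_ip_cong fourier_cmult v) auto
  then show ?thesis by (simp only: weighted_ip_scale_right)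
qed

lemma weighted_ip_hdot_weight_scale:
  fixes f :: "'a::euclidean_space \<Rightarrow> complex"
  assumes [measurable]: "f \<in> borel_measurable borel" and c: "0 < c"
  shows "f \<in> weighted_L2 (hdot_weight \<sigma>) \<Longrightarrow> (\<lambda>\<xi>. f (\<xi> /\<^sub>R c)) \<in> weighted_L2 (hdot_weight \<sigma>)"
    and "weighted_ip (hdot_weight \<sigma>) (\<lambda>\<xi>. f (\<xi> /\<^sub>R c)) (\<lambda>\<xi>. f (\<xi> /\<^sub>R c)) = c powr (2 * \<sigma> + DIM('a))
        * weighted_ip (hdot_weight \<sigma>) f f"
proof -
  let ?g = "\<lambda>\<xi>. hdot_weight \<sigma> \<xi> * (cmod (f (\<xi> /\<^sub>R c)))\<^sup>2"
  have h: "hdot_weight \<sigma> (c *\<^sub>R \<xi>) = c powr (2 * \<sigma>) * hdot_weight \<sigma> \<xi>" for \<xi> :: 'a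
    using c by (simp add: hdot_weight_def powr_mult)
  have eq: "?g (0 + c *\<^sub>R \<xi>) = c powr (2 * \<sigma>) * (hdot_weight \<sigma> \<xi> * (cmod (f \<xi>))\<^sup>2)" for \<xi>
    using c by (simp add: h)
  have "(LINT \<xi>|lborel. ?g \<xi>) = \<bar>c\<bar> ^ DIM('a) *\<^sub>R (LINT \<xi>|lborel. ?g (0 + c *\<^sub>R \<xi>))"
    by (rule integral_lborel_affine) (use c in auto)
  also have "\<dots> = c powr (2 * \<sigma> + DIM('a)) * weighted_ip (hdot_weight \<sigma>) f f"
    unfolding eq weighted_ip_self integral_mult_right_zero using c
    by (simp add: powr_add powr_realpow)
  finally show "weighted_ip (hdot_weight \<sigma>) (\<lambda>\<xi>. f (\<xi> /\<^sub>R c)) (\<lambda>\<xi>. f (\<xi> /\<^sub>R c))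
      = c powr (2 * \<sigma> + DIM('a)) * weighted_ip (hdot_weight \<sigma>) f f"
    unfolding weighted_ip_self .
  assume f: "f \<in> weighted_L2 (hdot_weight \<sigma>)"
  have "integrable lborel (\<lambda>\<xi>. c powr (2 * \<sigma>) * (hdot_weight \<sigma> (0 + inverse c *\<^sub>R \<xi>)
      * (cmod (f (0 + inverse c *\<^sub>R \<xi>)))\<^sup>2))"
    using f c by (intro integrable_mult_right integrable_lborel_affine[of "\<lambda>\<xi>. hdot_weight \<sigma> \<xi>
        * (cmod (f \<xi>))\<^sup>2"]) (auto simp: weighted_L2_def)
  moreover have "c powr (2 * \<sigma>) * hdot_weight \<sigma> (inverse c *\<^sub>R \<xi>) = hdot_weight \<sigma> \<xi>" for \<xi> :: 'a
    using h[of "inverse c *\<^sub>R \<xi>"] c by simp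
  ultimately have "integrable lborel ?g" by (simp only: add_0 mult.assoc[symmetric])
  then show "(\<lambda>\<xi>. f (\<xi> /\<^sub>R c)) \<in> weighted_L2 (hdot_weight \<sigma>)" by (simp add: weighted_L2_def)
qed

context
  fixes s :: real assumes s: "0 < s"
begin

lemma Hs_hdot_weight: "u \<in> Hs s \<Longrightarrow> fourier u \<in> weighted_L2 (hdot_weight s)"
  using weighted_L2_mono(1)[of "fourier u" "hs_weight s" "hdot_weight s"]
      hdot_weight_le_hs_weight[of s] s by (auto simp: Hs_iff hdot_weight_nonneg)

text \<open>\<open>Hdot_norm\<close> is defined by a function in physical space; the isometry of
  \<open>inv_fourier\<close> moves it to the Fourier side, where it is a quadratic form.\<close>

lemma Hdot_norm_sq:
  fixes u :: "'a::euclidean_space \<Rightarrow> complex"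
  assumes u: "u \<in> Hs s"
  shows "(Hdot_norm s u)\<^sup>2 = weighted_ip (hdot_weight s) (fourier u) (fourier u)"
proof -
  let ?v = "\<lambda>\<xi>. complex_of_real (norm \<xi> powr (2 * (s / 2))) * fourier u \<xi>"
  have [measurable]: "fourier u \<in> borel_measurable borel" using u
    by (intro fourier_measurable) (simp add: Hs_iff)
  have eq: "(cmod (?v \<xi>))\<^sup>2 = hdot_weight s \<xi> * (cmod (fourier u \<xi>))\<^sup>2" for \<xi>
    by (simp add: hdot_weight_def norm_mult power_mult_distrib power2_eq_square flip: powr_add)
  have v: "?v \<in> Lspace 2"
    using Hs_hdot_weight[OF u]
    unfolding weighted_L2_1_iff[symmetric] weighted_L2_def mem_Collect_eq mult_1 eq by simp
  have "ennreal ((Lnorm 2 (inv_fourier ?v))\<^sup>2) = ennreal ((Lnorm 2 ?v)\<^sup>2)"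
    using v by (simp only: Lnorm2_sq_ennreal l2sq_inv_fourier)
  then have "(Lnorm 2 (inv_fourier ?v))\<^sup>2 = (Lnorm 2 ?v)\<^sup>2" by simp
  also have "\<dots> = weighted_ip (hdot_weight s) (fourier u) (fourier u)"
    unfolding Lnorm2_sq eq weighted_ip_self by (rule refl)
  finally show ?thesis by (simp add: Hdot_norm_def frac_laplace_def)
qed

lemma Hdot_norm_le: "u \<in> Hs s \<Longrightarrow> (Hdot_norm s u)\<^sup>2 \<le> (Hs_norm s u)\<^sup>2"
  unfolding Hdot_norm_sq Hs_norm_sq
  using weighted_L2_mono(2)[of "fourier u" "hs_weight s" "hdot_weight s"]
      hdot_weight_le_hs_weight[of s] s by (auto simp: Hs_iff hdot_weight_nonneg)

lemma Lnorm2_le: "u \<in> Hs s \<Longrightarrow> (Lnorm 2 u)\<^sup>2 \<le> (Hs_norm s u)\<^sup>2"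
  unfolding Lnorm2_sq_weighted_ip Hs_norm_sq
  using weighted_L2_mono(2)[of "fourier u" "hs_weight s" "\<lambda>_. 1"] one_le_hs_weight[of s] s
      plancherel_weighted_ip[of u] by (auto simp: Hs_iff)

lemma Hs_add:
  assumes u: "u \<in> Hs s" and v: "v \<in> Hs s"
  shows "(\<lambda>x. u x + v x) \<in> Hs s"
proof -
  have L: "u \<in> Lspace 2" "v \<in> Lspace 2" using u v by (auto simp: Hs_iff)
  have m: "(\<lambda>\<xi>. fourier u \<xi> + fourier v \<xi>) \<in> weighted_L2 (hs_weight s)"
    using u v by (intro weighted_L2_add) (auto simp: Hs_iff hs_weight_nonneg)
  have ae: "AE \<xi> in lborel. fourier u \<xi> + fourier v \<xi> = fourier (\<lambda>x. u x + v x) \<xi>"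
    using fourier_add[OF L] by eventually_elim simp
  have "fourier (\<lambda>x. u x + v x) \<in> weighted_L2 (hs_weight s)"
    by (rule weighted_L2_cong[OF ae m fourier_measurable[OF Lspace2_add[OF L]]
        hs_weight_measurable])
  then show ?thesis using Lspace2_add[OF L] by (simp add: Hs_iff)
qed

lemma Hs_cmult:
  assumes u: "u \<in> Hs s"
  shows "(\<lambda>x. c * u x) \<in> Hs s"
proof -
  have L: "u \<in> Lspace 2" using u by (auto simp: Hs_iff)
  have m: "(\<lambda>\<xi>. c * fourier u \<xi>) \<in> weighted_L2 (hs_weight s)" using u
    by (intro weighted_L2_cmult) (auto simp: Hs_iff)
  have ae: "AE \<xi> in lborel. c * fourier u \<xi> = fourier (\<lambda>x. c * u x) \<xi>"
    using fourier_cmult[OF L, of c] by eventually_elim simp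
  have "fourier (\<lambda>x. c * u x) \<in> weighted_L2 (hs_weight s)"
    by (rule weighted_L2_cong[OF ae m fourier_measurable[OF Lspace2_cmult[OF L]]
        hs_weight_measurable])
  then show ?thesis using Lspace2_cmult[OF L] by (simp add: Hs_iff)
qed

lemma Hs_norm_cmult: "u \<in> Hs s \<Longrightarrow> (Hs_norm s (\<lambda>x. c * u x))\<^sup>2 = (cmod c)\<^sup>2 * (Hs_norm s u)\<^sup>2"
  unfolding Hs_norm_sq by (intro weighted_ip_fourier_cmult) (auto simp: Hs_iff)

lemma Hdot_norm_cmult: "u \<in> Hs s \<Longrightarrow> (Hdot_norm s (\<lambda>x. c * u x))\<^sup>2 = (cmod c)\<^sup>2 * (Hdot_norm s u)\<^sup>2"
  using Hs_cmult[of u c] by (simp add: Hdot_norm_sq weighted_ip_fourier_cmult Hs_in_L2)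

lemma Lnorm2_add:
  assumes u: "u \<in> Hs s" and v: "v \<in> Hs s"
  shows "(Lnorm 2 (\<lambda>x. u x + v x))\<^sup>2 = (Lnorm 2 u)\<^sup>2 + 2 * weighted_ip (\<lambda>_. 1) u v + (Lnorm 2 v)\<^sup>2"
  unfolding Lnorm2_sq_weighted_ip using u v
  by (intro weighted_L2_add) (auto simp: weighted_L2_1_iff Hs_in_L2)

lemma Hdot_norm_add:
  assumes u: "u \<in> Hs s" and v: "v \<in> Hs s"
  shows "(Hdot_norm s (\<lambda>x. u x + v x))\<^sup>2
      = (Hdot_norm s u)\<^sup>2 + 2 * weighted_ip (hdot_weight s) (fourier u) (fourier v) + (Hdot_norm s
      v)\<^sup>2"
proof -
  have L: "u \<in> Lspace 2" "v \<in> Lspace 2" using u v by (auto simp: Hs_iff)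
  have [measurable]: "fourier u \<in> borel_measurable borel" "fourier v \<in> borel_measurable borel"
      "fourier (\<lambda>x. u x + v x) \<in> borel_measurable borel"
    using L Lspace2_add[OF L] by (auto intro: fourier_measurable)
  have "weighted_ip (hdot_weight s) (fourier (\<lambda>x. u x + v x)) (fourier (\<lambda>x. u x + v x))
      = weighted_ip (hdot_weight s) (\<lambda>\<xi>. fourier u \<xi> + fourier v \<xi>) (\<lambda>\<xi>. fourier u \<xi> + fourier v \<xi>)"
    by (intro weighted_ip_cong fourier_add L) measurable
  also have "\<dots> = weighted_ip (hdot_weight s) (fourier u) (fourier u) + 2
      * weighted_ip (hdot_weight s) (fourier u) (fourier v) + weighted_ip (hdot_weight s) (fourier
      v) (fourier v)"
    using u v by (intro weighted_L2_add(2)) (auto simp: hdot_weight_nonneg Hs_hdot_weight)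
  finally show ?thesis using Hs_add[OF u v] u v by (simp add: Hdot_norm_sq)
qed

lemma hs_weight_le: "hs_weight s \<xi> \<le> 2 powr s * (1 + hdot_weight s \<xi>)"
proof -
  have "hs_weight s \<xi> \<le> (2 * max 1 ((norm \<xi>)\<^sup>2)) powr s"
    unfolding hs_weight_def using s by (intro powr_mono2) auto
  also have "\<dots> = 2 powr s * (max 1 ((norm \<xi>)\<^sup>2)) powr s" by (simp add: powr_mult)
  also have "(max 1 ((norm \<xi>)\<^sup>2)) powr s \<le> 1 + hdot_weight s \<xi>"
  proof -
    have "((norm \<xi>)\<^sup>2) powr s = (norm \<xi> powr 2) powr s" by simp
    also have "\<dots> = hdot_weight s \<xi>" by (simp only: hdot_weight_def powr_powr)
    finally show ?thesis by (simp add: max_def hdot_weight_nonneg)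
  qed
  finally show ?thesis by (simp add: mult_left_mono)
qed

text \<open>The homogeneous weight is the one that scales by a power under dilations, so membership
  of dilated functions is checked in this form.\<close>

lemma Hs_iff_hdot_weight: "u \<in> Hs s \<longleftrightarrow> u \<in> Lspace 2 \<and> fourier u \<in> weighted_L2 (hdot_weight s)"
proof (intro iffI conjI)
  assume "u \<in> Lspace 2 \<and> fourier u \<in> weighted_L2 (hdot_weight s)"
  then have u: "u \<in> Lspace 2" "fourier u \<in> weighted_L2 (hdot_weight s)" by auto
  then have "fourier u \<in> weighted_L2 (\<lambda>_. 1)" by (simp add: weighted_L2_1_iff)
  then have "fourier u \<in> weighted_L2 (\<lambda>\<xi>. 2 powr s * (1 + hdot_weight s \<xi>))"
    using u(2) by (auto simp: weighted_L2_def distrib_right mult.assoc)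
  then have "fourier u \<in> weighted_L2 (hs_weight s)"
    by (rule weighted_L2_mono(1)) (auto simp: hs_weight_nonneg hs_weight_le)
  then show "u \<in> Hs s" using u by (simp add: Hs_iff)
qed (auto simp: Hs_hdot_weight Hs_in_L2)

lemma Hs_scale:
  fixes u :: "'a::euclidean_space \<Rightarrow> complex"
  assumes u: "u \<in> Hs s" and c: "0 < c"
  shows "(\<lambda>x. u (c *\<^sub>R x)) \<in> Hs s"
    and "(Hdot_norm s (\<lambda>x. u (c *\<^sub>R x)))\<^sup>2 = c powr (2 * s - DIM('a)) * (Hdot_norm s u)\<^sup>2"
proof -
  let ?k = "complex_of_real (c powr (- real DIM('a)))"
  have L: "u \<in> Lspace 2" using u by (auto simp: Hs_iff)
  have [measurable]: "fourier u \<in> borel_measurable borel" "fourier (\<lambda>x. u (c *\<^sub>R x)) \<in>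
      borel_measurable borel"
    using L Lspace2_scale[OF L c] by (auto intro: fourier_measurable)
  have F: "AE \<xi> in lborel. ?k * fourier u (\<xi> /\<^sub>R c) = fourier (\<lambda>x. u (c *\<^sub>R x)) \<xi>"
    using fourier_scale[OF L c] by eventually_elim simp
  have "(\<lambda>\<xi>. ?k * fourier u (\<xi> /\<^sub>R c)) \<in> weighted_L2 (hdot_weight s)"
    by (intro weighted_L2_cmult weighted_ip_hdot_weight_scale Hs_hdot_weight u c) auto
  then have "fourier (\<lambda>x. u (c *\<^sub>R x)) \<in> weighted_L2 (hdot_weight s)"
    by (rule weighted_L2_cong[OF F]) auto
  then show I: "(\<lambda>x. u (c *\<^sub>R x)) \<in> Hs s" using Lspace2_scale[OF L c]
    by (simp add: Hs_iff_hdot_weight)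
  have "weighted_ip (hdot_weight s) (fourier (\<lambda>x. u (c *\<^sub>R x))) (fourier (\<lambda>x. u (c *\<^sub>R x)))
      = weighted_ip (hdot_weight s) (\<lambda>\<xi>. ?k * fourier u (\<xi> /\<^sub>R c)) (\<lambda>\<xi>. ?k * fourier u (\<xi> /\<^sub>R c))"
    by (intro weighted_ip_cong fourier_scale L c) auto
  also have "\<dots> = (c powr (- real DIM('a)))\<^sup>2 * (c powr (2 * s + DIM('a))
      * weighted_ip (hdot_weight s) (fourier u) (fourier u))"
    by (simp only: weighted_L2_cmult(2) weighted_ip_hdot_weight_scale[OF \<open>fourier u \<in>
        borel_measurable borel\<close> c] norm_of_real abs_of_nonneg[OF powr_ge_zero])
  also have "(c powr (- real DIM('a)))\<^sup>2 * (c powr (2 * s + DIM('a))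
      * weighted_ip (hdot_weight s) (fourier u) (fourier u)) = c powr (2 * s - DIM('a)) *
      weighted_ip (hdot_weight s) (fourier u) (fourier u)"
    unfolding power2_eq_square mult.assoc[symmetric] powr_add[symmetric] by simp
  finally show "(Hdot_norm s (\<lambda>x. u (c *\<^sub>R x)))\<^sup>2 = c powr (2 * s - DIM('a)) * (Hdot_norm s u)\<^sup>2"
    using I u by (simp add: Hdot_norm_sq)
qed

lemma Lnorm2_scale:
  fixes u :: "'a::euclidean_space \<Rightarrow> complex"
  assumes u: "u \<in> Hs s" and c: "0 < c"
  shows "(Lnorm 2 (\<lambda>x. u (c *\<^sub>R x)))\<^sup>2 = c powr (- real DIM('a)) * (Lnorm 2 u)\<^sup>2"
proof -
  have L: "u \<in> Lspace 2" using u by (auto simp: Hs_iff)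
  have "ennreal ((Lnorm 2 (\<lambda>x. u (c *\<^sub>R x)))\<^sup>2) = ennreal (c powr (- real DIM('a)) * (Lnorm 2 u)\<^sup>2)"
    using L Lspace2_scale[OF L c] c
    by (simp add: Lnorm2_sq_ennreal l2sq_scale Lspace2_iff ennreal_mult)
  then show ?thesis by simp
qed

text \<open>The homogeneous weight vanishes only at the origin, a null set, so a zero seminorm
  forces \<open>fourier u\<close> and, by Plancherel, \<open>u\<close> to vanish almost
  everywhere.\<close>

lemma Hdot_norm_pos:
  assumes u: "u \<in> Hs s" and nz: "\<not> (AE x in lborel. u x = 0)"
  shows "0 < (Hdot_norm s u)\<^sup>2" "0 < (Lnorm 2 u)\<^sup>2"
proof -
  have L: "u \<in> Lspace 2" using u by (auto simp: Hs_iff)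
  have um[measurable]: "u \<in> borel_measurable borel" "fourier u \<in> borel_measurable borel" using L
    by (auto simp: Lspace2_iff fourier_measurable)
  have n0: "l2sq u \<noteq> 0" using nz l2sq_eq_0_iff[OF um(1)] by simp
  then show "0 < (Lnorm 2 u)\<^sup>2" using Lnorm2_sq_ennreal[OF L]
    by (metis ennreal_0 less_eq_real_def zero_le_power2)
  show "0 < (Hdot_norm s u)\<^sup>2"
  proof (rule ccontr)
    assume "\<not> 0 < (Hdot_norm s u)\<^sup>2"
    then have "weighted_ip (hdot_weight s) (fourier u) (fourier u) = 0"
      using Hdot_norm_sq[OF u] weighted_ip_self_nonneg[of "hdot_weight s" "fourier u", OF
          hdot_weight_nonneg] by simp
    then have "AE \<xi> in lborel. hdot_weight s \<xi> * (cmod (fourier u \<xi>))\<^sup>2 = 0"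
      using Hs_hdot_weight[OF u] unfolding weighted_ip_self
      by (subst (asm) integral_nonneg_eq_0_iff_AE) (auto simp: weighted_L2_def hdot_weight_nonneg)
    moreover have "AE \<xi> in lborel. \<xi> \<noteq> 0" by (rule AE_lborel_singleton)
    ultimately have "AE \<xi> in lborel. fourier u \<xi> = 0"
      by eventually_elim (auto simp: hdot_weight_def)
    then have "l2sq (fourier u) = 0" by (subst l2sq_eq_0_iff) auto
    then show False using n0 plancherel[OF L] by simp
  qed
qed

end

section \<open>The Gagliardo seminorm\<close>

lemma nn_integral_norm_powr_annulus:
  fixes a :: real
  shows "(\<integral>\<^sup>+z. ennreal (norm (z::'a::euclidean_space) powr (- a)) * indicator {z. 1
      < norm z \<and> norm z \<le> 2} z \<partial>lborel) < \<infinity>"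
proof -
  have "(\<integral>\<^sup>+z. ennreal (norm (z::'a) powr (- a)) * indicator {z. 1 < norm z \<and> norm z \<le> 2} z \<partial>lborel)
    \<le> (\<integral>\<^sup>+z. ennreal (2 powr \<bar>a\<bar>) * indicator (cball (0::'a) 2) z \<partial>lborel)"
  proof (intro nn_integral_mono)
    fix z :: 'a
    have "norm z powr (- a) \<le> 2 powr \<bar>a\<bar>" if "1 < norm z" "norm z \<le> 2"
    proof -
      have "norm z powr (- a) \<le> norm z powr \<bar>a\<bar>" using that by (intro powr_mono) auto
      also have "\<dots> \<le> 2 powr \<bar>a\<bar>" using that by (intro powr_mono2) auto
      finally show ?thesis .
    qed
    then show "ennreal (norm z powr (- a)) * indicator {z. 1 < norm z \<and> norm z \<le> 2} z
        \<le> ennreal (2 powr \<bar>a\<bar>) * indicator (cball (0::'a) 2) z"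
      by (auto simp: indicator_def intro!: ennreal_leI)
  qed
  also have "\<dots> = ennreal (2 powr \<bar>a\<bar>) * emeasure lborel (cball (0::'a) 2)"
    by (subst nn_integral_cmult_indicator) auto
  also have "\<dots> < \<infinity>" using emeasure_bounded_finite[of "cball (0::'a) 2"]
    by (auto simp: ennreal_mult_less_top)
  finally show ?thesis .
qed

text \<open>Cover \<open>X\<close> by dilates of the annulus between radii 1 and 2. By scaling,
  their integrals form a geometric series with ratio \<open>b powr (a - DIM('a))\<close>; taking
  \<open>b = 1/2\<close> or \<open>b = 2\<close> serves the exterior or the interior of the unit
  ball.\<close>

lemma nn_integral_norm_powr_scaled_annuli:
  fixes a :: real
  assumes q: "0 < b" "b powr (a - DIM('a)) < 1" and
    cover: "\<And>z::'a::euclidean_space. z \<in> X \<Longrightarrow> z \<noteq> 0 \<Longrightarrow> \<exists>k::nat. 1 < c * b ^ k * norm z \<and> c * b ^ k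
        * norm z \<le> 2"
    and [measurable]: "X \<in> sets borel" and c: "0 < c"
  shows "(\<integral>\<^sup>+z. ennreal (norm z powr (- a)) * indicator X z \<partial>lborel) < \<infinity>"
proof -
  let ?A = "{z::'a. 1 < norm z \<and> norm z \<le> 2}"
  let ?I = "\<integral>\<^sup>+z. ennreal (norm z powr (- a)) * indicator ?A z \<partial>lborel"
  let ?q = "b powr (a - DIM('a))"
  have ann: "(\<integral>\<^sup>+z. ennreal (norm z powr (- a)) * indicator ?A (d *\<^sub>R z) \<partial>lborel)
      = ennreal (d powr (a - DIM('a))) * ?I" if d: "0 < d" for d
  proof -
    have "ennreal (norm z powr (- a)) * indicator ?A (d *\<^sub>R z)
        = ennreal (d powr a) * (\<lambda>z. ennreal (norm z powr (- a)) * indicator ?A z) (d *\<^sub>R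
        z)" for z :: 'a
    proof -
      have "d powr a * (norm (d *\<^sub>R z)) powr (- a) = norm z powr (- a)"
        using d by (simp add: powr_mult powr_minus)
      then show ?thesis using d
        by (simp only: mult.assoc[symmetric] ennreal_mult'[symmetric] powr_ge_zero)
    qed
    then have "(\<integral>\<^sup>+z. ennreal (norm z powr (- a)) * indicator ?A (d *\<^sub>R z) \<partial>lborel)
      = (\<integral>\<^sup>+z. ennreal (d powr a) * (\<lambda>z. ennreal (norm z powr (- a)) * indicator ?A z) (d *\<^sub>R z)
          \<partial>lborel)"
      by (simp only:)
    also have "\<dots> = ennreal (d powr a) * (\<integral>\<^sup>+z. (\<lambda>z. ennreal (norm z powr (- a))
        * indicator ?A z) (d *\<^sub>R z) \<partial>lborel)"
      by (rule nn_integral_cmult) measurable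
    also have "\<dots> = ennreal (d powr a) * (ennreal (d powr (- DIM('a))) * ?I)"
      by (subst nn_integral_lborel_scale[OF _ d]) auto
    also have "\<dots> = ennreal (d powr (a - DIM('a))) * ?I"
      using d by (simp add: mult.assoc[symmetric] ennreal_mult'[symmetric] flip: powr_add)
    finally show ?thesis .
  qed
  have "(\<integral>\<^sup>+z. ennreal (norm z powr (- a)) * indicator X z \<partial>lborel)
    \<le> (\<integral>\<^sup>+z. (\<Sum>k. ennreal (norm z powr (- a)) * indicator ?A ((c * b ^ k) *\<^sub>R z)) \<partial>lborel)"
  proof (intro nn_integral_mono_AE, use AE_lborel_singleton[of 0] in eventually_elim)
    case (elim z)
    show ?case
    proof (cases "z \<in> X")
      case True
      then obtain k where k: "1 < c * b ^ k * norm z" "c * b ^ k * norm z \<le> 2"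
        using cover[OF True elim] by blast
      have "ennreal (norm z powr (- a)) * indicator X z = (\<Sum>k\<in>{k}. ennreal (norm z powr (- a))
          * indicator ?A ((c * b ^ k) *\<^sub>R z))"
        using True k c q by (simp add: abs_mult)
      also have "\<dots> \<le> (\<Sum>k. ennreal (norm z powr (- a)) * indicator ?A ((c * b ^ k) *\<^sub>R z))"
        by (intro sum_le_suminf summableI) auto
      finally show ?thesis .
    qed simp
  qed
  also have "\<dots> = (\<Sum>k. \<integral>\<^sup>+z. ennreal (norm z powr (- a)) * indicator ?A ((c * b ^ k) *\<^sub>R z) \<partial>lborel)"
    by (intro nn_integral_suminf) measurable
  also have "\<dots> = (\<Sum>k. ennreal (?q ^ k) * (ennreal (c powr (a - DIM('a))) * ?I))"
  proof (intro suminf_cong)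
    fix k
    have "(c * b ^ k) powr (a - DIM('a)) = ?q ^ k * c powr (a - DIM('a))"
      using c q by (simp add: powr_mult powr_realpow[symmetric] powr_powr mult.commute)
    then show "(\<integral>\<^sup>+z. ennreal (norm z powr (- a)) * indicator ?A ((c * b ^ k) *\<^sub>R z) \<partial>lborel)
        = ennreal (?q ^ k) * (ennreal (c powr (a - DIM('a))) * ?I)"
      using c q by (subst ann) (auto simp: ennreal_mult mult.assoc)
  qed
  also have "\<dots> = (\<Sum>k. ennreal (?q ^ k)) * (ennreal (c powr (a - DIM('a))) * ?I)"
    by simp
  also have "(\<Sum>k. ennreal (?q ^ k)) = ennreal (\<Sum>k. ?q ^ k)"
    using q by (intro suminf_ennreal2 summable_geometric) auto
  also have "ennreal (\<Sum>k. ?q ^ k) * (ennreal (c powr (a - DIM('a))) * ?I) < \<infinity>"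
    using nn_integral_norm_powr_annulus[where 'a='a, of a] by (simp add: ennreal_mult_less_top)
  finally show ?thesis .
qed

lemma nn_integral_norm_powr_outside:
  assumes a: "real DIM('a) < a"
  shows "(\<integral>\<^sup>+z. ennreal (norm (z::'a::euclidean_space) powr (- a)) * indicator {z. 1
      < norm z} z \<partial>lborel) < \<infinity>"
proof (rule nn_integral_norm_powr_scaled_annuli[where b="1/2" and c=1])
  have "(1/2::real) powr (a - DIM('a)) < (1/2) powr 0" using a by (intro powr_less_mono') auto
  then show "(1/2::real) powr (a - DIM('a)) < 1" by simp
  fix z :: 'a assume "z \<in> {z. 1 < norm z}"
  then have z: "1 < norm z" by simp
  obtain n :: nat where "norm z < 2 ^ n" using real_arch_pow[of 2 "norm z"] by auto
  then have ex: "norm z \<le> 2 ^ (Suc n)" using power_increasing[of n "Suc n" "2::real"] by linarith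
  \<comment> \<open>Minimality gives \<open>2 ^ k < norm z\<close>; for \<open>k = 0\<close> this is
    the assumption that \<open>z\<close> lies outside the unit ball.\<close>
  define k where "k = (LEAST k. norm z \<le> 2 ^ Suc k)"
  have k: "norm z \<le> 2 ^ Suc k" unfolding k_def by (rule LeastI[of "\<lambda>k. norm z \<le> 2 ^ Suc k", OF ex])
  have "2 ^ k < norm z"
  proof (cases k)
    case (Suc j)
    then show ?thesis using not_less_Least[of j "\<lambda>k. norm z \<le> 2 ^ Suc k"] by (auto simp: k_def)
  qed (use z in simp)
  then show "\<exists>k::nat. 1 < 1 * (1/2) ^ k * norm z \<and> 1 * (1/2) ^ k * norm z \<le> 2"
    using k by (intro exI[of _ k]) (auto simp: power_divide field_simps)
qed auto

lemma nn_integral_norm_powr_inside: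
  assumes a: "a < real DIM('a)"
  shows "(\<integral>\<^sup>+z. ennreal (norm (z::'a::euclidean_space) powr (- a)) * indicator {z. norm z
      \<le> 1} z \<partial>lborel) < \<infinity>"
\<comment> \<open>The annulus excludes radius 1 and includes radius 2, so the factor
  \<open>c = 2\<close> makes \<open>k = 0\<close> serve points of norm 1.\<close>
proof (rule nn_integral_norm_powr_scaled_annuli[where b="2" and c=2])
  have "(2::real) powr (a - DIM('a)) < 2 powr 0" using a by (intro powr_less_mono) auto
  then show "(2::real) powr (a - DIM('a)) < 1" by simp
  fix z :: 'a assume "z \<in> {z. norm z \<le> 1}" and z0: "z \<noteq> 0"
  then have z: "norm z \<le> 1" "0 < norm z" by simp_all
  obtain n :: nat where "1 / norm z < 2 ^ n" using real_arch_pow[of 2 "1 / norm z"] by auto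
  then have ex: "1 < 2 ^ (Suc n) * norm z" using z by (simp add: field_simps)
  define k where "k = (LEAST k. 1 < 2 ^ Suc k * norm z)"
  have k: "1 < 2 ^ Suc k * norm z" unfolding k_def
    by (rule LeastI[of "\<lambda>k. 1 < 2 ^ Suc k * norm z", OF ex])
  have "2 ^ k * norm z \<le> 1"
  proof (cases k)
    case (Suc j)
    then show ?thesis using not_less_Least[of j "\<lambda>k. 1 < 2 ^ Suc k * norm z"] by (auto simp: k_def)
  qed (use z in simp)
  then show "\<exists>k::nat. 1 < 2 * 2 ^ k * norm z \<and> 2 * 2 ^ k * norm z \<le> 2"
    using k by (intro exI[of _ k]) auto
qed auto

lemma cmod_cis_minus_1_le: "cmod (cis t - 1) \<le> \<bar>t\<bar>" "cmod (cis t - 1) \<le> 2"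
proof -
  show "cmod (cis t - 1) \<le> \<bar>t\<bar>" using iexp_approx1[of t 0] by (simp add: cis_conv_exp)
  show "cmod (cis t - 1) \<le> 2" using norm_triangle_ineq4[of "cis t" 1] by simp
qed

text \<open>A translation becomes a phase under the transform, and Plancherel carries the difference
  over.\<close>

lemma l2sq_shift_diff:
  fixes u :: "'a::euclidean_space \<Rightarrow> complex"
  assumes u: "u \<in> Lspace 2"
  shows "l2sq (\<lambda>x. u (x + y) - u x)
      = (\<integral>\<^sup>+\<xi>. ennreal ((cmod (cis (y \<bullet> \<xi>) - 1))\<^sup>2 * (cmod (fourier u \<xi>))\<^sup>2) \<partial>lborel)"
proof -
  have L: "(\<lambda>x. u (x + y)) \<in> Lspace 2" "(\<lambda>x. (-1) * u x) \<in> Lspace 2"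
    using Lspace2_shift[OF u] Lspace2_cmult[OF u, of "-1"] by auto
  have "l2sq (\<lambda>x. u (x + y) - u x) = l2sq (fourier (\<lambda>x. u (x + y) + (-1) * u x))"
    using plancherel[OF Lspace2_add[OF L]] by simp
  also have "\<dots> = l2sq (\<lambda>\<xi>. (cis (y \<bullet> \<xi>) - 1) * fourier u \<xi>)"
  proof (rule l2sq_cong)
    show "AE \<xi> in lborel. cmod (fourier (\<lambda>x. u (x + y) + (-1) * u x) \<xi>)
        = cmod ((cis (y \<bullet> \<xi>) - 1) * fourier u \<xi>)"
      using fourier_add[OF L] fourier_shift[OF u, of y] fourier_cmult[OF u, of "-1"]
    proof eventually_elim
      case (elim \<xi>)
      have "fourier (\<lambda>x. u (x + y) + (-1) * u x) \<xi> = (cis (y \<bullet> \<xi>) - 1) * fourier u \<xi>"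
        using elim by (simp add: left_diff_distrib)
      then show ?case by (rule arg_cong)
    qed
  qed
  finally show ?thesis by (simp add: l2sq_def norm_mult power_mult_distrib)
qed

text \<open>The inner integral of the squared Gagliardo seminorm, kept as a function of
  \<open>x\<close> because the Sobolev inequality is proved pointwise in \<open>x\<close>.\<close>

definition gagliardo_density :: "real \<Rightarrow> ('a::euclidean_space \<Rightarrow> complex) \<Rightarrow> 'a \<Rightarrow> ennreal" where
  "gagliardo_density s u x = (\<integral>\<^sup>+y. ennreal ((cmod (u (x + y) - u x))\<^sup>2
      * norm y powr (- (real DIM('a) + 2 * s))) \<partial>lborel)"

text \<open>Plancherel in \<open>x\<close> for each displacement \<open>y\<close> and Tonelli reduce
  the claim to a kernel integral over \<open>y\<close>. Dilating \<open>y\<close> by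
  \<open>norm \<xi>\<close> extracts \<open>norm \<xi> powr (2 * s)\<close> and leaves the constant
  \<open>K\<close>.\<close>

lemma gagliardo_le_Hdot:
  assumes s: "0 < s" "s < 1"
  shows "\<exists>K\<ge>0. \<forall>u\<in>(Hs s :: ('a::euclidean_space \<Rightarrow> complex) set).
    (\<integral>\<^sup>+x. gagliardo_density s u x \<partial>lborel) \<le> ennreal (K * (Hdot_norm s u)\<^sup>2)"
proof -
  let ?a = "real DIM('a) + 2 * s"
  \<comment> \<open>The minimum dominates |e^(i t) - 1|^2 for |t| at most \<open>norm z\<close>.
    Near 0 the integrand behaves like the power \<open>- (?a - 2)\<close>, integrable since
    \<open>s < 1\<close>; at infinity like \<open>- ?a\<close>, integrable since
    \<open>0 < s\<close>.\<close>
  define K where "K = (\<integral>\<^sup>+z. ennreal (min 4 ((norm z)\<^sup>2) * norm z powr (- ?a)) \<partial>(lborel::'a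
      measure))"
  have "K \<le> (\<integral>\<^sup>+z. (ennreal (norm z powr (- (?a - 2))) * indicator {z. norm z
      \<le> 1} z + 4 * (ennreal (norm z powr (- ?a)) * indicator {z. 1 < norm z} z)) \<partial>(lborel::'a
      measure))"
    unfolding K_def
  proof (intro nn_integral_mono)
    fix z :: 'a
    show "ennreal (min 4 ((norm z)\<^sup>2) * norm z powr (- ?a)) \<le> ennreal (norm z powr (- (?a - 2)))
        * indicator {z. norm z \<le> 1} z + 4 * (ennreal (norm z powr (- ?a)) * indicator {z. 1 < norm
        z} z)"
    proof (cases "norm z \<le> 1")
      case True
      have "min 4 ((norm z)\<^sup>2) * norm z powr (- ?a) \<le> (norm z)\<^sup>2 * norm z powr (- ?a)"
        by (intro mult_right_mono) auto
      also have "\<dots> = norm z powr (- (?a - 2))"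
        by (cases "z = 0") (simp_all add: powr_add[symmetric] algebra_simps flip: powr_numeral)
      finally show ?thesis using True by (simp add: ennreal_leI)
    next
      case False
      have "min 4 ((norm z)\<^sup>2) * norm z powr (- ?a) \<le> 4 * norm z powr (- ?a)"
        by (intro mult_right_mono) auto
      then have "ennreal (min 4 ((norm z)\<^sup>2) * norm z powr (- ?a))
          \<le> ennreal (4 * norm z powr (- ?a))" by (rule ennreal_leI)
      also have "\<dots> = 4 * ennreal (norm z powr (- ?a))" by (simp add: ennreal_mult)
      finally show ?thesis using False by simp
    qed
  qed
  also have "\<dots> = (\<integral>\<^sup>+z. ennreal (norm z powr (- (?a - 2))) * indicator {z. norm z
      \<le> 1} z \<partial>(lborel::'a measure)) + 4 * (\<integral>\<^sup>+z. ennreal (norm z powr (- ?a)) * indicator {z. 1 <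
      norm z} z \<partial>(lborel::'a measure))"
    by (subst nn_integral_add) (auto simp: nn_integral_cmult)
  also have "\<dots> < \<infinity>"
  proof -
    have "(\<integral>\<^sup>+z. ennreal (norm z powr (- (?a - 2))) * indicator {z. norm z
        \<le> 1} z \<partial>(lborel::'a measure)) < \<infinity>"
      using s by (intro nn_integral_norm_powr_inside) auto
    moreover have "(\<integral>\<^sup>+z. ennreal (norm z powr (- ?a)) * indicator {z. 1
        < norm z} z \<partial>(lborel::'a measure)) < \<infinity>"
      using s by (intro nn_integral_norm_powr_outside) auto
    ultimately show ?thesis by (simp add: ennreal_mult_less_top)
  qed
  finally have "K < \<infinity>" .
  then obtain k where k: "K = ennreal k" "0 \<le> k" by (cases K) auto
  have kernel: "(\<integral>\<^sup>+y. ennreal ((cmod (cis (y \<bullet> \<xi>) - 1))\<^sup>2 * norm y powr (- ?a)) \<partial>lborel)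
      \<le> ennreal (hdot_weight s \<xi>) * K" if "\<xi> \<noteq> 0" for \<xi> :: 'a
  proof -
    let ?h = "\<lambda>z::'a. ennreal (min 4 ((norm z)\<^sup>2) * norm z powr (- ?a))"
    have n: "0 < norm \<xi>" using that by simp
    have "(\<integral>\<^sup>+y. ennreal ((cmod (cis (y \<bullet> \<xi>) - 1))\<^sup>2 * norm y powr (- ?a)) \<partial>lborel)
        \<le> (\<integral>\<^sup>+y. ennreal (norm \<xi> powr ?a) * ?h (norm \<xi> *\<^sub>R y) \<partial>lborel)"
    proof (intro nn_integral_mono)
      fix y :: 'a
      have "cmod (cis (y \<bullet> \<xi>) - 1) \<le> norm \<xi> * norm y"
        using cmod_cis_minus_1_le(1)[of "y \<bullet> \<xi>"] Cauchy_Schwarz_ineq2[of y \<xi>]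
        by (simp add: mult.commute)
      then have 1: "(cmod (cis (y \<bullet> \<xi>) - 1))\<^sup>2 \<le> (norm (norm \<xi> *\<^sub>R y))\<^sup>2" by (intro power_mono) auto
      have "(cmod (cis (y \<bullet> \<xi>) - 1))\<^sup>2 \<le> 2\<^sup>2" using cmod_cis_minus_1_le(2)[of "y \<bullet> \<xi>"]
        by (intro power_mono) auto
      with 1 have 2: "(cmod (cis (y \<bullet> \<xi>) - 1))\<^sup>2 \<le> min 4 ((norm (norm \<xi> *\<^sub>R y))\<^sup>2)" by simp
      have 3: "norm y powr (- ?a) = norm \<xi> powr ?a * norm (norm \<xi> *\<^sub>R y) powr (- ?a)"
        using n by (simp add: powr_mult mult.assoc[symmetric] flip: powr_add)
      have "(cmod (cis (y \<bullet> \<xi>) - 1))\<^sup>2 * norm y powr (- ?a)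
          \<le> norm \<xi> powr ?a * (min 4 ((norm (norm \<xi> *\<^sub>R y))\<^sup>2) * norm (norm \<xi> *\<^sub>R y) powr (- ?a))"
        unfolding 3 using mult_right_mono[OF 2, of "norm \<xi> powr ?a
            * norm (norm \<xi> *\<^sub>R y) powr (- ?a)"] by (simp add: mult_ac)
      then have "ennreal ((cmod (cis (y \<bullet> \<xi>) - 1))\<^sup>2 * norm y powr (- ?a))
          \<le> ennreal (norm \<xi> powr ?a * (min 4 ((norm (norm \<xi> *\<^sub>R y))\<^sup>2) * norm (norm \<xi> *\<^sub>R y) powr (-
          ?a)))"
        by (rule ennreal_leI)
      also have "\<dots> = ennreal (norm \<xi> powr ?a) * ?h (norm \<xi> *\<^sub>R y)" by (rule ennreal_mult') simp
      finally show "ennreal ((cmod (cis (y \<bullet> \<xi>) - 1))\<^sup>2 * norm y powr (- ?a))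
          \<le> ennreal (norm \<xi> powr ?a) * ?h (norm \<xi> *\<^sub>R y)" .
    qed
    also have "\<dots> = ennreal (norm \<xi> powr ?a) * (\<integral>\<^sup>+y. ?h (norm \<xi> *\<^sub>R y) \<partial>lborel)"
      by (rule nn_integral_cmult) measurable
    also have "(\<integral>\<^sup>+y. ?h (norm \<xi> *\<^sub>R y) \<partial>lborel) = ennreal (norm \<xi> powr (- real DIM('a))) * K"
      unfolding K_def by (rule nn_integral_lborel_scale[OF _ n]) measurable
    also have "ennreal (norm \<xi> powr ?a) * (ennreal (norm \<xi> powr (- real DIM('a))) * K)
        = ennreal (hdot_weight s \<xi>) * K"
      by (simp add: hdot_weight_def mult.assoc[symmetric] ennreal_mult'[symmetric] flip: powr_add)
    finally show ?thesis .
  qed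
  show ?thesis
  proof (intro exI[of _ k] conjI ballI k)
    fix u :: "'a \<Rightarrow> complex" assume u: "u \<in> Hs s"
    then have L: "u \<in> Lspace 2" by (rule Hs_in_L2)
    have [measurable]: "u \<in> borel_measurable borel" "fourier u \<in> borel_measurable borel"
      using L fourier_measurable[OF L] by (auto simp: Lspace2_iff)
    have "(\<integral>\<^sup>+x. gagliardo_density s u x \<partial>lborel) = (\<integral>\<^sup>+y. \<integral>\<^sup>+x. ennreal ((cmod (u (x + y) - u x))\<^sup>2
        * norm y powr (- ?a)) \<partial>lborel \<partial>lborel)"
      unfolding gagliardo_density_def by (rule lborel_pair.Fubini') measurable
    also have "\<dots> = (\<integral>\<^sup>+y. ennreal (norm y powr (- ?a)) * l2sq (\<lambda>x. u (x + y) - u x) \<partial>lborel)"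
      unfolding l2sq_def by (subst nn_integral_cmult[symmetric]) (auto simp: ennreal_mult
          mult.commute)
    also have "\<dots> = (\<integral>\<^sup>+y. \<integral>\<^sup>+\<xi>. ennreal ((cmod (fourier u \<xi>))\<^sup>2)
        * ennreal ((cmod (cis (y \<bullet> \<xi>) - 1))\<^sup>2 * norm y powr (- ?a)) \<partial>lborel \<partial>lborel)"
      unfolding l2sq_shift_diff[OF L]
      by (subst nn_integral_cmult[symmetric]) (auto simp: ennreal_mult mult_ac)
    also have "\<dots> = (\<integral>\<^sup>+\<xi>. \<integral>\<^sup>+y. ennreal ((cmod (fourier u \<xi>))\<^sup>2)
        * ennreal ((cmod (cis (y \<bullet> \<xi>) - 1))\<^sup>2 * norm y powr (- ?a)) \<partial>lborel \<partial>lborel)"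
      by (rule lborel_pair.Fubini') measurable
    also have "\<dots> = (\<integral>\<^sup>+\<xi>. ennreal ((cmod (fourier u \<xi>))\<^sup>2)
        * (\<integral>\<^sup>+y. ennreal ((cmod (cis (y \<bullet> \<xi>) - 1))\<^sup>2 * norm y powr (- ?a)) \<partial>lborel) \<partial>lborel)"
      by (subst nn_integral_cmult) auto
    also have "\<dots> \<le> (\<integral>\<^sup>+\<xi>. ennreal ((cmod (fourier u \<xi>))\<^sup>2) * (ennreal (hdot_weight s \<xi>)
        * K) \<partial>lborel)"
    proof (intro nn_integral_mono_AE)
      show "AE \<xi> in lborel. ennreal ((cmod (fourier u \<xi>))\<^sup>2)
          * (\<integral>\<^sup>+y. ennreal ((cmod (cis (y \<bullet> \<xi>) - 1))\<^sup>2 * norm y powr (- ?a)) \<partial>lborel)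
        \<le> ennreal ((cmod (fourier u \<xi>))\<^sup>2) * (ennreal (hdot_weight s \<xi>) * K)"
        using AE_lborel_singleton[of 0] by eventually_elim (intro mult_left_mono kernel, auto)
    qed
    also have "\<dots> = (\<integral>\<^sup>+\<xi>. ennreal (hdot_weight s \<xi> * (cmod (fourier u \<xi>))\<^sup>2) * K \<partial>lborel)"
      by (simp add: ennreal_mult hdot_weight_nonneg mult_ac)
    also have "\<dots> = (\<integral>\<^sup>+\<xi>. ennreal (hdot_weight s \<xi> * (cmod (fourier u \<xi>))\<^sup>2) \<partial>lborel) * K"
      by (rule nn_integral_multc) measurable
    also have "(\<integral>\<^sup>+\<xi>. ennreal (hdot_weight s \<xi> * (cmod (fourier u \<xi>))\<^sup>2) \<partial>lborel)
        = ennreal ((Hdot_norm s u)\<^sup>2)"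
      using Hs_hdot_weight[OF s(1) u] unfolding Hdot_norm_sq[OF s(1) u] weighted_ip_self
      by (intro nn_integral_eq_integral) (auto simp: weighted_L2_def hdot_weight_nonneg)
    also have "\<dots> * K = ennreal (k * (Hdot_norm s u)\<^sup>2)"
      using k by (simp add: ennreal_mult' mult.commute[of k])
    finally show "(\<integral>\<^sup>+x. gagliardo_density s u x \<partial>lborel) \<le> ennreal (k * (Hdot_norm s u)\<^sup>2)" .
  qed
qed

section \<open>The Sobolev inequality\<close>

text \<open>
  The hypothesis compares \<open>v\<close> with its mean over a ball of radius \<open>r\<close>. Splitting at the level
  \<open>v / sqrt 8\<close> takes the place of Hoelder's inequality, and \<open>r\<close> is chosen so that the terms without
  \<open>\<Gamma>\<close> make up half of the left-hand side.
\<close>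

lemma sobolev_pointwise_algebra:
  fixes N s q \<beta> v S \<Gamma> :: real
  assumes pos: "0 < N" "0 < \<beta>" "0 < v" "0 < S"
    and q: "q * (2 * s / N) = q - 2"
    and bound: "\<And>r. 0 < r \<Longrightarrow> \<beta> * r powr N * v\<^sup>2 \<le> 2 * (r powr (N + 2 * s) * \<Gamma>) + 2 * ((v / sqrt 8)\<^sup>2
        * (\<beta> * r powr N) + (v / sqrt 8) powr (2 - q) * S)"
  shows "v powr q \<le> (4 / \<beta>) * (8 powr (q / 2) / \<beta>) powr (2 * s / N) * S powr (2 * s / N) * \<Gamma>"
proof -
  define L where "L = (v / sqrt 8) powr (2 - q)"
  \<comment> \<open>\<open>R\<close> is the value of \<open>r powr N\<close>. It satisfies
    \<open>8 * (L * S) = \<beta> * R * v\<^sup>2\<close>, so each of the two terms without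
    \<open>\<Gamma>\<close> is a quarter of the left-hand side.\<close>
  define R where "R = 8 * L * S / (\<beta> * v\<^sup>2)"
  have L: "0 < L" using pos by (simp add: L_def)
  have R: "0 < R" using pos L by (simp add: R_def)
  have RN: "(R powr (1 / N)) powr N = R" using pos R by (simp add: powr_powr)
  have Rs: "(R powr (1 / N)) powr (N + 2 * s) = R * R powr (2 * s / N)"
    using pos R by (simp add: powr_powr distrib_right add_divide_distrib powr_add)
  have LR: "8 * (L * S) = \<beta> * R * v\<^sup>2" using pos by (simp add: R_def)
  have v8: "(v / sqrt 8)\<^sup>2 = v\<^sup>2 / 8" by (simp add: power_divide)
  have "0 < R powr (1 / N)" using R by simp
  from bound[OF this] have "\<beta> * R * v\<^sup>2 \<le> 2 * (R * R powr (2 * s / N) * \<Gamma>) + 2 * (v\<^sup>2 / 8 * (\<beta> * R)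
      + L * S)"
    unfolding RN Rs L_def[symmetric] v8 .
  then have "8 * (\<beta> * R * v\<^sup>2) \<le> 16 * (R * R powr (2 * s / N) * \<Gamma>) + 2 * (\<beta> * R * v\<^sup>2) + 2
      * (8 * (L * S))"
    by (simp add: algebra_simps)
  then have "R * (\<beta> * v\<^sup>2) \<le> R * (4 * (R powr (2 * s / N) * \<Gamma>))"
    unfolding LR by (simp add: algebra_simps)
  then have "\<beta> * v\<^sup>2 \<le> 4 * (R powr (2 * s / N) * \<Gamma>)" using R by simp
  then have v2: "v\<^sup>2 \<le> (4 / \<beta>) * R powr (2 * s / N) * \<Gamma>" using pos by (simp add: field_simps)
  have "L = v powr (2 - q) * 8 powr ((q - 2) / 2)"
  proof -
    have "L = v powr (2 - q) / (sqrt 8) powr (2 - q)" using pos by (simp add: L_def powr_divide)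
    also have "(sqrt 8) powr (2 - q) = 8 powr ((2 - q) / 2)"
      by (simp add: powr_half_sqrt[symmetric] powr_powr)
    also have "v powr (2 - q) / 8 powr ((2 - q) / 2) = v powr (2 - q) * 8 powr (- ((2 - q) / 2))"
      by (simp add: powr_minus_divide)
    finally show ?thesis by (simp add: minus_divide_left)
  qed
  then have "R = (8 * 8 powr ((q - 2) / 2)) * (v powr (2 - q) / v\<^sup>2) * S / \<beta>"
    by (simp add: R_def mult_ac)
  also have "8 * 8 powr ((q - 2) / 2) = (8::real) powr (1 + (q - 2) / 2)" by (subst powr_add) simp
  also have "1 + (q - 2) / 2 = q / 2" by (simp add: diff_divide_distrib)
  also have "v powr (2 - q) / v\<^sup>2 = v powr (- q)"
  proof -
    have "v powr (2 - q) = v powr (- q) * v powr 2" by (simp flip: powr_add)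
    then show ?thesis using pos by simp
  qed
  finally have Rq: "R = (8 powr (q / 2) / \<beta> * S) * v powr (- q)" by simp
  have "R powr (2 * s / N) = (8 powr (q / 2) / \<beta> * S) powr (2 * s / N) * (v powr (- q)) powr (2
      * s / N)"
    unfolding Rq by (rule powr_mult)
  also have "(8 powr (q / 2) / \<beta> * S) powr (2 * s / N) = (8 powr (q / 2) / \<beta>) powr (2 * s / N)
      * S powr (2 * s / N)"
    by (rule powr_mult)
  also have "(v powr (- q)) powr (2 * s / N) = v powr (- (q * (2 * s / N)))"
    by (simp add: powr_powr)
  finally have "R powr (2 * s / N) = (8 powr (q / 2) / \<beta>) powr (2 * s / N) * S powr (2 * s / N)
      * v powr (- (q * (2 * s / N)))" .
  then have Rp: "R powr (2 * s / N) = (8 powr (q / 2) / \<beta>) powr (2 * s / N) * S powr (2 * s / N)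
      * v powr (- (q - 2))"
    unfolding q .
  have "v powr q = v powr (q - 2) * v powr 2" by (simp flip: powr_add)
  also have "\<dots> = v powr (q - 2) * v\<^sup>2" using pos by simp
  also have "\<dots> \<le> v powr (q - 2) * ((4 / \<beta>) * R powr (2 * s / N) * \<Gamma>)"
    by (intro mult_left_mono v2) simp
  also have "\<dots> = (4 / \<beta>) * (8 powr (q / 2) / \<beta>) powr (2 * s / N) * S powr (2 * s / N) * \<Gamma>
      * (v powr (q - 2) * v powr (- (q - 2)))"
    unfolding Rp by (simp add: mult_ac)
  also have "v powr (q - 2) * v powr (- (q - 2)) = 1" using pos by (simp flip: powr_add)
  finally show ?thesis by simp
qed

lemma nn_integral_lincomb:
  fixes a b c :: ennreal
  assumes "f \<in> borel_measurable M" "B \<in> sets M" "h \<in> borel_measurable M"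
  shows "(\<integral>\<^sup>+x. a * f x + (b * indicator B x + c * h x) \<partial>M) = a * (\<integral>\<^sup>+x. f x \<partial>M) + (b * emeasure M B
      + c * (\<integral>\<^sup>+x. h x \<partial>M))"
  using assms by (simp add: nn_integral_add nn_integral_cmult nn_integral_cmult_indicator)

text \<open>Integrate over displacements \<open>y\<close> in a ball of radius \<open>r\<close> the
  inequality comparing \<open>w x\<close> with \<open>w (x + y)\<close>; increments of
  \<open>w\<close> are paid for by \<open>gagliardo_density\<close>. Keeping \<open>w\<close> apart
  from \<open>u\<close> admits bounded truncations of \<open>cmod (u x)\<close>, whose increments
  are no larger than those of \<open>u\<close>.\<close>

lemma sobolev_pointwise:
  fixes u :: "'a::euclidean_space \<Rightarrow> complex" and w :: "'a \<Rightarrow> real"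
  assumes [measurable]: "u \<in> borel_measurable borel" "w \<in> borel_measurable borel"
    and w0: "\<And>x. 0 \<le> w x" and wu: "\<And>x y. \<bar>w x - w y\<bar> \<le> cmod (u x - u y)"
    and s: "0 < s" and q: "2 < q" "q * (2 * s / DIM('a)) = q - 2"
    and S: "(\<integral>\<^sup>+x. ennreal (w x powr q) \<partial>lborel) = ennreal S" "0 < S"
  shows "ennreal (w x powr q) \<le> ennreal ((4 / unit_ball_vol DIM('a))
      * (8 powr (q / 2) / unit_ball_vol DIM('a)) powr (2 * s / DIM('a)) * S powr (2 * s / DIM('a)))
      * gagliardo_density s u x"
    (is "_ \<le> ennreal ?K * _")
\<comment> \<open>If the density is infinite, the right-hand side is infinite because the constant
  in front is positive.\<close>
proof (cases "w x = 0 \<or> gagliardo_density s u x = \<infinity>")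
  case True
  have ub: "unit_ball_vol (real DIM('a)) \<noteq> 0"
    using unit_ball_vol_pos[of "real DIM('a)"] by (metis less_irrefl of_nat_0_le_iff)
  have "0 < ?K"
    by (intro mult_pos_pos divide_pos_pos) (use S ub in \<open>auto simp: powr_gt_zero dest:
        less_imp_neq\<close>)
  then show ?thesis using True by (auto simp: ennreal_mult_top)
next
  case False
  let ?\<beta> = "unit_ball_vol (real DIM('a))" and ?N = "real DIM('a)"
  define v where "v = w x"
  have v: "0 < v" using False w0[of x] by (simp add: v_def)
  obtain \<Gamma> where \<Gamma>: "gagliardo_density s u x = ennreal \<Gamma>" "0 \<le> \<Gamma>"
    using False by (cases "gagliardo_density s u x") auto
  define l where "l = v / sqrt 8"
  have l: "0 < l" using v by (simp add: l_def)
  have "?\<beta> * r powr ?N * v\<^sup>2 \<le> 2 * (r powr (?N + 2 * s) * \<Gamma>) + 2 * (l\<^sup>2 * (?\<beta> * r powr ?N)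
      + l powr (2 - q) * S)" if r: "0 < r" for r
  proof -
    let ?B = "ball (0::'a) r"
    have B: "emeasure lborel ?B = ennreal (?\<beta> * r powr ?N)" using r
      by (simp add: emeasure_ball powr_realpow)
    have pt: "ennreal (v\<^sup>2) * indicator ?B y \<le> ennreal (2 * r powr (?N + 2 * s))
        * ennreal ((cmod (u (x + y) - u x))\<^sup>2 * norm y powr (- (?N + 2 * s)))
        + (ennreal (2 * l\<^sup>2) * indicator ?B y + ennreal (2 * l powr (2 - q)) * ennreal (w (x + y)
            powr q))" for y
    proof (cases "y \<in> ?B")
      case True
      let ?\<delta> = "cmod (u (x + y) - u x)"
      have "(v - w (x + y))\<^sup>2 \<le> ?\<delta>\<^sup>2"
        using wu[of "x + y" x] by (intro abs_le_square_iff[THEN iffD1]) (simp add: v_def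
            abs_minus_commute)
      moreover have "v\<^sup>2 \<le> 2 * (v - w (x + y))\<^sup>2 + 2 * (w (x + y))\<^sup>2"
        using zero_le_power2[of "v - 2 * w (x + y)"] by (simp add: power2_eq_square algebra_simps)
      ultimately have 1: "v\<^sup>2 \<le> 2 * ?\<delta>\<^sup>2 + 2 * (w (x + y))\<^sup>2" by linarith
      \<comment> \<open>Inside the ball the factor
        \<open>r powr (?N + 2 * s) * norm y powr (- (?N + 2 * s))\<close> is at least 1 for nonzero
        \<open>y\<close>; at \<open>y = 0\<close>, where \<open>powr\<close> gives 0, the increment
        itself is 0.\<close>
      have 2: "?\<delta>\<^sup>2 \<le> r powr (?N + 2 * s) * (?\<delta>\<^sup>2 * norm y powr (- (?N + 2 * s)))"
      proof (cases "y = 0")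
        case False
        have "1 = norm y powr (?N + 2 * s) * norm y powr (- (?N + 2 * s))" using False
          by (simp flip: powr_add)
        also have "\<dots> \<le> r powr (?N + 2 * s) * norm y powr (- (?N + 2 * s))"
          using True s by (intro mult_right_mono powr_mono2) auto
        finally have "?\<delta>\<^sup>2 * 1 \<le> ?\<delta>\<^sup>2 * (r powr (?N + 2 * s) * norm y powr (- (?N + 2 * s)))"
          by (intro mult_left_mono) auto
        then show ?thesis by (simp add: mult_ac)
      qed simp
      \<comment> \<open>Below the level \<open>l\<close> the value is bounded by \<open>l\<close>;
        above it, the negative exponent \<open>2 - q\<close> lets
        \<open>w (x + y) powr (2 - q)\<close> be replaced by its value at \<open>l\<close>.\<close>
      have 3: "(w (x + y))\<^sup>2 \<le> l\<^sup>2 + l powr (2 - q) * w (x + y) powr q"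
      proof (cases "w (x + y) \<le> l")
        case True
        then have "(w (x + y))\<^sup>2 \<le> l\<^sup>2" using w0 by (intro power_mono) auto
        then show ?thesis by (simp add: add_increasing2)
      next
        case False
        then have wp: "0 < w (x + y)" using l by simp
        have "(w (x + y))\<^sup>2 = w (x + y) powr (2 - q) * w (x + y) powr q" using wp
          by (simp flip: powr_add)
        also have "\<dots> \<le> l powr (2 - q) * w (x + y) powr q"
          using False l q(1) by (intro mult_right_mono powr_mono2') auto
        finally show ?thesis by (simp add: add_increasing)
      qed
      have "v\<^sup>2 \<le> 2 * r powr (?N + 2 * s) * (?\<delta>\<^sup>2 * norm y powr (- (?N + 2 * s))) + (2 * l\<^sup>2 + 2
          * l powr (2 - q) * w (x + y) powr q)"
        using 1 2 3 by linarith
      then have "ennreal (v\<^sup>2) \<le> ennreal (2 * r powr (?N + 2 * s) * (?\<delta>\<^sup>2 * norm y powr (- (?N + 2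
          * s))) + (2 * l\<^sup>2 + 2 * l powr (2 - q) * w (x + y) powr q))"
        by (rule ennreal_leI)
      also have "\<dots> = ennreal (2 * r powr (?N + 2 * s) * (?\<delta>\<^sup>2 * norm y powr (- (?N + 2 * s))))
          + (ennreal (2 * l\<^sup>2) + ennreal (2 * l powr (2 - q) * w (x + y) powr q))"
        by (subst ennreal_plus; (subst ennreal_plus)?; simp)
      also have "ennreal (2 * r powr (?N + 2 * s) * (?\<delta>\<^sup>2 * norm y powr (- (?N + 2 * s))))
          = ennreal (2 * r powr (?N + 2 * s)) * ennreal (?\<delta>\<^sup>2 * norm y powr (- (?N + 2 * s)))"
        by (rule ennreal_mult) auto
      also have "ennreal (2 * l powr (2 - q) * w (x + y) powr q) = ennreal (2 * l powr (2 - q))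
          * ennreal (w (x + y) powr q)"
        by (rule ennreal_mult) auto
      finally show ?thesis using True by simp
    qed simp
    have "ennreal (v\<^sup>2 * (?\<beta> * r powr ?N)) = (\<integral>\<^sup>+y. ennreal (v\<^sup>2) * indicator ?B y \<partial>lborel)"
      by (subst nn_integral_cmult_indicator) (simp_all add: B ennreal_mult)
    also have "\<dots> \<le> (\<integral>\<^sup>+y. ennreal (2 * r powr (?N + 2 * s)) * ennreal ((cmod (u (x + y) - u x))\<^sup>2
        * norm y powr (- (?N + 2 * s)))
        + (ennreal (2 * l\<^sup>2) * indicator ?B y + ennreal (2 * l powr (2 - q)) * ennreal (w (x + y)
            powr q)) \<partial>lborel)"
      by (intro nn_integral_mono pt)
    also have "\<dots> = ennreal (2 * r powr (?N + 2 * s)) * gagliardo_density s u x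
        + (ennreal (2 * l\<^sup>2) * emeasure lborel ?B + ennreal (2 * l powr (2 - q)) * (\<integral>\<^sup>+y. ennreal (w
            (x + y) powr q) \<partial>lborel))"
      unfolding gagliardo_density_def
      by (rule nn_integral_lincomb) measurable
    also have "(\<integral>\<^sup>+y. ennreal (w (x + y) powr q) \<partial>lborel) = ennreal S"
      using nn_integral_lborel_shift[of "\<lambda>y. ennreal (w y powr q)" x]
      by (simp add: S(1) add.commute)
    also have "ennreal (2 * r powr (?N + 2 * s)) * gagliardo_density s u x + (ennreal (2 * l\<^sup>2)
        * emeasure lborel ?B + ennreal (2 * l powr (2 - q)) * ennreal S)
       = ennreal (2 * r powr (?N + 2 * s) * \<Gamma> + (2 * l\<^sup>2 * (?\<beta> * r powr ?N) + 2 * l powr (2 - q) *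
           S))"
    proof -
      have "ennreal (2 * r powr (?N + 2 * s) * \<Gamma> + (2 * l\<^sup>2 * (?\<beta> * r powr ?N) + 2 * l powr (2 - q)
          * S))
        = ennreal (2 * r powr (?N + 2 * s) * \<Gamma>) + ennreal (2 * l\<^sup>2 * (?\<beta> * r powr ?N) + 2 * l powr
            (2 - q) * S)"
        using \<Gamma>(2) S(2) by (intro ennreal_plus add_nonneg_nonneg mult_nonneg_nonneg) auto
      also have "ennreal (2 * l\<^sup>2 * (?\<beta> * r powr ?N) + 2 * l powr (2 - q) * S)
          = ennreal (2 * l\<^sup>2 * (?\<beta> * r powr ?N)) + ennreal (2 * l powr (2 - q) * S)"
        using S(2) by (intro ennreal_plus add_nonneg_nonneg mult_nonneg_nonneg) auto
      finally show ?thesis using \<Gamma> S(2) B by (simp add: ennreal_mult)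
    qed
    finally have "v\<^sup>2 * (?\<beta> * r powr ?N) \<le> 2 * r powr (?N + 2 * s) * \<Gamma> + (2 * l\<^sup>2 * (?\<beta> * r powr ?N)
        + 2 * l powr (2 - q) * S)"
      using \<Gamma>(2) S(2) by (subst (asm) ennreal_le_iff) (auto intro!: add_nonneg_nonneg
          mult_nonneg_nonneg)
    then show ?thesis by (simp add: algebra_simps)
  qed
  then have "v powr q \<le> ?K * \<Gamma>"
    unfolding l_def by (intro sobolev_pointwise_algebra) (use v S q in auto)
  then have "ennreal (v powr q) \<le> ennreal (?K * \<Gamma>)" by (rule ennreal_leI)
  also have "\<dots> = ennreal ?K * ennreal \<Gamma>" using \<Gamma>(2) S by (intro ennreal_mult) auto
  finally show ?thesis by (simp add: v_def \<Gamma>(1))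
qed

text \<open>
  The pointwise bound needs a finite \<open>L\<^sup>q\<close> norm beforehand, hence the truncations \<open>min \<bar>u\<bar> n\<close>.
\<close>

theorem sobolev:
  fixes s :: real
  assumes s: "0 < s" "s < 1" and N: "2 * s < real DIM('a::euclidean_space)"
  defines "q \<equiv> 2 * real DIM('a) / (real DIM('a) - 2 * s)"
  shows "\<exists>C\<ge>0. \<forall>u\<in>(Hs s :: ('a \<Rightarrow> complex) set).
    (\<integral>\<^sup>+x. ennreal (cmod (u x) powr q) \<partial>lborel) \<le> ennreal (C * ((Hdot_norm s u)\<^sup>2) powr (q / 2))"
proof -
  let ?N = "real DIM('a)"
  let ?\<sigma> = "2 * s / ?N"
  obtain k where k: "0 \<le> k" "\<And>u :: 'a \<Rightarrow> complex. u \<in> Hs s \<Longrightarrow> (\<integral>\<^sup>+x. gagliardo_density s u x \<partial>lborel)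
      \<le> ennreal (k * (Hdot_norm s u)\<^sup>2)"
    using gagliardo_le_Hdot[OF s, where 'a='a] by blast
  define K where "K = (4 / unit_ball_vol ?N) * (8 powr (q / 2) / unit_ball_vol ?N) powr ?\<sigma>"
  have ub: "unit_ball_vol ?N \<noteq> 0"
    using unit_ball_vol_pos[of ?N] by (metis less_irrefl of_nat_0_le_iff)
  have K: "0 < K" unfolding K_def
    by (intro mult_pos_pos divide_pos_pos) (use ub in \<open>auto simp: powr_gt_zero dest: less_imp_neq\<close>)
  have N0: "0 < ?N" by simp
  have q2: "2 < q" using s N by (simp add: q_def field_simps)
  have qs: "q * ?\<sigma> = q - 2" using s N by (simp add: q_def field_simps)
  \<comment> \<open>The bound on \<open>S\<close> below contains \<open>S powr ?\<sigma>\<close>;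
    solving it for \<open>S\<close> raises to the power \<open>1 / (1 - ?\<sigma>)\<close>, which is
    \<open>q / 2\<close>.\<close>
  have s1: "?\<sigma> < 1" "1 / (1 - ?\<sigma>) = q / 2" using s N by (simp_all add: q_def field_simps)
  show ?thesis
  proof (intro exI[of _ "(K * k) powr (q / 2)"] conjI ballI)
    fix u :: "'a \<Rightarrow> complex" assume u: "u \<in> Hs s"
    have um[measurable]: "u \<in> borel_measurable borel" using u by (rule Hs_measurable)
    define A where "A = (Hdot_norm s u)\<^sup>2"
    have A: "0 \<le> A" by (simp add: A_def)
    define w where "w = (\<lambda>(n::nat) x. min (cmod (u x)) n)"
    have [measurable]: "w n \<in> borel_measurable borel" for n unfolding w_def by measurable
    have w0: "0 \<le> w n x" for n x by (simp add: w_def)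
    have main: "(\<integral>\<^sup>+x. ennreal (w n x powr q) \<partial>lborel)
        \<le> ennreal ((K * k) powr (q / 2) * A powr (q / 2))" for n
    proof -
      have "(\<integral>\<^sup>+x. ennreal (w n x powr q) \<partial>lborel) \<le> (\<integral>\<^sup>+x. ennreal (real n powr (q - 2))
          * ennreal ((cmod (u x))\<^sup>2) \<partial>lborel)"
      proof (intro nn_integral_mono)
        fix x
        have "w n x powr q = w n x powr (q - 2) * w n x powr 2"
          by (simp only: powr_add[symmetric]) simp
        also have "\<dots> \<le> real n powr (q - 2) * (cmod (u x)) powr 2"
          using q2 w0 by (intro mult_mono powr_mono2) (auto simp: w_def)
        finally show "ennreal (w n x powr q) \<le> ennreal (real n powr (q - 2))
            * ennreal ((cmod (u x))\<^sup>2)"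
          by (simp add: ennreal_mult[symmetric] ennreal_leI)
      qed
      also have "\<dots> = ennreal (real n powr (q - 2)) * l2sq u"
        unfolding l2sq_def by (rule nn_integral_cmult) measurable
      also have "\<dots> < \<infinity>" using Hs_in_L2[OF u] by (simp add: Lspace2_iff ennreal_mult_less_top)
      finally have "(\<integral>\<^sup>+x. ennreal (w n x powr q) \<partial>lborel) < \<infinity>" .
      then obtain S where S: "(\<integral>\<^sup>+x. ennreal (w n x powr q) \<partial>lborel) = ennreal S" "0 \<le> S"
        by (cases "\<integral>\<^sup>+x. ennreal (w n x powr q) \<partial>lborel") auto
      show ?thesis
      proof (cases "S = 0")
        case False
        then have S0: "0 < S" using S by simp
        have wu: "\<bar>w n x - w n y\<bar> \<le> cmod (u x - u y)" for x y
        proof -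
          have "\<bar>w n x - w n y\<bar> \<le> \<bar>cmod (u x) - cmod (u y)\<bar>" by (auto simp: w_def min_def)
          also have "\<dots> \<le> cmod (u x - u y)" by (rule norm_triangle_ineq3)
          finally show ?thesis .
        qed
        have [measurable]: "gagliardo_density s u \<in> borel_measurable borel"
          unfolding gagliardo_density_def[abs_def] by measurable
        have "ennreal S \<le> (\<integral>\<^sup>+x. ennreal (K * S powr ?\<sigma>) * gagliardo_density s u x \<partial>lborel)"
          unfolding S(1)[symmetric] K_def
          by (intro nn_integral_mono sobolev_pointwise[OF um _ w0 wu s(1) q2 qs S(1) S0]) simp
        also have "\<dots> = ennreal (K * S powr ?\<sigma>) * (\<integral>\<^sup>+x. gagliardo_density s u x \<partial>lborel)"
          by (rule nn_integral_cmult) measurable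
        also have "\<dots> \<le> ennreal (K * S powr ?\<sigma>) * ennreal (k * A)"
          unfolding A_def by (intro mult_left_mono k u) auto
        also have "\<dots> = ennreal (K * S powr ?\<sigma> * (k * A))" using K
          by (intro ennreal_mult[symmetric] mult_nonneg_nonneg k A) auto
        finally have "S \<le> K * S powr ?\<sigma> * (k * A)"
          using K k A by (subst (asm) ennreal_le_iff) (auto intro!: mult_nonneg_nonneg)
        \<comment> \<open>Since \<open>S\<close> is finite and positive, its lower power on the
          right can be divided out.\<close>
        then have "S powr (1 - ?\<sigma>) * S powr ?\<sigma> \<le> (K * k * A) * S powr ?\<sigma>"
          using S0 by (simp add: mult_ac flip: powr_add)
        then have "S powr (1 - ?\<sigma>) \<le> K * k * A" using S0 by (simp add: mult_le_cancel_right)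
        then have "(S powr (1 - ?\<sigma>)) powr (1 / (1 - ?\<sigma>)) \<le> (K * k * A) powr (1 / (1 - ?\<sigma>))"
          using s1(1) by (intro powr_mono2) auto
        moreover have "(S powr (1 - ?\<sigma>)) powr (1 / (1 - ?\<sigma>)) = S" using s1(1) S0
          by (simp add: powr_powr)
        moreover have "(K * k * A) powr (1 / (1 - ?\<sigma>)) = (K * k) powr (q / 2) * A powr (q / 2)"
          unfolding s1(2) by (rule powr_mult)
        ultimately show ?thesis unfolding S(1) by (intro ennreal_leI) simp
      qed (simp add: S)
    qed
    \<comment> \<open>The bound is uniform in the truncation level, so Fatou's lemma removes the
      truncation.\<close>
    have "(\<integral>\<^sup>+x. ennreal (cmod (u x) powr q) \<partial>lborel)
        = (\<integral>\<^sup>+x. liminf (\<lambda>n. ennreal (w n x powr q)) \<partial>lborel)"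
    proof (intro nn_integral_cong)
      fix x
      obtain m :: nat where "cmod (u x) \<le> m" using real_arch_simple by blast
      then have "w n x = cmod (u x)" if "n \<ge> m" for n using that by (auto simp: w_def min_def)
      then have "(\<lambda>n. ennreal (w n x powr q)) \<longlonglongrightarrow> ennreal (cmod (u x) powr q)"
        by (intro tendsto_eventually) (auto simp: eventually_sequentially intro!: exI[of _ m])
      from lim_imp_Liminf[OF sequentially_bot this] show "ennreal (cmod (u x) powr q)
          = liminf (\<lambda>n. ennreal (w n x powr q))" by simp
    qed
    also have "\<dots> \<le> liminf (\<lambda>n. \<integral>\<^sup>+x. ennreal (w n x powr q) \<partial>lborel)"
      by (intro nn_integral_liminf) measurable
    also have "\<dots> \<le> ennreal ((K * k) powr (q / 2) * A powr (q / 2))"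
      by (rule Liminf_le) (auto intro: always_eventually main)
    finally show "(\<integral>\<^sup>+x. ennreal (cmod (u x) powr q) \<partial>lborel)
        \<le> ennreal ((K * k) powr (q / 2) * ((Hdot_norm s u)\<^sup>2) powr (q / 2))"
      by (simp add: A_def)
  qed simp
qed

text \<open>For \<open>p\<close> between 2 and the Sobolev exponent, the power is at most the sum of
  the two extreme powers. A bound on the unit ball suffices later, where perturbations are rescaled
  to norm at most 1.\<close>

corollary Hs_Lp_bound:
  fixes s p :: real
  assumes s: "0 < s" "s < 1" and N: "2 * s < real DIM('a::euclidean_space)"
    and p: "2 \<le> p" "p * (real DIM('a) - 2 * s) \<le> 2 * real DIM('a)"
  shows "\<exists>C\<ge>0. \<forall>u\<in>(Hs s :: ('a \<Rightarrow> complex) set). integrable lborel (\<lambda>x. cmod (u x) powr p) \<and>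
    (Hs_norm s u \<le> 1 \<longrightarrow> (LINT x|lborel. cmod (u x) powr p) \<le> C)"
proof -
  define q where "q = 2 * real DIM('a) / (real DIM('a) - 2 * s)"
  have q: "p \<le> q" using p N by (simp add: q_def field_simps)
  obtain C where C: "0 \<le> C" and sob: "\<And>u :: 'a \<Rightarrow> complex. u \<in> Hs s
      \<Longrightarrow> (\<integral>\<^sup>+x. ennreal (cmod (u x) powr q) \<partial>lborel) \<le> ennreal (C * ((Hdot_norm s u)\<^sup>2) powr (q /
      2))"
    using sobolev[OF s N] unfolding q_def by blast
  show ?thesis
  proof (intro exI[of _ "1 + C"] conjI ballI impI)
    fix u :: "'a \<Rightarrow> complex" assume u: "u \<in> Hs s"
    have [measurable]: "u \<in> borel_measurable borel" using u by (rule Hs_measurable)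
    have i2: "integrable lborel (\<lambda>x. (cmod (u x))\<^sup>2)" using Hs_in_L2[OF u] by (simp add: Lspace_def)
    have iq: "integrable lborel (\<lambda>x. cmod (u x) powr q)"
      using le_less_trans[OF sob[OF u]] by (simp add: integrable_iff_bounded)
    have le: "cmod (u x) powr p \<le> (cmod (u x))\<^sup>2 + cmod (u x) powr q" for x
    proof (cases "cmod (u x) \<le> 1")
      case True
      then have "cmod (u x) powr p \<le> cmod (u x) powr 2" using p(1)
        by (cases "u x = 0") (auto intro!: powr_mono' simp del: powr_numeral)
      then show ?thesis by (simp add: add_increasing2)
    next
      case False
      then have "cmod (u x) powr p \<le> cmod (u x) powr q" using q by (intro powr_mono) auto
      then show ?thesis by (simp add: add_increasing)
    qed
    show ip: "integrable lborel (\<lambda>x. cmod (u x) powr p)"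
      by (rule Bochner_Integration.integrable_bound[OF Bochner_Integration.integrable_add[OF i2
          iq]])
         (use le in \<open>auto simp: abs_of_nonneg\<close>)
    assume n: "Hs_norm s u \<le> 1"
    have n2: "(Hs_norm s u)\<^sup>2 \<le> 1" using n Hs_norm_nonneg[of s u] by (simp add: power_le_one)
    have "(LINT x|lborel. cmod (u x) powr p) \<le> (LINT x|lborel. (cmod (u x))\<^sup>2 + cmod (u x) powr q)"
      by (intro integral_mono ip Bochner_Integration.integrable_add i2 iq le)
    also have "\<dots> = (Lnorm 2 u)\<^sup>2 + (LINT x|lborel. cmod (u x) powr q)"
      using i2 iq by (simp add: Lnorm2_sq)
    also have "(Lnorm 2 u)\<^sup>2 \<le> 1" using Lnorm2_le[OF s(1) u] n2 by simp
    also have "(LINT x|lborel. cmod (u x) powr q) \<le> C"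
    proof -
      have "ennreal (LINT x|lborel. cmod (u x) powr q)
          = (\<integral>\<^sup>+x. ennreal (cmod (u x) powr q) \<partial>lborel)"
        by (rule nn_integral_eq_integral[symmetric, OF iq]) auto
      also have "\<dots> \<le> ennreal (C * ((Hdot_norm s u)\<^sup>2) powr (q / 2))" by (rule sob[OF u])
      finally have "(LINT x|lborel. cmod (u x) powr q) \<le> C * ((Hdot_norm s u)\<^sup>2) powr (q / 2)"
        using C by (simp add: ennreal_le_iff)
      also have "((Hdot_norm s u)\<^sup>2) powr (q / 2) \<le> 1"
        using Hdot_norm_le[OF s(1) u] n2 q p by (intro powr_le1) auto
      then have "C * ((Hdot_norm s u)\<^sup>2) powr (q / 2) \<le> C" using C by (rule mult_left_le)
      finally show ?thesis .
    qed
    finally show "(LINT x|lborel. cmod (u x) powr p) \<le> 1 + C" by simp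
  qed (use C in auto)
qed

section \<open>The power functional\<close>

text \<open>The tangent line inequality for the convex function \<open>x powr m\<close>, obtained
  from Young's inequality with exponents \<open>m\<close> and \<open>m / (m - 1)\<close>, so that no
  differentiability at \<open>x = 0\<close> is involved.\<close>

lemma powr_tangent:
  fixes x y m :: real
  assumes "0 \<le> x" "0 \<le> y" "1 < m"
  shows "m * x powr (m - 1) * (y - x) \<le> y powr m - x powr m"
proof -
  let ?c = "m / (m - 1)"
  have c: "1 < ?c" "1 / m + 1 / ?c = 1" using assms by (simp_all add: field_simps)
  have "y * x powr (m - 1) \<le> y powr m / m + (x powr (m - 1)) powr ?c / ?c"
    by (rule Youngs_inequality) (use assms c in auto)
  also have "(x powr (m - 1)) powr ?c = x powr m" using assms by (simp add: powr_powr)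
  finally have "m * (y * x powr (m - 1)) \<le> m * (y powr m / m + x powr m / ?c)"
    using assms by (intro mult_left_mono) auto
  also have "\<dots> = y powr m + (m - 1) * x powr m" using assms by (simp add: field_simps)
  finally have "m * (y * x powr (m - 1)) \<le> y powr m + (m - 1) * x powr m" .
  moreover have "x * x powr (m - 1) = x powr m"
    using assms by (cases "x = 0") (auto simp: powr_diff)
  ultimately show ?thesis by (simp add: algebra_simps)
qed

text \<open>For \<open>p < 1\<close> the power is not Lipschitz at 0; the factor \<open>x\<close>
  repairs this, because moving it inside the difference leads to the convex power
  \<open>p + 1\<close>.\<close>

lemma powr_diff_le:
  fixes x y p :: real
  assumes "0 \<le> x" "0 \<le> y" "0 < p" "x \<le> T" "y \<le> T"
  shows "x * \<bar>y powr p - x powr p\<bar> \<le> (p + 1) * T powr p * \<bar>y - x\<bar>"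
proof (cases "x \<le> y")
  case True
  have xx: "z * z powr p = z powr (p + 1)" if "0 \<le> z" for z :: real
    using that by (cases "z = 0") (auto simp: powr_add)
  have "x powr p \<le> y powr p" using True assms by (intro powr_mono2) auto
  then have "x * \<bar>y powr p - x powr p\<bar> = x * y powr p - x powr (p + 1)"
    using xx[of x] assms by (simp add: right_diff_distrib)
  also have "\<dots> \<le> y * y powr p - x powr (p + 1)" using True
    by (intro diff_right_mono mult_right_mono) auto
  also have "\<dots> = y powr (p + 1) - x powr (p + 1)" using xx[of y] assms by simp
  also have "\<dots> \<le> (p + 1) * y powr p * (y - x)"
    using powr_tangent[of y x "p + 1"] assms by (simp add: algebra_simps)
  also have "\<dots> \<le> (p + 1) * T powr p * \<bar>y - x\<bar>"
    using True assms by (intro mult_mono mult_nonneg_nonneg powr_mono2) auto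
  finally show ?thesis .
next
  case False
  have xx: "z * z powr p = z powr (p + 1)" if "0 \<le> z" for z :: real
    using that by (cases "z = 0") (auto simp: powr_add)
  have "y powr p \<le> x powr p" using False assms by (intro powr_mono2) auto
  then have "x * \<bar>y powr p - x powr p\<bar> = x powr (p + 1) - x * y powr p"
    using xx[of x] assms by (simp add: right_diff_distrib)
  also have "\<dots> \<le> x powr (p + 1) - y * y powr p" using False
    by (intro diff_left_mono mult_right_mono) auto
  also have "\<dots> = x powr (p + 1) - y powr (p + 1)" using xx[of y] assms by simp
  also have "\<dots> \<le> (p + 1) * x powr p * (x - y)"
    using powr_tangent[of x y "p + 1"] assms by (simp add: algebra_simps)
  also have "\<dots> \<le> (p + 1) * T powr p * \<bar>y - x\<bar>"
    using False assms by (intro mult_mono mult_nonneg_nonneg powr_mono2) auto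
  finally show ?thesis .
qed

text \<open>Written as \<open>((cmod z)\<^sup>2) powr m\<close>, the function is a convex power of a
  quantity whose increment is exactly \<open>2 * R + (cmod b)\<^sup>2\<close>. Tangents at both
  endpoints enclose the remainder. The bound separates \<open>t\<^sup>2\<close> from
  \<open>T\<close>, whose power can be integrated uniformly over the unit ball.\<close>

lemma cmod_powr_expand:
  fixes a \<eta> :: complex and p t :: real
  assumes p: "0 < p" and t: "0 \<le> t" "t \<le> 1"
  defines "b \<equiv> of_real t * \<eta>" and "T \<equiv> cmod a + cmod \<eta>"
  shows "\<bar>cmod (a + b) powr (p + 2) - cmod a powr (p + 2) - (p + 2) * (cmod a powr p
      * Re (a * cnj b))\<bar>
    \<le> (p + 2) * (2 * p + 3) * (t\<^sup>2 * T powr (p + 2))"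
proof -
  define m where "m = (p + 2) / 2"
  have m: "1 < m" using p by (simp add: m_def)
  define X where "X = (cmod a)\<^sup>2"
  define Y where "Y = (cmod (a + b))\<^sup>2"
  define R where "R = Re (a * cnj b)"
  have YX: "Y - X = 2 * R + (cmod b)\<^sup>2"
    unfolding X_def Y_def R_def cmod_power2 by (simp add: power2_eq_square algebra_simps)
  have pw: "((cmod z)\<^sup>2) powr r = cmod z powr (2 * r)" for z :: complex and r
  proof -
    have "((cmod z)\<^sup>2) powr r = (cmod z powr 2) powr r" by simp
    then show ?thesis by (simp only: powr_powr)
  qed
  have Xm: "X powr m = cmod a powr (p + 2)" "Y powr m = cmod (a + b) powr (p + 2)"
    "X powr (m - 1) = cmod a powr p" "Y powr (m - 1) = cmod (a + b) powr p"
  proof -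
    have "2 * m = p + 2" "2 * (m - 1) = p" by (simp_all add: m_def field_simps)
    then show "X powr m = cmod a powr (p + 2)" "Y powr m = cmod (a + b) powr (p + 2)"
      "X powr (m - 1) = cmod a powr p" "Y powr (m - 1) = cmod (a + b) powr p"
      unfolding X_def Y_def pw by simp_all
  qed
  have b: "cmod b = t * cmod \<eta>" using t by (simp add: b_def norm_mult)
  then have bT: "cmod b \<le> cmod \<eta>" using t by (simp add: mult_left_le_one_le)
  have T0: "0 \<le> T" by (simp add: T_def)
  have abT: "cmod (a + b) \<le> T" "cmod a \<le> T" using norm_triangle_ineq[of a b] bT
    by (auto simp: T_def)
  have lower: "m * X powr (m - 1) * (Y - X) \<le> Y powr m - X powr m"
    by (rule powr_tangent) (auto simp: X_def Y_def m)
  have upper: "Y powr m - X powr m \<le> m * Y powr (m - 1) * (Y - X)"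
    using powr_tangent[of Y X m] m by (simp add: X_def Y_def algebra_simps)
  let ?rem = "cmod (a + b) powr (p + 2) - cmod a powr (p + 2) - (p + 2) * (cmod a powr p * R)"
  have rem: "?rem = Y powr m - X powr m - m * X powr (m - 1) * (2 * R)" unfolding Xm
    by (simp add: m_def)
  have "0 \<le> m * X powr (m - 1) * (cmod b)\<^sup>2" using m by simp
  \<comment> \<open>By convexity the remainder is nonnegative, so only an upper bound is left to
    prove.\<close>
  then have low: "0 \<le> ?rem" using lower unfolding rem YX by (simp add: algebra_simps)
  have R: "\<bar>R\<bar> \<le> cmod a * cmod b"
    using abs_Re_le_cmod[of "a * cnj b"] by (simp add: R_def norm_mult)
  have diff: "cmod a * \<bar>Y powr (m - 1) - X powr (m - 1)\<bar> \<le> (p + 1) * T powr p * cmod b"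
  proof -
    have "cmod a * \<bar>cmod (a + b) powr p - cmod a powr p\<bar> \<le> (p + 1) * T powr p * \<bar>cmod (a + b)
        - cmod a\<bar>"
      by (rule powr_diff_le) (use abT p in auto)
    also have "\<dots> \<le> (p + 1) * T powr p * cmod b"
      using norm_triangle_ineq3[of "a + b" a] p by (intro mult_left_mono) auto
    finally show ?thesis by (simp only: Xm)
  qed
  \<comment> \<open>The tangent at \<open>Y\<close> gives the upper bound; exchanging
    \<open>Y powr (m - 1)\<close> for \<open>X powr (m - 1)\<close> in the linear term is the place
    where \<open>diff\<close> enters.\<close>
  have "?rem \<le> m * Y powr (m - 1) * (2 * R + (cmod b)\<^sup>2) - m * X powr (m - 1) * (2 * R)"
    using upper unfolding rem YX by simp
  also have "\<dots> = m * (2 * ((Y powr (m - 1) - X powr (m - 1)) * R)) + m * (Y powr (m - 1)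
      * (cmod b)\<^sup>2)"
    by (simp add: algebra_simps)
  also have "\<dots> \<le> m * (2 * ((p + 1) * T powr p * cmod b * cmod b)) + m * (T powr p * (cmod b)\<^sup>2)"
  proof (intro add_mono mult_left_mono)
    have "(Y powr (m - 1) - X powr (m - 1)) * R \<le> \<bar>Y powr (m - 1) - X powr (m - 1)\<bar> * \<bar>R\<bar>"
      by (metis abs_ge_self abs_mult)
    also have "\<dots> \<le> \<bar>Y powr (m - 1) - X powr (m - 1)\<bar> * (cmod a * cmod b)"
      by (intro mult_left_mono R) auto
    also have "\<dots> = (cmod a * \<bar>Y powr (m - 1) - X powr (m - 1)\<bar>) * cmod b" by (simp add: mult_ac)
    also have "\<dots> \<le> (p + 1) * T powr p * cmod b * cmod b" by (intro mult_right_mono diff) auto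
    finally show "(Y powr (m - 1) - X powr (m - 1)) * R \<le> (p + 1) * T powr p * cmod b * cmod b" .
    show "Y powr (m - 1) * (cmod b)\<^sup>2 \<le> T powr p * (cmod b)\<^sup>2"
      unfolding Xm using abT p by (intro mult_right_mono powr_mono2) auto
  qed (use m in auto)
  also have "\<dots> = m * (2 * p + 3) * (T powr p * (cmod b)\<^sup>2)"
    by (simp add: power2_eq_square algebra_simps)
  also have "\<dots> \<le> (p + 2) * (2 * p + 3) * (t\<^sup>2 * T powr (p + 2))"
  proof (rule mult_mono)
    show "m * (2 * p + 3) \<le> (p + 2) * (2 * p + 3)" using p
      by (intro mult_right_mono) (auto simp: m_def)
    have "(cmod b)\<^sup>2 = t\<^sup>2 * (cmod \<eta>)\<^sup>2" by (simp add: b power_mult_distrib)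
    also have "\<dots> \<le> t\<^sup>2 * T\<^sup>2" by (intro mult_left_mono power_mono) (auto simp: T_def)
    finally have "T powr p * (cmod b)\<^sup>2 \<le> T powr p * (t\<^sup>2 * T\<^sup>2)" by (rule mult_left_mono) simp
    also have "\<dots> = t\<^sup>2 * T powr (p + 2)" using T0 by (simp add: powr_add)
    finally show "T powr p * (cmod b)\<^sup>2 \<le> t\<^sup>2 * T powr (p + 2)" .
  qed (use p m in \<open>auto simp: m_def\<close>)
  finally show ?thesis using low unfolding R_def by simp
qed

text \<open>Presents \<open>h\<close> as \<open>t\<close> times a function of norm at most 1.
  Allowing any positive bound \<open>t\<close> includes directions of norm 0.\<close>

lemma Hs_normalize:
  assumes s: "0 < s" and h: "h \<in> Hs s" "Hs_norm s h \<le> t" and t: "0 < t"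
  shows "(\<lambda>x. of_real (1 / t) * h x) \<in> Hs s" "Hs_norm s (\<lambda>x. of_real (1 / t) * h x) \<le> 1"
proof -
  show "(\<lambda>x. of_real (1 / t) * h x) \<in> Hs s" by (rule Hs_cmult[OF s h(1)])
  have "(Hs_norm s (\<lambda>x. of_real (1 / t) * h x))\<^sup>2 = (1 / t)\<^sup>2 * (Hs_norm s h)\<^sup>2"
    using Hs_norm_cmult[OF s h(1), of "of_real (1 / t)"] by (simp only: norm_of_real power2_abs)
  also have "\<dots> \<le> (1 / t)\<^sup>2 * t\<^sup>2" using h(2) Hs_norm_nonneg
    by (intro mult_left_mono power_mono) auto
  also have "\<dots> = 1\<^sup>2" using t by (simp add: power_divide)
  finally show "Hs_norm s (\<lambda>x. of_real (1 / t) * h x) \<le> 1" by (rule power2_le_imp_le) simp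
qed

lemma powr_add_le:
  fixes a b q :: real
  assumes "0 \<le> a" "0 \<le> b" "0 \<le> q"
  shows "(a + b) powr q \<le> 2 powr q * (a powr q + b powr q)"
proof -
  have "(a + b) powr q \<le> (2 * max a b) powr q" using assms by (intro powr_mono2) auto
  also have "\<dots> = 2 powr q * (max a b) powr q" by (rule powr_mult)
  also have "\<dots> \<le> 2 powr q * (a powr q + b powr q)" by (intro mult_left_mono) (auto simp: max_def)
  finally show ?thesis .
qed

lemma integrable_powr_sum:
  fixes u v :: "'a::euclidean_space \<Rightarrow> complex"
  assumes [measurable]: "u \<in> borel_measurable borel" "v \<in> borel_measurable borel"
    and u: "integrable lborel (\<lambda>x. cmod (u x) powr q)"
        and v: "integrable lborel (\<lambda>x. cmod (v x) powr q)" and q: "0 \<le> q"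
  shows "integrable lborel (\<lambda>x. (cmod (u x) + cmod (v x)) powr q)"
    "(LINT x|lborel. (cmod (u x) + cmod (v x)) powr q)
        \<le> 2 powr q * ((LINT x|lborel. cmod (u x) powr q) + (LINT x|lborel. cmod (v x) powr q))"
proof -
  have i: "integrable lborel (\<lambda>x. 2 powr q * (cmod (u x) powr q + cmod (v x) powr q))"
    by (intro integrable_mult_right Bochner_Integration.integrable_add u v)
  show j: "integrable lborel (\<lambda>x. (cmod (u x) + cmod (v x)) powr q)"
    by (rule Bochner_Integration.integrable_bound[OF i]) (use powr_add_le q in \<open>auto simp: abs_mult
        abs_of_nonneg\<close>)
  have "(LINT x|lborel. (cmod (u x) + cmod (v x)) powr q)
      \<le> (LINT x|lborel. 2 powr q * (cmod (u x) powr q + cmod (v x) powr q))"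
    by (intro integral_mono j i powr_add_le q) auto
  also have "\<dots> = 2 powr q * ((LINT x|lborel. cmod (u x) powr q)
      + (LINT x|lborel. cmod (v x) powr q))"
    using u v by simp
  finally show "(LINT x|lborel. (cmod (u x) + cmod (v x)) powr q)
      \<le> 2 powr q * ((LINT x|lborel. cmod (u x) powr q) + (LINT x|lborel. cmod (v x) powr q))" .
qed

text \<open>Integrates \<open>cmod_powr_expand\<close> with \<open>\<eta>\<close> equal to
  \<open>h / t\<close>. The integral of the majorant
  \<open>(cmod (u x) + cmod (\<eta> x)) powr (p + 2)\<close> stays bounded by
  \<open>Hs_Lp_bound\<close>.\<close>

lemma power_functional_expand:
  fixes u :: "'a::euclidean_space \<Rightarrow> complex" and s p :: real
  assumes s: "0 < s" "s < 1" and N: "2 * s < real DIM('a)"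
    and p: "0 < p" "(p + 2) * (real DIM('a) - 2 * s) \<le> 2 * real DIM('a)" and u: "u \<in> Hs s"
  shows "\<exists>C\<ge>0. \<forall>t h. 0 < t \<longrightarrow> t \<le> 1 \<longrightarrow> h \<in> Hs s \<longrightarrow> Hs_norm s h \<le> t \<longrightarrow>
    \<bar>(LINT x|lborel. cmod (u x + h x) powr (p + 2)) - (LINT x|lborel. cmod (u x) powr (p + 2))
      - (p + 2) * Re (LINT x|lborel. of_real (cmod (u x) powr p) * u x * cnj (h x))\<bar> \<le> C * t\<^sup>2"
proof -
  have p2: "2 \<le> p + 2" using p by simp
  obtain C0 where C0: "0 \<le> C0" and Lp: "\<And>v :: 'a \<Rightarrow> complex. v \<in> Hs s
      \<Longrightarrow> integrable lborel (\<lambda>x. cmod (v x) powr (p + 2))"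
    and bd: "\<And>v :: 'a \<Rightarrow> complex. v \<in> Hs s \<Longrightarrow> Hs_norm s v \<le> 1
        \<Longrightarrow> (LINT x|lborel. cmod (v x) powr (p + 2)) \<le> C0"
    using Hs_Lp_bound[OF s N p2 p(2)] by blast
  define U where "U = (LINT x|lborel. cmod (u x) powr (p + 2))"
  have U0: "0 \<le> U" by (simp add: U_def integral_nonneg_AE)
  have [measurable]: "u \<in> borel_measurable borel" using u by (rule Hs_measurable)
  define c where "c = (p + 2) * (2 * p + 3)"
  have c0: "0 \<le> c" using p by (simp add: c_def)
  show ?thesis
  proof (intro exI[of _ "c * (2 powr (p + 2) * (U + C0))"] conjI allI impI)
    show "0 \<le> c * (2 powr (p + 2) * (U + C0))" using c0 U0 C0 by simp
    fix t :: real and h :: "'a \<Rightarrow> complex"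
    assume t: "0 < t" "t \<le> 1" and h: "h \<in> Hs s" "Hs_norm s h \<le> t"
    have [measurable]: "h \<in> borel_measurable borel" using h by (intro Hs_measurable)
    define \<eta> where "\<eta> = (\<lambda>x. of_real (1 / t) * h x)"
    have \<eta>: "\<eta> \<in> Hs s" "Hs_norm s \<eta> \<le> 1" unfolding \<eta>_def using Hs_normalize[OF s(1) h t(1)] by auto
    have [measurable]: "\<eta> \<in> borel_measurable borel" using \<eta> by (intro Hs_measurable)
    have h\<eta>: "h x = of_real t * \<eta> x" for x using t by (simp add: \<eta>_def)
    let ?T = "\<lambda>x. (cmod (u x) + cmod (\<eta> x)) powr (p + 2)"
    have iT: "integrable lborel ?T" by (intro integrable_powr_sum Lp u \<eta>) (use p in auto)
    have "(LINT x|lborel. ?T x) \<le> 2 powr (p + 2) * (U + (LINT x|lborel. cmod (\<eta> x) powr (p + 2)))"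
      unfolding U_def by (intro integrable_powr_sum Lp u \<eta>) (use p in auto)
    also have "\<dots> \<le> 2 powr (p + 2) * (U + C0)" using bd[OF \<eta>]
      by (intro mult_left_mono add_left_mono) auto
    finally have T: "(LINT x|lborel. ?T x) \<le> 2 powr (p + 2) * (U + C0)" .
    have ifh: "integrable lborel (\<lambda>x. of_real (cmod (u x) powr p) * u x * cnj (h x))"
    proof (rule Bochner_Integration.integrable_bound[OF iT])
      show "AE x in lborel. norm (of_real (cmod (u x) powr p) * u x * cnj (h x)) \<le> norm (?T x)"
      proof (intro AE_I2)
        fix x
        let ?S = "cmod (u x) + cmod (\<eta> x)"
        have "cmod (h x) \<le> cmod (\<eta> x)" using t unfolding h\<eta>
          by (simp add: norm_mult mult_left_le_one_le)
        then have "cmod (h x) \<le> ?S" using norm_ge_zero[of "u x"] by linarith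
        then have "cmod (u x) powr p * cmod (u x) * cmod (h x) \<le> ?S powr p * ?S * ?S"
          using p by (intro mult_mono powr_mono2) auto
        also have "\<dots> = ?T x" by (simp add: powr_add power2_eq_square)
        finally show "norm (of_real (cmod (u x) powr p) * u x * cnj (h x)) \<le> norm (?T x)"
          by (simp add: norm_mult)
      qed
    qed simp
    let ?r = "\<lambda>x. cmod (u x + h x) powr (p + 2) - cmod (u x) powr (p + 2) - (p + 2)
        * Re (of_real (cmod (u x) powr p) * u x * cnj (h x))"
    have iuh: "integrable lborel (\<lambda>x. cmod (u x + h x) powr (p + 2))"
      by (rule Lp[OF Hs_add[OF s(1) u h(1)]])
    have iRe: "integrable lborel (\<lambda>x. Re (of_real (cmod (u x) powr p) * u x * cnj (h x)))"
      by (rule integrable_Re[OF ifh])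
    have ir: "integrable lborel ?r"
      by (intro Bochner_Integration.integrable_diff integrable_mult_right iuh Lp u iRe)
    have rb: "\<bar>?r x\<bar> \<le> c * (t\<^sup>2 * ?T x)" for x
    proof -
      have "Re (of_real (cmod (u x) powr p) * u x * cnj (h x))
          = cmod (u x) powr p * Re (u x * cnj (h x))"
        by (simp add: algebra_simps)
      then show ?thesis
        using cmod_powr_expand[of p t "u x" "\<eta> x"] p(1) t unfolding h\<eta> c_def
        by (simp add: mult.assoc)
    qed
    have E: "(LINT x|lborel. cmod (u x + h x) powr (p + 2)) - U - (p + 2)
        * Re (LINT x|lborel. of_real (cmod (u x) powr p) * u x * cnj (h x)) = (LINT x|lborel. ?r x)"
    proof -
      have "(LINT x|lborel. ?r x) = (LINT x|lborel. cmod (u x + h x) powr (p + 2)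
          - cmod (u x) powr (p + 2))
          - (LINT x|lborel. (p + 2) * Re (of_real (cmod (u x) powr p) * u x * cnj (h x)))"
        by (rule Bochner_Integration.integral_diff[OF Bochner_Integration.integrable_diff[OF iuh
            Lp[OF u]] integrable_mult_right[OF iRe]])
      also have "(LINT x|lborel. cmod (u x + h x) powr (p + 2) - cmod (u x) powr (p + 2))
          = (LINT x|lborel. cmod (u x + h x) powr (p + 2)) - U"
        unfolding U_def by (rule Bochner_Integration.integral_diff[OF iuh Lp[OF u]])
      also have "(LINT x|lborel. (p + 2) * Re (of_real (cmod (u x) powr p) * u x * cnj (h x)))
          = (p + 2) * (LINT x|lborel. Re (of_real (cmod (u x) powr p) * u x * cnj (h x)))"
        by (rule integral_mult_right_zero)
      also have "(LINT x|lborel. Re (of_real (cmod (u x) powr p) * u x * cnj (h x)))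
          = Re (LINT x|lborel. of_real (cmod (u x) powr p) * u x * cnj (h x))"
        by (rule integral_Re[OF ifh])
      finally show ?thesis by (rule sym)
    qed
    have "\<bar>LINT x|lborel. ?r x\<bar> \<le> (LINT x|lborel. c * (t\<^sup>2 * ?T x))"
    proof (rule integral_abs_bound[THEN order_trans])
      show "(LINT x|lborel. \<bar>?r x\<bar>) \<le> (LINT x|lborel. c * (t\<^sup>2 * ?T x))"
        by (intro integral_mono integrable_abs ir integrable_mult_right iT rb)
    qed
    also have "\<dots> = c * (t\<^sup>2 * (LINT x|lborel. ?T x))" by simp
    also have "\<dots> \<le> c * (t\<^sup>2 * (2 powr (p + 2) * (U + C0)))" using T c0
      by (intro mult_left_mono) auto
    finally show "\<bar>(LINT x|lborel. cmod (u x + h x) powr (p + 2))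
        - (LINT x|lborel. cmod (u x) powr (p + 2))
      - (p + 2) * Re (LINT x|lborel. of_real (cmod (u x) powr p) * u x * cnj (h x))\<bar> \<le> c * (2 powr
          (p + 2) * (U + C0)) * t\<^sup>2"
      unfolding U_def[symmetric] E by (simp only: mult_ac)
  qed
qed

section \<open>The Hartree functional\<close>

text \<open>
  The exponents satisfy \<open>1 / r + 2 / a = 2\<close>; the left-hand side is a weighted geometric mean of the
  three summands on the right.
\<close>

lemma young_pointwise:
  fixes X Y k r a :: real
  assumes XY: "0 \<le> X" "0 \<le> Y" "0 \<le> k" and r: "1 \<le> r" and a: "a = 2 * r / (2 * r - 1)"
  shows "k * (X * Y) \<le> X powr a * Y powr a + X powr a * k powr r + Y powr a * k powr r"
proof (cases "X = 0 \<or> Y = 0 \<or> k = 0")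
  case False
  then have pos: "0 < X" "0 < Y" "0 < k" using XY by auto
  define P where "P = X powr a * Y powr a"
  define Q where "Q = X powr a * k powr r"
  define R where "R = Y powr a * k powr r"
  define M where "M = max P (max Q R)"
  \<comment> \<open>The weights satisfy \<open>\<theta> + 2 * \<phi> = 1\<close>,
    \<open>a * (\<theta> + \<phi>) = 1\<close> and \<open>2 * r * \<phi> = 1\<close>, so that the
    weighted geometric mean has exponent 1 in each of \<open>X\<close>, \<open>Y\<close> and
    \<open>k\<close>.\<close>
  define \<theta> where "\<theta> = 1 - 1 / r"
  define \<phi> where "\<phi> = 1 / (2 * r)"
  have th: "0 \<le> \<theta>" "0 \<le> \<phi>" "\<theta> + \<phi> + \<phi> = 1" "a * \<theta> + a * \<phi> = 1" "r * \<phi> + r * \<phi> = 1"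
  proof -
    have "\<theta> + \<phi> = (2 * r - 1) / (2 * r)" using r by (simp add: \<theta>_def \<phi>_def field_simps)
    then have "a * (\<theta> + \<phi>) = 1" using r by (simp add: a)
    then show "a * \<theta> + a * \<phi> = 1" by (simp add: distrib_left)
  qed (use r in \<open>simp_all add: \<theta>_def \<phi>_def field_simps\<close>)
  have nn: "0 < P" "0 < Q" "0 < R" using pos by (simp_all add: P_def Q_def R_def)
  have M: "P \<le> M" "Q \<le> M" "R \<le> M" "0 < M" using nn by (auto simp: M_def)
  have "P powr \<theta> * Q powr \<phi> * R powr \<phi> = X powr (a * \<theta> + a * \<phi>) * Y powr (a * \<theta> + a * \<phi>) * k powr (r
      * \<phi> + r * \<phi>)"
    unfolding P_def Q_def R_def by (simp only: powr_mult powr_powr powr_add mult_ac)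
  then have "k * (X * Y) = P powr \<theta> * Q powr \<phi> * R powr \<phi>"
    unfolding th using pos by (simp add: mult_ac)
  also have "\<dots> \<le> M powr \<theta> * M powr \<phi> * M powr \<phi>"
    using M nn th by (intro mult_mono powr_mono2) auto
  also have "\<dots> = M" using M(4) th(3) by (simp flip: powr_add)
  also have "M \<le> P + Q + R" using nn by (auto simp: M_def)
  finally show ?thesis by (simp add: P_def Q_def R_def)
qed (use XY in auto)

text \<open>Where \<open>norm (x - y) > 1\<close> the kernel is at most 1 and the product of the
  masses suffices; elsewhere \<open>young_pointwise\<close> splits the integrand into terms whose
  double integrals factor, the kernel contributing \<open>\<kappa>\<close> by translation
  invariance.\<close>

lemma young_convolution_bound:
  fixes f :: "'a::euclidean_space \<Rightarrow> real" and \<gamma> r a :: real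
  assumes [measurable]: "f \<in> borel_measurable borel" and f0: "\<And>x. 0 \<le> f x"
    and \<gamma>: "0 \<le> \<gamma>" and r: "1 \<le> r" "\<gamma> * r < real DIM('a)" and a: "a = 2 * r / (2 * r - 1)"
  defines "\<kappa> \<equiv> (\<integral>\<^sup>+z. ennreal (norm z powr (- (\<gamma> * r))) * indicator {z. norm z
      \<le> 1} z \<partial>(lborel :: 'a measure))"
  shows "(\<integral>\<^sup>+x. \<integral>\<^sup>+y. ennreal (norm (x - y) powr (- \<gamma>) * (f x * f y)) \<partial>lborel \<partial>lborel)
    \<le> (\<integral>\<^sup>+x. ennreal (f x) \<partial>lborel) * (\<integral>\<^sup>+x. ennreal (f x) \<partial>lborel)
      + (\<integral>\<^sup>+x. ennreal (f x powr a) \<partial>lborel) * (\<integral>\<^sup>+x. ennreal (f x powr a) \<partial>lborel)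
      + (\<integral>\<^sup>+x. ennreal (f x powr a) \<partial>lborel) * \<kappa> + (\<integral>\<^sup>+x. ennreal (f x powr a) \<partial>lborel) * \<kappa>"
proof -
  define \<rho> where "\<rho> = (\<lambda>z::'a. ennreal (norm z powr (- (\<gamma> * r))) * indicator {z. norm z \<le> 1} z)"
  have [measurable]: "\<rho> \<in> borel_measurable borel" unfolding \<rho>_def by measurable
  have \<kappa>: "(\<integral>\<^sup>+z. \<rho> z \<partial>lborel) = \<kappa>" by (simp add: \<rho>_def \<kappa>_def)
  define g where "g = (\<lambda>x. ennreal (f x))"
  define h where "h = (\<lambda>x. ennreal (f x powr a))"
  have [measurable]: "g \<in> borel_measurable borel" "h \<in> borel_measurable borel" unfolding g_def h_def
    by measurable
  have pt: "ennreal (norm (x - y) powr (- \<gamma>) * (f x * f y)) \<le> g x * g y + h x * h y + h x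
      * \<rho> (x - y) + h y * \<rho> (x - y)" for x y
  proof (cases "norm (x - y) \<le> 1")
    case True
    have "(norm (x - y) powr (- \<gamma>)) powr r = norm (x - y) powr (- (\<gamma> * r))" by (simp add: powr_powr)
    with young_pointwise[OF f0[of x] f0[of y] powr_ge_zero[of "norm (x - y)" "- \<gamma>"] r(1) a]
    have "norm (x - y) powr (- \<gamma>) * (f x * f y) \<le> f x powr a * f y powr a + f x powr a
        * norm (x - y) powr (- (\<gamma> * r)) + f y powr a * norm (x - y) powr (- (\<gamma> * r))"
      by simp
    then have "ennreal (norm (x - y) powr (- \<gamma>) * (f x * f y))
        \<le> ennreal (f x powr a * f y powr a + f x powr a * norm (x - y) powr (- (\<gamma> * r)) + f y powr a
        * norm (x - y) powr (- (\<gamma> * r)))"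
      by (rule ennreal_leI)
    also have "\<dots> = h x * h y + h x * \<rho> (x - y) + h y * \<rho> (x - y)"
      using True by (simp add: h_def \<rho>_def ennreal_mult)
    finally show ?thesis by (simp add: add.assoc add_increasing)
  next
    case False
    then have "x \<noteq> y" by auto
    have "norm (x - y) powr (- \<gamma>) \<le> norm (x - y) powr 0" using \<gamma> False by (intro powr_mono) auto
    also have "\<dots> = 1" using \<open>x \<noteq> y\<close> by simp
    finally have "norm (x - y) powr (- \<gamma>) \<le> 1" .
    then have "norm (x - y) powr (- \<gamma>) * (f x * f y) \<le> 1 * (f x * f y)"
      using f0 by (intro mult_right_mono) auto
    then have "ennreal (norm (x - y) powr (- \<gamma>) * (f x * f y)) \<le> ennreal (f x * f y)"
      by (simp add: ennreal_leI)
    also have "\<dots> = g x * g y" unfolding g_def using f0 by (intro ennreal_mult)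
    finally show ?thesis by (simp add: add.assoc add_increasing2)
  qed
  have \<rho>1: "(\<integral>\<^sup>+y. \<rho> (x - y) \<partial>lborel) = \<kappa>" for x
    using nn_integral_lborel_reflect[of \<rho> x] \<kappa> by simp
  have \<rho>2: "(\<integral>\<^sup>+x. \<rho> (x - y) \<partial>lborel) = \<kappa>" for y
    using nn_integral_lborel_shift[of \<rho> "- y"] \<kappa> by simp
  have swap: "(\<integral>\<^sup>+x. \<integral>\<^sup>+y. h y * \<rho> (x - y) \<partial>lborel \<partial>lborel)
      = (\<integral>\<^sup>+y. \<integral>\<^sup>+x. h y * \<rho> (x - y) \<partial>lborel \<partial>lborel)"
    by (rule lborel_pair.Fubini') measurable
  have "(\<integral>\<^sup>+x. \<integral>\<^sup>+y. ennreal (norm (x - y) powr (- \<gamma>) * (f x * f y)) \<partial>lborel \<partial>lborel)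
    \<le> (\<integral>\<^sup>+x. \<integral>\<^sup>+y. g x * g y + h x * h y + h x * \<rho> (x - y) + h y * \<rho> (x - y) \<partial>lborel \<partial>lborel)"
    by (intro nn_integral_mono pt)
  also have "\<dots> = (\<integral>\<^sup>+x. g x * (\<integral>\<^sup>+y. g y \<partial>lborel) + h x * (\<integral>\<^sup>+y. h y \<partial>lborel) + h x * \<kappa> + (\<integral>\<^sup>+y. h y
      * \<rho> (x - y) \<partial>lborel) \<partial>lborel)"
    by (simp add: nn_integral_add nn_integral_cmult \<rho>1)
  also have "\<dots> = (\<integral>\<^sup>+x. g x \<partial>lborel) * (\<integral>\<^sup>+x. g x \<partial>lborel) + (\<integral>\<^sup>+x. h x \<partial>lborel)
      * (\<integral>\<^sup>+x. h x \<partial>lborel)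
      + (\<integral>\<^sup>+x. h x \<partial>lborel) * \<kappa> + (\<integral>\<^sup>+x. \<integral>\<^sup>+y. h y * \<rho> (x - y) \<partial>lborel \<partial>lborel)"
    by (simp add: nn_integral_add nn_integral_multc)
  also have "(\<integral>\<^sup>+x. \<integral>\<^sup>+y. h y * \<rho> (x - y) \<partial>lborel \<partial>lborel) = (\<integral>\<^sup>+x. h x \<partial>lborel) * \<kappa>"
    unfolding swap by (simp add: nn_integral_cmult nn_integral_multc \<rho>2)
  finally show ?thesis by (simp add: g_def h_def)
qed

text \<open>The Riesz kernel on the product space, where Fubini and the exchange of variables apply;
  on the diagonal its value is 0 by the convention for \<open>powr\<close>.\<close>

definition riesz_pair :: "real \<Rightarrow> 'a::euclidean_space \<times> 'a \<Rightarrow> real" where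
  "riesz_pair \<gamma> z = norm (fst z - snd z) powr (- \<gamma>)"

lemma riesz_pair_measurable[measurable]: "riesz_pair \<gamma> \<in> borel_measurable (lborel \<Otimes>\<^sub>M lborel)"
  unfolding riesz_pair_def[abs_def] by measurable

lemma riesz_pair_nonneg: "0 \<le> riesz_pair \<gamma> z" by (simp add: riesz_pair_def)

text \<open>\<open>fourier\<close> of the zero function is a chosen representative that vanishes
  almost everywhere, hence the detour through Plancherel.\<close>

lemma Hs_zero: "0 < s \<Longrightarrow> (\<lambda>_::'a::euclidean_space. 0) \<in> Hs s" "Hs_norm s (\<lambda>_::'a. 0) = 0"
proof -
  have L: "(\<lambda>_::'a. 0) \<in> Lspace 2" by (simp add: Lspace2_iff l2sq_def)
  have "fourier (\<lambda>_::'a. 0::complex) \<in> borel_measurable borel" using L by (rule fourier_measurable)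
  moreover have "l2sq (fourier (\<lambda>_::'a. 0::complex)) = 0" using plancherel[OF L]
    by (simp add: l2sq_def)
  ultimately have F: "AE \<xi> in lborel. fourier (\<lambda>_::'a. 0::complex) \<xi> = 0"
    by (simp add: l2sq_eq_0_iff)
  have [measurable]: "fourier (\<lambda>_::'a. 0::complex) \<in> borel_measurable borel" by fact
  have eq: "weighted_ip (hs_weight s) (fourier (\<lambda>_::'a. 0)) (fourier (\<lambda>_::'a. 0))
      = weighted_ip (hs_weight s) (\<lambda>_::'a. 0) (\<lambda>_. 0)"
    by (intro weighted_ip_cong F) auto
  then have "(Hs_norm s (\<lambda>_::'a. 0))\<^sup>2 = 0" unfolding Hs_norm_sq by (simp add: weighted_ip_def)
  then show "Hs_norm s (\<lambda>_::'a. 0) = 0" by simp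
  have "AE \<xi> in lborel. 0 = fourier (\<lambda>_::'a. 0::complex) \<xi>" using F by eventually_elim simp
  moreover have "(\<lambda>_::'a. 0) \<in> weighted_L2 (hs_weight s)" by (simp add: weighted_L2_def)
  ultimately have "fourier (\<lambda>_::'a. 0::complex) \<in> weighted_L2 (hs_weight s)"
    by (rule weighted_L2_cong) auto
  then show "(\<lambda>_::'a. 0) \<in> Hs s" using L by (simp add: Hs_iff)
qed

text \<open>
  For \<open>r = max 1 (N / (4 s))\<close> the exponent \<open>2 a\<close> does not exceed the Sobolev exponent, and
  \<open>\<gamma> r < N\<close> keeps the singular part of the kernel in \<open>L\<^sup>r\<close>.
\<close>

lemma hartree_quartic_bound:
  fixes u :: "'a::euclidean_space \<Rightarrow> complex" and s \<gamma> :: real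
  assumes s: "0 < s" "s < 1" and N: "2 * s < real DIM('a)"
    and \<gamma>: "0 < \<gamma>" "\<gamma> < real DIM('a)" "\<gamma> < 4 * s" and u: "u \<in> Hs s"
  shows "\<exists>C\<ge>0. \<forall>\<eta>. \<eta> \<in> Hs s \<longrightarrow>
     integrable (lborel \<Otimes>\<^sub>M lborel) (\<lambda>z. riesz_pair \<gamma> z * ((cmod (u (fst z)) + cmod (\<eta> (fst z)))\<^sup>2 *
         (cmod (u (snd z)) + cmod (\<eta> (snd z)))\<^sup>2))
    \<and> (Hs_norm s \<eta> \<le> 1 \<longrightarrow> (LINT z|(lborel \<Otimes>\<^sub>M lborel). riesz_pair \<gamma> z * ((cmod (u (fst z)) + cmod (\<eta>
        (fst z)))\<^sup>2 * (cmod (u (snd z)) + cmod (\<eta> (snd z)))\<^sup>2)) \<le> C)"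
proof -
  define r where "r = max 1 (real DIM('a) / (4 * s))"
  define a where "a = 2 * r / (2 * r - 1)"
  have r1: "1 \<le> r" by (simp add: r_def)
  have rN: "real DIM('a) \<le> 4 * s * r" using s by (simp add: r_def max_def field_simps)
  have r2: "\<gamma> * r < real DIM('a)"
  proof (cases "real DIM('a) / (4 * s) \<le> 1")
    case False
    then have "\<gamma> * r = \<gamma> / (4 * s) * real DIM('a)" by (simp add: r_def)
    also have "\<dots> < 1 * real DIM('a)" using \<gamma> s
      by (intro mult_strict_right_mono) (auto simp: field_simps)
    finally show ?thesis by simp
  qed (use \<gamma> in \<open>simp add: r_def max_def\<close>)
  have a2: "2 \<le> 2 * a" using r1 by (simp add: a_def field_simps)
  \<comment> \<open>After clearing denominators this is exactly
    \<open>real DIM('a) \<le> 4 * s * r\<close>, the reason for the second entry of the maximum in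
    \<open>r\<close>.\<close>
  have aN: "2 * a * (real DIM('a) - 2 * s) \<le> 2 * real DIM('a)"
  proof -
    have "4 * r * (real DIM('a) - 2 * s) \<le> 2 * real DIM('a) * (2 * r - 1)" using rN
      by (simp add: algebra_simps)
    then show ?thesis using r1 by (simp add: a_def field_simps)
  qed
  define \<kappa> where "\<kappa> = (\<integral>\<^sup>+z. ennreal (norm z powr (- (\<gamma> * r))) * indicator {z. norm z
      \<le> 1} z \<partial>(lborel :: 'a measure))"
  have "\<kappa> < \<infinity>" unfolding \<kappa>_def by (rule nn_integral_norm_powr_inside[OF r2])
  then obtain k where k: "\<kappa> = ennreal k" "0 \<le> k" by (cases \<kappa>) auto
  obtain Ca where Ca: "0 \<le> Ca" and ia: "\<And>v :: 'a \<Rightarrow> complex. v \<in> Hs s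
      \<Longrightarrow> integrable lborel (\<lambda>x. cmod (v x) powr (2 * a))"
    and ba: "\<And>v :: 'a \<Rightarrow> complex. v \<in> Hs s \<Longrightarrow> Hs_norm s v \<le> 1
        \<Longrightarrow> (LINT x|lborel. cmod (v x) powr (2 * a)) \<le> Ca"
    using Hs_Lp_bound[OF s N a2 aN] by blast
  have e2: "2 * (real DIM('a) - 2 * s) \<le> 2 * real DIM('a)" using s by simp
  obtain C2 where C2: "0 \<le> C2" and i2: "\<And>v :: 'a \<Rightarrow> complex. v \<in> Hs s
      \<Longrightarrow> integrable lborel (\<lambda>x. cmod (v x) powr 2)"
    and b2: "\<And>v :: 'a \<Rightarrow> complex. v \<in> Hs s \<Longrightarrow> Hs_norm s v \<le> 1 \<Longrightarrow> (LINT x|lborel. cmod (v x) powr 2)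
        \<le> C2"
    using Hs_Lp_bound[OF s N order_refl e2] by blast
  have [measurable]: "u \<in> borel_measurable borel" using u by (rule Hs_measurable)
  \<comment> \<open>The right-hand side of \<open>young_convolution_bound\<close> as a function of
    the two integrals; it is increasing in both on nonnegative arguments.\<close>
  define G where "G = (\<lambda>F1 Fa. F1 * F1 + Fa * Fa + Fa * k + Fa * k :: real)"
  define B1 where "B1 = 2 powr 2 * ((LINT x|lborel. cmod (u x) powr 2) + C2)"
  define Ba where "Ba = 2 powr (2 * a) * ((LINT x|lborel. cmod (u x) powr (2 * a)) + Ca)"
  have B0: "0 \<le> B1" "0 \<le> Ba" using C2 Ca by (auto simp: B1_def Ba_def integral_nonneg_AE)
  show ?thesis
  proof (intro exI[of _ "G B1 Ba"] conjI allI impI)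
    show "0 \<le> G B1 Ba" using B0 k by (simp add: G_def)
    fix \<eta> :: "'a \<Rightarrow> complex" assume \<eta>: "\<eta> \<in> Hs s"
    have [measurable]: "\<eta> \<in> borel_measurable borel" using \<eta> by (rule Hs_measurable)
    define f where "f = (\<lambda>x. (cmod (u x) + cmod (\<eta> x))\<^sup>2)"
    have [measurable]: "f \<in> borel_measurable borel" unfolding f_def by measurable
    have f0: "0 \<le> f x" for x by (simp add: f_def)
    have fp: "f x = (cmod (u x) + cmod (\<eta> x)) powr 2" "f x powr a
        = (cmod (u x) + cmod (\<eta> x)) powr (2 * a)" for x
    proof -
      show fx: "f x = (cmod (u x) + cmod (\<eta> x)) powr 2" by (simp add: f_def)
      show "f x powr a = (cmod (u x) + cmod (\<eta> x)) powr (2 * a)" unfolding fx powr_powr by simp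
    qed
    have if1: "integrable lborel f" unfolding fp(1)[abs_def]
      by (intro integrable_powr_sum i2 u \<eta>) auto
    have ifa: "integrable lborel (\<lambda>x. f x powr a)" unfolding fp(2)
      by (intro integrable_powr_sum ia u \<eta>) (use a2 in auto)
    define F1 where "F1 = (LINT x|lborel. f x)"
    define Fa where "Fa = (LINT x|lborel. f x powr a)"
    have F0: "0 \<le> F1" "0 \<le> Fa" by (auto simp: F1_def Fa_def f0 integral_nonneg_AE)
    have n1: "(\<integral>\<^sup>+x. ennreal (f x) \<partial>lborel) = ennreal F1" unfolding F1_def
      by (rule nn_integral_eq_integral[OF if1]) (simp add: f0)
    have na: "(\<integral>\<^sup>+x. ennreal (f x powr a) \<partial>lborel) = ennreal Fa" unfolding Fa_def
      by (rule nn_integral_eq_integral[OF ifa]) simp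
    let ?P = "\<lambda>z. riesz_pair \<gamma> z * (f (fst z) * f (snd z))"
    have "(\<integral>\<^sup>+z. ennreal (?P z) \<partial>(lborel \<Otimes>\<^sub>M lborel))
        = (\<integral>\<^sup>+x. \<integral>\<^sup>+y. ennreal (norm (x - y) powr (- \<gamma>) * (f x * f y)) \<partial>lborel \<partial>lborel)"
      by (subst lborel.nn_integral_fst[symmetric]) (auto simp: riesz_pair_def)
    also have "\<dots> \<le> ennreal F1 * ennreal F1 + ennreal Fa * ennreal Fa + ennreal Fa * ennreal k
        + ennreal Fa * ennreal k"
      using young_convolution_bound[of f \<gamma> r a] f0 \<gamma>(1) r1 r2 unfolding n1 na \<kappa>_def[symmetric] k(1)
      by (simp add: a_def)
    also have "\<dots> = ennreal (G F1 Fa)"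
      by (simp only: G_def ennreal_plus ennreal_mult add_nonneg_nonneg mult_nonneg_nonneg F0 k(2))
    finally have nP: "(\<integral>\<^sup>+z. ennreal (?P z) \<partial>(lborel \<Otimes>\<^sub>M lborel)) \<le> ennreal (G F1 Fa)" .
    have P0: "0 \<le> ?P z" for z using f0 by (simp add: riesz_pair_nonneg)
    have iP: "integrable (lborel \<Otimes>\<^sub>M lborel) ?P"
      using le_less_trans[OF nP] P0 by (intro integrableI_bounded) auto
    then show "integrable (lborel \<Otimes>\<^sub>M lborel) (\<lambda>z. riesz_pair \<gamma> z * ((cmod (u (fst z))
        + cmod (\<eta> (fst z)))\<^sup>2 * (cmod (u (snd z)) + cmod (\<eta> (snd z)))\<^sup>2))"
      by (simp add: f_def)
    assume n: "Hs_norm s \<eta> \<le> 1"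
    have "F1 \<le> 2 powr 2 * ((LINT x|lborel. cmod (u x) powr 2) + (LINT x|lborel. cmod (\<eta> x) powr 2))"
      unfolding F1_def fp(1) by (intro integrable_powr_sum i2 u \<eta>) auto
    also have "\<dots> \<le> B1" unfolding B1_def using b2[OF \<eta> n]
      by (intro mult_left_mono add_left_mono) auto
    finally have F1: "F1 \<le> B1" .
    have "Fa \<le> 2 powr (2 * a) * ((LINT x|lborel. cmod (u x) powr (2 * a))
        + (LINT x|lborel. cmod (\<eta> x) powr (2 * a)))"
      unfolding Fa_def fp(2) by (intro integrable_powr_sum ia u \<eta>) (use a2 in auto)
    also have "\<dots> \<le> Ba" unfolding Ba_def using ba[OF \<eta> n]
      by (intro mult_left_mono add_left_mono) auto
    finally have Fa: "Fa \<le> Ba" .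
    have "ennreal (LINT z|(lborel \<Otimes>\<^sub>M lborel). ?P z) = (\<integral>\<^sup>+z. ennreal (?P z) \<partial>(lborel \<Otimes>\<^sub>M lborel))"
      by (rule nn_integral_eq_integral[symmetric, OF iP]) (use P0 in auto)
    also have "\<dots> \<le> ennreal (G F1 Fa)" by (rule nP)
    also have "\<dots> \<le> ennreal (G B1 Ba)"
      unfolding G_def using F1 Fa F0 k(2) B0 by (intro ennreal_leI add_mono mult_mono) auto
    finally have "(LINT z|(lborel \<Otimes>\<^sub>M lborel). ?P z) \<le> G B1 Ba"
      using B0 k by (subst (asm) ennreal_le_iff) (auto simp: G_def)
    then show "(LINT z|(lborel \<Otimes>\<^sub>M lborel). riesz_pair \<gamma> z * ((cmod (u (fst z))
        + cmod (\<eta> (fst z)))\<^sup>2 * (cmod (u (snd z)) + cmod (\<eta> (snd z)))\<^sup>2)) \<le> G B1 Ba"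
      by (simp add: f_def)
  qed
qed

text \<open>Each squared modulus is its value at \<open>t = 0\<close> plus a part \<open>x1\<close>
  of order \<open>t\<close> and a part \<open>x2\<close> of order \<open>t\<^sup>2\<close>. Six
  products remain after the constant and linear terms; their constants 4, 1, 1, 2, 2, 1 add up to
  11.\<close>

lemma quartic_remainder:
  fixes a b \<alpha> \<beta> :: complex and t :: real
  assumes t: "0 \<le> t" "t \<le> 1"
  defines "A \<equiv> (cmod a + cmod \<alpha>)\<^sup>2" and "B \<equiv> (cmod b + cmod \<beta>)\<^sup>2"
  shows "\<bar>(cmod (a + of_real t * \<alpha>))\<^sup>2 * (cmod (b + of_real t * \<beta>))\<^sup>2 - (cmod a)\<^sup>2 * (cmod b)\<^sup>2
    - (2 * Re (a * cnj (of_real t * \<alpha>)) * (cmod b)\<^sup>2 + 2 * Re (b * cnj (of_real t * \<beta>)) * (cmod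
        a)\<^sup>2)\<bar> \<le> 11 * (t\<^sup>2 * (A * B))"
proof -
  have ex: "\<exists>x1 x2. (cmod (c + of_real t * \<delta>))\<^sup>2 = (cmod c)\<^sup>2 + x1 + x2 \<and> x1
      = 2 * Re (c * cnj (of_real t * \<delta>))
    \<and> \<bar>x1\<bar> \<le> 2 * t * (cmod c + cmod \<delta>)\<^sup>2 \<and> 0 \<le> x2 \<and> x2 \<le> t\<^sup>2 * (cmod c + cmod
        \<delta>)\<^sup>2" for c \<delta> :: complex
  proof (intro exI conjI)
    show "(cmod (c + of_real t * \<delta>))\<^sup>2 = (cmod c)\<^sup>2 + 2 * Re (c * cnj (of_real t * \<delta>)) + t\<^sup>2
        * (cmod \<delta>)\<^sup>2"
      unfolding cmod_power2 by (simp add: power2_eq_square algebra_simps)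
    have "\<bar>Re (c * cnj (of_real t * \<delta>))\<bar> \<le> cmod (c * cnj (of_real t * \<delta>))" by (rule abs_Re_le_cmod)
    also have "\<dots> = t * (cmod c * cmod \<delta>)" using t by (simp add: norm_mult)
    also have "\<dots> \<le> t * (cmod c + cmod \<delta>)\<^sup>2"
      using t by (intro mult_left_mono) (auto simp: power2_eq_square algebra_simps)
    finally show "\<bar>2 * Re (c * cnj (of_real t * \<delta>))\<bar> \<le> 2 * t * (cmod c + cmod \<delta>)\<^sup>2" by simp
    show "t\<^sup>2 * (cmod \<delta>)\<^sup>2 \<le> t\<^sup>2 * (cmod c + cmod \<delta>)\<^sup>2" by (intro mult_left_mono power_mono) auto
  qed auto
  obtain x1 x2 where x: "(cmod (a + of_real t * \<alpha>))\<^sup>2 = (cmod a)\<^sup>2 + x1 + x2" "x1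
      = 2 * Re (a * cnj (of_real t * \<alpha>))"
    "\<bar>x1\<bar> \<le> 2 * t * A" "0 \<le> x2" "x2 \<le> t\<^sup>2 * A" using ex[of a \<alpha>] unfolding A_def by blast
  obtain y1 y2 where y: "(cmod (b + of_real t * \<beta>))\<^sup>2 = (cmod b)\<^sup>2 + y1 + y2" "y1
      = 2 * Re (b * cnj (of_real t * \<beta>))"
    "\<bar>y1\<bar> \<le> 2 * t * B" "0 \<le> y2" "y2 \<le> t\<^sup>2 * B" using ex[of b \<beta>] unfolding B_def by blast
  have A: "(cmod a)\<^sup>2 \<le> A" "0 \<le> A" unfolding A_def by (auto intro: power_mono)
  have B: "(cmod b)\<^sup>2 \<le> B" "0 \<le> B" unfolding B_def by (auto intro: power_mono)
  have t2: "0 \<le> t\<^sup>2" "t * t\<^sup>2 \<le> t\<^sup>2" "t\<^sup>2 * t\<^sup>2 \<le> t\<^sup>2"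
  proof -
    have "t\<^sup>2 \<le> 1" using t by (simp add: power_le_one)
    then show "t\<^sup>2 * t\<^sup>2 \<le> t\<^sup>2" by (intro mult_left_le) auto
    show "t * t\<^sup>2 \<le> t\<^sup>2" using t by (intro mult_left_le_one_le) auto
  qed auto
  have AB: "0 \<le> A * B" using A B by simp
  have m: "\<bar>p * q\<bar> \<le> c * d" if "\<bar>p\<bar> \<le> c" "\<bar>q\<bar> \<le> d" for p q c d :: real
    unfolding abs_mult using that abs_ge_zero[of p] abs_ge_zero[of q] by (intro mult_mono) linarith+
  have e1: "\<bar>x1 * y1\<bar> \<le> 4 * (t\<^sup>2 * (A * B))" using m[OF x(3) y(3)]
    by (simp add: power2_eq_square mult_ac)
  have e2: "\<bar>x2 * (cmod b)\<^sup>2\<bar> \<le> t\<^sup>2 * (A * B)" using m[of x2 "t\<^sup>2 * A" "(cmod b)\<^sup>2" B] x B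
    by (simp add: mult_ac)
  have e3: "\<bar>y2 * (cmod a)\<^sup>2\<bar> \<le> t\<^sup>2 * (A * B)" using m[of y2 "t\<^sup>2 * B" "(cmod a)\<^sup>2" A] y A
    by (simp add: mult_ac)
  have e4: "\<bar>x1 * y2\<bar> \<le> 2 * (t\<^sup>2 * (A * B))"
  proof -
    have "\<bar>x1 * y2\<bar> \<le> 2 * t * A * (t\<^sup>2 * B)" using m[OF x(3), of y2 "t\<^sup>2 * B"] y by simp
    also have "\<dots> = 2 * ((t * t\<^sup>2) * (A * B))" by (simp add: mult_ac)
    also have "\<dots> \<le> 2 * (t\<^sup>2 * (A * B))" using t2 AB by (intro mult_left_mono mult_right_mono) auto
    finally show ?thesis .
  qed
  have e5: "\<bar>x2 * y1\<bar> \<le> 2 * (t\<^sup>2 * (A * B))"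
  proof -
    have "\<bar>x2 * y1\<bar> \<le> t\<^sup>2 * A * (2 * t * B)" using m[of x2 "t\<^sup>2 * A", OF _ y(3)] x by simp
    also have "\<dots> = 2 * ((t * t\<^sup>2) * (A * B))" by (simp add: mult_ac)
    also have "\<dots> \<le> 2 * (t\<^sup>2 * (A * B))" using t2 AB by (intro mult_left_mono mult_right_mono) auto
    finally show ?thesis .
  qed
  have e6: "\<bar>x2 * y2\<bar> \<le> t\<^sup>2 * (A * B)"
  proof -
    have "\<bar>x2 * y2\<bar> \<le> t\<^sup>2 * A * (t\<^sup>2 * B)" using m[of x2 "t\<^sup>2 * A" y2 "t\<^sup>2 * B"] x y by simp
    also have "\<dots> = (t\<^sup>2 * t\<^sup>2) * (A * B)" by (simp add: mult_ac)
    also have "\<dots> \<le> t\<^sup>2 * (A * B)" using t2 AB by (intro mult_right_mono) auto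
    finally show ?thesis .
  qed
  have "(cmod (a + of_real t * \<alpha>))\<^sup>2 * (cmod (b + of_real t * \<beta>))\<^sup>2 - (cmod a)\<^sup>2 * (cmod b)\<^sup>2
    - (2 * Re (a * cnj (of_real t * \<alpha>)) * (cmod b)\<^sup>2 + 2 * Re (b * cnj (of_real t * \<beta>)) * (cmod
        a)\<^sup>2)
    = x1 * y1 + x2 * (cmod b)\<^sup>2 + y2 * (cmod a)\<^sup>2 + x1 * y2 + x2 * y1 + x2 * y2"
    unfolding x(1) y(1) x(2)[symmetric] y(2)[symmetric] by (simp add: algebra_simps)
  then show ?thesis using e1 e2 e3 e4 e5 e6 by linarith
qed

context
  fixes s \<gamma> :: real
  assumes s: "0 < s" "s < 1" and \<gamma>: "0 < \<gamma>" "\<gamma> < 4 * s"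
begin

text \<open>The quartic bound with \<open>\<eta> = 0\<close> gives integrability on the product
  space, and Fubini then identifies the iterated integral in \<open>hartree_D\<close>.\<close>

lemma hartree_integrable:
  fixes u :: "'a::euclidean_space \<Rightarrow> complex"
  assumes N: "2 * s < real DIM('a)" "\<gamma> < real DIM('a)" and u: "u \<in> Hs s"
  shows "integrable (lborel \<Otimes>\<^sub>M lborel) (\<lambda>z. riesz_pair \<gamma> z * ((cmod (u (fst z)))\<^sup>2
      * (cmod (u (snd z)))\<^sup>2))"
    and "hartree_D \<gamma> u = (LINT z|(lborel \<Otimes>\<^sub>M lborel). riesz_pair \<gamma> z * ((cmod (u (fst z)))\<^sup>2
        * (cmod (u (snd z)))\<^sup>2))"
proof -
  show i: "integrable (lborel \<Otimes>\<^sub>M lborel) (\<lambda>z. riesz_pair \<gamma> z * ((cmod (u (fst z)))\<^sup>2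
      * (cmod (u (snd z)))\<^sup>2))"
  proof -
    have "integrable (lborel \<Otimes>\<^sub>M lborel) (\<lambda>z. riesz_pair \<gamma> z * ((cmod (u (fst z))
        + cmod (0::complex))\<^sup>2 * (cmod (u (snd z)) + cmod (0::complex))\<^sup>2))"
      using hartree_quartic_bound[OF s N(1) \<gamma>(1) N(2) \<gamma>(2) u] Hs_zero(1)[OF s(1), where 'a='a]
      by blast
    then show ?thesis by simp
  qed
  have "hartree_D \<gamma> u = (LINT x|lborel. LINT y|lborel. riesz_pair \<gamma> (x, y) * ((cmod (u x))\<^sup>2
      * (cmod (u y))\<^sup>2))"
    unfolding hartree_D_def riesz_conv_def integral_mult_left_zero[symmetric]
    by (simp add: riesz_pair_def mult_ac)
  also have "\<dots> = (LINT z|(lborel \<Otimes>\<^sub>M lborel). riesz_pair \<gamma> z * ((cmod (u (fst z)))\<^sup>2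
      * (cmod (u (snd z)))\<^sup>2))"
    using lborel_pair.integral_fst'[OF i] by simp
  finally show "hartree_D \<gamma> u = (LINT z|(lborel \<Otimes>\<^sub>M lborel). riesz_pair \<gamma> z * ((cmod (u (fst z)))\<^sup>2
      * (cmod (u (snd z)))\<^sup>2))" .
qed

text \<open>The kernel is strictly positive off the diagonal, and for fixed \<open>x\<close> the
  diagonal is a single point.\<close>

lemma hartree_pos:
  fixes u :: "'a::euclidean_space \<Rightarrow> complex"
  assumes N: "2 * s < real DIM('a)" "\<gamma> < real DIM('a)" and u: "u \<in> Hs s"
      and nz: "\<not> (AE x in lborel. u x = 0)"
  shows "0 < hartree_D \<gamma> u"
proof (rule ccontr)
  have [measurable]: "u \<in> borel_measurable borel" using u by (rule Hs_measurable)
  let ?P = "\<lambda>z. riesz_pair \<gamma> z * ((cmod (u (fst z)))\<^sup>2 * (cmod (u (snd z)))\<^sup>2)"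
  note i = hartree_integrable(1)[OF N u]
  assume "\<not> 0 < hartree_D \<gamma> u"
  moreover have "0 \<le> hartree_D \<gamma> u"
    unfolding hartree_integrable(2)[OF N u]
    by (intro integral_nonneg_AE) (simp add: riesz_pair_nonneg)
  ultimately have "(LINT z|(lborel \<Otimes>\<^sub>M lborel). ?P z) = 0"
    unfolding hartree_integrable(2)[OF N u] by simp
  then have "AE z in lborel \<Otimes>\<^sub>M lborel. ?P z = 0"
    by (subst (asm) integral_nonneg_eq_0_iff_AE[OF i]) (auto simp: riesz_pair_nonneg)
  then have "AE x in lborel. AE y in lborel. ?P (x, y) = 0"
    by (rule lborel_pair.AE_pair)
  then have "AE x in lborel. u x = 0"
  proof eventually_elim
    case (elim x)
    show "u x = 0"
    proof (rule ccontr)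
      assume ux: "u x \<noteq> 0"
      have "AE y in lborel. u y = 0"
        using elim AE_lborel_singleton[of x]
      proof eventually_elim
        case (elim y)
        then have "riesz_pair \<gamma> (x, y) \<noteq> 0" by (simp add: riesz_pair_def)
        then show ?case using elim ux by simp
      qed
      then show False using nz by simp
    qed
  qed
  then show False using nz by simp
qed

text \<open>The first variation of the double integral has one term per variable. The kernel is
  symmetric, so exchanging the variables shows that the two agree, whence the factor
  \<open>4 = 2 + 2\<close>.\<close>

lemma hartree_expand:
  fixes u :: "'a::euclidean_space \<Rightarrow> complex"
  assumes N: "2 * s < real DIM('a)" "\<gamma> < real DIM('a)" and u: "u \<in> Hs s"
  shows "\<exists>C\<ge>0. \<forall>t h. 0 < t \<longrightarrow> t \<le> 1 \<longrightarrow> h \<in> Hs s \<longrightarrow> Hs_norm s h \<le> t \<longrightarrow>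
    \<bar>hartree_D \<gamma> (\<lambda>x. u x + h x) - hartree_D \<gamma> u
      - 4 * Re (LINT x|lborel. of_real (riesz_conv \<gamma> u x) * u x * cnj (h x))\<bar> \<le> C * t\<^sup>2"
proof -
  let ?LL = "lborel \<Otimes>\<^sub>M lborel :: ('a \<times> 'a) measure"
  let ?T = "\<lambda>\<eta> z. riesz_pair \<gamma> z * ((cmod (u (fst z)) + cmod (\<eta> (fst z)))\<^sup>2 * (cmod (u (snd z))
      + cmod (\<eta> (snd z)))\<^sup>2)"
  obtain C where C: "0 \<le> C" and iT: "\<And>\<eta>. \<eta> \<in> Hs s \<Longrightarrow> integrable ?LL (?T \<eta>)"
    and bT: "\<And>\<eta>. \<eta> \<in> Hs s \<Longrightarrow> Hs_norm s \<eta> \<le> 1 \<Longrightarrow> (LINT z|?LL. ?T \<eta> z) \<le> C"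
    using hartree_quartic_bound[OF s N(1) \<gamma>(1) N(2) \<gamma>(2) u] by blast
  have [measurable]: "u \<in> borel_measurable borel" using u by (rule Hs_measurable)
  show ?thesis
  proof (intro exI[of _ "11 * C"] conjI allI impI)
    show "0 \<le> 11 * C" using C by simp
    fix t :: real and h :: "'a \<Rightarrow> complex"
    assume t: "0 < t" "t \<le> 1" and h: "h \<in> Hs s" "Hs_norm s h \<le> t"
    have [measurable]: "h \<in> borel_measurable borel" using h by (intro Hs_measurable)
    define \<eta> where "\<eta> = (\<lambda>x. of_real (1 / t) * h x)"
    have \<eta>: "\<eta> \<in> Hs s" "Hs_norm s \<eta> \<le> 1" unfolding \<eta>_def using Hs_normalize[OF s(1) h t(1)] by auto
    have h\<eta>: "h x = of_real t * \<eta> x" for x using t by (simp add: \<eta>_def)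
    let ?G = "\<lambda>z. of_real (riesz_pair \<gamma> z * (cmod (u (snd z)))\<^sup>2) * (u (fst z) * cnj (h (fst z)))"
    have Gm: "?G \<in> borel_measurable ?LL" by measurable
    have iG: "integrable ?LL ?G"
    proof (rule Bochner_Integration.integrable_bound[OF iT[OF h(1)] Gm])
      show "AE z in ?LL. norm (?G z) \<le> norm (?T h z)"
      proof (intro AE_I2)
        fix z :: "'a \<times> 'a"
        have "cmod (u (fst z)) * cmod (h (fst z)) \<le> (cmod (u (fst z)) + cmod (h (fst z)))\<^sup>2"
          by (simp add: power2_eq_square algebra_simps)
        moreover have "(cmod (u (snd z)))\<^sup>2 \<le> (cmod (u (snd z)) + cmod (h (snd z)))\<^sup>2"
          by (intro power_mono) auto
        ultimately have "riesz_pair \<gamma> z * ((cmod (u (fst z)) * cmod (h (fst z)))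
            * (cmod (u (snd z)))\<^sup>2) \<le> ?T h z"
          by (intro mult_left_mono mult_mono) (auto simp: riesz_pair_nonneg)
        moreover have "norm (?G z) = riesz_pair \<gamma> z * ((cmod (u (fst z)) * cmod (h (fst z)))
            * (cmod (u (snd z)))\<^sup>2)"
          by (simp only: norm_mult norm_of_real abs_mult abs_power2 complex_mod_cnj abs_of_nonneg[OF
              riesz_pair_nonneg] mult_ac)
        ultimately show "norm (?G z) \<le> norm (?T h z)" using abs_ge_self[of "?T h z"] by simp
      qed
    qed
    have LG: "(LINT x|lborel. of_real (riesz_conv \<gamma> u x) * u x * cnj (h x)) = (LINT z|?LL. ?G z)"
    proof -
      have "(LINT x|lborel. of_real (riesz_conv \<gamma> u x) * u x * cnj (h x))
          = (LINT x|lborel. LINT y|lborel. ?G (x, y))"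
        unfolding riesz_conv_def integral_complex_of_real[symmetric] mult.assoc
            integral_mult_left_zero[symmetric]
        by (simp add: riesz_pair_def)
      then show ?thesis using lborel_pair.integral_fst'[OF iG] by simp
    qed
    let ?g = "\<lambda>z. Re (?G z)"
    have ig: "integrable ?LL ?g" by (rule integrable_Re[OF iG])
    have Lg: "Re (LINT z|?LL. ?G z) = (LINT z|?LL. ?g z)" by (rule integral_Re[symmetric, OF iG])
    let ?g' = "\<lambda>z. ?g (snd z, fst z)"
    have gm: "?g \<in> borel_measurable ?LL" using ig by auto
    have ig': "integrable ?LL ?g'" using lborel_pair.integrable_product_swap[OF ig]
      by (simp only: case_prod_unfold)
    have Lg': "(LINT z|?LL. ?g' z) = (LINT z|?LL. ?g z)"
      using lborel_pair.integral_product_swap[OF gm] by (simp only: case_prod_unfold)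
    let ?D = "\<lambda>v z. riesz_pair \<gamma> z * ((cmod (v (fst z)))\<^sup>2 * (cmod (v (snd z)))\<^sup>2)"
    have uh: "(\<lambda>x. u x + h x) \<in> Hs s" by (rule Hs_add[OF s(1) u h(1)])
    note iD = hartree_integrable(1)[OF N u] hartree_integrable(1)[OF N uh]
    let ?r = "\<lambda>z. ?D (\<lambda>x. u x + h x) z - ?D u z - (2 * ?g z + 2 * ?g' z)"
    have ir: "integrable ?LL ?r"
      by (intro Bochner_Integration.integrable_diff Bochner_Integration.integrable_add
          integrable_mult_right iD ig ig')
    have E: "hartree_D \<gamma> (\<lambda>x. u x + h x) - hartree_D \<gamma> u - 4
        * Re (LINT x|lborel. of_real (riesz_conv \<gamma> u x) * u x * cnj (h x)) = (LINT z|?LL. ?r z)"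
    proof -
      have "(LINT z|?LL. ?r z) = (LINT z|?LL. ?D (\<lambda>x. u x + h x) z - ?D u z) - (LINT z|?LL. 2 * ?g z
          + 2 * ?g' z)"
        by (intro Bochner_Integration.integral_diff Bochner_Integration.integrable_diff
            Bochner_Integration.integrable_add integrable_mult_right iD ig ig')
      also have "(LINT z|?LL. ?D (\<lambda>x. u x + h x) z - ?D u z) = hartree_D \<gamma> (\<lambda>x. u x + h x)
          - hartree_D \<gamma> u"
        unfolding hartree_integrable(2)[OF N u] hartree_integrable(2)[OF N uh]
        by (rule Bochner_Integration.integral_diff[OF iD(2) iD(1)])
      also have "(LINT z|?LL. 2 * ?g z + 2 * ?g' z) = (LINT z|?LL. 2 * ?g z) + (LINT z|?LL. 2
          * ?g' z)"
        by (intro Bochner_Integration.integral_add integrable_mult_right ig ig')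
      also have "(LINT z|?LL. 2 * ?g z) = 2 * (LINT z|?LL. ?g z)" by (rule integral_mult_right_zero)
      also have "(LINT z|?LL. 2 * ?g' z) = 2 * (LINT z|?LL. ?g z)" unfolding Lg'[symmetric]
        by (rule integral_mult_right_zero)
      finally show ?thesis unfolding LG Lg by linarith
    qed
    have "\<bar>LINT z|?LL. ?r z\<bar> \<le> (LINT z|?LL. 11 * (t\<^sup>2 * ?T \<eta> z))"
    proof (rule integral_abs_bound[THEN order_trans], intro integral_mono integrable_abs ir
        integrable_mult_right iT \<eta>)
      fix z :: "'a \<times> 'a"
      let ?a = "u (fst z)" and ?b = "u (snd z)" and ?\<alpha> = "\<eta> (fst z)" and ?\<beta> = "\<eta> (snd z)"
      have sym: "riesz_pair \<gamma> (snd z, fst z) = riesz_pair \<gamma> z"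
        by (simp add: riesz_pair_def norm_minus_commute)
      have g1: "?g z = riesz_pair \<gamma> z * (Re (?a * cnj (h (fst z))) * (cmod ?b)\<^sup>2)"
        by (simp add: algebra_simps)
      have g2: "?g' z = riesz_pair \<gamma> z * (Re (?b * cnj (h (snd z))) * (cmod ?a)\<^sup>2)"
        by (simp add: sym algebra_simps)
      have "?r z = riesz_pair \<gamma> z * ((cmod (?a + of_real t * ?\<alpha>))\<^sup>2 * (cmod (?b + of_real t * ?\<beta>))\<^sup>2
          - (cmod ?a)\<^sup>2 * (cmod ?b)\<^sup>2
          - (2 * Re (?a * cnj (of_real t * ?\<alpha>)) * (cmod ?b)\<^sup>2 + 2 * Re (?b * cnj (of_real t * ?\<beta>)) *
              (cmod ?a)\<^sup>2))"
        unfolding g1 g2 h\<eta>[symmetric]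
        by (simp only: right_diff_distrib distrib_left mult.assoc mult.left_commute[of 2])
      then have "\<bar>?r z\<bar> = riesz_pair \<gamma> z * \<bar>(cmod (?a + of_real t * ?\<alpha>))\<^sup>2 * (cmod (?b + of_real t
          * ?\<beta>))\<^sup>2 - (cmod ?a)\<^sup>2 * (cmod ?b)\<^sup>2
          - (2 * Re (?a * cnj (of_real t * ?\<alpha>)) * (cmod ?b)\<^sup>2 + 2 * Re (?b * cnj (of_real t * ?\<beta>)) *
              (cmod ?a)\<^sup>2)\<bar>"
        by (simp only: abs_mult abs_of_nonneg[OF riesz_pair_nonneg])
      also have "\<dots> \<le> riesz_pair \<gamma> z * (11 * (t\<^sup>2 * ((cmod ?a + cmod ?\<alpha>)\<^sup>2 * (cmod ?b
          + cmod ?\<beta>)\<^sup>2)))"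
        using t by (intro mult_left_mono quartic_remainder riesz_pair_nonneg) auto
      also have "\<dots> = 11 * (t\<^sup>2 * ?T \<eta> z)" by (simp only: mult_ac)
      finally show "\<bar>?r z\<bar> \<le> 11 * (t\<^sup>2 * ?T \<eta> z)" .
    qed
    also have "\<dots> = 11 * (t\<^sup>2 * (LINT z|?LL. ?T \<eta> z))" by (simp only: integral_mult_right_zero)
    also have "\<dots> \<le> 11 * (t\<^sup>2 * C)" by (intro mult_left_mono bT \<eta>) auto
    finally show "\<bar>hartree_D \<gamma> (\<lambda>x. u x + h x) - hartree_D \<gamma> u
      - 4 * Re (LINT x|lborel. of_real (riesz_conv \<gamma> u x) * u x * cnj (h x))\<bar> \<le> 11 * C * t\<^sup>2"
      unfolding E by (simp only: mult_ac)
  qed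
qed

end

section \<open>Test functions\<close>

text \<open>The derivative is continuous, hence bounded on the compact support, and it vanishes off
  the support; the mean value inequality on the whole space gives the constant.\<close>

lemma test_function_lipschitz:
  fixes \<phi> :: "'a::euclidean_space \<Rightarrow> complex"
  assumes "\<phi> \<in> test_functions"
  obtains L where "0 \<le> L" "\<And>x y. cmod (\<phi> x - \<phi> y) \<le> L * norm (x - y)"
proof -
  let ?K = "closure {x. \<phi> x \<noteq> 0}"
  have K: "compact ?K" and C: "Ck 1 \<phi>" using assms by (auto simp: test_functions_def)
  have diff: "\<phi> differentiable (at x)" for x using C by simp
  have cont: "continuous_on UNIV (\<lambda>x. frechet_derivative \<phi> (at x) v)" for v using C by simp
  let ?D = "\<lambda>x. \<Sum>b\<in>Basis. cmod (frechet_derivative \<phi> (at x) b)"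
  have "continuous_on ?K ?D"
    by (intro continuous_intros continuous_on_subset[OF cont]) auto
  then have "bounded (?D ` ?K)" by (intro compact_imp_bounded compact_continuous_image K)
  then obtain B where "\<And>x. x \<in> ?K \<Longrightarrow> norm (?D x) \<le> B" unfolding bounded_iff by blast
  then have B: "?D x \<le> B" if "x \<in> ?K" for x using that by fastforce
  have D: "?D x \<le> max B 0" for x
  proof (cases "x \<in> ?K")
    case False
    have "((\<lambda>_. 0) has_derivative (\<lambda>_. 0)) (at x)" by simp
    then have "(\<phi> has_derivative (\<lambda>_. 0)) (at x)"
    proof (rule has_derivative_transform_within_open[where s="- ?K"])
      show "0 = \<phi> y" if "y \<in> - ?K" for y using that closure_subset[of "{x. \<phi> x \<noteq> 0}"] by auto
    qed (use False in auto)
    then have "frechet_derivative \<phi> (at x) = (\<lambda>_. 0)" by (rule frechet_derivative_at[symmetric])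
    then show ?thesis by simp
  qed (use B in \<open>auto simp: le_max_iff_disj\<close>)
  have "cmod (\<phi> x - \<phi> y) \<le> max B 0 * norm (x - y)" for x y
  proof (rule differentiable_bound[of UNIV \<phi> "\<lambda>x. frechet_derivative \<phi> (at x)"])
    fix z :: 'a
    have der: "(\<phi> has_derivative frechet_derivative \<phi> (at z)) (at z)"
      using diff[of z] frechet_derivative_works by blast
    then show "(\<phi> has_derivative frechet_derivative \<phi> (at z)) (at z within UNIV)" by simp
    interpret bounded_linear "frechet_derivative \<phi> (at z)" using der
      by (rule has_derivative_bounded_linear)
    show "onorm (frechet_derivative \<phi> (at z)) \<le> max B 0"
    proof (rule onorm_bound)
      fix h :: 'a
      have "frechet_derivative \<phi> (at z) h = frechet_derivative \<phi> (at z) (\<Sum>b\<in>Basis. (h \<bullet> b) *\<^sub>R b)"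
        by (simp add: euclidean_representation)
      also have "\<dots> = (\<Sum>b\<in>Basis. (h \<bullet> b) *\<^sub>R frechet_derivative \<phi> (at z) b)"
        by (simp only: sum scale)
      finally have "cmod (frechet_derivative \<phi> (at z) h)
          \<le> (\<Sum>b\<in>Basis. cmod ((h \<bullet> b) *\<^sub>R frechet_derivative \<phi> (at z) b))"
        by (simp only: norm_sum)
      also have "\<dots> \<le> (\<Sum>b\<in>Basis. norm h * cmod (frechet_derivative \<phi> (at z) b))"
        by (intro sum_mono) (simp add: mult_right_mono Basis_le_norm)
      also have "\<dots> = ?D z * norm h" by (simp add: sum_distrib_left mult.commute)
      also have "\<dots> \<le> max B 0 * norm h" by (intro mult_right_mono D) simp
      finally show "cmod (frechet_derivative \<phi> (at z) h) \<le> max B 0 * norm h" .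
    qed simp
  qed auto
  then show thesis using that[of "max B 0"] by simp
qed

lemma continuous_compact_support:
  fixes \<phi> :: "'a::euclidean_space \<Rightarrow> complex"
  assumes cont: "continuous_on UNIV \<phi>" and K: "compact (closure {x. \<phi> x \<noteq> 0})"
  shows "integrable lborel \<phi>" "\<phi> \<in> Lspace 2"
proof -
  let ?K = "closure {x. \<phi> x \<noteq> 0}"
  have [measurable]: "\<phi> \<in> borel_measurable borel" using cont
    by (rule borel_measurable_continuous_onI)
  have [measurable]: "?K \<in> sets borel" by simp
  have "bounded (\<phi> ` ?K)" by (intro compact_imp_bounded compact_continuous_image K
      continuous_on_subset[OF cont]) auto
  then obtain B where B: "\<And>x. x \<in> ?K \<Longrightarrow> cmod (\<phi> x) \<le> B" unfolding bounded_iff by blast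
  have out: "\<phi> x = 0" if "x \<notin> ?K" for x using that closure_subset[of "{x. \<phi> x \<noteq> 0}"] by auto
  have iK: "integrable lborel (indicator ?K :: 'a \<Rightarrow> real)"
    using emeasure_bounded_finite[OF compact_imp_bounded[OF K]]
    by (intro integrable_real_indicator) auto
  show "integrable lborel \<phi>"
  proof (rule Bochner_Integration.integrable_bound[OF integrable_mult_right[OF iK, of B]])
    show "AE x in lborel. norm (\<phi> x) \<le> norm (B * indicator ?K x)"
    proof (intro AE_I2)
      fix x show "norm (\<phi> x) \<le> norm (B * indicator ?K x)"
        using B[of x] out[of x] by (cases "x \<in> ?K") auto
    qed
  qed simp
  have "integrable lborel (\<lambda>x. (cmod (\<phi> x))\<^sup>2)"
  proof (rule Bochner_Integration.integrable_bound[OF integrable_mult_right[OF iK, of "B\<^sup>2"]])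
    show "AE x in lborel. norm ((cmod (\<phi> x))\<^sup>2) \<le> norm (B\<^sup>2 * indicator ?K x)"
    proof (intro AE_I2)
      fix x show "norm ((cmod (\<phi> x))\<^sup>2) \<le> norm (B\<^sup>2 * indicator ?K x)"
        using power_mono[OF B[of x], of 2] out[of x] by (cases "x \<in> ?K") auto
    qed
  qed simp
  then show "\<phi> \<in> Lspace 2" by (simp add: Lspace_def)
qed

text \<open>The linear Taylor term dominates: the second order error is at most
  \<open>t\<^sup>2 / 2\<close>, which on this range is at most half of
  \<open>\<bar>t\<bar>\<close>.\<close>

lemma cmod_cis_minus_1_ge:
  assumes "\<bar>t\<bar> \<le> 1"
  shows "\<bar>t\<bar> \<le> 2 * cmod (cis t - 1)"
proof -
  have "cmod (iexp t - (1 + \<i> * of_real t)) \<le> t\<^sup>2 / 2"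
    using iexp_approx1[of t 1] by (simp add: power2_eq_square)
  then have "cmod (cis t - 1 - \<i> * of_real t) \<le> t\<^sup>2 / 2"
    by (simp add: cis_conv_exp algebra_simps)
  moreover have "cmod (\<i> * of_real t) = \<bar>t\<bar>" by (simp add: norm_mult)
  then have "\<bar>t\<bar> \<le> cmod (cis t - 1) + cmod (cis t - 1 - \<i> * of_real t)"
    using norm_triangle_ineq4[of "cis t - 1" "cis t - 1 - \<i> * of_real t"] by simp
  moreover have "t\<^sup>2 \<le> \<bar>t\<bar>"
  proof -
    have "t\<^sup>2 = \<bar>t\<bar> * \<bar>t\<bar>" by (simp only: abs_mult_self_eq power2_eq_square)
    also have "\<dots> \<le> \<bar>t\<bar>" using assms by (intro mult_left_le) auto
    finally show ?thesis .
  qed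
  ultimately show ?thesis by simp
qed

text \<open>Difference quotients of \<open>\<phi>\<close> are bounded in L^2, so Plancherel and
  Fatou make \<open>norm \<xi> * cmod (fourier \<phi> \<xi>)\<close> square integrable; for
  \<open>s < 1\<close> the homogeneous weight is at most
  \<open>1 + (norm \<xi>)\<^sup>2\<close>.\<close>

lemma lipschitz_compact_support_Hs:
  fixes \<phi> :: "'a::euclidean_space \<Rightarrow> complex"
  assumes s: "0 < s" "s < 1"
    and L: "0 \<le> L" "\<And>x y. cmod (\<phi> x - \<phi> y) \<le> L * norm (x - y)"
        and K: "compact (closure {x. \<phi> x \<noteq> 0})"
    and cont: "continuous_on UNIV \<phi>"
  shows "\<phi> \<in> Hs s"
proof -
  let ?K = "closure {x. \<phi> x \<noteq> 0}"
  have \<phi>: "\<phi> \<in> Lspace 2" by (rule continuous_compact_support[OF cont K])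
  have [measurable]: "\<phi> \<in> borel_measurable borel" "fourier \<phi> \<in> borel_measurable borel"
    using \<phi> fourier_measurable[OF \<phi>] by (auto simp: Lspace2_iff)
  have [measurable]: "?K \<in> sets borel" by simp
  have out: "\<phi> x = 0" if "x \<notin> ?K" for x using that closure_subset[of "{x. \<phi> x \<noteq> 0}"] by auto
  define m where "m = emeasure lborel ?K"
  have "m < \<infinity>" unfolding m_def by (rule emeasure_bounded_finite[OF compact_imp_bounded[OF K]])
  have tr: "l2sq (\<lambda>x. \<phi> (x + y) - \<phi> x) \<le> ennreal ((L * norm y)\<^sup>2) * (m + m)" for y
  proof -
    have "l2sq (\<lambda>x. \<phi> (x + y) - \<phi> x) \<le> (\<integral>\<^sup>+x. ennreal ((L * norm y)\<^sup>2) * (indicator ?K (x + y)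
        + indicator ?K x) \<partial>lborel)"
      unfolding l2sq_def
    proof (intro nn_integral_mono)
      fix x
      show "ennreal ((cmod (\<phi> (x + y) - \<phi> x))\<^sup>2) \<le> ennreal ((L * norm y)\<^sup>2) * (indicator ?K (x + y)
          + indicator ?K x)"
      proof (cases "x \<in> ?K \<or> x + y \<in> ?K")
        case True
        have "ennreal ((cmod (\<phi> (x + y) - \<phi> x))\<^sup>2) \<le> ennreal ((L * norm y)\<^sup>2) * 1"
          using L(2)[of "x + y" x] by (auto intro!: ennreal_leI power_mono)
        also have "\<dots> \<le> ennreal ((L * norm y)\<^sup>2) * (indicator ?K (x + y) + indicator ?K x)"
          using True by (intro mult_left_mono) (auto simp: indicator_def)
        finally show ?thesis .
      next
        case False
        then show ?thesis using out[of x] out[of "x + y"] by simp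
      qed
    qed
    also have "\<dots> = ennreal ((L * norm y)\<^sup>2) * (m + m)"
      using nn_integral_lborel_shift[of "indicator ?K" y]
      by (simp add: nn_integral_cmult nn_integral_add m_def)
    finally show ?thesis .
  qed
  define c where "c = ennreal (L\<^sup>2) * (m + m)"
  have c: "c < \<infinity>" using \<open>m < \<infinity>\<close> by (simp add: c_def ennreal_mult_less_top)
  have dir: "(\<integral>\<^sup>+\<xi>. ennreal ((\<xi> \<bullet> b)\<^sup>2 * (cmod (fourier \<phi> \<xi>))\<^sup>2) \<partial>lborel) \<le> 4 * c" if b: "b \<in> Basis"
      for b
  proof -
    let ?n = "\<lambda>n. real (Suc n)"
    \<comment> \<open>Squared difference quotients of step \<open>1 / (n + 1)\<close> in direction
      \<open>b\<close>, seen on the Fourier side; the factor 4 comes from squaring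
      \<open>cmod_cis_minus_1_ge\<close>.\<close>
    let ?g = "\<lambda>n \<xi>. ennreal (4 * (?n n)\<^sup>2) * ennreal ((cmod (cis (((1 / ?n n) *\<^sub>R b) \<bullet> \<xi>) - 1))\<^sup>2
        * (cmod (fourier \<phi> \<xi>))\<^sup>2)"
    have gn: "(\<integral>\<^sup>+\<xi>. ?g n \<xi> \<partial>lborel) \<le> 4 * c" for n
    proof -
      have "(\<integral>\<^sup>+\<xi>. ?g n \<xi> \<partial>lborel) = ennreal (4 * (?n n)\<^sup>2) * l2sq (\<lambda>x. \<phi> (x + (1 / ?n n) *\<^sub>R b)
          - \<phi> x)"
        unfolding l2sq_shift_diff[OF \<phi>] by (rule nn_integral_cmult) measurable
      also have "\<dots> \<le> ennreal (4 * (?n n)\<^sup>2) * (ennreal ((L * norm ((1 / ?n n) *\<^sub>R b))\<^sup>2) * (m + m))"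
        by (intro mult_left_mono tr) auto
      also have "\<dots> = ennreal (4 * (?n n)\<^sup>2 * (L * norm ((1 / ?n n) *\<^sub>R b))\<^sup>2) * (m + m)"
        by (simp add: ennreal_mult mult.assoc)
      also have "4 * (?n n)\<^sup>2 * (L * norm ((1 / ?n n) *\<^sub>R b))\<^sup>2 = 4 * L\<^sup>2"
        using b by (simp add: power_mult_distrib power_divide)
      also have "ennreal (4 * L\<^sup>2) * (m + m) = 4 * c" by (simp add: c_def ennreal_mult mult.assoc)
      finally show ?thesis .
    qed
    have "(\<integral>\<^sup>+\<xi>. ennreal ((\<xi> \<bullet> b)\<^sup>2 * (cmod (fourier \<phi> \<xi>))\<^sup>2) \<partial>lborel)
        \<le> (\<integral>\<^sup>+\<xi>. liminf (\<lambda>n. ?g n \<xi>) \<partial>lborel)"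
    proof (intro nn_integral_mono Liminf_bounded)
      fix \<xi> :: 'a
      obtain M :: nat where M: "\<bar>\<xi> \<bullet> b\<bar> \<le> real M" using real_arch_simple by blast
      \<comment> \<open>For large \<open>n\<close> the phase
        \<open>(\<xi> \<bullet> b) / (n + 1)\<close> lies in the range where the lower bound for
        \<open>cis\<close> holds.\<close>
      show "\<forall>\<^sub>F n in sequentially. ennreal ((\<xi> \<bullet> b)\<^sup>2 * (cmod (fourier \<phi> \<xi>))\<^sup>2) \<le> ?g n \<xi>"
        using eventually_ge_at_top[of M]
      proof eventually_elim
        case (elim n)
        let ?t = "(\<xi> \<bullet> b) / ?n n"
        have t: "\<bar>?t\<bar> \<le> 1" using M elim by (simp add: abs_divide field_simps)
        have eq: "((1 / ?n n) *\<^sub>R b) \<bullet> \<xi> = ?t" by (simp add: inner_commute)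
        have ge: "\<bar>?t\<bar> \<le> 2 * cmod (cis ?t - 1)" by (rule cmod_cis_minus_1_ge[OF t])
        have "\<bar>\<xi> \<bullet> b\<bar> = ?n n * \<bar>?t\<bar>" by (simp add: abs_divide)
        also have "\<dots> \<le> ?n n * (2 * cmod (cis ?t - 1))" by (rule mult_left_mono[OF ge]) simp
        finally have "\<bar>\<xi> \<bullet> b\<bar>\<^sup>2 \<le> (?n n * (2 * cmod (cis ?t - 1)))\<^sup>2" by (rule power_mono) simp
        then have "(\<xi> \<bullet> b)\<^sup>2 \<le> 4 * (?n n)\<^sup>2 * (cmod (cis ?t - 1))\<^sup>2"
          by (simp add: power_mult_distrib)
        then have "(\<xi> \<bullet> b)\<^sup>2 * (cmod (fourier \<phi> \<xi>))\<^sup>2 \<le> 4 * (?n n)\<^sup>2 * ((cmod (cis ?t - 1))\<^sup>2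
            * (cmod (fourier \<phi> \<xi>))\<^sup>2)"
          unfolding mult.assoc[symmetric] by (rule mult_right_mono) simp
        then have "ennreal ((\<xi> \<bullet> b)\<^sup>2 * (cmod (fourier \<phi> \<xi>))\<^sup>2)
            \<le> ennreal (4 * (?n n)\<^sup>2 * ((cmod (cis ?t - 1))\<^sup>2 * (cmod (fourier \<phi> \<xi>))\<^sup>2))"
          by (rule ennreal_leI)
        also have "\<dots> = ?g n \<xi>" unfolding eq by (rule ennreal_mult) auto
        finally show ?case .
      qed
    qed
    also have "\<dots> \<le> liminf (\<lambda>n. \<integral>\<^sup>+\<xi>. ?g n \<xi> \<partial>lborel)" by (intro nn_integral_liminf) measurable
    also have "\<dots> \<le> 4 * c" by (intro Liminf_le always_eventually allI gn) simp
    finally show ?thesis .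
  qed
  have i0: "integrable lborel (\<lambda>\<xi>. (cmod (fourier \<phi> \<xi>))\<^sup>2)" using fourier_in_L2[OF \<phi>]
    by (simp add: Lspace_def)
  have i1: "integrable lborel (\<lambda>\<xi>. (\<xi> \<bullet> b)\<^sup>2 * (cmod (fourier \<phi> \<xi>))\<^sup>2)" if "b \<in> Basis" for b
  proof (rule integrableI_bounded)
    have "(\<integral>\<^sup>+\<xi>. ennreal ((\<xi> \<bullet> b)\<^sup>2 * (cmod (fourier \<phi> \<xi>))\<^sup>2) \<partial>lborel) < \<infinity>"
      by (rule le_less_trans[OF dir[OF that]]) (use c in \<open>simp add: ennreal_mult_less_top\<close>)
    then show "(\<integral>\<^sup>+\<xi>. ennreal (norm ((\<xi> \<bullet> b)\<^sup>2 * (cmod (fourier \<phi> \<xi>))\<^sup>2)) \<partial>lborel) < \<infinity>" by simp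
  qed simp
  have i2: "integrable lborel (\<lambda>\<xi>. (cmod (fourier \<phi> \<xi>))\<^sup>2 + (norm \<xi>)\<^sup>2 * (cmod (fourier \<phi> \<xi>))\<^sup>2)"
    unfolding norm_sq_Basis[where 'a='a] sum_distrib_right
    by (intro Bochner_Integration.integrable_add i0 Bochner_Integration.integrable_sum i1)
  have "integrable lborel (\<lambda>\<xi>. hdot_weight s \<xi> * (cmod (fourier \<phi> \<xi>))\<^sup>2)"
  proof (rule Bochner_Integration.integrable_bound[OF i2])
    show "AE \<xi> in lborel. norm (hdot_weight s \<xi> * (cmod (fourier \<phi> \<xi>))\<^sup>2)
        \<le> norm ((cmod (fourier \<phi> \<xi>))\<^sup>2 + (norm \<xi>)\<^sup>2 * (cmod (fourier \<phi> \<xi>))\<^sup>2)"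
    proof (intro AE_I2)
      fix \<xi> :: 'a
      have "hdot_weight s \<xi> \<le> 1 + (norm \<xi>)\<^sup>2"
      proof (cases "norm \<xi> \<le> 1")
        case True
        then have "hdot_weight s \<xi> \<le> 1" unfolding hdot_weight_def using s by (intro powr_le1) auto
        then show ?thesis by (simp add: add_increasing2)
      next
        case False
        then have "hdot_weight s \<xi> \<le> norm \<xi> powr 2" unfolding hdot_weight_def using s
          by (intro powr_mono) auto
        then show ?thesis by simp
      qed
      then have "hdot_weight s \<xi> * (cmod (fourier \<phi> \<xi>))\<^sup>2
          \<le> (1 + (norm \<xi>)\<^sup>2) * (cmod (fourier \<phi> \<xi>))\<^sup>2" by (rule mult_right_mono) simp
      then show "norm (hdot_weight s \<xi> * (cmod (fourier \<phi> \<xi>))\<^sup>2)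
          \<le> norm ((cmod (fourier \<phi> \<xi>))\<^sup>2 + (norm \<xi>)\<^sup>2 * (cmod (fourier \<phi> \<xi>))\<^sup>2)"
        by (simp add: hdot_weight_nonneg abs_mult distrib_right)
    qed
  qed simp
  then show ?thesis using \<phi> by (simp add: Hs_iff_hdot_weight[OF s(1)] weighted_L2_def)
qed

text \<open>Conjugation turns the factor \<open>\<i>\<close> in the second slot into
  \<open>- \<i>\<close>, and the real part of \<open>- \<i> * Z\<close> is \<open>Im Z\<close>; so
  the real pairing determines the complex one.\<close>

lemma weighted_ip_complex:
  assumes w: "w \<in> borel_measurable borel" "\<And>x. 0 \<le> w x" and f: "f \<in> weighted_L2 w"
      and g: "g \<in> weighted_L2 w"
  defines "Z \<equiv> (LINT x|lborel. complex_of_real (w x) * (f x * cnj (g x)))"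
  shows "weighted_ip w f g = Re Z" "weighted_ip w f (\<lambda>x. \<i> * g x) = Im Z"
proof -
  note i = weighted_ip_integrable(1)[OF w f g]
  have "weighted_ip w f g = (LINT x|lborel. Re (complex_of_real (w x) * (f x * cnj (g x))))"
    by (simp add: weighted_ip_def)
  then show "weighted_ip w f g = Re Z" unfolding Z_def by (simp only: integral_Re[OF i])
  have "weighted_ip w f (\<lambda>x. \<i> * g x)
      = (LINT x|lborel. Im (complex_of_real (w x) * (f x * cnj (g x))))"
    unfolding weighted_ip_def
    by (intro Bochner_Integration.integral_cong) (auto simp: algebra_simps)
  then show "weighted_ip w f (\<lambda>x. \<i> * g x) = Im Z" unfolding Z_def by (simp only: integral_Im[OF i])
qed

text \<open>
  The real and imaginary parts of the equation tested with \<open>\<phi>\<close> are the real equations tested with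
  \<open>cnj \<phi>\<close> and \<open>\<i> cnj \<phi>\<close>.
\<close>

lemma weak_solutionI:
  fixes u :: "'a::euclidean_space \<Rightarrow> complex"
  assumes s: "0 < s" "s < 1" and u: "u \<in> Hs s"
    and eq: "\<And>h. h \<in> Hs s \<Longrightarrow> weighted_ip (hdot_weight s) (fourier u) (fourier h) + \<omega>
        * weighted_ip (\<lambda>_. 1) u h
      - Re (LINT x|lborel. nonlin f u x * cnj (h x)) = 0"
  shows "weak_solution s f \<omega> u"
  unfolding weak_solution_def
proof (intro conjI ballI u)
  fix \<phi> :: "'a \<Rightarrow> complex" assume \<phi>: "\<phi> \<in> test_functions"
  define h where "h = (\<lambda>x. cnj (\<phi> x))"
  obtain L where L: "0 \<le> L" "\<And>x y. cmod (\<phi> x - \<phi> y) \<le> L * norm (x - y)"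
    using test_function_lipschitz[OF \<phi>] by blast
  have "Ck 0 \<phi>" using \<phi> unfolding test_functions_def by blast
  then have cont: "continuous_on UNIV \<phi>" by simp
  have ch: "continuous_on UNIV h" unfolding h_def by (intro continuous_intros cont)
  have kh: "compact (closure {x. h x \<noteq> 0})" using \<phi> by (simp add: h_def test_functions_def)
  have Lh: "cmod (h x - h y) \<le> L * norm (x - y)" for x y
    using L(2)[of x y] unfolding h_def complex_cnj_diff[symmetric] complex_mod_cnj .
  have hH: "h \<in> Hs s" by (rule lipschitz_compact_support_Hs[OF s L(1) Lh kh ch])
  have hL: "h \<in> Lspace 2" "integrable lborel h" using continuous_compact_support[OF ch kh] by auto
  have uL: "u \<in> Lspace 2" using u by (rule Hs_in_L2)
  have [measurable]: "u \<in> borel_measurable borel" "h \<in> borel_measurable borel" using uL hL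
    by (auto simp: Lspace2_iff)
  have Fm[measurable]: "fourier u \<in> borel_measurable borel" "fourier h \<in> borel_measurable borel"
    "fourier (\<lambda>x. \<i> * h x) \<in> borel_measurable borel"
    using fourier_measurable uL hL(1) Lspace2_cmult[OF hL(1)] by blast+
  let ?Z = "LINT \<xi>|lborel. complex_of_real (hdot_weight s \<xi>) * (fourier u \<xi> * cnj (fourier h \<xi>))"
  let ?Y = "LINT x|lborel. complex_of_real 1 * (u x * cnj (h x))"
  let ?X = "LINT x|lborel. nonlin f u x * cnj (h x)"
  \<comment> \<open>\<open>frac_laplace_distr\<close> pairs bilinearly, \<open>weighted_ip\<close>
    with a conjugate in the second slot; with \<open>h = cnj \<phi>\<close> pointwise the two
    conventions meet.\<close>
  have conj: "cnj (fourier_integral h \<xi>) = inv_fourier_integral \<phi> \<xi>" for \<xi>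
  proof -
    have "cnj (LINT x|lborel. cis (- (x \<bullet> \<xi>)) * h x) = (LINT x|lborel. cis (\<xi> \<bullet> x) * \<phi> x)"
      using Bochner_Integration.integral_cnj[of lborel "\<lambda>x. cis (- (x \<bullet> \<xi>)) * h x"]
      by (simp add: cis_cnj h_def inner_commute)
    then show ?thesis by (simp add: fourier_integral_def inv_fourier_integral_def)
  qed
  have Z: "frac_laplace_distr s u \<phi> = ?Z"
    unfolding frac_laplace_distr_def
  proof (rule integral_cong_AE)
    have [measurable]: "(\<lambda>\<xi>. inv_fourier_integral \<phi> \<xi>) \<in> borel_measurable borel"
      unfolding conj[symmetric] by measurable
    show "(\<lambda>\<xi>. complex_of_real (norm \<xi> powr (2 * s)) * fourier u \<xi>
        * inv_fourier_integral \<phi> \<xi>) \<in> borel_measurable lborel"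
      by measurable
    show "(\<lambda>\<xi>. complex_of_real (hdot_weight s \<xi>) * (fourier u \<xi> * cnj (fourier h \<xi>))) \<in>
        borel_measurable lborel"
      by measurable
    show "AE \<xi> in lborel. complex_of_real (norm \<xi> powr (2 * s)) * fourier u \<xi>
        * inv_fourier_integral \<phi> \<xi> = complex_of_real (hdot_weight s \<xi>) * (fourier u \<xi> * cnj (fourier
        h \<xi>))"
      using fourier_L1_L2[OF hL] by eventually_elim (simp add: conj hdot_weight_def)
  qed
  have Y: "(LINT x|lborel. u x * \<phi> x) = ?Y" by (simp add: h_def)
  have X: "(LINT x|lborel. nonlin f u x * \<phi> x) = ?X" by (simp add: h_def)
  have w1: "u \<in> weighted_L2 (\<lambda>_. 1)" "h \<in> weighted_L2 (\<lambda>_. 1)" using uL hL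
    by (auto simp: weighted_L2_1_iff)
  note zz = weighted_ip_complex[OF hdot_weight_measurable hdot_weight_nonneg Hs_hdot_weight[OF s(1)
      u] Hs_hdot_weight[OF s(1) hH]]
  note yy = weighted_ip_complex[OF _ _ w1, simplified]
  have ihH: "(\<lambda>x. \<i> * h x) \<in> Hs s" by (rule Hs_cmult[OF s(1) hH])
  have "weighted_ip (hdot_weight s) (fourier u) (fourier (\<lambda>x. \<i> * h x))
      = weighted_ip (hdot_weight s) (fourier u) (\<lambda>\<xi>. \<i> * fourier h \<xi>)"
    by (intro weighted_ip_cong fourier_cmult hL) measurable
  then have zi: "weighted_ip (hdot_weight s) (fourier u) (fourier (\<lambda>x. \<i> * h x)) = Im ?Z"
    using zz(2) by simp
  have "(LINT x|lborel. nonlin f u x * cnj (\<i> * h x))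
      = (LINT x|lborel. (- \<i>) * (nonlin f u x * cnj (h x)))"
    by (intro Bochner_Integration.integral_cong) auto
  also have "\<dots> = - \<i> * ?X" by (rule integral_mult_right_zero)
  finally have xi: "Re (LINT x|lborel. nonlin f u x * cnj (\<i> * h x)) = Im ?X" by simp
  have re: "Re ?Z + \<omega> * Re ?Y - Re ?X = 0" using eq[OF hH] zz(1) yy(1) by simp
  have im: "Im ?Z + \<omega> * Im ?Y - Im ?X = 0" using eq[OF ihH] unfolding zi xi using yy(2) by simp
  show "frac_laplace_distr s u \<phi> + complex_of_real \<omega> * (LINT x|lborel. u x * \<phi> x)
      - (LINT x|lborel. nonlin f u x * \<phi> x) = 0"
    unfolding Z Y X using re im by (intro complex_eqI) simp_all
qed

section \<open>Variational algebra\<close>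

fun nl_exponent :: "nonlinearity \<Rightarrow> real" where
  "nl_exponent (Power p) = p + 2"
| "nl_exponent (Hartree \<gamma>) = 4"

fun nl_dilation :: "'a::euclidean_space itself \<Rightarrow> nonlinearity \<Rightarrow> real" where
  "nl_dilation _ (Power p) = real DIM('a) * p / 2"
| "nl_dilation _ (Hartree \<gamma>) = \<gamma>"

fun nl_potential :: "nonlinearity \<Rightarrow> ('a::euclidean_space \<Rightarrow> complex) \<Rightarrow> real" where
  "nl_potential (Power p) u = (LINT x|lborel. cmod (u x) powr (p + 2))"
| "nl_potential (Hartree \<gamma>) u = hartree_D \<gamma> u"

lemma Lnorm_powr: "0 < q \<Longrightarrow> Lnorm q u powr q = (LINT x|lborel. cmod (u x) powr q)"
  by (simp add: Lnorm_def powr_powr integral_nonneg_AE)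

text \<open>
  For the quotient \<open>B / (A powr \<alpha> * M powr \<beta>)\<close> of kinetic energy \<open>A\<close>, mass \<open>M\<close> and potential
  \<open>B\<close>, amplitude and dilation parameters can be chosen so that any competitor satisfies
  the two constraints.
\<close>

lemma scaling_algebra:
  fixes A M B Ac c k q s :: real
  assumes pos: "0 < A" "0 < M" "0 < B" "0 < Ac" "0 < c" "0 < s" "0 < q" and k: "2 * s < k"
    and min: "\<And>\<nu> \<mu>. 0 < \<nu> \<Longrightarrow> 0 < \<mu> \<Longrightarrow> \<nu>\<^sup>2 * M = c \<Longrightarrow>
      s * (\<nu>\<^sup>2 * \<mu> powr (2 * s) * A) = k / q * (\<nu> powr q * \<mu> powr k * B) \<Longrightarrow> Ac \<le> \<nu>\<^sup>2 * \<mu> powr (2 * s)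
          * A"
  defines "\<alpha> \<equiv> k / (2 * s)" and "\<beta> \<equiv> (q - k / s) / 2"
  shows "B \<le> (q * s / k * Ac) / (Ac powr \<alpha> * c powr \<beta>) * (A powr \<alpha> * M powr \<beta>)"
proof -
  have k0: "0 < k" using k pos by simp
  \<comment> \<open>\<open>\<nu>\<close> is fixed by the mass constraint. Given
    \<open>\<nu>\<close>, the dilation \<open>\<mu>\<close> solves the constraint
    \<open>Q = 0\<close> after division by \<open>\<mu> powr (2 * s)\<close>;
    \<open>k > 2 * s\<close> makes the exponent \<open>k - 2 * s\<close> invertible.\<close>
  define \<nu> where "\<nu> = sqrt (c / M)"
  have \<nu>: "0 < \<nu>" "\<nu>\<^sup>2 * M = c" using pos by (simp_all add: \<nu>_def)
  define \<mu> where "\<mu> = (s * q * \<nu>\<^sup>2 * A / (k * \<nu> powr q * B)) powr (1 / (k - 2 * s))"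
  have b: "0 < s * q * \<nu>\<^sup>2 * A / (k * \<nu> powr q * B)" using pos k0 \<nu> by simp
  have \<mu>: "0 < \<mu>" unfolding \<mu>_def powr_gt_zero using b by (metis less_irrefl)
  have "(X powr (1 / (k - 2 * s))) powr (k - 2 * s) = X" if "0 < X" for X :: real
    using that k by (simp add: powr_powr)
  from this[OF b] have "\<mu> powr (k - 2 * s) = s * q * \<nu>\<^sup>2 * A / (k * \<nu> powr q * B)"
    unfolding \<mu>_def .
  then have e1: "\<mu> powr (2 * s) * (k * \<nu> powr q * B) * \<mu> powr (k - 2 * s)
      = \<mu> powr (2 * s) * (s * q * \<nu>\<^sup>2 * A)"
    using pos k0 \<nu> by simp
  have e2: "\<mu> powr (2 * s) * \<mu> powr (k - 2 * s) = \<mu> powr k" using \<mu> by (simp flip: powr_add)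
  have "s * q * (\<nu>\<^sup>2 * \<mu> powr (2 * s) * A) = \<mu> powr (2 * s) * (s * q * \<nu>\<^sup>2 * A)"
    by (simp only: mult_ac)
  also have "\<dots> = \<mu> powr (2 * s) * (k * \<nu> powr q * B) * \<mu> powr (k - 2 * s)" by (rule e1[symmetric])
  also have "\<dots> = k * (\<nu> powr q * (\<mu> powr (2 * s) * \<mu> powr (k - 2 * s)) * B)" by (simp only: mult_ac)
  finally have E: "s * q * (\<nu>\<^sup>2 * \<mu> powr (2 * s) * A) = k * (\<nu> powr q * \<mu> powr k * B)"
    unfolding e2 .
  define Aw where "Aw = \<nu>\<^sup>2 * \<mu> powr (2 * s) * A"
  have "s * Aw = k / q * (\<nu> powr q * \<mu> powr k * B)" using E pos by (simp add: Aw_def field_simps)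
  then have Aw: "Ac \<le> Aw" unfolding Aw_def using \<nu> \<mu> by (intro min)
  have Aw0: "0 < Aw" using Aw pos by simp
  have \<alpha>: "1 < \<alpha>" using k pos by (simp add: \<alpha>_def field_simps)
  have B: "B = q * s / k * Aw * (\<nu> powr (- q) * \<mu> powr (- k))"
  proof -
    have "q * s / k * Aw = \<nu> powr q * \<mu> powr k * B" using E k0 by (simp add: Aw_def field_simps)
    then show ?thesis using \<nu> \<mu> by (simp add: powr_minus field_simps)
  qed
  have \<nu>2: "\<nu>\<^sup>2 = \<nu> powr 2" using \<nu> by simp
  have A: "A powr \<alpha> = Aw powr \<alpha> * \<nu> powr (- (2 * \<alpha>)) * \<mu> powr (- k)"
  proof -
    have "Aw powr \<alpha> = \<nu> powr (2 * \<alpha>) * \<mu> powr (2 * s * \<alpha>) * A powr \<alpha>"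
      unfolding Aw_def \<nu>2 by (simp only: powr_mult powr_powr)
    also have "2 * s * \<alpha> = k" using pos by (simp add: \<alpha>_def)
    finally show ?thesis using \<nu> \<mu> by (simp add: powr_minus field_simps)
  qed
  have Mb: "M powr \<beta> = c powr \<beta> * \<nu> powr (- (2 * \<beta>))"
  proof -
    have "c powr \<beta> = \<nu> powr (2 * \<beta>) * M powr \<beta>"
      unfolding \<nu>(2)[symmetric] \<nu>2 by (simp only: powr_mult powr_powr)
    then show ?thesis using \<nu> by (simp add: powr_minus field_simps)
  qed
  have n: "\<nu> powr (- (2 * \<alpha>)) * \<nu> powr (- (2 * \<beta>)) = \<nu> powr (- q)"
    using pos by (simp add: \<alpha>_def \<beta>_def field_simps flip: powr_add)
  have "A powr \<alpha> * M powr \<beta> = Aw powr \<alpha> * c powr \<beta> * (\<nu> powr (- (2 * \<alpha>)) * \<nu> powr (- (2 * \<beta>))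
      * \<mu> powr (- k))"
    unfolding A Mb by (simp only: mult_ac)
  then have AM: "A powr \<alpha> * M powr \<beta> = Aw powr \<alpha> * c powr \<beta> * (\<nu> powr (- q) * \<mu> powr (- k))"
    unfolding n .
  \<comment> \<open>The one place where minimality is turned into an estimate: the ratio is at least
    1 and \<open>\<alpha> > 1\<close>. The identities around it are scaling bookkeeping.\<close>
  have "Aw / Ac \<le> (Aw / Ac) powr \<alpha>"
    using powr_mono[of 1 \<alpha> "Aw / Ac"] \<alpha> Aw Aw0 pos by simp
  then have "Aw \<le> Ac * (Aw powr \<alpha> / Ac powr \<alpha>)"
    using pos Aw0 by (simp add: powr_divide pos_divide_le_eq mult.commute)
  then have "q * s / k * Aw * (\<nu> powr (- q) * \<mu> powr (- k))
      \<le> q * s / k * (Ac * (Aw powr \<alpha> / Ac powr \<alpha>)) * (\<nu> powr (- q) * \<mu> powr (- k))"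
    using pos k0 by (intro mult_right_mono mult_left_mono) auto
  also have "\<dots> = (q * s / k * Ac) / (Ac powr \<alpha> * c powr \<beta>) * (A powr \<alpha> * M powr \<beta>)"
    unfolding AM using pos by simp
  finally show ?thesis unfolding B[symmetric] .
qed

text \<open>Let \<open>x\<close>, \<open>y\<close>, \<open>\<tau>\<close> be the ratios of kinetic
  energy, mass and potential to those of the minimizer. The Nehari identities give
  \<open>\<tau> = \<theta> * x + (1 - \<theta>) * y\<close>, the mean inequality gives
  \<open>x powr \<theta> * y powr (1 - \<theta>) \<le> \<tau>\<close>, and \<open>gn\<close> gives
  \<open>\<tau> \<le> x powr \<alpha> * y powr \<beta>\<close>. Hence
  \<open>\<tau> \<le> \<tau> powr (q / 2)\<close>, which for positive \<open>\<tau>\<close> and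
  \<open>q > 2\<close> forces \<open>\<tau> \<ge> 1\<close>.\<close>

lemma ground_state_algebra:
  fixes A M B Ac c Bc \<omega> \<alpha> \<beta> q :: real
  assumes pos: "0 < A" "0 < M" "0 < Ac" "0 < c" "0 < \<omega>" "0 < \<alpha>" "0 < \<beta>" "2 < q" "\<alpha> + \<beta> = q / 2"
    and gn: "B \<le> Bc / (Ac powr \<alpha> * c powr \<beta>) * (A powr \<alpha> * M powr \<beta>)"
    and nehari: "A + \<omega> * M = B" "Ac + \<omega> * c = Bc"
    and ratio: "\<beta> * Ac = \<alpha> * (\<omega> * c)"
  shows "Bc \<le> B"
proof -
  define x where "x = A / Ac"
  define y where "y = M / c"
  define \<theta> where "\<theta> = 2 * \<alpha> / q"
  have xy: "0 < x" "0 < y" using pos by (simp_all add: x_def y_def)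
  have Bc: "0 < Bc" using nehari(2) pos by (metis add_pos_pos mult_pos_pos)
  have \<theta>: "0 \<le> \<theta>" "0 \<le> 1 - \<theta>" "1 - \<theta> = 2 * \<beta> / q" "\<theta> * (q / 2) = \<alpha>" "(1 - \<theta>) * (q / 2) = \<beta>"
  proof -
    have "1 - \<theta> = (q - 2 * \<alpha>) / q" using pos by (simp add: \<theta>_def diff_divide_distrib)
    also have "q - 2 * \<alpha> = 2 * \<beta>" using pos by simp
    finally show th: "1 - \<theta> = 2 * \<beta> / q" .
    show "0 \<le> 1 - \<theta>" "(1 - \<theta>) * (q / 2) = \<beta>" unfolding th using pos by simp_all
    show "0 \<le> \<theta>" "\<theta> * (q / 2) = \<alpha>" using pos by (simp_all add: \<theta>_def)
  qed
  \<comment> \<open>The hypothesis \<open>ratio\<close> says that the two parts \<open>Ac\<close>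
    and \<open>\<omega> * c\<close> of \<open>Bc\<close> are in the proportion
    \<open>\<alpha>\<close> to \<open>\<beta>\<close>.\<close>
  have Ac: "Ac = \<theta> * Bc" and wc: "\<omega> * c = (1 - \<theta>) * Bc"
  proof -
    have "\<alpha> * Bc = \<alpha> * Ac + \<beta> * Ac" unfolding nehari(2)[symmetric] ratio by (simp add: distrib_left)
    also have "\<dots> = (q / 2) * Ac" unfolding pos(9)[symmetric] by (simp add: distrib_right)
    finally show "Ac = \<theta> * Bc" using pos(8) by (simp add: \<theta>_def field_simps)
    then show "\<omega> * c = (1 - \<theta>) * Bc" using nehari(2) by (simp add: left_diff_distrib)
  qed
  define \<tau> where "\<tau> = B / Bc"
  have "B = x * Ac + y * (\<omega> * c)" using nehari(1) pos by (simp add: x_def y_def mult.commute)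
  also have "\<dots> = (\<theta> * x + (1 - \<theta>) * y) * Bc" unfolding wc by (subst Ac) (simp add: algebra_simps)
  finally have \<tau>: "\<tau> = \<theta> * x + (1 - \<theta>) * y" using Bc by (simp add: \<tau>_def)
  have "x powr \<theta> * y powr (1 - \<theta>) \<le> \<tau>"
    unfolding \<tau> by (rule Youngs_inequality_0) (use \<theta> xy in auto)
  then have "(x powr \<theta> * y powr (1 - \<theta>)) powr (q / 2) \<le> \<tau> powr (q / 2)"
    using pos xy by (intro powr_mono2) auto
  moreover have "(x powr \<theta> * y powr (1 - \<theta>)) powr (q / 2) = x powr \<alpha> * y powr \<beta>"
    by (simp only: powr_mult powr_powr \<theta>(4,5))
  moreover have "\<tau> \<le> x powr \<alpha> * y powr \<beta>"
    using gn Bc pos by (simp add: \<tau>_def x_def y_def powr_divide field_simps)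
  ultimately have t: "\<tau> \<le> \<tau> powr (q / 2)" by linarith
  have "0 < \<tau>" unfolding \<tau>_def using Bc nehari(1) pos
    by (metis add_pos_pos mult_pos_pos divide_pos_pos)
  have "1 \<le> \<tau>"
  proof (rule ccontr)
    assume "\<not> 1 \<le> \<tau>"
    then have "\<tau> powr (q / 2) < \<tau> powr 1" using \<open>0 < \<tau>\<close> pos by (intro powr_less_mono') auto
    then show False using t \<open>0 < \<tau>\<close> by simp
  qed
  then show ?thesis using Bc by (simp add: \<tau>_def)
qed

lemma DERIV_from_quadratic_remainder:
  fixes g :: "real \<Rightarrow> real"
  assumes "0 < d" "\<And>t. \<bar>t\<bar> \<le> d \<Longrightarrow> \<bar>g t - g 0 - t * l\<bar> \<le> C * t\<^sup>2"
  shows "DERIV g 0 :> l"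
proof -
  have "((\<lambda>t. (g (0 + t) - g 0) / t - l) \<longlongrightarrow> 0) (at 0)"
  proof (rule Lim_null_comparison)
    show "\<forall>\<^sub>F t in at 0. norm ((g (0 + t) - g 0) / t - l) \<le> C * \<bar>t\<bar>"
    proof -
      have "norm ((g (0 + t) - g 0) / t - l) \<le> C * \<bar>t\<bar>" if "t \<noteq> 0" "\<bar>t\<bar> < d" for t
      proof -
        have "(g (0 + t) - g 0) / t - l = (g t - g 0 - t * l) / t" using that
          by (simp add: field_simps)
        then have "norm ((g (0 + t) - g 0) / t - l) = \<bar>g t - g 0 - t * l\<bar> / \<bar>t\<bar>"
          by (simp add: abs_divide)
        also have "\<dots> \<le> C * t\<^sup>2 / \<bar>t\<bar>" using assms(2)[of t] that by (intro divide_right_mono) auto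
        also have "\<dots> = C * \<bar>t\<bar>" using that by (simp add: power2_eq_square abs_if)
        finally show ?thesis .
      qed
      then show ?thesis using assms(1)
        by (auto simp: eventually_at dist_real_def intro!: exI[of _ d])
    qed
    have "((\<lambda>t::real. C * \<bar>t\<bar>) \<longlongrightarrow> C * \<bar>0\<bar>) (at 0)" by (intro tendsto_intros)
    then show "((\<lambda>t::real. C * \<bar>t\<bar>) \<longlongrightarrow> 0) (at 0)" by simp
  qed
  then have "((\<lambda>t. (g (0 + t) - g 0) / t) \<longlongrightarrow> l) (at 0)" by (rule Lim_null[THEN iffD2])
  then show ?thesis by (simp add: DERIV_def)
qed

section \<open>The constrained minimizer\<close>

lemma integral_lborel_scale:
  fixes g :: "'a::euclidean_space \<Rightarrow> real"
  assumes "g \<in> borel_measurable borel" "0 < c"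
  shows "(LINT x|lborel. g (c *\<^sub>R x)) = c powr (- real DIM('a)) * (LINT x|lborel. g x)"
proof -
  have "c powr (- real DIM('a)) * c ^ DIM('a) = 1" using assms(2)
    by (simp add: powr_minus powr_realpow)
  then show ?thesis using integral_lborel_affine[OF assms(1), of c 0] assms(2)
    by (simp add: mult.assoc[symmetric])
qed

lemma Hs_norm_scale_real:
  assumes "0 < s" "h \<in> Hs s"
  shows "Hs_norm s (\<lambda>x. complex_of_real t * h x) = \<bar>t\<bar> * Hs_norm s h"
proof (rule power2_eq_imp_eq)
  show "(Hs_norm s (\<lambda>x. complex_of_real t * h x))\<^sup>2 = (\<bar>t\<bar> * Hs_norm s h)\<^sup>2"
    unfolding Hs_norm_cmult[OF assms] power_mult_distrib norm_of_real by (rule refl)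
qed (auto simp: Hs_norm_nonneg)

lemma riesz_conv_scale:
  fixes u :: "'a::euclidean_space \<Rightarrow> complex"
  assumes [measurable]: "u \<in> borel_measurable borel" and c: "0 < c"
  shows "riesz_conv \<gamma> (\<lambda>x. u (c *\<^sub>R x)) x = c powr (\<gamma> - real DIM('a)) * riesz_conv \<gamma> u (c *\<^sub>R x)"
proof -
  have eq: "norm (x - y) powr (- \<gamma>) = c powr \<gamma> * norm (c *\<^sub>R x - c *\<^sub>R y) powr (- \<gamma>)" for y
  proof -
    have "norm (c *\<^sub>R x - c *\<^sub>R y) = c * norm (x - y)" using c by (simp flip: scaleR_diff_right)
    then show ?thesis using c by (simp add: powr_mult mult.assoc[symmetric] flip: powr_add)
  qed
  have "riesz_conv \<gamma> (\<lambda>x. u (c *\<^sub>R x)) x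
      = (LINT y|lborel. c powr \<gamma> * (norm (c *\<^sub>R x - c *\<^sub>R y) powr (- \<gamma>) * (cmod (u (c *\<^sub>R y)))\<^sup>2))"
    unfolding riesz_conv_def eq mult.assoc by (rule refl)
  also have "\<dots> = c powr \<gamma> * (LINT y|lborel. norm (c *\<^sub>R x - c *\<^sub>R y) powr (- \<gamma>)
      * (cmod (u (c *\<^sub>R y)))\<^sup>2)"
    by (rule integral_mult_right_zero)
  also have "(LINT y|lborel. norm (c *\<^sub>R x - c *\<^sub>R y) powr (- \<gamma>) * (cmod (u (c *\<^sub>R y)))\<^sup>2)
      = c powr (- real DIM('a)) * riesz_conv \<gamma> u (c *\<^sub>R x)"
    unfolding riesz_conv_def by (rule integral_lborel_scale[OF _ c]) measurable
  finally show ?thesis by (simp add: mult.assoc[symmetric] flip: powr_add)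
qed

lemma riesz_conv_measurable [measurable]:
  fixes u :: "'a::euclidean_space \<Rightarrow> complex"
  assumes [measurable]: "u \<in> borel_measurable borel"
  shows "riesz_conv \<gamma> u \<in> borel_measurable borel"
  unfolding riesz_conv_def[abs_def] by measurable

section \<open>Both nonlinearities in terms of \<open>q\<close>, \<open>k\<close> and
  \<open>B\<close>\<close>

locale frac_schroedinger =
  fixes s :: real and f :: nonlinearity and T :: "'a::euclidean_space itself"
  assumes s: "0 < s" "s < 1" and N: "2 * s < real DIM('a)" and adm: "admissible TYPE('a) s f"
begin

abbreviation q where "q \<equiv> nl_exponent f"
abbreviation k where "k \<equiv> nl_dilation T f"
abbreviation A :: "('a \<Rightarrow> complex) \<Rightarrow> real" where "A u \<equiv> (Hdot_norm s u)\<^sup>2"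
abbreviation M :: "('a \<Rightarrow> complex) \<Rightarrow> real" where "M u \<equiv> (Lnorm 2 u)\<^sup>2"
abbreviation B :: "('a \<Rightarrow> complex) \<Rightarrow> real" where "B \<equiv> nl_potential f"

text \<open>The second inequality is mass supercriticality, the third energy subcriticality,
  rewritten in terms of \<open>q\<close> and \<open>k\<close>.\<close>

lemma params: "2 < q" "2 * s < k" "k / s < q"
proof -
  have "2 < q \<and> 2 * s < k \<and> k / s < q"
  proof (cases f)
    case (Power p)
    then have p: "4 * s < p * real DIM('a)" "p * (real DIM('a) - 2 * s) < 4 * s"
      using adm N by (simp_all add: pos_divide_less_eq pos_less_divide_eq)
    have "0 < p * real DIM('a)" using p(1) s by linarith
    then have "0 < p" by (simp add: zero_less_mult_iff)
    then show ?thesis using p s Power by (simp add: pos_divide_less_eq algebra_simps)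
  next
    case (Hartree \<gamma>)
    then show ?thesis using adm s by (simp add: pos_divide_less_eq)
  qed
  then show "2 < q" "2 * s < k" "k / s < q" by auto
qed

lemma power_params:
  assumes "f = Power p"
  shows "0 < p" "(p + 2) * (real DIM('a) - 2 * s) \<le> 2 * real DIM('a)"
proof -
  show "0 < p" using params(1) assms by simp
  have "p * (real DIM('a) - 2 * s) < 4 * s"
    using adm N assms by (simp add: pos_less_divide_eq)
  then show "(p + 2) * (real DIM('a) - 2 * s) \<le> 2 * real DIM('a)" by (simp add: algebra_simps)
qed

lemma hartree_params:
  assumes "f = Hartree \<gamma>"
  shows "0 < \<gamma>" "\<gamma> < 4 * s" "\<gamma> < real DIM('a)"
  using adm s assms by auto

lemma energy_eq: "energy s f u = A u / 2 - B u / q"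
proof (cases f)
  case (Power p)
  then show ?thesis using power_params(1)[OF Power] by (simp add: Lnorm_powr)
qed simp

lemma Qfun_eq: "Qfun s f u = s * A u - k / q * B u"
proof (cases f)
  case (Power p)
  then show ?thesis using power_params(1)[OF Power] by (simp add: Lnorm_powr)
qed simp

lemma action_eq: "action s f \<omega> u = A u / 2 - B u / q + \<omega> / 2 * M u"
  by (simp add: action_def energy_eq)

lemma B_pos:
  assumes u: "u \<in> Hs s" and nz: "\<not> (AE x in lborel. u x = 0)"
  shows "0 < B u"
proof (cases f)
  case (Power p)
  note p = power_params[OF Power]
  have p2: "2 \<le> p + 2" using p by simp
  have i: "integrable lborel (\<lambda>x. cmod (u x) powr (p + 2))"
    using Hs_Lp_bound[OF s N p2 p(2)] u by blast
  have "(LINT x|lborel. cmod (u x) powr (p + 2)) \<noteq> 0"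
    using nz by (subst integral_nonneg_eq_0_iff_AE[OF i]) auto
  moreover have "0 \<le> (LINT x|lborel. cmod (u x) powr (p + 2))" by (simp add: integral_nonneg_AE)
  ultimately have "0 < (LINT x|lborel. cmod (u x) powr (p + 2))" by linarith
  then show ?thesis using Power by simp
next
  case (Hartree \<gamma>)
  then show ?thesis using hartree_pos[OF s hartree_params(1,2)[OF Hartree] N hartree_params(3)[OF
      Hartree] u nz] by simp
qed

lemma B_null:
  assumes "AE x in lborel. u x = 0"
  shows "B u = 0"
proof (cases f)
  case (Power p)
  have "(LINT x|lborel. cmod (u x) powr (p + 2)) = 0"
    by (rule integral_eq_zero_AE) (use assms in \<open>eventually_elim, simp\<close>)
  then show ?thesis using Power by simp
next
  case (Hartree \<gamma>)
  have "hartree_D \<gamma> u = 0"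
    unfolding hartree_D_def by (rule integral_eq_zero_AE) (use assms in \<open>eventually_elim, simp\<close>)
  then show ?thesis using Hartree by simp
qed

text \<open>The exponent of \<open>c\<close> is arranged so that the mass-preserving amplitude
  \<open>c powr (DIM('a) / 2)\<close> leaves exactly \<open>c powr k\<close>.\<close>

lemma B_scale:
  assumes u: "u \<in> Hs s" and m: "0 < m" and c: "0 < c"
  shows "B (\<lambda>x. complex_of_real m * u (c *\<^sub>R x)) = m powr q * c powr (k - q * real DIM('a) / 2)
      * B u"
proof -
  have [measurable]: "u \<in> borel_measurable borel" using u by (rule Hs_measurable)
  show ?thesis
  proof (cases f)
    case (Power p)
    have "(LINT x|lborel. cmod (complex_of_real m * u (c *\<^sub>R x)) powr (p + 2))
        = m powr (p + 2) * (LINT x|lborel. cmod (u (c *\<^sub>R x)) powr (p + 2))"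
      using m by (simp add: norm_mult powr_mult)
    also have "(LINT x|lborel. cmod (u (c *\<^sub>R x)) powr (p + 2)) = c powr (- real DIM('a))
        * (LINT x|lborel. cmod (u x) powr (p + 2))"
      by (rule integral_lborel_scale[OF _ c, of "\<lambda>x. cmod (u x) powr (p + 2)"]) measurable
    also have "- real DIM('a) = k - q * real DIM('a) / 2" using Power by (simp add: field_simps)
    finally show ?thesis using Power by (simp add: mult.assoc)
  next
    case (Hartree \<gamma>)
    have r: "riesz_conv \<gamma> (\<lambda>x. complex_of_real m * u (c *\<^sub>R x)) x
        = m\<^sup>2 * (c powr (\<gamma> - real DIM('a)) * riesz_conv \<gamma> u (c *\<^sub>R x))" for x
    proof -
      have "riesz_conv \<gamma> (\<lambda>x. complex_of_real m * u (c *\<^sub>R x)) x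
          = (LINT y|lborel. m\<^sup>2 * (norm (x - y) powr (- \<gamma>) * (cmod (u (c *\<^sub>R y)))\<^sup>2))"
        unfolding riesz_conv_def by (simp add: norm_mult power_mult_distrib mult_ac)
      also have "\<dots> = m\<^sup>2 * riesz_conv \<gamma> (\<lambda>x. u (c *\<^sub>R x)) x" unfolding riesz_conv_def
        by (rule integral_mult_right_zero)
      finally show ?thesis by (simp only: riesz_conv_scale[OF \<open>u \<in> borel_measurable borel\<close> c])
    qed
    have "hartree_D \<gamma> (\<lambda>x. complex_of_real m * u (c *\<^sub>R x))
        = (LINT x|lborel. (m^4 * c powr (\<gamma> - real DIM('a))) * (riesz_conv \<gamma> u (c *\<^sub>R x) * (cmod (u
        (c *\<^sub>R x)))\<^sup>2))"
      unfolding hartree_D_def r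
      by (simp add: norm_mult power_mult_distrib mult_ac power4_eq_xxxx power2_eq_square)
    also have "\<dots> = (m^4 * c powr (\<gamma> - real DIM('a))) * (LINT x|lborel. riesz_conv \<gamma> u (c *\<^sub>R x)
        * (cmod (u (c *\<^sub>R x)))\<^sup>2)"
      by (rule integral_mult_right_zero)
    also have "(LINT x|lborel. riesz_conv \<gamma> u (c *\<^sub>R x) * (cmod (u (c *\<^sub>R x)))\<^sup>2)
        = c powr (- real DIM('a)) * hartree_D \<gamma> u"
      unfolding hartree_D_def by (rule integral_lborel_scale[OF _ c, of "\<lambda>x. riesz_conv \<gamma> u x
          * (cmod (u x))\<^sup>2"]) measurable
    also have "m^4 * c powr (\<gamma> - real DIM('a)) * (c powr (- real DIM('a)) * hartree_D \<gamma> u)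
        = m powr 4 * (c powr (\<gamma> - real DIM('a)) * c powr (- real DIM('a))) * hartree_D \<gamma> u"
      using m by (simp add: mult_ac)
    also have "c powr (\<gamma> - real DIM('a)) * c powr (- real DIM('a))
        = c powr (k - q * real DIM('a) / 2)"
      using Hartree by (simp flip: powr_add)
    finally show ?thesis using Hartree by simp
  qed
qed

text \<open>The derivative of \<open>B\<close> at \<open>u\<close> in direction \<open>h\<close>,
  divided by \<open>q\<close>, as \<open>B_expand\<close> confirms.\<close>

definition L :: "('a \<Rightarrow> complex) \<Rightarrow> ('a \<Rightarrow> complex) \<Rightarrow> real" where
  "L u h = Re (LINT x|lborel. nonlin f u x * cnj (h x))"

lemma L_scale: "L u (\<lambda>x. complex_of_real t * h x) = t * L u h"
proof -
  have "(LINT x|lborel. nonlin f u x * cnj (complex_of_real t * h x))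
      = (LINT x|lborel. complex_of_real t * (nonlin f u x * cnj (h x)))"
    by (intro Bochner_Integration.integral_cong) (auto simp: mult_ac)
  also have "\<dots> = complex_of_real t * (LINT x|lborel. nonlin f u x * cnj (h x))"
    by (rule integral_mult_right_zero)
  finally show ?thesis by (simp add: L_def)
qed

lemma L_self: "L u u = B u"
proof (cases f)
  case (Power p)
  have "nonlin f u x * cnj (u x) = complex_of_real (cmod (u x) powr (p + 2))" for x
  proof -
    have "nonlin f u x * cnj (u x) = complex_of_real (cmod (u x) powr p)
        * complex_of_real ((cmod (u x))\<^sup>2)"
      using Power by (simp add: complex_norm_square[symmetric] mult.assoc)
    also have "\<dots> = complex_of_real (cmod (u x) powr (p + 2))" by (simp add: powr_add)
    finally show ?thesis .
  qed
  then show ?thesis unfolding L_def using Power by simp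
next
  case (Hartree \<gamma>)
  have "nonlin f u x * cnj (u x) = complex_of_real (riesz_conv \<gamma> u x * (cmod (u x))\<^sup>2)" for x
    using Hartree by (simp add: complex_norm_square[symmetric] mult.assoc)
  then show ?thesis unfolding L_def using Hartree
    by (simp only: integral_complex_of_real Re_complex_of_real hartree_D_def nl_potential.simps)
qed

lemma B_expand:
  assumes u: "u \<in> Hs s"
  shows "\<exists>C\<ge>0. \<forall>t h. 0 < t \<longrightarrow> t \<le> 1 \<longrightarrow> h \<in> Hs s \<longrightarrow> Hs_norm s h \<le> t \<longrightarrow>
    \<bar>B (\<lambda>x. u x + h x) - B u - q * L u h\<bar> \<le> C * t\<^sup>2"
proof (cases f)
  case (Power p)
  then show ?thesis using power_functional_expand[OF s N power_params[OF Power] u] unfolding L_def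
    by simp
next
  case (Hartree \<gamma>)
  then show ?thesis using hartree_expand[OF s hartree_params(1,2)[OF Hartree] N hartree_params(3)[OF
      Hartree] u]
    unfolding L_def by simp
qed

definition action_deriv :: "real \<Rightarrow> ('a \<Rightarrow> complex) \<Rightarrow> ('a \<Rightarrow> complex) \<Rightarrow> real" where
  "action_deriv \<omega> u h = weighted_ip (hdot_weight s) (fourier u) (fourier h) + \<omega>
      * weighted_ip (\<lambda>_. 1) u h - L u h"

lemma action_deriv_scale:
  assumes "u \<in> Hs s" "h \<in> Hs s"
  shows "action_deriv \<omega> u (\<lambda>x. complex_of_real t * h x) = t * action_deriv \<omega> u h"
  unfolding action_deriv_def L_scale weighted_ip_scale_right
    weighted_ip_fourier_scale_right[OF Hs_in_L2[OF assms(1)] Hs_in_L2[OF assms(2)]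
        hdot_weight_measurable]
  by (simp add: algebra_simps)

lemma action_deriv_self:
  assumes "u \<in> Hs s"
  shows "action_deriv \<omega> u u = A u + \<omega> * M u - B u"
  unfolding action_deriv_def L_self Hdot_norm_sq[OF s(1) assms] Lnorm2_sq_weighted_ip by (rule refl)

lemma action_expand:
  assumes u: "u \<in> Hs s" and \<omega>: "0 \<le> \<omega>"
  shows "\<exists>C\<ge>0. \<forall>t h. 0 < t \<longrightarrow> t \<le> 1 \<longrightarrow> h \<in> Hs s \<longrightarrow> Hs_norm s h \<le> t \<longrightarrow>
    \<bar>action s f \<omega> (\<lambda>x. u x + h x) - action s f \<omega> u - action_deriv \<omega> u h\<bar> \<le> C * t\<^sup>2"
proof -
  obtain C where C: "0 \<le> C" "\<And>t h. 0 < t \<Longrightarrow> t \<le> 1 \<Longrightarrow> h \<in> Hs s \<Longrightarrow> Hs_norm s h \<le> t \<Longrightarrow>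
    \<bar>B (\<lambda>x. u x + h x) - B u - q * L u h\<bar> \<le> C * t\<^sup>2" using B_expand[OF u] by blast
  have q0: "0 < q" using params by simp
  show ?thesis
  proof (intro exI[of _ "1 / 2 + \<omega> / 2 + C / q"] conjI allI impI)
    show "0 \<le> 1 / 2 + \<omega> / 2 + C / q" using \<omega> C q0 by simp
    fix t :: real and h :: "'a \<Rightarrow> complex" assume t: "0 < t" "t \<le> 1" and h: "h \<in> Hs s" "Hs_norm s h
        \<le> t"
    have n: "(Hs_norm s h)\<^sup>2 \<le> t\<^sup>2" using h(2) Hs_norm_nonneg by (intro power_mono) auto
    have a: "0 \<le> A h" "A h \<le> t\<^sup>2" using Hdot_norm_le[OF s(1) h(1)] n by auto
    have m: "0 \<le> \<omega> * M h" "\<omega> * M h \<le> \<omega> * t\<^sup>2"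
      using Lnorm2_le[OF s(1) h(1)] n \<omega> by (auto intro: mult_left_mono)
    define r where "r = B (\<lambda>x. u x + h x) - B u - q * L u h"
    have r: "\<bar>r\<bar> \<le> C * t\<^sup>2" unfolding r_def by (rule C(2)[OF t h])
    have "action s f \<omega> (\<lambda>x. u x + h x) - action s f \<omega> u - action_deriv \<omega> u h
        = A h / 2 + \<omega> * M h / 2 - r / q"
    proof -
      have "B (\<lambda>x. u x + h x) / q = B u / q + L u h + r / q" using q0
        by (simp add: r_def field_simps)
      then show ?thesis
        unfolding action_eq action_deriv_def Hdot_norm_add[OF s(1) u h(1)] Lnorm2_add[OF s(1) u
            h(1)]
        by (simp add: algebra_simps)
    qed
    moreover have "\<bar>r / q\<bar> \<le> C * t\<^sup>2 / q" using r q0 by (simp add: abs_divide divide_right_mono)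
    ultimately have "\<bar>action s f \<omega> (\<lambda>x. u x + h x) - action s f \<omega> u - action_deriv \<omega> u h\<bar>
        \<le> t\<^sup>2 / 2 + \<omega> * t\<^sup>2 / 2 + C * t\<^sup>2 / q"
      using a m by linarith
    then show "\<bar>action s f \<omega> (\<lambda>x. u x + h x) - action s f \<omega> u - action_deriv \<omega> u h\<bar>
        \<le> (1 / 2 + \<omega> / 2 + C / q) * t\<^sup>2"
      by (simp add: algebra_simps)
  qed
qed

text \<open>The expansion with quadratic remainder identifies the Frechet derivative. For the
  forward direction \<open>h\<close> is replaced by a small multiple, and the linear term is
  compared with \<open>\<epsilon>\<close> times the norm.\<close>

lemma action_critical_iff:
  assumes u: "u \<in> Hs s" and \<omega>: "0 \<le> \<omega>"
  shows "action_critical s f \<omega> u \<longleftrightarrow> (\<forall>h\<in>Hs s. action_deriv \<omega> u h = 0)"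
proof -
  obtain C where C: "0 \<le> C" and exp: "\<And>t h. 0 < t \<Longrightarrow> t \<le> 1 \<Longrightarrow> h \<in> Hs s \<Longrightarrow> Hs_norm s h \<le> t \<Longrightarrow>
    \<bar>action s f \<omega> (\<lambda>x. u x + h x) - action s f \<omega> u - action_deriv \<omega> u h\<bar> \<le> C * t\<^sup>2"
    using action_expand[OF u \<omega>] by blast
  show ?thesis
  proof
    assume crit: "action_critical s f \<omega> u"
    show "\<forall>h\<in>Hs s. action_deriv \<omega> u h = 0"
    proof
      fix h :: "'a \<Rightarrow> complex" assume h: "h \<in> Hs s"
      define n where "n = Hs_norm s h + 1"
      have n: "0 < n" "Hs_norm s h \<le> n" using Hs_norm_nonneg[of s h] by (auto simp: n_def)
      have bd: "\<bar>action_deriv \<omega> u h\<bar> \<le> \<epsilon> * (n + 1)" if \<epsilon>: "0 < \<epsilon>" for \<epsilon>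
      proof -
        obtain \<delta> where \<delta>: "0 < \<delta>" "\<And>h. h \<in> Hs s \<Longrightarrow> Hs_norm s h < \<delta> \<Longrightarrow> \<bar>action s f \<omega> (\<lambda>x. u x + h x)
            - action s f \<omega> u - 0\<bar> \<le> \<epsilon> * Hs_norm s h"
          using crit \<epsilon> unfolding action_critical_def has_Hs_derivative_def by blast
        \<comment> \<open>The three entries keep the scaled direction in the range of the expansion,
          keep its norm below \<open>\<delta>\<close>, and keep the remainder below
          \<open>\<epsilon>\<close> after division by \<open>t\<close>.\<close>
        define t where "t = min (1 / n) (min (\<delta> / (2 * n)) (\<epsilon> / (C * n\<^sup>2 + 1)))"
        have Cn: "0 < C * n\<^sup>2 + 1" using C by (simp add: add_nonneg_pos)
        have t: "0 < t" using n \<delta> \<epsilon> Cn by (simp add: t_def)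
        have "t \<le> 1 / n" "t \<le> \<delta> / (2 * n)" "t \<le> \<epsilon> / (C * n\<^sup>2 + 1)" by (auto simp: t_def)
        then have t': "t * n \<le> 1" "t * n \<le> \<delta> / 2" "t * (C * n\<^sup>2 + 1) \<le> \<epsilon>"
          using n Cn by (simp_all add: pos_le_divide_eq mult.assoc mult.commute[of 2])
        let ?h = "\<lambda>x. complex_of_real t * h x"
        have th: "?h \<in> Hs s" by (rule Hs_cmult[OF s(1) h])
        have nt: "Hs_norm s ?h = t * Hs_norm s h" using Hs_norm_scale_real[OF s(1) h] t by simp
        have le: "Hs_norm s ?h \<le> t * n" unfolding nt using n t by (intro mult_left_mono) auto
        have 1: "\<bar>action s f \<omega> (\<lambda>x. u x + ?h x) - action s f \<omega> u\<bar> \<le> \<epsilon> * (t * n)"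
        proof -
          have "Hs_norm s ?h < \<delta>" using le t'(2) \<delta>(1) by linarith
          from \<delta>(2)[OF th this] have "\<bar>action s f \<omega> (\<lambda>x. u x + ?h x) - action s f \<omega> u\<bar>
              \<le> \<epsilon> * Hs_norm s ?h" by simp
          also have "\<dots> \<le> \<epsilon> * (t * n)" using le \<epsilon> by (intro mult_left_mono) auto
          finally show ?thesis .
        qed
        have 2: "\<bar>action s f \<omega> (\<lambda>x. u x + ?h x) - action s f \<omega> u - action_deriv \<omega> u ?h\<bar>
            \<le> C * (t * n)\<^sup>2"
          using n t t' by (intro exp th le) auto
        have "\<bar>t * action_deriv \<omega> u h\<bar> \<le> \<epsilon> * (t * n) + C * (t * n)\<^sup>2"
          using 1 2 unfolding action_deriv_scale[OF u h] by linarith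
        then have "t * \<bar>action_deriv \<omega> u h\<bar> \<le> t * (\<epsilon> * n + t * (C * n\<^sup>2))"
          using t by (simp add: abs_mult power_mult_distrib power2_eq_square algebra_simps)
        then have "\<bar>action_deriv \<omega> u h\<bar> \<le> \<epsilon> * n + t * (C * n\<^sup>2)" using t by simp
        also have "\<dots> \<le> \<epsilon> * n + \<epsilon>" using t'(3) t by (simp add: distrib_left)
        finally show ?thesis by (simp add: distrib_left)
      qed
      have "\<bar>action_deriv \<omega> u h\<bar> \<le> 0"
      proof (rule field_le_epsilon)
        fix e :: real assume "0 < e"
        then show "\<bar>action_deriv \<omega> u h\<bar> \<le> 0 + e" using bd[of "e / (n + 1)"] n by simp
      qed
      then show "action_deriv \<omega> u h = 0" by simp
    qed
  next
    assume z: "\<forall>h\<in>Hs s. action_deriv \<omega> u h = 0"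
    have "\<exists>\<delta>>0. \<forall>h\<in>Hs s. Hs_norm s h < \<delta> \<longrightarrow> \<bar>action s f \<omega> (\<lambda>x. u x + h x) - action s f \<omega> u - 0\<bar>
        \<le> \<epsilon> * Hs_norm s h"
      if \<epsilon>: "0 < \<epsilon>" for \<epsilon>
    proof (intro exI[of _ "min 1 (\<epsilon> / (C + 1))"] conjI ballI impI)
      show "0 < min 1 (\<epsilon> / (C + 1))" using \<epsilon> C by simp
      fix h :: "'a \<Rightarrow> complex" assume h: "h \<in> Hs s" and "Hs_norm s h < min 1 (\<epsilon> / (C + 1))"
      then have n: "Hs_norm s h < 1" "Hs_norm s h < \<epsilon> / (C + 1)" by auto
      have "Hs_norm s h * (C + 1) < \<epsilon>" using n(2) C by (simp add: pos_less_divide_eq)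
      then have n2: "C * Hs_norm s h \<le> \<epsilon>" using Hs_norm_nonneg[of s h] by (simp add: algebra_simps)
      define X where "X = \<bar>action s f \<omega> (\<lambda>x. u x + h x) - action s f \<omega> u\<bar>"
      have X: "X \<le> C * t\<^sup>2" if "0 < t" "t \<le> 1" "Hs_norm s h \<le> t" for t
        using exp[OF that(1,2) h that(3)] z h by (simp add: X_def)
      have "X \<le> \<epsilon> * Hs_norm s h"
      proof (cases "Hs_norm s h = 0")
        case True
        \<comment> \<open>The expansion is stated for positive \<open>t\<close> only, so a direction
          of norm 0 is handled by letting \<open>t\<close> tend to 0.\<close>
        have "((\<lambda>t. C * t\<^sup>2) \<longlongrightarrow> C * 0\<^sup>2) (at_right 0)" by (intro tendsto_intros)
        then have "X \<le> C * 0\<^sup>2"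
        proof (rule tendsto_lowerbound)
          have "\<forall>\<^sub>F t in at_right (0::real). 0 < t \<and> t < 1"
            unfolding eventually_at_right_field by (intro exI[of _ 1]) auto
          then show "\<forall>\<^sub>F t in at_right 0. X \<le> C * t\<^sup>2" by eventually_elim (use X True in auto)
        qed simp
        then show ?thesis using True by simp
      next
        case False
        then have "0 < Hs_norm s h" using Hs_norm_nonneg[of s h] by simp
        then have "X \<le> C * (Hs_norm s h)\<^sup>2" using X n by simp
        also have "\<dots> = (C * Hs_norm s h) * Hs_norm s h" by (simp add: power2_eq_square)
        also have "\<dots> \<le> \<epsilon> * Hs_norm s h" by (intro mult_right_mono n2 Hs_norm_nonneg)
        finally show ?thesis .
      qed
      then show "\<bar>action s f \<omega> (\<lambda>x. u x + h x) - action s f \<omega> u - 0\<bar> \<le> \<epsilon> * Hs_norm s h"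
        by (simp add: X_def)
    qed
    moreover have "\<exists>C. \<forall>h\<in>(Hs s :: ('a \<Rightarrow> complex) set). \<bar>0\<bar> \<le> C * Hs_norm s h"
      by (intro exI[of _ 0]) simp
    ultimately show "action_critical s f \<omega> u" unfolding action_critical_def has_Hs_derivative_def
      by simp
  qed
qed

end

section \<open>Consequences of minimality\<close>

locale constrained_minimizer = frac_schroedinger s f T
  for s :: real and f :: nonlinearity and T :: "'a::euclidean_space itself" +
  fixes c :: real and uc :: "'a \<Rightarrow> complex"
  assumes c: "0 < c" and uc: "uc \<in> Mset s f c"
begin

abbreviation \<alpha> where "\<alpha> \<equiv> k / (2 * s)"
abbreviation \<beta> where "\<beta> \<equiv> (q - k / s) / 2"

lemma uc_Hs: "uc \<in> Hs s" and uc_mass: "M uc = c" and uc_Q: "B uc = q * s / k * A uc"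
proof -
  have V: "uc \<in> Vset s f c" using uc by (simp add: Mset_def)
  then show "uc \<in> Hs s" "M uc = c" by (auto simp: Vset_def Sset_def)
  have "s * A uc = k / q * B uc" using V by (simp add: Vset_def Qfun_eq)
  then show "B uc = q * s / k * A uc" using params s by (simp add: field_simps)
qed

lemma uc_nonzero: "\<not> (AE x in lborel. uc x = 0)"
proof
  assume z: "AE x in lborel. uc x = 0"
  have "(LINT x|lborel. (cmod (uc x))\<^sup>2) = 0"
    by (rule integral_eq_zero_AE) (use z in \<open>eventually_elim, simp\<close>)
  then show False using uc_mass c by (simp add: Lnorm2_sq)
qed

lemma uc_pos: "0 < A uc" "0 < B uc"
  using Hdot_norm_pos[OF s(1) uc_Hs uc_nonzero] B_pos[OF uc_Hs uc_nonzero] by auto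

lemma kinetic_minimal:
  assumes "w \<in> Hs s" "M w = c" "s * A w = k / q * B w"
  shows "A uc \<le> A w"
proof -
  have E: "energy s f v = (1 / 2 - s / k) * A v" if "s * A v = k / q * B v" for v
  proof -
    have "B v / q = s / k * A v" using that params s by (simp add: field_simps)
    then show ?thesis by (simp add: energy_eq algebra_simps)
  qed
  have "w \<in> Vset s f c" using assms by (simp add: Vset_def Sset_def Qfun_eq)
  then have "(INF v\<in>(Vset s f c :: ('a \<Rightarrow> complex) set). ereal (energy s f v))
      \<le> ereal (energy s f w)" by (rule INF_lower)
  moreover have "ereal (energy s f uc)
      = (INF v\<in>(Vset s f c :: ('a \<Rightarrow> complex) set). ereal (energy s f v))"
    using uc unfolding Mset_def by blast
  ultimately have "ereal (energy s f uc) \<le> ereal (energy s f w)" by (simp only:)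
  then have "energy s f uc \<le> energy s f w" by simp
  moreover have "s * A uc = k / q * B uc" unfolding uc_Q using params s by simp
  ultimately have "(1 / 2 - s / k) * A uc \<le> (1 / 2 - s / k) * A w" using E assms(3) by simp
  moreover have "0 < 1 / 2 - s / k" using params s by (simp add: field_simps)
  ultimately show ?thesis by simp
qed

text \<open>The Gagliardo-Nirenberg inequality with its sharp constant: equality holds for
  \<open>v = uc\<close>.\<close>

lemma gagliardo_nirenberg:
  assumes v: "v \<in> Hs s"
  shows "B v \<le> B uc / (A uc powr \<alpha> * c powr \<beta>) * (A v powr \<alpha> * M v powr \<beta>)"
proof (cases "AE x in lborel. v x = 0")
  case True
  have "0 \<le> B uc / (A uc powr \<alpha> * c powr \<beta>) * (A v powr \<alpha> * M v powr \<beta>)"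
    using uc_pos by simp
  then show ?thesis using B_null[OF True] by simp
next
  case False
  have pos: "0 < A v" "0 < M v" "0 < B v"
    using Hdot_norm_pos[OF s(1) v False] B_pos[OF v False] by auto
  have q0: "0 < q" using params by simp
  have "B v \<le> (q * s / k * A uc) / (A uc powr \<alpha> * c powr \<beta>) * (A v powr \<alpha> * M v powr \<beta>)"
  proof (rule scaling_algebra[OF pos uc_pos(1) c s(1) q0 params(2)])
    fix \<nu> \<mu> :: real assume \<nu>: "0 < \<nu>" and \<mu>: "0 < \<mu>" and mass: "\<nu>\<^sup>2 * M v = c"
      and Q: "s * (\<nu>\<^sup>2 * \<mu> powr (2 * s) * A v) = k / q * (\<nu> powr q * \<mu> powr k * B v)"
    \<comment> \<open>The power of \<open>\<mu>\<close> compensates the change of mass under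
      dilation, so \<open>\<nu>\<close> alone controls the mass of \<open>w\<close>.\<close>
    define m where "m = \<nu> * \<mu> powr (real DIM('a) / 2)"
    have m: "0 < m" using \<nu> \<mu> by (simp add: m_def)
    define w where "w = (\<lambda>x. complex_of_real m * v (\<mu> *\<^sub>R x))"
    have m2: "m\<^sup>2 = \<nu>\<^sup>2 * \<mu> powr real DIM('a)"
      using \<mu> by (simp add: m_def power2_eq_square mult_ac flip: powr_add)
    have vs: "(\<lambda>x. v (\<mu> *\<^sub>R x)) \<in> Hs s" by (rule Hs_scale(1)[OF s(1) v \<mu>])
    have wH: "w \<in> Hs s" unfolding w_def by (rule Hs_cmult[OF s(1) vs])
    have "A w = m\<^sup>2 * (\<mu> powr (2 * s - real DIM('a)) * A v)"
      unfolding w_def Hdot_norm_cmult[OF s(1) vs] Hs_scale(2)[OF s(1) v \<mu>] using m by simp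
    also have "\<dots> = \<nu>\<^sup>2 * (\<mu> powr real DIM('a) * \<mu> powr (2 * s - real DIM('a))) * A v" unfolding m2
      by (simp only: mult_ac)
    also have "\<mu> powr real DIM('a) * \<mu> powr (2 * s - real DIM('a)) = \<mu> powr (2 * s)" using \<mu>
      by (simp flip: powr_add)
    finally have Aw: "A w = \<nu>\<^sup>2 * \<mu> powr (2 * s) * A v" .
    have "M w = m\<^sup>2 * (\<mu> powr (- real DIM('a)) * M v)"
      unfolding w_def Lnorm2_cmult Lnorm2_scale[OF s(1) v \<mu>] using m by simp
    also have "\<dots> = \<nu>\<^sup>2 * (\<mu> powr real DIM('a) * \<mu> powr (- real DIM('a))) * M v" unfolding m2
      by (simp only: mult_ac)
    also have "\<mu> powr real DIM('a) * \<mu> powr (- real DIM('a)) = 1" using \<mu> by (simp flip: powr_add)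
    finally have Mw: "M w = c" using mass by simp
    have "B w = m powr q * \<mu> powr (k - q * real DIM('a) / 2) * B v"
      unfolding w_def by (rule B_scale[OF v m \<mu>])
    also have "m powr q = \<nu> powr q * \<mu> powr (q * real DIM('a) / 2)"
      unfolding m_def powr_mult powr_powr by (simp add: mult.commute)
    also have "\<nu> powr q * \<mu> powr (q * real DIM('a) / 2) * \<mu> powr (k - q * real DIM('a) / 2)
        = \<nu> powr q * \<mu> powr k"
      unfolding mult.assoc powr_add[symmetric] by simp
    finally have Bw: "B w = \<nu> powr q * \<mu> powr k * B v" .
    have "A uc \<le> A w" by (rule kinetic_minimal[OF wH Mw]) (unfold Aw Bw, rule Q)
    then show "A uc \<le> \<nu>\<^sup>2 * \<mu> powr (2 * s) * A v" unfolding Aw .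
  qed
  then show ?thesis unfolding uc_Q .
qed

text \<open>In the first variation of the quotient the kinetic and mass parts carry the weights
  \<open>2 * \<alpha> / A uc\<close> and \<open>2 * \<beta> / c\<close>. Multiplied by
  \<open>B uc / q\<close>, which equals \<open>s / k * A uc\<close> on the constraint, the first
  becomes 1 and the second becomes this number.\<close>

definition \<omega> where "\<omega> = s / k * (2 * \<beta>) * A uc / c"

lemma \<omega>_pos: "0 < \<omega>"
proof -
  have "0 < \<beta>" "0 < k" using params s by auto
  then show ?thesis unfolding \<omega>_def using uc_pos c s by (intro divide_pos_pos mult_pos_pos) auto
qed

text \<open>Along \<open>uc + t * h\<close> the difference of the two sides of
  \<open>gagliardo_nirenberg\<close> is nonnegative and zero at \<open>t = 0\<close>; since
  \<open>t\<close> takes both signs, its derivative vanishes there.\<close>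

lemma euler_lagrange:
  assumes h: "h \<in> Hs s"
  shows "action_deriv \<omega> uc h = 0"
proof -
  define a where "a = weighted_ip (hdot_weight s) (fourier uc) (fourier h)"
  define m where "m = weighted_ip (\<lambda>_. 1) uc h"
  define \<kappa> where "\<kappa> = B uc / (A uc powr \<alpha> * c powr \<beta>)"
  let ?v = "\<lambda>t x. uc x + complex_of_real t * h x"
  have th: "(\<lambda>x. complex_of_real t * h x) \<in> Hs s" for t by (rule Hs_cmult[OF s(1) h])
  have vH: "?v t \<in> Hs s" for t by (rule Hs_add[OF s(1) uc_Hs th])
  have At: "A (?v t) = A uc + 2 * (t * a) + t\<^sup>2 * A h" for t
    unfolding Hdot_norm_add[OF s(1) uc_Hs th] Hdot_norm_cmult[OF s(1) h]
      weighted_ip_fourier_scale_right[OF Hs_in_L2[OF uc_Hs] Hs_in_L2[OF h] hdot_weight_measurable]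
          a_def by simp
  have Mt: "M (?v t) = c + 2 * (t * m) + t\<^sup>2 * M h" for t
    unfolding Lnorm2_add[OF s(1) uc_Hs th] Lnorm2_cmult weighted_ip_scale_right uc_mass m_def
    by simp
  define g where "g = (\<lambda>t. \<kappa> * ((A uc + 2 * (t * a) + t\<^sup>2 * A h) powr \<alpha> * (c + 2 * (t * m) + t\<^sup>2
      * M h) powr \<beta>) - B (?v t))"
  have g0: "0 \<le> g t" for t
    using gagliardo_nirenberg[OF vH[of t]] unfolding At Mt by (simp add: g_def \<kappa>_def)
  have g00: "g 0 = 0" using uc_pos c by (simp add: g_def \<kappa>_def)
  obtain C where C: "0 \<le> C" and exp: "\<And>t h. 0 < t \<Longrightarrow> t \<le> 1 \<Longrightarrow> h \<in> Hs s \<Longrightarrow> Hs_norm s h \<le> t \<Longrightarrow>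
    \<bar>B (\<lambda>x. uc x + h x) - B uc - q * L uc h\<bar> \<le> C * t\<^sup>2" using B_expand[OF uc_Hs] by blast
  \<comment> \<open>Adding 1 keeps the scale \<open>\<bar>t\<bar> * n\<close> positive even when
    \<open>h\<close> has norm 0, as the expansion requires.\<close>
  define n where "n = Hs_norm s h + 1"
  have n: "0 < n" "Hs_norm s h \<le> n" using Hs_norm_nonneg[of s h] by (auto simp: n_def)
  have dB: "DERIV (\<lambda>t. B (?v t)) 0 :> q * L uc h"
  proof (rule DERIV_from_quadratic_remainder[where d="1 / n" and C="C * n\<^sup>2"])
    show "0 < 1 / n" using n by simp
    fix t :: real assume t: "\<bar>t\<bar> \<le> 1 / n"
    show "\<bar>B (?v t) - B (?v 0) - t * (q * L uc h)\<bar> \<le> C * n\<^sup>2 * t\<^sup>2"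
    proof (cases "t = 0")
      case False
      have "\<bar>B (?v t) - B uc - q * L uc (\<lambda>x. complex_of_real t * h x)\<bar> \<le> C * (\<bar>t\<bar> * n)\<^sup>2"
      proof (rule exp[OF _ _ th])
        show "0 < \<bar>t\<bar> * n" "\<bar>t\<bar> * n \<le> 1" using False n t by (simp_all add: pos_le_divide_eq)
        show "Hs_norm s (\<lambda>x. complex_of_real t * h x) \<le> \<bar>t\<bar> * n"
          unfolding Hs_norm_scale_real[OF s(1) h] using n by (intro mult_left_mono) auto
      qed
      then show ?thesis unfolding L_scale by (simp add: power_mult_distrib mult_ac)
    qed simp
  qed
  have dA: "DERIV (\<lambda>t. (A uc + 2 * (t * a) + t\<^sup>2 * A h) powr \<alpha>) 0 :> \<alpha> * A uc powr (\<alpha> - 1)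
      * (2 * a)"
  proof -
    have "DERIV (\<lambda>t. A uc + 2 * (t * a) + t\<^sup>2 * A h) 0 :> 2 * a"
      by (auto intro!: derivative_eq_intros)
    from DERIV_fun_powr[OF this, of \<alpha>] show ?thesis using uc_pos by simp
  qed
  have dM: "DERIV (\<lambda>t. (c + 2 * (t * m) + t\<^sup>2 * M h) powr \<beta>) 0 :> \<beta> * c powr (\<beta> - 1) * (2 * m)"
  proof -
    have "DERIV (\<lambda>t. c + 2 * (t * m) + t\<^sup>2 * M h) 0 :> 2 * m"
      by (auto intro!: derivative_eq_intros)
    from DERIV_fun_powr[OF this, of \<beta>] show ?thesis using c by simp
  qed
  have "DERIV g 0 :> \<kappa> * (\<alpha> * A uc powr (\<alpha> - 1) * (2 * a) * c powr \<beta> + \<beta> * c powr (\<beta> - 1) * (2 * m)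
      * A uc powr \<alpha>) - q * L uc h"
    unfolding g_def using DERIV_diff[OF DERIV_cmult[OF DERIV_mult[OF dA dM], of \<kappa>] dB] by simp
  then have "\<kappa> * (\<alpha> * A uc powr (\<alpha> - 1) * (2 * a) * c powr \<beta> + \<beta> * c powr (\<beta> - 1) * (2 * m)
      * A uc powr \<alpha>) - q * L uc h = 0"
    by (rule DERIV_local_min[where d=1]) (use g0 g00 in auto)
  moreover have "A uc powr (\<alpha> - 1) = A uc powr \<alpha> / A uc" "c powr (\<beta> - 1) = c powr \<beta> / c"
    using uc_pos c by (simp_all add: powr_diff)
  ultimately have "q * L uc h = \<kappa> * (A uc powr \<alpha> * c powr \<beta>) * (2 * \<alpha> * a / A uc + 2 * \<beta> * m / c)"
    by (simp add: algebra_simps)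
  also have "\<kappa> * (A uc powr \<alpha> * c powr \<beta>) = B uc" using uc_pos c by (simp add: \<kappa>_def)
  also have "B uc * (2 * \<alpha> * a / A uc + 2 * \<beta> * m / c) = q * (s / k * (2 * \<alpha>) * a + \<omega> * m)"
    unfolding uc_Q \<omega>_def using uc_pos(1) c by (simp add: distrib_left) (simp add: algebra_simps)
  also have "s / k * (2 * \<alpha>) = 1" using params s by simp
  finally have "L uc h = a + \<omega> * m" using params by simp
  then show ?thesis by (simp add: action_deriv_def a_def m_def)
qed

lemma uc_weak_solution: "weak_solution s f \<omega> uc"
  using euler_lagrange by (intro weak_solutionI[OF s uc_Hs]) (simp add: action_deriv_def L_def)

lemma uc_critical: "action_critical s f \<omega> uc"
  using euler_lagrange \<omega>_pos by (subst action_critical_iff[OF uc_Hs]) auto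

lemma action_nehari:
  assumes "A u + \<omega> * M u = B u"
  shows "action s f \<omega> u = (1 / 2 - 1 / q) * B u"
  unfolding action_eq using assms[symmetric] by (simp add: algebra_simps add_divide_distrib)

lemma uc_ground_state:
  fixes u :: "'a \<Rightarrow> complex"
  assumes u: "u \<in> Hs s" and crit: "action_critical s f \<omega> u" and nz: "\<not> (AE x in lborel. u x = 0)"
  shows "action s f \<omega> uc \<le> action s f \<omega> u"
proof -
  have nehari: "A v + \<omega> * M v = B v" if "v \<in> Hs s" "action_critical s f \<omega> v" for v
    using that action_critical_iff[OF that(1), of \<omega>] \<omega>_pos action_deriv_self[OF that(1), of \<omega>]
    by auto
  have ab: "0 < \<alpha>" "0 < \<beta>" "\<alpha> + \<beta> = q / 2" using params s by (simp_all add: field_simps)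
  have k0: "0 < k" using params s by simp
  have "B uc \<le> B u"
  proof (rule ground_state_algebra[OF Hdot_norm_pos[OF s(1) u nz] uc_pos(1) c \<omega>_pos ab(1,2)
        params(1) ab(3) gagliardo_nirenberg[OF u] nehari[OF u crit]])
    show "A uc + \<omega> * c = B uc" using nehari[OF uc_Hs uc_critical] unfolding uc_mass .
    \<comment> \<open>By the choice of \<open>\<omega>\<close>, the numbers \<open>A uc\<close> and
      \<open>\<omega> * c\<close> stand in the ratio \<open>\<alpha>\<close> to
      \<open>\<beta>\<close>; this is the hypothesis \<open>ratio\<close>.\<close>
    have "\<alpha> * (\<omega> * c) = \<alpha> * (s / k * 2) * \<beta> * A uc" unfolding \<omega>_def using c by simp
    also have "\<alpha> * (s / k * 2) = 1" using s k0 by simp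
    finally show "\<beta> * A uc = \<alpha> * (\<omega> * c)" by simp
  qed
  then show ?thesis
    unfolding action_nehari[OF nehari[OF u crit]] action_nehari[OF nehari[OF uc_Hs uc_critical]]
    using params(1) by (intro mult_left_mono) (auto simp: field_simps)
qed

end

theorem theorem1p3:
  fixes s c :: real and f :: nonlinearity and u\<^sub>c :: "'a::euclidean_space \<Rightarrow> complex"
  assumes "0 < s" and "s < 1"
    and "real DIM('a) > 2 * s"
    and "admissible TYPE('a) s f"
    and "c > 0"
    and "u\<^sub>c \<in> Mset s f c"
  shows "\<exists>\<omega>\<^sub>c>0.
    weak_solution s f \<omega>\<^sub>c u\<^sub>c \<and>
    ereal (action s f \<omega>\<^sub>c u\<^sub>c) =
      (INF u\<in>{u :: 'a \<Rightarrow> complex. u \<in> Hs s \<and> action_critical s f \<omega>\<^sub>c u \<and> \<not> (AE x in lborel. u x = 0)}.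
         ereal (action s f \<omega>\<^sub>c u))"
proof -
  interpret constrained_minimizer s f "TYPE('a)" c u\<^sub>c
    by unfold_locales (use assms in auto)
  show ?thesis
  proof (intro exI[of _ \<omega>] conjI \<omega>_pos uc_weak_solution antisym)
    show "ereal (action s f \<omega> u\<^sub>c) \<le> (INF u\<in>{u :: 'a \<Rightarrow> complex. u \<in> Hs s \<and> action_critical s f \<omega> u
        \<and> \<not> (AE x in lborel. u x = 0)}. ereal (action s f \<omega> u))"
      by (rule INF_greatest) (auto intro: uc_ground_state)
    \<comment> \<open>The infimum is attained, as \<open>u\<^sub>c\<close> is itself a nonzero
      critical point.\<close>
    show "(INF u\<in>{u :: 'a \<Rightarrow> complex. u \<in> Hs s \<and> action_critical s f \<omega> u
        \<and> \<not> (AE x in lborel. u x = 0)}. ereal (action s f \<omega> u)) \<le> ereal (action s f \<omega> u\<^sub>c)"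
      by (rule INF_lower) (use uc_Hs uc_critical uc_nonzero in auto)
  qed
qed

end
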